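(* Let $\mathbf{V}$ be any dagger compact category. Then there is a functor $F\colon\mathrm{CP}^*[\mathbf{V}]\to\mathrm{Split}^\dagger[\mathrm{CPM}[\mathbf{V}]]$ acting on objects as $F(A,m_A,u_A,z_A)=(A,\ \alpha_A\circ z_A\circ z_A\circ\alpha_A^\dagger)$ and on morphisms $f\colon(A,m_A,u_A,z_A)\to(B,m_B,u_B,z_B)$ as $F(f)=\alpha_B\circ z_B\circ f\circ z_A\circ\alpha_A^\dagger$. It is full, faithful, and strongly dagger symmetric monoidal.
   Context: $\mathbf{V}$ is a dagger compact category with symmetry $\sigma$ and duals $\eta_A\colon I\to A^*\otimes A$, $\varepsilon_A\colon A\otimes A^*\to I$, where $\varepsilon_A=\eta_A^\dagger\circ\sigma_{A,A^*}$; we use $(A\otimes B)^*=B^*\otimes A^*$ and suppress coherence isomorphisms. For $g\colon A\to B$ put $g_*=(g^\dagger)^*\colon A^*\to B^*$. Completely positive: a morphism $f\colon A^*\otimes A\to B^*\otimes B$ is completely positive if $f=(1_{B^*}\otimes\eta_X^\dagger\otimes 1_B)\circ(g_*\otimes g)$ for some object $X$ and some $g\colon A\to X\otimes B$. $\mathrm{CPM}[\mathbf{V}]$: same objects as $\mathbf{V}$; morphisms $A\to B$ are completely positive morphisms $A^*\otimes A\to B^*\otimes B$ of $\mathbf{V}$; composition and dagger as in $\mathbf{V}$. It is dagger compact, with the tensor on objects that of $\mathbf{V}$ and on morphisms that of $\mathbf{V}$ after the evident reordering of tensor factors. Dagger Frobenius algebra: an object $A$ with $m\colon A\otimes A\to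 A$ and $u\colon I\to A$ such that $m$ is associative with two-sided unit $u$ and $(m\otimes 1)\circ(1\otimes m^\dagger)=m^\dagger\circ m=(1\otimes m)\circ(m^\dagger\otimes 1)$. A map $z\colon A\to A$ is central if $z\circ m=m\circ(z\otimes 1)=m\circ(1\otimes z)$, and positive if $z=h^\dagger\circ h$ for some $h$. The action is $\alpha_A=(1_{A^*}\otimes m)\circ(\eta_A\otimes 1_A)\colon A\to A^*\otimes A$, and the coaction is $\alpha_A^\dagger$. Normalisable: $(A,m,u)$ comes with a central positive isomorphism $z\colon A\to A$ (the normaliser) such that $\eta_A^\dagger\circ\alpha_A\circ z\circ z=u^\dagger$. $\mathrm{CP}^*[\mathbf{V}]$: objects are normalisable dagger Frobenius algebras $(A,m,u,z)$ in $\mathbf{V}$; morphisms $(A,m_A,u_A,z_A)\to(B,m_B,u_B,z_B)$ are morphisms $f\colon A\to B$ of $\mathbf{V}$ such that $\alpha_B\circ f\circ\alpha_A^\dagger$ is completely positive; composition, identities, dagger and tensor of morphisms are those of $\mathbf{V}$; the tensor of objects is $(A\otimes B,(m_A\otimes m_B)\circ(1\otimes\sigma\otimes1),u_A\otimes u_B,z_A\otimes z_B)$. $\mathrm{Split}^\dagger[\mathbf{C}]$, for a dagger category $\mathbf{C}$: objects are pairs $(X,p)$ with $p\colon X\to X$ a dagger idempotent, i.e. $p^\dagger=p=p\circ p$; morphisms $(X,p)\to(Y,q)$ are morphisms $f\colon X\to Y$ of $\mathbf{C}$ with $f=q\circ f\circ p$; composition and dagger are those of $\mathbf{C}$, and the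 identity of $(X,p)$ is $p$. When $\mathbf{C}$ is dagger compact, the tensor is $(X,p)\otimes(Y,q)=(X\otimes Y,p\otimes q)$. *)

theory Defs
  imports Main
begin

section \<open>Dagger symmetric monoidal and dagger compact categories\<close>

text \<open>
  Categories are records of carrier sets and operations, and the operations are only meaningful on
  composable arguments. Monoidal structure is not assumed to be strict, so every associator and
  unitor is written out. As these are unitary, their inverses are written as daggers.
\<close>

record ('o, 'a) cat =
  Ob :: "'o set"
  Arr :: "'a set"
  Dom :: "'a \<Rightarrow> 'o"
  Cod :: "'a \<Rightarrow> 'o"
  Idn :: "'o \<Rightarrow> 'a" (\<open>\<one>\<index>\<close>)
  Comp :: "'a \<Rightarrow> 'a \<Rightarrow> 'a" (infixr \<open>\<cdot>\<index>\<close> 55)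

record ('o, 'a) dagger_cat = "('o, 'a) cat" +
  Dag :: "'a \<Rightarrow> 'a" (\<open>_\<dagger>\<index>\<close> [1000] 999)

record ('o, 'a) dsm_cat = "('o, 'a) dagger_cat" +
  TensO :: "'o \<Rightarrow> 'o \<Rightarrow> 'o" (infixr \<open>\<odot>\<index>\<close> 70)
  TensA :: "'a \<Rightarrow> 'a \<Rightarrow> 'a" (infixr \<open>\<otimes>\<index>\<close> 70)
  UnitO :: "'o" (\<open>\<I>\<index>\<close>)
  Assoc :: "'o \<Rightarrow> 'o \<Rightarrow> 'o \<Rightarrow> 'a" (\<open>\<a>\<index>\<close>)
  LUnit :: "'o \<Rightarrow> 'a" (\<open>\<l>\<index>\<close>)
  RUnit :: "'o \<Rightarrow> 'a" (\<open>\<r>\<index>\<close>)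
  Symm :: "'o \<Rightarrow> 'o \<Rightarrow> 'a" (\<open>\<sigma>\<index>\<close>)

record ('o, 'a) dc_cat = "('o, 'a) dsm_cat" +
  Dual :: "'o \<Rightarrow> 'o" (\<open>_\<^sup>\<star>\<index>\<close> [1000] 999)
  DUnit :: "'o \<Rightarrow> 'a" (\<open>\<eta>\<index>\<close>)

definition Hom :: "('o, 'a, 'x) cat_scheme \<Rightarrow> 'o \<Rightarrow> 'o \<Rightarrow> 'a set" where
  "Hom C X Y = {f \<in> Arr C. Dom C f = X \<and> Cod C f = Y}"

locale category =
  fixes C :: "('o, 'a, 'x) cat_scheme" (structure)
  assumes Dom_Ob: "f \<in> Arr C \<Longrightarrow> Dom C f \<in> Ob C"
    and Cod_Ob: "f \<in> Arr C \<Longrightarrow> Cod C f \<in> Ob C"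
    and Idn_Hom: "X \<in> Ob C \<Longrightarrow> \<one> X \<in> Hom C X X"
    and Comp_Hom: "f \<in> Hom C X Y \<Longrightarrow> g \<in> Hom C Y Z \<Longrightarrow> g \<cdot> f \<in> Hom C X Z"
    and Comp_assoc: "f \<in> Hom C X Y \<Longrightarrow> g \<in> Hom C Y Z \<Longrightarrow> h \<in> Hom C Z W \<Longrightarrow>
      (h \<cdot> g) \<cdot> f = h \<cdot> (g \<cdot> f)"
    and Idn_left: "f \<in> Hom C X Y \<Longrightarrow> \<one> Y \<cdot> f = f"
    and Idn_right: "f \<in> Hom C X Y \<Longrightarrow> f \<cdot> \<one> X = f"

locale dagger_category = category C
  for C :: "('o, 'a, 'x) dagger_cat_scheme" (structure) +
  assumes Dag_Hom: "f \<in> Hom C X Y \<Longrightarrow> f\<dagger> \<in> Hom C Y X"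
    and Dag_Idn: "X \<in> Ob C \<Longrightarrow> (\<one> X)\<dagger> = \<one> X"
    and Dag_Comp: "f \<in> Hom C X Y \<Longrightarrow> g \<in> Hom C Y Z \<Longrightarrow> (g \<cdot> f)\<dagger> = f\<dagger> \<cdot> g\<dagger>"
    and Dag_Dag: "f \<in> Hom C X Y \<Longrightarrow> (f\<dagger>)\<dagger> = f"

definition unitary :: "('o, 'a, 'x) dagger_cat_scheme \<Rightarrow> 'o \<Rightarrow> 'o \<Rightarrow> 'a \<Rightarrow> bool" where
  "unitary C X Y f \<longleftrightarrow>
     f \<in> Hom C X Y \<and> f\<dagger>\<^bsub>C\<^esub> \<cdot>\<^bsub>C\<^esub> f = \<one>\<^bsub>C\<^esub> X \<and> f \<cdot>\<^bsub>C\<^esub> f\<dagger>\<^bsub>C\<^esub> = \<one>\<^bsub>C\<^esub> Y"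

locale dagger_symmetric_monoidal_category = dagger_category C
  for C :: "('o, 'a, 'x) dsm_cat_scheme" (structure) +
  assumes UnitO_Ob: "\<I> \<in> Ob C"
    and TensO_Ob: "X \<in> Ob C \<Longrightarrow> Y \<in> Ob C \<Longrightarrow> X \<odot> Y \<in> Ob C"
    and TensA_Hom: "f \<in> Hom C X Y \<Longrightarrow> g \<in> Hom C Z W \<Longrightarrow> f \<otimes> g \<in> Hom C (X \<odot> Z) (Y \<odot> W)"
    and TensA_Idn: "X \<in> Ob C \<Longrightarrow> Y \<in> Ob C \<Longrightarrow> \<one> X \<otimes> \<one> Y = \<one> (X \<odot> Y)"
    and TensA_Comp: "f \<in> Hom C X Y \<Longrightarrow> f' \<in> Hom C Y Z \<Longrightarrow> g \<in> Hom C U V \<Longrightarrow> g' \<in> Hom C V W \<Longrightarrow>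
      (f' \<cdot> f) \<otimes> (g' \<cdot> g) = (f' \<otimes> g') \<cdot> (f \<otimes> g)"
    and TensA_Dag: "f \<in> Hom C X Y \<Longrightarrow> g \<in> Hom C Z W \<Longrightarrow> (f \<otimes> g)\<dagger> = f\<dagger> \<otimes> g\<dagger>"
    and Assoc_unitary: "X \<in> Ob C \<Longrightarrow> Y \<in> Ob C \<Longrightarrow> Z \<in> Ob C \<Longrightarrow>
      unitary C ((X \<odot> Y) \<odot> Z) (X \<odot> (Y \<odot> Z)) (\<a> X Y Z)"
    and LUnit_unitary: "X \<in> Ob C \<Longrightarrow> unitary C (\<I> \<odot> X) X (\<l> X)"
    and RUnit_unitary: "X \<in> Ob C \<Longrightarrow> unitary C (X \<odot> \<I>) X (\<r> X)"
    and Symm_unitary: "X \<in> Ob C \<Longrightarrow> Y \<in> Ob C \<Longrightarrow> unitary C (X \<odot> Y) (Y \<odot> X) (\<sigma> X Y)"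
    and Assoc_natural:
      "f \<in> Hom C X X' \<Longrightarrow> g \<in> Hom C Y Y' \<Longrightarrow> h \<in> Hom C Z Z' \<Longrightarrow>
       \<a> X' Y' Z' \<cdot> ((f \<otimes> g) \<otimes> h) = (f \<otimes> (g \<otimes> h)) \<cdot> \<a> X Y Z"
    and LUnit_natural: "f \<in> Hom C X Y \<Longrightarrow> \<l> Y \<cdot> (\<one> \<I> \<otimes> f) = f \<cdot> \<l> X"
    and RUnit_natural: "f \<in> Hom C X Y \<Longrightarrow> \<r> Y \<cdot> (f \<otimes> \<one> \<I>) = f \<cdot> \<r> X"
    and Symm_natural: "f \<in> Hom C X X' \<Longrightarrow> g \<in> Hom C Y Y' \<Longrightarrow>
       \<sigma> X' Y' \<cdot> (f \<otimes> g) = (g \<otimes> f) \<cdot> \<sigma> X Y"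
    and pentagon: "X \<in> Ob C \<Longrightarrow> Y \<in> Ob C \<Longrightarrow> Z \<in> Ob C \<Longrightarrow> W \<in> Ob C \<Longrightarrow>
      (\<one> X \<otimes> \<a> Y Z W) \<cdot> \<a> X (Y \<odot> Z) W \<cdot> (\<a> X Y Z \<otimes> \<one> W) = \<a> X Y (Z \<odot> W) \<cdot> \<a> (X \<odot> Y) Z W"
    and triangle: "X \<in> Ob C \<Longrightarrow> Y \<in> Ob C \<Longrightarrow> (\<one> X \<otimes> \<l> Y) \<cdot> \<a> X \<I> Y = \<r> X \<otimes> \<one> Y"
    and Symm_Symm: "X \<in> Ob C \<Longrightarrow> Y \<in> Ob C \<Longrightarrow> \<sigma> Y X \<cdot> \<sigma> X Y = \<one> (X \<odot> Y)"
    and hexagon: "X \<in> Ob C \<Longrightarrow> Y \<in> Ob C \<Longrightarrow> Z \<in> Ob C \<Longrightarrow>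
      \<a> Y Z X \<cdot> \<sigma> X (Y \<odot> Z) \<cdot> \<a> X Y Z = (\<one> Y \<otimes> \<sigma> X Z) \<cdot> \<a> Y X Z \<cdot> (\<sigma> X Y \<otimes> \<one> Z)"

definition dcounit :: "('o, 'a, 'x) dc_cat_scheme \<Rightarrow> 'o \<Rightarrow> 'a" (\<open>\<epsilon>\<index>\<close>) where
  "\<epsilon>\<^bsub>V\<^esub> A = (\<eta>\<^bsub>V\<^esub> A)\<dagger>\<^bsub>V\<^esub> \<cdot>\<^bsub>V\<^esub> \<sigma>\<^bsub>V\<^esub> A (A\<^sup>\<star>\<^bsub>V\<^esub>)"

locale dagger_compact_category = dagger_symmetric_monoidal_category V
  for V :: "('o, 'a, 'x) dc_cat_scheme" (structure) +
  assumes Dual_Ob: "A \<in> Ob V \<Longrightarrow> A\<^sup>\<star> \<in> Ob V"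
    and DUnit_Hom: "A \<in> Ob V \<Longrightarrow> \<eta> A \<in> Hom V \<I> (A\<^sup>\<star> \<odot> A)"
    and snake: "A \<in> Ob V \<Longrightarrow>
      \<l> A \<cdot> (\<epsilon> A \<otimes> \<one> A) \<cdot> (\<a> A (A\<^sup>\<star>) A)\<dagger> \<cdot> (\<one> A \<otimes> \<eta> A) \<cdot> (\<r> A)\<dagger> = \<one> A"
    and snake_Dual: "A \<in> Ob V \<Longrightarrow>
      \<r> (A\<^sup>\<star>) \<cdot> (\<one> (A\<^sup>\<star>) \<otimes> \<epsilon> A) \<cdot> \<a> (A\<^sup>\<star>) A (A\<^sup>\<star>) \<cdot> (\<eta> A \<otimes> \<one> (A\<^sup>\<star>)) \<cdot> (\<l> (A\<^sup>\<star>))\<dagger> = \<one> (A\<^sup>\<star>)"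


section \<open>Functors\<close>

locale category_functor = source: category C + target: category D
  for C :: "('o, 'a, 'x) cat_scheme" and D :: "('p, 'b, 'y) cat_scheme" +
  fixes Fo :: "'o \<Rightarrow> 'p" and Fa :: "'a \<Rightarrow> 'b"
  assumes Fo_Ob: "X \<in> Ob C \<Longrightarrow> Fo X \<in> Ob D"
    and Fa_Hom: "f \<in> Hom C X Y \<Longrightarrow> Fa f \<in> Hom D (Fo X) (Fo Y)"
    and Fa_Idn: "X \<in> Ob C \<Longrightarrow> Fa (\<one>\<^bsub>C\<^esub> X) = \<one>\<^bsub>D\<^esub> (Fo X)"
    and Fa_Comp: "f \<in> Hom C X Y \<Longrightarrow> g \<in> Hom C Y Z \<Longrightarrow> Fa (g \<cdot>\<^bsub>C\<^esub> f) = Fa g \<cdot>\<^bsub>D\<^esub> Fa f"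

locale full_functor = category_functor +
  assumes full: "X \<in> Ob C \<Longrightarrow> Y \<in> Ob C \<Longrightarrow> g \<in> Hom D (Fo X) (Fo Y) \<Longrightarrow> \<exists>f \<in> Hom C X Y. Fa f = g"

locale faithful_functor = category_functor +
  assumes faithful: "X \<in> Ob C \<Longrightarrow> Y \<in> Ob C \<Longrightarrow> inj_on Fa (Hom C X Y)"

text \<open>The comparison maps of a strong dagger monoidal functor are required to be unitary.\<close>

locale strong_dagger_symmetric_monoidal_functor =
  category_functor C D Fo Fa +
  source: dagger_symmetric_monoidal_category C + target: dagger_symmetric_monoidal_category D
  for C :: "('o, 'a, 'x) dsm_cat_scheme" and D :: "('p, 'b, 'y) dsm_cat_scheme"
    and Fo :: "'o \<Rightarrow> 'p" and Fa :: "'a \<Rightarrow> 'b" +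
  fixes \<phi> :: "'o \<Rightarrow> 'o \<Rightarrow> 'b" and \<phi>0 :: "'b"
  assumes Fa_Dag: "f \<in> Hom C X Y \<Longrightarrow> Fa (f\<dagger>\<^bsub>C\<^esub>) = (Fa f)\<dagger>\<^bsub>D\<^esub>"
    and \<phi>_unitary: "X \<in> Ob C \<Longrightarrow> Y \<in> Ob C \<Longrightarrow>
      unitary D (Fo X \<odot>\<^bsub>D\<^esub> Fo Y) (Fo (X \<odot>\<^bsub>C\<^esub> Y)) (\<phi> X Y)"
    and \<phi>0_unitary: "unitary D \<I>\<^bsub>D\<^esub> (Fo \<I>\<^bsub>C\<^esub>) \<phi>0"
    and \<phi>_natural: "f \<in> Hom C X X' \<Longrightarrow> g \<in> Hom C Y Y' \<Longrightarrow>
      \<phi> X' Y' \<cdot>\<^bsub>D\<^esub> (Fa f \<otimes>\<^bsub>D\<^esub> Fa g) = Fa (f \<otimes>\<^bsub>C\<^esub> g) \<cdot>\<^bsub>D\<^esub> \<phi> X Y"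
    and \<phi>_Assoc: "X \<in> Ob C \<Longrightarrow> Y \<in> Ob C \<Longrightarrow> Z \<in> Ob C \<Longrightarrow>
      Fa (\<a>\<^bsub>C\<^esub> X Y Z) \<cdot>\<^bsub>D\<^esub> \<phi> (X \<odot>\<^bsub>C\<^esub> Y) Z \<cdot>\<^bsub>D\<^esub> (\<phi> X Y \<otimes>\<^bsub>D\<^esub> \<one>\<^bsub>D\<^esub> (Fo Z))
      = \<phi> X (Y \<odot>\<^bsub>C\<^esub> Z) \<cdot>\<^bsub>D\<^esub> (\<one>\<^bsub>D\<^esub> (Fo X) \<otimes>\<^bsub>D\<^esub> \<phi> Y Z) \<cdot>\<^bsub>D\<^esub> \<a>\<^bsub>D\<^esub> (Fo X) (Fo Y) (Fo Z)"
    and \<phi>_LUnit: "X \<in> Ob C \<Longrightarrow>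
      Fa (\<l>\<^bsub>C\<^esub> X) \<cdot>\<^bsub>D\<^esub> \<phi> \<I>\<^bsub>C\<^esub> X \<cdot>\<^bsub>D\<^esub> (\<phi>0 \<otimes>\<^bsub>D\<^esub> \<one>\<^bsub>D\<^esub> (Fo X)) = \<l>\<^bsub>D\<^esub> (Fo X)"
    and \<phi>_RUnit: "X \<in> Ob C \<Longrightarrow>
      Fa (\<r>\<^bsub>C\<^esub> X) \<cdot>\<^bsub>D\<^esub> \<phi> X \<I>\<^bsub>C\<^esub> \<cdot>\<^bsub>D\<^esub> (\<one>\<^bsub>D\<^esub> (Fo X) \<otimes>\<^bsub>D\<^esub> \<phi>0) = \<r>\<^bsub>D\<^esub> (Fo X)"
    and \<phi>_Symm: "X \<in> Ob C \<Longrightarrow> Y \<in> Ob C \<Longrightarrow>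
      Fa (\<sigma>\<^bsub>C\<^esub> X Y) \<cdot>\<^bsub>D\<^esub> \<phi> X Y = \<phi> Y X \<cdot>\<^bsub>D\<^esub> \<sigma>\<^bsub>D\<^esub> (Fo X) (Fo Y)"


section \<open>The dagger idempotent splitting\<close>

text \<open>
  One underlying arrow can be a morphism between several pairs of objects, so an arrow of the
  splitting, and likewise of \<open>CPM[V]\<close> and \<open>CP*[V]\<close> below, is a triple of its domain, an underlying
  arrow, and its codomain. A structure map of the splitting is that of the given
  category, composed with the idempotents on both sides.
\<close>

definition split_arr ::
  "('o, 'a, 'x) cat_scheme \<Rightarrow> 'o \<times> 'a \<Rightarrow> 'a \<Rightarrow> 'o \<times> 'a \<Rightarrow> ('o \<times> 'a) \<times> 'a \<times> ('o \<times> 'a)" where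
  "split_arr C P f Q = (P, snd Q \<cdot>\<^bsub>C\<^esub> f \<cdot>\<^bsub>C\<^esub> snd P, Q)"

definition split_Ob :: "('o, 'a, 'x) dagger_cat_scheme \<Rightarrow> ('o \<times> 'a) set" where
  "split_Ob C = {(X, p). X \<in> Ob C \<and> p \<in> Hom C X X \<and> p\<dagger>\<^bsub>C\<^esub> = p \<and> p \<cdot>\<^bsub>C\<^esub> p = p}"

definition split_TensO ::
  "('o, 'a, 'x) dsm_cat_scheme \<Rightarrow> 'o \<times> 'a \<Rightarrow> 'o \<times> 'a \<Rightarrow> 'o \<times> 'a" where
  "split_TensO C P Q = (fst P \<odot>\<^bsub>C\<^esub> fst Q, snd P \<otimes>\<^bsub>C\<^esub> snd Q)"

definition split_UnitO :: "('o, 'a, 'x) dsm_cat_scheme \<Rightarrow> 'o \<times> 'a" where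
  "split_UnitO C = (\<I>\<^bsub>C\<^esub>, \<one>\<^bsub>C\<^esub> \<I>\<^bsub>C\<^esub>)"

definition Split_dagger ::
  "('o, 'a, 'x) dsm_cat_scheme \<Rightarrow> ('o \<times> 'a, ('o \<times> 'a) \<times> 'a \<times> ('o \<times> 'a)) dsm_cat" where
  "Split_dagger C =
    \<lparr>Ob = split_Ob C,
     Arr = {((X, p), f, (Y, q)). (X, p) \<in> split_Ob C \<and> (Y, q) \<in> split_Ob C \<and>
              f \<in> Hom C X Y \<and> f = q \<cdot>\<^bsub>C\<^esub> f \<cdot>\<^bsub>C\<^esub> p},
     Dom = (\<lambda>(P, f, Q). P),
     Cod = (\<lambda>(P, f, Q). Q),
     Idn = (\<lambda>(X, p). ((X, p), p, (X, p))),
     Comp = (\<lambda>(Q', g, R) (P, f, Q). (P, g \<cdot>\<^bsub>C\<^esub> f, R)),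
     Dag = (\<lambda>(P, f, Q). (Q, f\<dagger>\<^bsub>C\<^esub>, P)),
     TensO = split_TensO C,
     TensA = (\<lambda>(P, f, Q) (P', g, Q'). (split_TensO C P P', f \<otimes>\<^bsub>C\<^esub> g, split_TensO C Q Q')),
     UnitO = split_UnitO C,
     Assoc = (\<lambda>P Q R. split_arr C (split_TensO C (split_TensO C P Q) R)
                (\<a>\<^bsub>C\<^esub> (fst P) (fst Q) (fst R)) (split_TensO C P (split_TensO C Q R))),
     LUnit = (\<lambda>P. split_arr C (split_TensO C (split_UnitO C) P) (\<l>\<^bsub>C\<^esub> (fst P)) P),
     RUnit = (\<lambda>P. split_arr C (split_TensO C P (split_UnitO C)) (\<r>\<^bsub>C\<^esub> (fst P)) P),
     Symm = (\<lambda>P Q. split_arr C (split_TensO C P Q) (\<sigma>\<^bsub>C\<^esub> (fst P) (fst Q)) (split_TensO C Q P))\<rparr>"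


section \<open>Completely positive morphisms\<close>

context
  fixes V :: "('o, 'a, 'x) dc_cat_scheme" (structure)
begin

definition transpose_arr :: "'a \<Rightarrow> 'a" where
  "transpose_arr f = (let A = Dom V f; B = Cod V f in
     \<r> (A\<^sup>\<star>) \<cdot> (\<one> (A\<^sup>\<star>) \<otimes> \<epsilon> B) \<cdot> \<a> (A\<^sup>\<star>) B (B\<^sup>\<star>) \<cdot> ((\<one> (A\<^sup>\<star>) \<otimes> f) \<otimes> \<one> (B\<^sup>\<star>))
       \<cdot> (\<eta> A \<otimes> \<one> (B\<^sup>\<star>)) \<cdot> (\<l> (B\<^sup>\<star>))\<dagger>)"

definition lower_star :: "'a \<Rightarrow> 'a" where
  "lower_star g = transpose_arr (g\<dagger>)"

text \<open>
  The map \<open>1 \<otimes> \<eta>\<^sub>X\<dagger> \<otimes> 1\<close> that caps off the two middle factors of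
  \<open>(B\<^sup>\<star> \<otimes> X\<^sup>\<star>) \<otimes> (X \<otimes> B)\<close>.
\<close>

definition cap_middle :: "'o \<Rightarrow> 'o \<Rightarrow> 'a" where
  "cap_middle X B = (\<one> (B\<^sup>\<star>) \<otimes> (\<l> B \<cdot> ((\<eta> X)\<dagger> \<otimes> \<one> B) \<cdot> (\<a> (X\<^sup>\<star>) X B)\<dagger>))
     \<cdot> \<a> (B\<^sup>\<star>) (X\<^sup>\<star>) (X \<odot> B)"

text \<open>
  The chosen dual of \<open>A \<otimes> B\<close> is only canonically isomorphic to \<open>B\<^sup>\<star> \<otimes> A\<^sup>\<star>\<close>.
  The nested unit \<open>I \<rightarrow> (B\<^sup>\<star> \<otimes> A\<^sup>\<star>) \<otimes> (A \<otimes> B)\<close> makes the latter a dual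
  as well, and \<open>dual_tensor A B : (A \<otimes> B)\<^sup>\<star> \<rightarrow> B\<^sup>\<star> \<otimes> A\<^sup>\<star>\<close> is the resulting comparison
  map. It is unitary, and it is the identity if \<open>(A \<otimes> B)\<^sup>\<star> = B\<^sup>\<star> \<otimes> A\<^sup>\<star>\<close> with nested unit.
\<close>

definition nested_unit :: "'o \<Rightarrow> 'o \<Rightarrow> 'a" where
  "nested_unit A B = (cap_middle A B)\<dagger> \<cdot> \<eta> B"

definition dual_tensor :: "'o \<Rightarrow> 'o \<Rightarrow> 'a" where
  "dual_tensor A B = (let P = (A \<odot> B)\<^sup>\<star>; Q = B\<^sup>\<star> \<odot> A\<^sup>\<star> in
     \<r> Q \<cdot> (\<one> Q \<otimes> \<epsilon> (A \<odot> B)) \<cdot> \<a> Q (A \<odot> B) P \<cdot> (nested_unit A B \<otimes> \<one> P) \<cdot> (\<l> P)\<dagger>)"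

definition completely_positive :: "'o \<Rightarrow> 'o \<Rightarrow> 'a \<Rightarrow> bool" where
  "completely_positive A B f \<longleftrightarrow> (\<exists>X \<in> Ob V. \<exists>g \<in> Hom V A (X \<odot> B).
     f = cap_middle X B \<cdot> (dual_tensor X B \<otimes> \<one> (X \<odot> B)) \<cdot> (lower_star g \<otimes> g))"

text \<open>
  The reordering
  \<open>(A\<^sup>\<star> \<otimes> A) \<otimes> (B\<^sup>\<star> \<otimes> B) \<rightarrow> (B\<^sup>\<star> \<otimes> A\<^sup>\<star>) \<otimes> (A \<otimes> B) \<rightarrow> (A \<otimes> B)\<^sup>\<star> \<otimes> (A \<otimes> B)\<close>.
\<close>

definition reorder :: "'o \<Rightarrow> 'o \<Rightarrow> 'a" where
  "reorder A B = ((dual_tensor A B)\<dagger> \<otimes> \<one> (A \<odot> B)) \<cdot> (\<a> (B\<^sup>\<star>) (A\<^sup>\<star>) (A \<odot> B))\<dagger>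
     \<cdot> (\<one> (B\<^sup>\<star>) \<otimes> \<a> (A\<^sup>\<star>) A B) \<cdot> \<a> (B\<^sup>\<star>) (A\<^sup>\<star> \<odot> A) B
     \<cdot> (\<sigma> (A\<^sup>\<star> \<odot> A) (B\<^sup>\<star>) \<otimes> \<one> B) \<cdot> (\<a> (A\<^sup>\<star> \<odot> A) (B\<^sup>\<star>) B)\<dagger>"

text \<open>
  The structure maps of \<open>CPM[V]\<close> are the images of those of \<open>V\<close> under the functor
  \<open>g \<mapsto> g\<^sub>* \<otimes> g\<close>.
\<close>

definition double :: "'a \<Rightarrow> 'o \<times> 'a \<times> 'o" where
  "double g = (Dom V g, lower_star g \<otimes> g, Cod V g)"

definition CPM :: "('o, 'o \<times> 'a \<times> 'o) dsm_cat" where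
  "CPM =
    \<lparr>Ob = Ob V,
     Arr = {(A, f, B). A \<in> Ob V \<and> B \<in> Ob V \<and> completely_positive A B f},
     Dom = (\<lambda>(A, f, B). A),
     Cod = (\<lambda>(A, f, B). B),
     Idn = (\<lambda>A. (A, \<one> (A\<^sup>\<star> \<odot> A), A)),
     Comp = (\<lambda>(B', g, C) (A, f, B). (A, g \<cdot> f, C)),
     Dag = (\<lambda>(A, f, B). (B, f\<dagger>, A)),
     TensO = (\<lambda>A B. A \<odot> B),
     TensA = (\<lambda>(A, f, B) (C, g, D).
                (A \<odot> C, reorder B D \<cdot> (f \<otimes> g) \<cdot> (reorder A C)\<dagger>, B \<odot> D)),
     UnitO = \<I>,
     Assoc = (\<lambda>A B C. double (\<a> A B C)),
     LUnit = (\<lambda>A. double (\<l> A)),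
     RUnit = (\<lambda>A. double (\<r> A)),
     Symm = (\<lambda>A B. double (\<sigma> A B))\<rparr>"


section \<open>Normalisable dagger Frobenius algebras\<close>

definition dagger_frobenius :: "'o \<Rightarrow> 'a \<Rightarrow> 'a \<Rightarrow> bool" where
  "dagger_frobenius A m u \<longleftrightarrow>
     A \<in> Ob V \<and> m \<in> Hom V (A \<odot> A) A \<and> u \<in> Hom V \<I> A \<and>
     m \<cdot> (m \<otimes> \<one> A) = m \<cdot> (\<one> A \<otimes> m) \<cdot> \<a> A A A \<and>
     m \<cdot> (u \<otimes> \<one> A) = \<l> A \<and> m \<cdot> (\<one> A \<otimes> u) = \<r> A \<and>
     (m \<otimes> \<one> A) \<cdot> (\<a> A A A)\<dagger> \<cdot> (\<one> A \<otimes> m\<dagger>) = m\<dagger> \<cdot> m \<and>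
     m\<dagger> \<cdot> m = (\<one> A \<otimes> m) \<cdot> \<a> A A A \<cdot> (m\<dagger> \<otimes> \<one> A)"

definition central :: "'o \<Rightarrow> 'a \<Rightarrow> 'a \<Rightarrow> bool" where
  "central A m z \<longleftrightarrow> z \<in> Hom V A A \<and> z \<cdot> m = m \<cdot> (z \<otimes> \<one> A) \<and> m \<cdot> (z \<otimes> \<one> A) = m \<cdot> (\<one> A \<otimes> z)"

definition positive :: "'o \<Rightarrow> 'a \<Rightarrow> bool" where
  "positive A z \<longleftrightarrow> (\<exists>B \<in> Ob V. \<exists>h \<in> Hom V A B. z = h\<dagger> \<cdot> h)"

definition isomorphism :: "'o \<Rightarrow> 'o \<Rightarrow> 'a \<Rightarrow> bool" where
  "isomorphism A B f \<longleftrightarrow> f \<in> Hom V A B \<and> (\<exists>g \<in> Hom V B A. g \<cdot> f = \<one> A \<and> f \<cdot> g = \<one> B)"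

definition action :: "'o \<Rightarrow> 'a \<Rightarrow> 'a" where
  "action A m = (\<one> (A\<^sup>\<star>) \<otimes> m) \<cdot> \<a> (A\<^sup>\<star>) A A \<cdot> (\<eta> A \<otimes> \<one> A) \<cdot> (\<l> A)\<dagger>"

definition normaliser :: "'o \<Rightarrow> 'a \<Rightarrow> 'a \<Rightarrow> 'a \<Rightarrow> bool" where
  "normaliser A m u z \<longleftrightarrow> central A m z \<and> positive A z \<and> isomorphism A A z \<and>
     (\<eta> A)\<dagger> \<cdot> action A m \<cdot> z \<cdot> z = u\<dagger>"

text \<open>The middle interchange \<open>1 \<otimes> \<sigma> \<otimes> 1 : (A \<otimes> B) \<otimes> (C \<otimes> D) \<rightarrow> (A \<otimes> C) \<otimes> (B \<otimes> D)\<close>.\<close>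

definition interchange :: "'o \<Rightarrow> 'o \<Rightarrow> 'o \<Rightarrow> 'o \<Rightarrow> 'a" where
  "interchange A B C D = (\<a> A C (B \<odot> D))\<dagger>
     \<cdot> (\<one> A \<otimes> (\<a> C B D \<cdot> (\<sigma> B C \<otimes> \<one> D) \<cdot> (\<a> B C D)\<dagger>)) \<cdot> \<a> A B (C \<odot> D)"

fun cpstar_TensO :: "'o \<times> 'a \<times> 'a \<times> 'a \<Rightarrow> 'o \<times> 'a \<times> 'a \<times> 'a \<Rightarrow> 'o \<times> 'a \<times> 'a \<times> 'a" where
  "cpstar_TensO (A, mA, uA, zA) (B, mB, uB, zB) =
     (A \<odot> B, (mA \<otimes> mB) \<cdot> interchange A B A B, (uA \<otimes> uB) \<cdot> (\<l> \<I>)\<dagger>, zA \<otimes> zB)"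

definition cpstar_UnitO :: "'o \<times> 'a \<times> 'a \<times> 'a" where
  "cpstar_UnitO = (\<I>, \<l> \<I>, \<one> \<I>, \<one> \<I>)"

definition cpstar_Ob :: "('o \<times> 'a \<times> 'a \<times> 'a) set" where
  "cpstar_Ob = {(A, m, u, z). dagger_frobenius A m u \<and> normaliser A m u z}"

definition CPstar ::
  "('o \<times> 'a \<times> 'a \<times> 'a, ('o \<times> 'a \<times> 'a \<times> 'a) \<times> 'a \<times> ('o \<times> 'a \<times> 'a \<times> 'a)) dsm_cat" where
  "CPstar =
    \<lparr>Ob = cpstar_Ob,
     Arr = {((A, mA, uA, zA), f, (B, mB, uB, zB)).
              (A, mA, uA, zA) \<in> cpstar_Ob \<and> (B, mB, uB, zB) \<in> cpstar_Ob \<and> f \<in> Hom V A B \<and>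
              completely_positive A B (action B mB \<cdot> f \<cdot> (action A mA)\<dagger>)},
     Dom = (\<lambda>(P, f, Q). P),
     Cod = (\<lambda>(P, f, Q). Q),
     Idn = (\<lambda>P. (P, \<one> (fst P), P)),
     Comp = (\<lambda>(Q', g, R) (P, f, Q). (P, g \<cdot> f, R)),
     Dag = (\<lambda>(P, f, Q). (Q, f\<dagger>, P)),
     TensO = cpstar_TensO,
     TensA = (\<lambda>(P, f, Q) (P', g, Q'). (cpstar_TensO P P', f \<otimes> g, cpstar_TensO Q Q')),
     UnitO = cpstar_UnitO,
     Assoc = (\<lambda>P Q R. (cpstar_TensO (cpstar_TensO P Q) R, \<a> (fst P) (fst Q) (fst R),
                       cpstar_TensO P (cpstar_TensO Q R))),
     LUnit = (\<lambda>P. (cpstar_TensO cpstar_UnitO P, \<l> (fst P), P)),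
     RUnit = (\<lambda>P. (cpstar_TensO P cpstar_UnitO, \<r> (fst P), P)),
     Symm = (\<lambda>P Q. (cpstar_TensO P Q, \<sigma> (fst P) (fst Q), cpstar_TensO Q P))\<rparr>"

end

end

theory Submission
  imports Defs
begin

text \<open>
  A morphism \<open>X \<rightarrow> A\<^sup>\<star> \<otimes> Y\<close> is determined by its curried form \<open>A \<otimes> X \<rightarrow> Y\<close>. The curried
  form of the action of an algebra is its multiplication, that of \<open>g\<^sub>* \<otimes> g\<close> is \<open>\<rho> \<mapsto> g \<rho> g\<^sup>\<dagger>\<close>,
  and that of the reordering is the interchange of tensor factors. Hence \<open>g \<mapsto> g\<^sub>* \<otimes> g\<close> is a
  strong dagger symmetric monoidal endofunctor of \<open>V\<close>, and the completely positive morphisms are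
  its values followed by partial traces; the monoidal structure of \<open>CPM[V]\<close> follows.

  For a normalisable algebra, normalisation gives \<open>\<alpha>\<^sup>\<dagger> \<alpha> z\<^sup>2 = 1\<close>, which makes \<open>F\<close> functorial, full and
  faithful as soon as \<open>\<alpha> z \<alpha>\<^sup>\<dagger>\<close> and \<open>\<alpha> \<alpha>\<^sup>\<dagger>\<close> are completely positive. They are, with the
  comultiplication as Kraus morphism, because the form \<open>u\<^sup>\<dagger>(a b)\<close> is the trace of right
  multiplication by \<open>z\<^sup>2 a b\<close> and therefore symmetric. Finally \<open>\<alpha>\<close> of a tensor product is the
  reordering of \<open>\<alpha> \<otimes> \<alpha>\<close>, so that \<open>F\<close> preserves tensor products on the nose.
\<close>

text \<open>The shape of \<open>F\<close> comes from one isometry. Put v = \<alpha> z. Normalisation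
  gives z \<alpha>\<dagger> \<alpha> z = 1, so \<open>F\<close> sends an algebra to the range
  projection v v\<dagger> and f to v f v\<dagger>, and c \<mapsto> v\<dagger> c v is the inverse on
  hom-sets. The exponents of z need care, because complete positivity in CP* is tested with \<alpha>
  alone while v carries one z. The difference is repaired with two completely positive maps:
  \<alpha> z \<alpha>\<dagger>, and the doubling of z, which acts on \<alpha> as z z on its source.
  The same device repairs composition in CP*, where \<alpha>\<dagger> \<alpha> is in general not the
  identity. In CPM the delicate point is closure under the dagger. The dagger of a partial trace
  over X creates \<eta> at X, and a Kraus morphism for that state has the dual of X as environment,
  so the double dual enters. Two obstacles shape the calculations: \<open>V\<close> is not strict,
  and the dual of a tensor product is an arbitrary chosen object. Hence equations between maps into
  doubled objects are compared only after currying.\<close>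

context category
begin

text \<open>The axioms are phrased with \<open>Hom\<close>. Separating arrow, domain and codomain
  turns composability conditions into equations that the simplifier can discharge.\<close>

lemma Hom_iff: "f \<in> Hom C X Y \<longleftrightarrow> f \<in> Arr C \<and> Dom C f = X \<and> Cod C f = Y"
  by (auto simp: Hom_def)

lemma Dom_in_Ob [simp]: "f \<in> Arr C \<Longrightarrow> Dom C f \<in> Ob C"
  and Cod_in_Ob [simp]: "f \<in> Arr C \<Longrightarrow> Cod C f \<in> Ob C"
  by (simp_all add: Dom_Ob Cod_Ob)

lemma idn_arr [simp]:
  assumes "X \<in> Ob C"
  shows "\<one> X \<in> Arr C" "Dom C (\<one> X) = X" "Cod C (\<one> X) = X"
  using Idn_Hom[OF assms] by (simp_all add: Hom_iff)

lemma comp_arr [simp]: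
  assumes "f \<in> Arr C" "g \<in> Arr C" "Cod C f = Dom C g"
  shows "g \<cdot> f \<in> Arr C" "Dom C (g \<cdot> f) = Dom C f" "Cod C (g \<cdot> f) = Cod C g"
  using Comp_Hom[of f "Dom C f" "Cod C f" g "Cod C g"] assms by (simp_all add: Hom_iff)

lemma comp_assoc [simp]:
  assumes "f \<in> Arr C" "g \<in> Arr C" "h \<in> Arr C" "Cod C f = Dom C g" "Cod C g = Dom C h"
  shows "(h \<cdot> g) \<cdot> f = h \<cdot> g \<cdot> f"
  using Comp_assoc[of f "Dom C f" "Cod C f" g "Cod C g" h "Cod C h"] assms by (simp add: Hom_iff)

lemma idn_left [simp]: "f \<in> Arr C \<Longrightarrow> Cod C f = Y \<Longrightarrow> \<one> Y \<cdot> f = f"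
  and idn_right [simp]: "f \<in> Arr C \<Longrightarrow> Dom C f = X \<Longrightarrow> f \<cdot> \<one> X = f"
  using Idn_left[of f "Dom C f" Y] Idn_right[of f X "Cod C f"] by (simp_all add: Hom_iff)

text \<open>Composites are kept right-nested, so an equation for a composite of two arrows does not
  match inside a longer one. This rule gives it a tail.\<close>

lemma comp_lift:
  assumes "g \<cdot> f = k" "f \<in> Arr C" "g \<in> Arr C" "Cod C f = Dom C g" "h \<in> Arr C" "Cod C h = Dom C f"
  shows "g \<cdot> f \<cdot> h = k \<cdot> h"
  using comp_assoc[of h f g] assms by simp

end

section \<open>Daggers and unitary arrows\<close>

context dagger_category
begin

lemma dag_arr [simp]:
  assumes "f \<in> Arr C"
  shows "f\<dagger> \<in> Arr C" "Dom C (f\<dagger>) = Cod C f" "Cod C (f\<dagger>) = Dom C f"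
  using Dag_Hom[of f "Dom C f" "Cod C f"] assms by (simp_all add: Hom_iff)

lemma dag_dag [simp]: "f \<in> Arr C \<Longrightarrow> (f\<dagger>)\<dagger> = f"
  using Dag_Dag[of f "Dom C f" "Cod C f"] by (simp add: Hom_iff)

lemma dag_comp [simp]:
  "f \<in> Arr C \<Longrightarrow> g \<in> Arr C \<Longrightarrow> Cod C f = Dom C g \<Longrightarrow> (g \<cdot> f)\<dagger> = f\<dagger> \<cdot> g\<dagger>"
  using Dag_Comp[of f "Dom C f" "Cod C f" g "Cod C g"] by (simp add: Hom_iff)

declare Dag_Idn [simp]

text \<open>Unlike \<open>unitary\<close>, this reads domain and codomain off the arrow, so that it
  can serve in rewriting without guessing them.\<close>

definition unit_arr :: "'a \<Rightarrow> bool" where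
  "unit_arr f \<longleftrightarrow> f \<in> Arr C \<and> f\<dagger> \<cdot> f = \<one> (Dom C f) \<and> f \<cdot> f\<dagger> = \<one> (Cod C f)"

lemma unitary_iff: "unitary C X Y f \<longleftrightarrow> unit_arr f \<and> Dom C f = X \<and> Cod C f = Y"
  by (auto simp: unitary_def unit_arr_def Hom_iff)

lemma unit_arrD:
  assumes "unit_arr f"
  shows "f \<in> Arr C" "f\<dagger> \<cdot> f = \<one> (Dom C f)" "f \<cdot> f\<dagger> = \<one> (Cod C f)"
  using assms by (simp_all add: unit_arr_def)

lemma unit_arr_cancel:
  assumes "unit_arr f"
  shows "h \<in> Arr C \<Longrightarrow> Cod C h = Dom C f \<Longrightarrow> f\<dagger> \<cdot> f \<cdot> h = h"
    and "h \<in> Arr C \<Longrightarrow> Cod C h = Cod C f \<Longrightarrow> f \<cdot> f\<dagger> \<cdot> h = h"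
  using assms comp_lift[OF unit_arrD(2)[OF assms]] comp_lift[OF unit_arrD(3)[OF assms]]
  by (simp_all add: unit_arr_def)

lemma unit_arr_idn [simp]: "X \<in> Ob C \<Longrightarrow> unit_arr (\<one> X)"
  by (simp add: unit_arr_def)

lemma unit_arr_dag [simp]: "unit_arr f \<Longrightarrow> unit_arr (f\<dagger>)"
  by (simp add: unit_arr_def)

lemma unit_arr_comp [simp]:
  assumes "unit_arr f" "unit_arr g" "Cod C f = Dom C g" shows "unit_arr (g \<cdot> f)"
  using assms unit_arr_cancel[OF assms(1)] unit_arr_cancel[OF assms(2)]
  by (simp add: unit_arr_def)

lemma unit_arr_left_eq:
  assumes "unit_arr u" "f \<in> Arr C" "g \<in> Arr C" "Cod C f = Dom C u" "Cod C g = Dom C u"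
    "u \<cdot> f = u \<cdot> g"
  shows "f = g"
proof -
  note u = unit_arrD[OF assms(1)] unit_arr_cancel[OF assms(1)]
  have "f = u\<dagger> \<cdot> u \<cdot> f" using assms(2,4) u by simp
  also have "\<dots> = u\<dagger> \<cdot> u \<cdot> g" by (simp only: assms(6))
  also have "\<dots> = g" using assms(3,5) u by simp
  finally show ?thesis .
qed

lemma unit_arr_right_eq:
  assumes "unit_arr u" "f \<in> Arr C" "g \<in> Arr C" "Dom C f = Cod C u" "Dom C g = Cod C u"
    "f \<cdot> u = g \<cdot> u"
  shows "f = g"
proof -
  note u = unit_arrD[OF assms(1)]
  have "f = (f \<cdot> u) \<cdot> u\<dagger>" using assms(2,4) u by simp
  also have "\<dots> = (g \<cdot> u) \<cdot> u\<dagger>" by (simp only: assms(6))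
  also have "\<dots> = g" using assms(3,5) u by simp
  finally show ?thesis .
qed

lemma dag_inject:
  assumes "f \<in> Arr C" "g \<in> Arr C" "f\<dagger> = g\<dagger>" shows "f = g"
  using assms dag_dag by metis

text \<open>Multiply by \<open>u\<dagger>\<close> on the left and by \<open>v\<dagger>\<close> on
  the right. It converts naturality of a structure map into naturality of its inverse.\<close>

lemma unit_arr_flip:
  assumes "u \<cdot> x = y \<cdot> v" "unit_arr u" "unit_arr v" "x \<in> Arr C" "y \<in> Arr C"
    "Cod C x = Dom C u" "Dom C y = Cod C v" "Dom C x = Dom C v" "Cod C y = Cod C u"
  shows "u\<dagger> \<cdot> y = x \<cdot> v\<dagger>"
proof -
  note u = unit_arrD[OF assms(2)] and v = unit_arrD[OF assms(3)]
  have "u\<dagger> \<cdot> y = u\<dagger> \<cdot> (y \<cdot> v) \<cdot> v\<dagger>" using assms u v by simp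
  also have "\<dots> = u\<dagger> \<cdot> u \<cdot> x \<cdot> v\<dagger>" using assms u v by (simp flip: assms(1))
  also have "\<dots> = x \<cdot> v\<dagger>" using assms u v unit_arr_cancel(1)[OF assms(2)] by simp
  finally show ?thesis .
qed

end

section \<open>Rewriting in a non-strict symmetric monoidal dagger category\<close>

context dagger_symmetric_monoidal_category
begin

declare UnitO_Ob [simp] TensO_Ob [simp]

lemma tens_arr [simp]:
  assumes "f \<in> Arr C" "g \<in> Arr C"
  shows "f \<otimes> g \<in> Arr C" "Dom C (f \<otimes> g) = Dom C f \<odot> Dom C g" "Cod C (f \<otimes> g) = Cod C f \<odot> Cod C g"
  using TensA_Hom[of f "Dom C f" "Cod C f" g "Dom C g" "Cod C g"] assms by (simp_all add: Hom_iff)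

declare TensA_Idn [simp]

lemma tens_dag [simp]: "f \<in> Arr C \<Longrightarrow> g \<in> Arr C \<Longrightarrow> (f \<otimes> g)\<dagger> = f\<dagger> \<otimes> g\<dagger>"
  using TensA_Dag[of f "Dom C f" "Cod C f" g "Dom C g" "Cod C g"] by (simp add: Hom_iff)

lemma tens_comp:
  assumes "f \<in> Arr C" "f' \<in> Arr C" "g \<in> Arr C" "g' \<in> Arr C"
    "Cod C f = Dom C f'" "Cod C g = Dom C g'"
  shows "(f' \<otimes> g') \<cdot> (f \<otimes> g) = (f' \<cdot> f) \<otimes> (g' \<cdot> g)"
  using TensA_Comp[of f "Dom C f" "Cod C f" f' "Cod C f'" g "Dom C g" "Cod C g" g' "Cod C g'"] assms
  by (simp add: Hom_iff)

text \<open>Bifunctoriality is needed in both directions: \<open>tens_merge\<close> fuses parallel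
  layers, \<open>whisk\<close> spreads a whiskered composite over several layers. Together they
  would loop, so a rewriting step takes one of them.\<close>

lemmas tens_merge = tens_comp comp_lift[OF tens_comp]

lemma whisk_left:
  assumes "f \<in> Arr C" "g \<in> Arr C" "Cod C f = Dom C g" "X \<in> Ob C"
  shows "\<one> X \<otimes> (g \<cdot> f) = (\<one> X \<otimes> g) \<cdot> (\<one> X \<otimes> f)"
  using assms by (simp add: tens_comp)

lemma whisk_right:
  assumes "f \<in> Arr C" "g \<in> Arr C" "Cod C f = Dom C g" "X \<in> Ob C"
  shows "(g \<cdot> f) \<otimes> \<one> X = (g \<otimes> \<one> X) \<cdot> (f \<otimes> \<one> X)"
  using assms by (simp add: tens_comp)

lemmas whisk = whisk_left whisk_right

lemma unit_arr_tens [simp]: "unit_arr f \<Longrightarrow> unit_arr g \<Longrightarrow> unit_arr (f \<otimes> g)"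
  by (auto simp add: unit_arr_def tens_comp)

lemma a_unit [simp]:
  assumes "X \<in> Ob C" "Y \<in> Ob C" "Z \<in> Ob C"
  shows "unit_arr (\<a> X Y Z)" "\<a> X Y Z \<in> Arr C"
    "Dom C (\<a> X Y Z) = (X \<odot> Y) \<odot> Z" "Cod C (\<a> X Y Z) = X \<odot> Y \<odot> Z"
  using Assoc_unitary[OF assms] by (simp_all add: unitary_iff unit_arr_def)

lemma l_unit [simp]:
  assumes "X \<in> Ob C"
  shows "unit_arr (\<l> X)" "\<l> X \<in> Arr C" "Dom C (\<l> X) = \<I> \<odot> X" "Cod C (\<l> X) = X"
  using LUnit_unitary[OF assms] by (simp_all add: unitary_iff unit_arr_def)

lemma r_unit [simp]:
  assumes "X \<in> Ob C"
  shows "unit_arr (\<r> X)" "\<r> X \<in> Arr C" "Dom C (\<r> X) = X \<odot> \<I>" "Cod C (\<r> X) = X"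
  using RUnit_unitary[OF assms] by (simp_all add: unitary_iff unit_arr_def)

lemma s_unit [simp]:
  assumes "X \<in> Ob C" "Y \<in> Ob C"
  shows "unit_arr (\<sigma> X Y)" "\<sigma> X Y \<in> Arr C" "Dom C (\<sigma> X Y) = X \<odot> Y" "Cod C (\<sigma> X Y) = Y \<odot> X"
  using Symm_unitary[OF assms] by (simp_all add: unitary_iff unit_arr_def)

lemma a_cancel [simp]:
  assumes "X \<in> Ob C" "Y \<in> Ob C" "Z \<in> Ob C"
  shows "\<a> X Y Z \<cdot> (\<a> X Y Z)\<dagger> = \<one> (X \<odot> Y \<odot> Z)" "(\<a> X Y Z)\<dagger> \<cdot> \<a> X Y Z = \<one> ((X \<odot> Y) \<odot> Z)"
    "h \<in> Arr C \<Longrightarrow> Cod C h = X \<odot> Y \<odot> Z \<Longrightarrow> \<a> X Y Z \<cdot> (\<a> X Y Z)\<dagger> \<cdot> h = h"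
    "h \<in> Arr C \<Longrightarrow> Cod C h = (X \<odot> Y) \<odot> Z \<Longrightarrow> (\<a> X Y Z)\<dagger> \<cdot> \<a> X Y Z \<cdot> h = h"
  using a_unit[OF assms] unit_arr_cancel[OF a_unit(1)[OF assms]] by (simp_all add: unit_arr_def)

lemma l_cancel [simp]:
  assumes "X \<in> Ob C"
  shows "\<l> X \<cdot> (\<l> X)\<dagger> = \<one> X" "(\<l> X)\<dagger> \<cdot> \<l> X = \<one> (\<I> \<odot> X)"
    "h \<in> Arr C \<Longrightarrow> Cod C h = X \<Longrightarrow> \<l> X \<cdot> (\<l> X)\<dagger> \<cdot> h = h"
    "h \<in> Arr C \<Longrightarrow> Cod C h = \<I> \<odot> X \<Longrightarrow> (\<l> X)\<dagger> \<cdot> \<l> X \<cdot> h = h"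
  using l_unit[OF assms] unit_arr_cancel[OF l_unit(1)[OF assms]] by (simp_all add: unit_arr_def)

lemma r_cancel [simp]:
  assumes "X \<in> Ob C"
  shows "\<r> X \<cdot> (\<r> X)\<dagger> = \<one> X" "(\<r> X)\<dagger> \<cdot> \<r> X = \<one> (X \<odot> \<I>)"
    "h \<in> Arr C \<Longrightarrow> Cod C h = X \<Longrightarrow> \<r> X \<cdot> (\<r> X)\<dagger> \<cdot> h = h"
    "h \<in> Arr C \<Longrightarrow> Cod C h = X \<odot> \<I> \<Longrightarrow> (\<r> X)\<dagger> \<cdot> \<r> X \<cdot> h = h"
  using r_unit[OF assms] unit_arr_cancel[OF r_unit(1)[OF assms]] by (simp_all add: unit_arr_def)

lemma s_dag [simp]:
  assumes "X \<in> Ob C" "Y \<in> Ob C" shows "(\<sigma> X Y)\<dagger> = \<sigma> Y X"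
  by (rule unit_arr_left_eq[of "\<sigma> X Y"])
    (use assms Symm_Symm[OF assms(2,1)] s_unit(1)[OF assms] in \<open>simp_all add: unit_arr_def\<close>)

lemma s_cancel [simp]:
  assumes "X \<in> Ob C" "Y \<in> Ob C"
  shows "\<sigma> Y X \<cdot> \<sigma> X Y = \<one> (X \<odot> Y)"
    "h \<in> Arr C \<Longrightarrow> Cod C h = X \<odot> Y \<Longrightarrow> \<sigma> Y X \<cdot> \<sigma> X Y \<cdot> h = h"
  using comp_lift[OF Symm_Symm[OF assms]] Symm_Symm[OF assms] assms by simp_all

text \<open>Naturality, oriented so that structure maps move towards the source.\<close>

lemma a_nat:
  assumes "f \<in> Arr C" "g \<in> Arr C" "h \<in> Arr C" "Cod C f = X" "Cod C g = Y" "Cod C h = Z"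
  shows "\<a> X Y Z \<cdot> ((f \<otimes> g) \<otimes> h) = (f \<otimes> g \<otimes> h) \<cdot> \<a> (Dom C f) (Dom C g) (Dom C h)"
  using Assoc_natural[of f "Dom C f" X g "Dom C g" Y h "Dom C h" Z] assms by (simp add: Hom_iff)

text \<open>The rule \<open>TensA_Idn\<close> fuses neighbouring identities, after which
  \<open>a_nat\<close> no longer matches; this is its form for the fused identity.\<close>

lemma a_nat_idn:
  assumes "X \<in> Ob C" "Y \<in> Ob C" "h \<in> Arr C" "Cod C h = Z"
  shows "\<a> X Y Z \<cdot> (\<one> (X \<odot> Y) \<otimes> h) = (\<one> X \<otimes> \<one> Y \<otimes> h) \<cdot> \<a> X Y (Dom C h)"
  using a_nat[of "\<one> X" "\<one> Y" h X Y Z] assms by simp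

lemma ad_nat:
  assumes "f \<in> Arr C" "g \<in> Arr C" "h \<in> Arr C" "Cod C f = X" "Cod C g = Y" "Cod C h = Z"
  shows "(\<a> X Y Z)\<dagger> \<cdot> (f \<otimes> g \<otimes> h) = ((f \<otimes> g) \<otimes> h) \<cdot> (\<a> (Dom C f) (Dom C g) (Dom C h))\<dagger>"
  by (rule unit_arr_flip[OF a_nat]) (use assms in auto)

lemma ad_nat_idn:
  assumes "Y \<in> Ob C" "Z \<in> Ob C" "f \<in> Arr C" "Cod C f = X"
  shows "(\<a> X Y Z)\<dagger> \<cdot> (f \<otimes> \<one> (Y \<odot> Z)) = ((f \<otimes> \<one> Y) \<otimes> \<one> Z) \<cdot> (\<a> (Dom C f) Y Z)\<dagger>"
  using ad_nat[of f "\<one> Y" "\<one> Z" X Y Z] assms by simp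

lemma l_nat: "f \<in> Arr C \<Longrightarrow> Cod C f = Y \<Longrightarrow> \<l> Y \<cdot> (\<one> \<I> \<otimes> f) = f \<cdot> \<l> (Dom C f)"
  using LUnit_natural[of f "Dom C f" Y] by (simp add: Hom_iff)

lemma r_nat: "f \<in> Arr C \<Longrightarrow> Cod C f = Y \<Longrightarrow> \<r> Y \<cdot> (f \<otimes> \<one> \<I>) = f \<cdot> \<r> (Dom C f)"
  using RUnit_natural[of f "Dom C f" Y] by (simp add: Hom_iff)

lemma ld_nat: "f \<in> Arr C \<Longrightarrow> Cod C f = Y \<Longrightarrow> (\<l> Y)\<dagger> \<cdot> f = (\<one> \<I> \<otimes> f) \<cdot> (\<l> (Dom C f))\<dagger>"
  by (rule unit_arr_flip[OF l_nat]) auto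

lemma rd_nat: "f \<in> Arr C \<Longrightarrow> Cod C f = Y \<Longrightarrow> (\<r> Y)\<dagger> \<cdot> f = (f \<otimes> \<one> \<I>) \<cdot> (\<r> (Dom C f))\<dagger>"
  by (rule unit_arr_flip[OF r_nat]) auto

lemma s_nat:
  assumes "f \<in> Arr C" "g \<in> Arr C" "Cod C f = X" "Cod C g = Y"
  shows "\<sigma> X Y \<cdot> (f \<otimes> g) = (g \<otimes> f) \<cdot> \<sigma> (Dom C f) (Dom C g)"
  using Symm_natural[of f "Dom C f" X g "Dom C g" Y] assms by (simp add: Hom_iff)

lemma s_nat_idn:
  assumes "f \<in> Arr C" "X \<in> Ob C" "Cod C f = Y"
  shows "\<sigma> Y X \<cdot> (f \<otimes> \<one> X) = (\<one> X \<otimes> f) \<cdot> \<sigma> (Dom C f) X"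
    "\<sigma> X Y \<cdot> (\<one> X \<otimes> f) = (f \<otimes> \<one> X) \<cdot> \<sigma> X (Dom C f)"
  using assms s_nat[of f "\<one> X" Y X] s_nat[of "\<one> X" f X Y] by simp_all

lemmas nat = a_nat comp_lift[OF a_nat] a_nat_idn comp_lift[OF a_nat_idn]
  ad_nat comp_lift[OF ad_nat] ad_nat_idn comp_lift[OF ad_nat_idn]
  l_nat comp_lift[OF l_nat] r_nat comp_lift[OF r_nat] 
  s_nat comp_lift[OF s_nat]

subsection \<open>Coherence of the units\<close>

text \<open>Conjugating with the unitor recovers \<open>f\<close> from its tensor product with the
  identity of the unit object. Coherence of units can therefore be proved after tensoring with that
  object, where pentagon and triangle apply.\<close>

lemma unit_faithful_left:
  assumes "f \<in> Arr C" "g \<in> Arr C" "Dom C f = Dom C g" "Cod C f = Cod C g" "\<one> \<I> \<otimes> f = \<one> \<I> \<otimes> g"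
  shows "f = g"
proof (rule unit_arr_right_eq)
  have "f \<cdot> \<l> (Dom C f) = \<l> (Cod C f) \<cdot> (\<one> \<I> \<otimes> f)" by (rule l_nat[symmetric]) (use assms in simp_all)
  also have "\<dots> = \<l> (Cod C g) \<cdot> (\<one> \<I> \<otimes> g)" by (simp only: assms(4,5))
  also have "\<dots> = g \<cdot> \<l> (Dom C g)" by (rule l_nat) (use assms in simp_all)
  also have "\<dots> = g \<cdot> \<l> (Dom C f)" by (simp only: assms(3))
  finally show "f \<cdot> \<l> (Dom C f) = g \<cdot> \<l> (Dom C f)" .
qed (use assms in \<open>simp_all flip: assms(3)\<close>)

lemma unit_faithful_right:
  assumes "f \<in> Arr C" "g \<in> Arr C" "Dom C f = Dom C g" "Cod C f = Cod C g" "f \<otimes> \<one> \<I> = g \<otimes> \<one> \<I>"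
  shows "f = g"
proof (rule unit_arr_right_eq)
  have "f \<cdot> \<r> (Dom C f) = \<r> (Cod C f) \<cdot> (f \<otimes> \<one> \<I>)" by (rule r_nat[symmetric]) (use assms in simp_all)
  also have "\<dots> = \<r> (Cod C g) \<cdot> (g \<otimes> \<one> \<I>)" by (simp only: assms(4,5))
  also have "\<dots> = g \<cdot> \<r> (Dom C g)" by (rule r_nat) (use assms in simp_all)
  also have "\<dots> = g \<cdot> \<r> (Dom C f)" by (simp only: assms(3))
  finally show "f \<cdot> \<r> (Dom C f) = g \<cdot> \<r> (Dom C f)" .
qed (use assms in \<open>simp_all flip: assms(3)\<close>)

lemma idn_l: "X \<in> Ob C \<Longrightarrow> \<one> \<I> \<otimes> \<l> X = \<l> (\<I> \<odot> X)"
  by (rule unit_arr_left_eq[of "\<l> X"]) (simp_all add: l_nat)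

lemma idn_r: "X \<in> Ob C \<Longrightarrow> \<r> X \<otimes> \<one> \<I> = \<r> (X \<odot> \<I>)"
  by (rule unit_arr_left_eq[of "\<r> X"]) (simp_all add: r_nat)

text \<open>Kelly's argument: tensored with the unit object, the claim follows from the pentagon for
  two unit objects, \<open>X\<close> and \<open>Y\<close> together with two triangles.\<close>

lemma l_tens:
  assumes [simp]: "X \<in> Ob C" "Y \<in> Ob C"
  shows "\<l> (X \<odot> Y) \<cdot> \<a> \<I> X Y = \<l> X \<otimes> \<one> Y"
proof (rule unit_faithful_left)
  let ?P = "\<a> \<I> (\<I> \<odot> X) Y \<cdot> (\<a> \<I> \<I> X \<otimes> \<one> Y)"
  have "(\<one> \<I> \<otimes> (\<l> (X \<odot> Y) \<cdot> \<a> \<I> X Y)) \<cdot> ?P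
    = (\<one> \<I> \<otimes> \<l> (X \<odot> Y)) \<cdot> (\<one> \<I> \<otimes> \<a> \<I> X Y) \<cdot> \<a> \<I> (\<I> \<odot> X) Y \<cdot> (\<a> \<I> \<I> X \<otimes> \<one> Y)"
    by (simp add: whisk)
  also have "\<dots> = ((\<one> \<I> \<otimes> \<l> (X \<odot> Y)) \<cdot> \<a> \<I> \<I> (X \<odot> Y)) \<cdot> \<a> (\<I> \<odot> \<I>) X Y"
    by (subst pentagon) simp_all
  also have "\<dots> = \<a> \<I> X Y \<cdot> ((\<r> \<I> \<otimes> \<one> X) \<otimes> \<one> Y)"
    by (subst triangle) (simp_all add: a_nat)
  also have "\<dots> = \<a> \<I> X Y \<cdot> (((\<one> \<I> \<otimes> \<l> X) \<cdot> \<a> \<I> \<I> X) \<otimes> \<one> Y)"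
    by (simp add: triangle)
  also have "\<dots> = (\<one> \<I> \<otimes> (\<l> X \<otimes> \<one> Y)) \<cdot> ?P"
    by (simp add: whisk nat)
  finally show "\<one> \<I> \<otimes> (\<l> (X \<odot> Y) \<cdot> \<a> \<I> X Y) = \<one> \<I> \<otimes> \<l> X \<otimes> \<one> Y"
    by (rule unit_arr_right_eq[rotated -1]) simp_all
qed simp_all

text \<open>Mirror image of \<open>l_tens\<close>: the pentagon for \<open>X\<close>,
  \<open>Y\<close> and two unit objects, and two triangles.\<close>

lemma r_tens:
  assumes [simp]: "X \<in> Ob C" "Y \<in> Ob C"
  shows "(\<one> X \<otimes> \<r> Y) \<cdot> \<a> X Y \<I> = \<r> (X \<odot> Y)"
proof (rule unit_faithful_right)
  have "\<a> X Y \<I> \<cdot> (((\<one> X \<otimes> \<r> Y) \<cdot> \<a> X Y \<I>) \<otimes> \<one> \<I>)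
     = (\<one> X \<otimes> (\<r> Y \<otimes> \<one> \<I>)) \<cdot> \<a> X (Y \<odot> \<I>) \<I> \<cdot> (\<a> X Y \<I> \<otimes> \<one> \<I>)"
    by (simp add: whisk nat)
  also have "\<dots> = (\<one> X \<otimes> (\<one> Y \<otimes> \<l> \<I>)) \<cdot> (\<one> X \<otimes> \<a> Y \<I> \<I>) \<cdot> \<a> X (Y \<odot> \<I>) \<I> \<cdot> (\<a> X Y \<I> \<otimes> \<one> \<I>)"
    by (simp add: whisk flip: triangle)
  also have "\<dots> = (\<one> X \<otimes> (\<one> Y \<otimes> \<l> \<I>)) \<cdot> \<a> X Y (\<I> \<odot> \<I>) \<cdot> \<a> (X \<odot> Y) \<I> \<I>"
    by (subst pentagon) simp_all
  also have "\<dots> = \<a> X Y \<I> \<cdot> (\<one> (X \<odot> Y) \<otimes> \<l> \<I>) \<cdot> \<a> (X \<odot> Y) \<I> \<I>"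
    by (simp add: nat)
  also have "\<dots> = \<a> X Y \<I> \<cdot> (\<r> (X \<odot> Y) \<otimes> \<one> \<I>)"
    by (subst triangle) simp_all
  finally show "((\<one> X \<otimes> \<r> Y) \<cdot> \<a> X Y \<I>) \<otimes> \<one> \<I> = \<r> (X \<odot> Y) \<otimes> \<one> \<I>"
    by (rule unit_arr_left_eq[rotated -1]) simp_all
qed simp_all

text \<open>After tensoring with the unit object, the triangle expresses one side and
  \<open>idn_l\<close> with \<open>l_tens\<close> the other.\<close>

lemma l_eq_r: "\<r> \<I> = \<l> \<I>"
proof -
  have "\<r> \<I> \<otimes> \<one> \<I> = (\<one> \<I> \<otimes> \<l> \<I>) \<cdot> \<a> \<I> \<I> \<I>" by (simp add: triangle)
  also have "\<dots> = \<l> \<I> \<otimes> \<one> \<I>" by (simp add: idn_l l_tens)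
  finally show ?thesis by (rule unit_faithful_right[rotated -1]) simp_all
qed

text \<open>The hexagon with two unit factors, read after tensoring with the unit object and
  composing with a symmetry that is cancelled at the end.\<close>

lemma l_sigma:
  assumes [simp]: "X \<in> Ob C"
  shows "\<l> X \<cdot> \<sigma> X \<I> = \<r> X"
proof (rule unit_faithful_right)
  have "\<sigma> X \<I> \<cdot> ((\<l> X \<cdot> \<sigma> X \<I>) \<otimes> \<one> \<I>) = \<sigma> X \<I> \<cdot> \<l> (X \<odot> \<I>) \<cdot> \<a> \<I> X \<I> \<cdot> (\<sigma> X \<I> \<otimes> \<one> \<I>)"
    by (simp add: whisk comp_lift[OF l_tens])
  also have "\<dots> = \<l> (\<I> \<odot> X) \<cdot> (\<one> \<I> \<otimes> \<sigma> X \<I>) \<cdot> \<a> \<I> X \<I> \<cdot> (\<sigma> X \<I> \<otimes> \<one> \<I>)"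
    by (simp add: nat)
  also have "\<dots> = \<l> (\<I> \<odot> X) \<cdot> \<a> \<I> \<I> X \<cdot> \<sigma> X (\<I> \<odot> \<I>) \<cdot> \<a> X \<I> \<I>"
    by (simp add: hexagon)
  also have "\<dots> = (\<l> \<I> \<otimes> \<one> X) \<cdot> \<sigma> X (\<I> \<odot> \<I>) \<cdot> \<a> X \<I> \<I>"
    by (simp add: comp_lift[OF l_tens])
  also have "\<dots> = \<sigma> X \<I> \<cdot> (\<one> X \<otimes> \<l> \<I>) \<cdot> \<a> X \<I> \<I>"
    by (simp add: nat)
  also have "\<dots> = \<sigma> X \<I> \<cdot> (\<r> X \<otimes> \<one> \<I>)"
    by (simp add: triangle)
  finally show "(\<l> X \<cdot> \<sigma> X \<I>) \<otimes> \<one> \<I> = \<r> X \<otimes> \<one> \<I>"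
    by (rule unit_arr_left_eq[rotated -1]) simp_all
qed simp_all

lemma sigma_tens_right:
  assumes [simp]: "X \<in> Ob C" "Y \<in> Ob C" "Z \<in> Ob C"
  shows "\<sigma> X (Y \<odot> Z) = (\<a> Y Z X)\<dagger> \<cdot> (\<one> Y \<otimes> \<sigma> X Z) \<cdot> \<a> Y X Z \<cdot> (\<sigma> X Y \<otimes> \<one> Z) \<cdot> (\<a> X Y Z)\<dagger>"
proof -
  have "\<sigma> X (Y \<odot> Z) = (\<a> Y Z X)\<dagger> \<cdot> (\<a> Y Z X \<cdot> \<sigma> X (Y \<odot> Z) \<cdot> \<a> X Y Z) \<cdot> (\<a> X Y Z)\<dagger>"
    by simp
  then show ?thesis by (simp add: hexagon)
qed

lemma sigma_tens_left:
  assumes [simp]: "X \<in> Ob C" "Y \<in> Ob C" "Z \<in> Ob C"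
  shows "\<sigma> (X \<odot> Y) Z = \<a> Z X Y \<cdot> (\<sigma> X Z \<otimes> \<one> Y) \<cdot> (\<a> X Z Y)\<dagger> \<cdot> (\<one> X \<otimes> \<sigma> Y Z) \<cdot> \<a> X Y Z"
proof -
  have "\<sigma> (X \<odot> Y) Z = (\<sigma> Z (X \<odot> Y))\<dagger>" by simp
  then show ?thesis by (subst (asm) sigma_tens_right) simp_all
qed

text \<open>Rewriting with these equations eliminates whiskered associators.\<close>

lemma pent:
  assumes [simp]: "X \<in> Ob C" "Y \<in> Ob C" "Z \<in> Ob C" "W \<in> Ob C"
  shows pent1: "\<a> X (Y \<odot> Z) W \<cdot> (\<a> X Y Z \<otimes> \<one> W)
      = (\<one> X \<otimes> (\<a> Y Z W)\<dagger>) \<cdot> \<a> X Y (Z \<odot> W) \<cdot> \<a> (X \<odot> Y) Z W"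
    and pent2: "\<a> (X \<odot> Y) Z W \<cdot> ((\<a> X Y Z)\<dagger> \<otimes> \<one> W)
      = (\<a> X Y (Z \<odot> W))\<dagger> \<cdot> (\<one> X \<otimes> \<a> Y Z W) \<cdot> \<a> X (Y \<odot> Z) W"
    and pent3: "((\<a> X Y Z)\<dagger> \<otimes> \<one> W) \<cdot> (\<a> X (Y \<odot> Z) W)\<dagger>
      = (\<a> (X \<odot> Y) Z W)\<dagger> \<cdot> (\<a> X Y (Z \<odot> W))\<dagger> \<cdot> (\<one> X \<otimes> \<a> Y Z W)"
    and pent4: "(\<a> X Y Z \<otimes> \<one> W) \<cdot> (\<a> (X \<odot> Y) Z W)\<dagger>
      = (\<a> X (Y \<odot> Z) W)\<dagger> \<cdot> (\<one> X \<otimes> (\<a> Y Z W)\<dagger>) \<cdot> \<a> X Y (Z \<odot> W)"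
proof -
  note p = pentagon[OF assms]
  show 1: "\<a> X (Y \<odot> Z) W \<cdot> (\<a> X Y Z \<otimes> \<one> W)
      = (\<one> X \<otimes> (\<a> Y Z W)\<dagger>) \<cdot> \<a> X Y (Z \<odot> W) \<cdot> \<a> (X \<odot> Y) Z W"
    by (subst p[symmetric]) (simp add: tens_merge)
  show 2: "\<a> (X \<odot> Y) Z W \<cdot> ((\<a> X Y Z)\<dagger> \<otimes> \<one> W)
      = (\<a> X Y (Z \<odot> W))\<dagger> \<cdot> (\<one> X \<otimes> \<a> Y Z W) \<cdot> \<a> X (Y \<odot> Z) W"
  proof -
    have "\<a> (X \<odot> Y) Z W \<cdot> ((\<a> X Y Z)\<dagger> \<otimes> \<one> W)
      = (\<a> X Y (Z \<odot> W))\<dagger> \<cdot> (\<a> X Y (Z \<odot> W) \<cdot> \<a> (X \<odot> Y) Z W) \<cdot> ((\<a> X Y Z)\<dagger> \<otimes> \<one> W)"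
      by simp
    also have "\<dots> = (\<a> X Y (Z \<odot> W))\<dagger> \<cdot> (\<one> X \<otimes> \<a> Y Z W) \<cdot> \<a> X (Y \<odot> Z) W"
      by (subst p[symmetric]) (simp add: tens_merge)
    finally show ?thesis .
  qed
  show "((\<a> X Y Z)\<dagger> \<otimes> \<one> W) \<cdot> (\<a> X (Y \<odot> Z) W)\<dagger>
      = (\<a> (X \<odot> Y) Z W)\<dagger> \<cdot> (\<a> X Y (Z \<odot> W))\<dagger> \<cdot> (\<one> X \<otimes> \<a> Y Z W)"
    by (rule dag_inject) (simp_all add: 1)
  show "(\<a> X Y Z \<otimes> \<one> W) \<cdot> (\<a> (X \<odot> Y) Z W)\<dagger>
      = (\<a> X (Y \<odot> Z) W)\<dagger> \<cdot> (\<one> X \<otimes> (\<a> Y Z W)\<dagger>) \<cdot> \<a> X Y (Z \<odot> W)"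
    by (rule dag_inject) (simp_all add: 2)
qed

lemmas pents = pent comp_lift[OF pent1] comp_lift[OF pent2] comp_lift[OF pent3] comp_lift[OF pent4]

text \<open>Applies an equation below a whisker after \<open>whisk\<close> has separated its two
  factors.\<close>

lemma whisk_lift:
  assumes "g \<cdot> f = k" "X \<in> Ob C" "f \<in> Arr C" "g \<in> Arr C" "Cod C f = Dom C g"
  shows "(\<one> X \<otimes> g) \<cdot> (\<one> X \<otimes> f) = \<one> X \<otimes> k"
  using assms by (simp add: tens_merge)

text \<open>Inverse pairs in the spread-out form that \<open>whisk\<close> produces, so that they
  cancel without fusing the layers again.\<close>

lemma winv:
  assumes u: "unit_arr u" and [simp]: "Z \<in> Ob C"
  shows "(\<one> Z \<otimes> u) \<cdot> (\<one> Z \<otimes> u\<dagger>) = \<one> (Z \<odot> Cod C u)"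
    "(\<one> Z \<otimes> u\<dagger>) \<cdot> (\<one> Z \<otimes> u) = \<one> (Z \<odot> Dom C u)"
    "(u \<otimes> \<one> Z) \<cdot> (u\<dagger> \<otimes> \<one> Z) = \<one> (Cod C u \<odot> Z)"
    "(u\<dagger> \<otimes> \<one> Z) \<cdot> (u \<otimes> \<one> Z) = \<one> (Dom C u \<odot> Z)"
    "W \<in> Ob C \<Longrightarrow> (\<one> W \<otimes> \<one> Z \<otimes> u) \<cdot> (\<one> W \<otimes> \<one> Z \<otimes> u\<dagger>) = \<one> (W \<odot> Z \<odot> Cod C u)"
    "W \<in> Ob C \<Longrightarrow> (\<one> W \<otimes> \<one> Z \<otimes> u\<dagger>) \<cdot> (\<one> W \<otimes> \<one> Z \<otimes> u) = \<one> (W \<odot> Z \<odot> Dom C u)"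
    "h \<in> Arr C \<Longrightarrow> Cod C h = Z \<odot> Cod C u \<Longrightarrow> (\<one> Z \<otimes> u) \<cdot> (\<one> Z \<otimes> u\<dagger>) \<cdot> h = h"
    "h \<in> Arr C \<Longrightarrow> Cod C h = Z \<odot> Dom C u \<Longrightarrow> (\<one> Z \<otimes> u\<dagger>) \<cdot> (\<one> Z \<otimes> u) \<cdot> h = h"
    "h \<in> Arr C \<Longrightarrow> Cod C h = Cod C u \<odot> Z \<Longrightarrow> (u \<otimes> \<one> Z) \<cdot> (u\<dagger> \<otimes> \<one> Z) \<cdot> h = h"
    "h \<in> Arr C \<Longrightarrow> Cod C h = Dom C u \<odot> Z \<Longrightarrow> (u\<dagger> \<otimes> \<one> Z) \<cdot> (u \<otimes> \<one> Z) \<cdot> h = h"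
    "W \<in> Ob C \<Longrightarrow> h \<in> Arr C \<Longrightarrow> Cod C h = W \<odot> Z \<odot> Cod C u \<Longrightarrow>
      (\<one> W \<otimes> \<one> Z \<otimes> u) \<cdot> (\<one> W \<otimes> \<one> Z \<otimes> u\<dagger>) \<cdot> h = h"
    "W \<in> Ob C \<Longrightarrow> h \<in> Arr C \<Longrightarrow> Cod C h = W \<odot> Z \<odot> Dom C u \<Longrightarrow>
      (\<one> W \<otimes> \<one> Z \<otimes> u\<dagger>) \<cdot> (\<one> W \<otimes> \<one> Z \<otimes> u) \<cdot> h = h"
  using unit_arrD[OF u] by (simp_all add: tens_merge)

text \<open>
  Morphisms are evaluated on right-nested words \<open>A \<otimes> (B \<otimes> (\<dots> \<otimes> Y))\<close>: \<^term>\<open>sw\<close> here, and the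
  constants \<open>ev\<close>, \<open>cv\<close>, \<open>mm\<close>, \<open>uu\<close>, \<open>bb\<close> below, act on the front of such a word and are
  natural in the rest. In this form associators disappear from the calculations.
\<close>

definition sw :: "'o \<Rightarrow> 'o \<Rightarrow> 'o \<Rightarrow> 'a" where
  "sw X Y Z = \<a> Y X Z \<cdot> (\<sigma> X Y \<otimes> \<one> Z) \<cdot> (\<a> X Y Z)\<dagger>"

lemma sw_unit [simp]:
  assumes "X \<in> Ob C" "Y \<in> Ob C" "Z \<in> Ob C"
  shows "unit_arr (sw X Y Z)" "sw X Y Z \<in> Arr C"
    "Dom C (sw X Y Z) = X \<odot> Y \<odot> Z" "Cod C (sw X Y Z) = Y \<odot> X \<odot> Z"
    "(sw X Y Z)\<dagger> = sw Y X Z"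
  using assms by (simp_all add: sw_def)

lemma sw_sw [simp]:
  assumes "X \<in> Ob C" "Y \<in> Ob C" "Z \<in> Ob C"
  shows "sw Y X Z \<cdot> sw X Y Z = \<one> (X \<odot> Y \<odot> Z)"
    "h \<in> Arr C \<Longrightarrow> Cod C h = X \<odot> Y \<odot> Z \<Longrightarrow> sw Y X Z \<cdot> sw X Y Z \<cdot> h = h"
  using unit_arrD(2)[OF sw_unit(1)[OF assms]] unit_arr_cancel(1)[OF sw_unit(1)[OF assms]] assms
  by simp_all

lemma sw_nat:
  assumes "f \<in> Arr C" "g \<in> Arr C" "h \<in> Arr C" "Cod C f = X" "Cod C g = Y" "Cod C h = Z"
  shows "sw X Y Z \<cdot> (f \<otimes> g \<otimes> h) = (g \<otimes> f \<otimes> h) \<cdot> sw (Dom C f) (Dom C g) (Dom C h)"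
proof -
  have [simp]: "X \<in> Ob C" "Y \<in> Ob C" "Z \<in> Ob C" using assms by auto
  have "sw X Y Z \<cdot> (f \<otimes> g \<otimes> h)
    = \<a> Y X Z \<cdot> ((\<sigma> X Y \<cdot> (f \<otimes> g)) \<otimes> h) \<cdot> (\<a> (Dom C f) (Dom C g) (Dom C h))\<dagger>"
    using assms by (simp add: sw_def nat tens_merge)
  also have "\<dots> = \<a> Y X Z \<cdot> ((g \<otimes> f) \<otimes> h) \<cdot> (\<sigma> (Dom C f) (Dom C g) \<otimes> \<one> (Dom C h)) \<cdot> (\<a> (Dom C f) (Dom C g) (Dom C h))\<dagger>"
    using assms by (simp add: s_nat tens_merge)
  also have "\<dots> = (g \<otimes> f \<otimes> h) \<cdot> sw (Dom C f) (Dom C g) (Dom C h)"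
    using assms by (simp add: sw_def nat)
  finally show ?thesis .
qed

lemma sw_nat_idn:
  assumes "f \<in> Arr C" "Y \<in> Ob C" "Z \<in> Ob C" "Cod C f = X"
  shows "sw X Y Z \<cdot> (f \<otimes> \<one> (Y \<odot> Z)) = (\<one> Y \<otimes> f \<otimes> \<one> Z) \<cdot> sw (Dom C f) Y Z"
  using assms sw_nat[of f "\<one> Y" "\<one> Z" X Y Z] by simp

lemma sw_nat_idn':
  assumes "f \<in> Arr C" "Y \<in> Ob C" "Z \<in> Ob C" "Cod C f = X"
  shows "sw Y X Z \<cdot> (\<one> Y \<otimes> f \<otimes> \<one> Z) = (f \<otimes> \<one> (Y \<odot> Z)) \<cdot> sw Y (Dom C f) Z"
  using assms sw_nat[of "\<one> Y" f "\<one> Z" Y X Z] by simp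

lemma sw_nat_last:
  assumes "f \<in> Arr C" "X \<in> Ob C" "Y \<in> Ob C" "Cod C f = Z"
  shows "sw X Y Z \<cdot> (\<one> X \<otimes> \<one> Y \<otimes> f) = (\<one> Y \<otimes> \<one> X \<otimes> f) \<cdot> sw X Y (Dom C f)"
  using assms sw_nat[of "\<one> X" "\<one> Y" f X Y Z] by simp

lemmas sw_nats = sw_nat comp_lift[OF sw_nat] sw_nat_idn comp_lift[OF sw_nat_idn]

text \<open>The hexagon: passing a tensor product means passing its factors in turn. The pentagon
  rules carry the associators out of the whiskers.\<close>

lemma sw_tens_mid:
  assumes [simp]: "X \<in> Ob C" "Y \<in> Ob C" "W \<in> Ob C" "Z \<in> Ob C"
  shows "\<a> Y W (X \<odot> Z) \<cdot> sw X (Y \<odot> W) Z = (\<one> Y \<otimes> sw X W Z) \<cdot> sw X Y (W \<odot> Z) \<cdot> (\<one> X \<otimes> \<a> Y W Z)"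
  by (simp add: sw_def sigma_tens_right whisk nat pents winv)

lemma sw_tens_mid':
  assumes [simp]: "X \<in> Ob C" "Y \<in> Ob C" "W \<in> Ob C" "Z \<in> Ob C"
  shows "sw X (Y \<odot> W) Z
    = (\<a> Y W (X \<odot> Z))\<dagger> \<cdot> (\<one> Y \<otimes> sw X W Z) \<cdot> sw X Y (W \<odot> Z) \<cdot> (\<one> X \<otimes> \<a> Y W Z)"
  by (simp flip: sw_tens_mid)

lemma sw_tens_first:
  assumes [simp]: "X \<in> Ob C" "Y \<in> Ob C" "W \<in> Ob C" "Z \<in> Ob C"
  shows "sw (Y \<odot> W) X Z
    = (\<one> X \<otimes> (\<a> Y W Z)\<dagger>) \<cdot> sw Y X (W \<odot> Z) \<cdot> (\<one> Y \<otimes> sw W X Z) \<cdot> \<a> Y W (X \<odot> Z)"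
  by (rule dag_inject) (simp_all add: sw_tens_mid')

lemma sw_tens_last:
  assumes [simp]: "X \<in> Ob C" "Y \<in> Ob C" "W \<in> Ob C" "Z \<in> Ob C"
  shows "\<a> Y (X \<odot> Z) W \<cdot> (sw X Y Z \<otimes> \<one> W)
    = (\<one> Y \<otimes> (\<a> X Z W)\<dagger>) \<cdot> sw X Y (Z \<odot> W) \<cdot> (\<one> X \<otimes> \<a> Y Z W) \<cdot> \<a> X (Y \<odot> Z) W"
  by (simp add: sw_def whisk nat pents winv)

text \<open>Passing the unit object changes only the bracketing: \<open>l_sigma\<close> turns the
  symmetry into a unitor, which the triangle then removes.\<close>

lemma sw_unit_mid:
  assumes [simp]: "X \<in> Ob C" "Y \<in> Ob C"
  shows "sw X \<I> Y = (\<l> (X \<odot> Y))\<dagger> \<cdot> (\<one> X \<otimes> \<l> Y)"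
proof -
  have "\<l> (X \<odot> Y) \<cdot> sw X \<I> Y = (\<l> X \<otimes> \<one> Y) \<cdot> (\<sigma> X \<I> \<otimes> \<one> Y) \<cdot> (\<a> X \<I> Y)\<dagger>"
    by (simp add: sw_def comp_lift[OF l_tens])
  also have "\<dots> = (\<r> X \<otimes> \<one> Y) \<cdot> (\<a> X \<I> Y)\<dagger>"
    by (simp add: tens_merge l_sigma)
  also have "\<dots> = \<one> X \<otimes> \<l> Y"
    by (simp flip: triangle)
  finally have e: "\<l> (X \<odot> Y) \<cdot> sw X \<I> Y = \<one> X \<otimes> \<l> Y" .
  have "(\<l> (X \<odot> Y))\<dagger> \<cdot> \<l> (X \<odot> Y) \<cdot> sw X \<I> Y = (\<l> (X \<odot> Y))\<dagger> \<cdot> (\<one> X \<otimes> \<l> Y)"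
    by (simp only: e)
  then show ?thesis by simp
qed

lemma sw_unit_first:
  assumes [simp]: "X \<in> Ob C" "Y \<in> Ob C"
  shows "sw \<I> X Y = (\<one> X \<otimes> (\<l> Y)\<dagger>) \<cdot> \<l> (X \<odot> Y)"
  by (rule dag_inject) (simp_all add: sw_unit_mid)

end

section \<open>Coherence of the middle interchange\<close>

context dagger_compact_category
begin

abbreviation ic :: "'o \<Rightarrow> 'o \<Rightarrow> 'o \<Rightarrow> 'o \<Rightarrow> 'a" where
  "ic \<equiv> interchange V"

lemma ic_eq: "ic A B C D = (\<a> A C (B \<odot> D))\<dagger> \<cdot> (\<one> A \<otimes> sw B C D) \<cdot> \<a> A B (C \<odot> D)"
  by (simp add: interchange_def sw_def)

lemma ic_unit [simp]:
  assumes "A \<in> Ob V" "B \<in> Ob V" "C \<in> Ob V" "D \<in> Ob V"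
  shows "unit_arr (ic A B C D)" "ic A B C D \<in> Arr V"
    "Dom V (ic A B C D) = (A \<odot> B) \<odot> (C \<odot> D)" "Cod V (ic A B C D) = (A \<odot> C) \<odot> (B \<odot> D)"
    "(ic A B C D)\<dagger> = ic A C B D"
  using assms by (simp_all add: ic_eq)

lemma ic_ic [simp]:
  assumes "A \<in> Ob V" "B \<in> Ob V" "C \<in> Ob V" "D \<in> Ob V"
  shows "ic A C B D \<cdot> ic A B C D = \<one> ((A \<odot> B) \<odot> (C \<odot> D))"
    "h \<in> Arr V \<Longrightarrow> Cod V h = (A \<odot> B) \<odot> (C \<odot> D) \<Longrightarrow> ic A C B D \<cdot> ic A B C D \<cdot> h = h"
  using unit_arrD(2)[OF ic_unit(1)[OF assms]] unit_arr_cancel(1)[OF ic_unit(1)[OF assms]] assms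
  by simp_all

lemma ic_nat:
  assumes [simp]: "f \<in> Arr V" "g \<in> Arr V" "h \<in> Arr V" "k \<in> Arr V"
    and [simp]: "Cod V f = A" "Cod V g = B" "Cod V h = C" "Cod V k = D"
  shows "ic A B C D \<cdot> ((f \<otimes> g) \<otimes> (h \<otimes> k)) = ((f \<otimes> h) \<otimes> (g \<otimes> k)) \<cdot> ic (Dom V f) (Dom V g) (Dom V h) (Dom V k)"
proof -
  have [simp]: "A \<in> Ob V" "B \<in> Ob V" "C \<in> Ob V" "D \<in> Ob V"
    using Cod_in_Ob[OF assms(1)] Cod_in_Ob[OF assms(2)] Cod_in_Ob[OF assms(3)] Cod_in_Ob[OF assms(4)]
    by simp_all
  have "ic A B C D \<cdot> ((f \<otimes> g) \<otimes> (h \<otimes> k))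
    = (\<a> A C (B \<odot> D))\<dagger> \<cdot> (f \<otimes> (sw B C D \<cdot> (g \<otimes> h \<otimes> k))) \<cdot> \<a> (Dom V f) (Dom V g) (Dom V h \<odot> Dom V k)"
    by (simp add: ic_eq nat tens_merge)
  also have "\<dots> = (\<a> A C (B \<odot> D))\<dagger> \<cdot> (f \<otimes> (h \<otimes> g \<otimes> k))
     \<cdot> (\<one> (Dom V f) \<otimes> sw (Dom V g) (Dom V h) (Dom V k)) \<cdot> \<a> (Dom V f) (Dom V g) (Dom V h \<odot> Dom V k)"
    by (simp add: sw_nat tens_merge)
  also have "\<dots> = ((f \<otimes> h) \<otimes> (g \<otimes> k)) \<cdot> ic (Dom V f) (Dom V g) (Dom V h) (Dom V k)"
    by (simp add: ic_eq nat)
  finally show ?thesis .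
qed

text \<open>On right-nested words both sides consist of three adjacent swaps: \<open>B\<close> past
  \<open>A'\<close>, \<open>B'\<close> past \<open>A''\<close>, and \<open>B\<close> past
  \<open>A''\<close>. Only the order of the first two differs, and these act on disjoint
  factors.\<close>

lemma ic_assoc:
  assumes [simp]: "A \<in> Ob V" "B \<in> Ob V" "A' \<in> Ob V" "B' \<in> Ob V" "A'' \<in> Ob V" "B'' \<in> Ob V"
  shows "(\<a> A A' A'' \<otimes> \<a> B B' B'') \<cdot> ic (A \<odot> A') (B \<odot> B') A'' B'' \<cdot> (ic A B A' B' \<otimes> \<one> (A'' \<odot> B''))
    = ic A B (A' \<odot> A'') (B' \<odot> B'') \<cdot> (\<one> (A \<odot> B) \<otimes> ic A' B' A'' B'') \<cdot> \<a> (A \<odot> B) (A' \<odot> B') (A'' \<odot> B'')"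
proof (rule unit_arr_left_eq)
  let ?Q = "(\<one> A \<otimes> \<a> A' A'' (B \<odot> B' \<odot> B'')) \<cdot> \<a> A (A' \<odot> A'') (B \<odot> B' \<odot> B'')"
  have s: "\<a> A A' A'' \<otimes> \<a> B B' B'' = (\<a> A A' A'' \<otimes> \<one> (B \<odot> B' \<odot> B'')) \<cdot> (\<one> ((A \<odot> A') \<odot> A'') \<otimes> \<a> B B' B'')"
    by (simp add: tens_merge)
  show "?Q \<cdot> (\<a> A A' A'' \<otimes> \<a> B B' B'') \<cdot> ic (A \<odot> A') (B \<odot> B') A'' B'' \<cdot> (ic A B A' B' \<otimes> \<one> (A'' \<odot> B''))
    = ?Q \<cdot> ic A B (A' \<odot> A'') (B' \<odot> B'') \<cdot> (\<one> (A \<odot> B) \<otimes> ic A' B' A'' B'') \<cdot> \<a> (A \<odot> B) (A' \<odot> B') (A'' \<odot> B'')"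
    by (simp add: s ic_eq whisk nat pents winv sw_tens_mid' sw_tens_first sw_nats whisk_lift[OF sw_tens_last]
      comp_lift[OF whisk_lift[OF sw_tens_last]] whisk_lift[OF sw_nat] comp_lift[OF whisk_lift[OF sw_nat]])
qed simp_all

text \<open>Obtained from \<open>ic_assoc\<close> by cancelling, since \<open>ic A C B D\<close> is
  inverse to \<open>ic A B C D\<close>.\<close>

lemma ic_assoc':
  assumes [simp]: "A \<in> Ob V" "B \<in> Ob V" "A' \<in> Ob V" "B' \<in> Ob V" "A'' \<in> Ob V" "B'' \<in> Ob V"
  shows "\<a> (A \<odot> B) (A' \<odot> B') (A'' \<odot> B'') \<cdot> (ic A A' B B' \<otimes> \<one> (A'' \<odot> B'')) \<cdot> ic (A \<odot> A') A'' (B \<odot> B') B''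
    = (\<one> (A \<odot> B) \<otimes> ic A' A'' B' B'') \<cdot> ic A (A' \<odot> A'') B (B' \<odot> B'') \<cdot> (\<a> A A' A'' \<otimes> \<a> B B' B'')"
proof -
  note e = ic_assoc[OF assms]
  have "(\<one> (A \<odot> B) \<otimes> ic A' A'' B' B'') \<cdot> ic A (A' \<odot> A'') B (B' \<odot> B'') \<cdot> (\<a> A A' A'' \<otimes> \<a> B B' B'')
    = (\<one> (A \<odot> B) \<otimes> ic A' A'' B' B'') \<cdot> ic A (A' \<odot> A'') B (B' \<odot> B'') \<cdot>
      ((\<a> A A' A'' \<otimes> \<a> B B' B'') \<cdot> ic (A \<odot> A') (B \<odot> B') A'' B'' \<cdot> (ic A B A' B' \<otimes> \<one> (A'' \<odot> B''))) \<cdot>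
      (ic A A' B B' \<otimes> \<one> (A'' \<odot> B'')) \<cdot> ic (A \<odot> A') A'' (B \<odot> B') B''"
    by (simp add: tens_merge)
  also have "\<dots> = \<a> (A \<odot> B) (A' \<odot> B') (A'' \<odot> B'') \<cdot> (ic A A' B B' \<otimes> \<one> (A'' \<odot> B'')) \<cdot> ic (A \<odot> A') A'' (B \<odot> B') B''"
    by (subst e) (simp add: tens_merge)
  finally show ?thesis by simp
qed

lemma ic_unit_left:
  assumes [simp]: "A \<in> Ob V" "B \<in> Ob V"
  shows "(\<l> A \<otimes> \<l> B) \<cdot> ic \<I> \<I> A B \<cdot> ((\<l> \<I>)\<dagger> \<otimes> \<one> (A \<odot> B)) = \<l> (A \<odot> B)"
proof -
  have "\<a> \<I> \<I> (A \<odot> B) \<cdot> ((\<l> \<I>)\<dagger> \<otimes> \<one> (A \<odot> B)) = \<one> \<I> \<otimes> (\<l> (A \<odot> B))\<dagger>"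
    by (rule dag_inject) (simp_all flip: triangle add: l_eq_r[symmetric])
  then have "(\<l> A \<otimes> \<l> B) \<cdot> ic \<I> \<I> A B \<cdot> ((\<l> \<I>)\<dagger> \<otimes> \<one> (A \<odot> B))
    = (\<l> A \<otimes> \<l> B) \<cdot> (\<a> \<I> A (\<I> \<odot> B))\<dagger> \<cdot> (\<one> \<I> \<otimes> \<one> A \<otimes> (\<l> B)\<dagger>)"
    by (simp add: ic_eq sw_unit_first whisk winv)
  also have "\<dots> = \<l> (A \<odot> B)"
    by (simp add: nat tens_merge comp_lift[OF l_tens] flip: l_tens)
  finally show ?thesis .
qed

lemma ic_unit_right:
  assumes [simp]: "A \<in> Ob V" "B \<in> Ob V"
  shows "(\<r> A \<otimes> \<r> B) \<cdot> ic A B \<I> \<I> \<cdot> (\<one> (A \<odot> B) \<otimes> (\<l> \<I>)\<dagger>) = \<r> (A \<odot> B)"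
proof -
  have e: "(\<a> A \<I> (B \<odot> \<I>))\<dagger> \<cdot> (\<one> A \<otimes> (\<l> (B \<odot> \<I>))\<dagger>) = (\<r> A)\<dagger> \<otimes> \<one> (B \<odot> \<I>)"
    by (rule dag_inject) (simp_all add: triangle)
  have "(\<r> A \<otimes> \<r> B) \<cdot> ic A B \<I> \<I> \<cdot> (\<one> (A \<odot> B) \<otimes> (\<l> \<I>)\<dagger>)
    = (\<r> A \<otimes> \<r> B) \<cdot> ((\<a> A \<I> (B \<odot> \<I>))\<dagger> \<cdot> (\<one> A \<otimes> (\<l> (B \<odot> \<I>))\<dagger>)) \<cdot> \<a> A B \<I>"
    by (simp add: ic_eq sw_unit_mid whisk winv nat)
  also have "\<dots> = \<r> (A \<odot> B)"
    by (subst e) (simp add: tens_merge r_tens)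
  finally show ?thesis .
qed

lemma ic_unit_left':
  assumes [simp]: "A \<in> Ob V" "B \<in> Ob V"
  shows "\<l> (A \<odot> B) \<cdot> (\<l> \<I> \<otimes> \<one> (A \<odot> B)) \<cdot> ic \<I> A \<I> B = \<l> A \<otimes> \<l> B"
  by (subst ic_unit_left[symmetric]) (simp_all add: tens_merge)

lemma ic_unit_right':
  assumes [simp]: "A \<in> Ob V" "B \<in> Ob V"
  shows "\<r> (A \<odot> B) \<cdot> (\<one> (A \<odot> B) \<otimes> \<l> \<I>) \<cdot> ic A \<I> B \<I> = \<r> A \<otimes> \<r> B"
  by (subst ic_unit_right[symmetric]) (simp_all add: tens_merge)

text \<open>By the hexagon the large symmetry on the right is a product of adjacent swaps. There
  \<open>A\<close> and \<open>D\<close> are exchanged and then exchanged back by the interchange;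
  what remains are the swaps on the left.\<close>

lemma ic_sigma:
  assumes [simp]: "A \<in> Ob V" "B \<in> Ob V" "C \<in> Ob V" "D \<in> Ob V"
  shows "(\<sigma> A C \<otimes> \<sigma> B D) \<cdot> ic A B C D = ic C D A B \<cdot> \<sigma> (A \<odot> B) (C \<odot> D)"
proof (rule unit_arr_left_eq)
  have s: "\<sigma> A C \<otimes> \<sigma> B D = (\<sigma> A C \<otimes> \<one> (D \<odot> B)) \<cdot> (\<one> (A \<odot> C) \<otimes> \<sigma> B D)"
    by (simp add: tens_merge)
  have e: "\<a> C A (D \<odot> B) \<cdot> (\<sigma> A C \<otimes> \<one> (D \<odot> B)) = sw A C (D \<odot> B) \<cdot> \<a> A C (D \<odot> B)"
    by (simp add: sw_def)
  have f: "\<sigma> (A \<odot> B) D = sw A D B \<cdot> (\<one> A \<otimes> \<sigma> B D) \<cdot> \<a> A B D"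
    by (simp add: sw_def sigma_tens_left)
  have g: "\<a> C D (A \<odot> B) \<cdot> \<sigma> (A \<odot> B) (C \<odot> D) = (\<one> C \<otimes> \<sigma> (A \<odot> B) D) \<cdot> sw (A \<odot> B) C D"
    by (subst sigma_tens_right) (simp_all add: sw_def)
  have "\<a> C A (D \<odot> B) \<cdot> (\<sigma> A C \<otimes> \<sigma> B D) \<cdot> ic A B C D
    = (\<one> C \<otimes> \<one> A \<otimes> \<sigma> B D) \<cdot> sw A C (B \<odot> D) \<cdot> (\<one> A \<otimes> sw B C D) \<cdot> \<a> A B (C \<odot> D)"
    by (simp add: s comp_lift[OF e] ic_eq nat sw_nats comp_lift[OF sw_nat_last])
  also have "\<dots> = \<a> C A (D \<odot> B) \<cdot> ic C D A B \<cdot> \<sigma> (A \<odot> B) (C \<odot> D)"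
    by (simp add: g comp_lift[OF g] ic_eq f whisk sw_tens_first winv) (simp add: tens_merge)
  finally show "\<a> C A (D \<odot> B) \<cdot> (\<sigma> A C \<otimes> \<sigma> B D) \<cdot> ic A B C D
    = \<a> C A (D \<odot> B) \<cdot> ic C D A B \<cdot> \<sigma> (A \<odot> B) (C \<odot> D)" .
qed simp_all

lemma ic_sigma':
  assumes [simp]: "A \<in> Ob V" "B \<in> Ob V" "C \<in> Ob V" "D \<in> Ob V"
  shows "\<sigma> (A \<odot> C) (B \<odot> D) \<cdot> ic A B C D = ic B A D C \<cdot> (\<sigma> A B \<otimes> \<sigma> C D)"
  by (rule dag_inject) (simp_all add: ic_sigma)

subsection \<open>Evaluation and transposition\<close>

declare Dual_Ob [simp]

lemma eta_arr [simp]: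
  assumes "A \<in> Ob V"
  shows "\<eta> A \<in> Arr V" "Dom V (\<eta> A) = \<I>" "Cod V (\<eta> A) = A\<^sup>\<star> \<odot> A"
  using DUnit_Hom[OF assms] by (simp_all add: Hom_iff)

lemma eps_arr [simp]:
  assumes "A \<in> Ob V"
  shows "\<epsilon> A \<in> Arr V" "Dom V (\<epsilon> A) = A \<odot> A\<^sup>\<star>" "Cod V (\<epsilon> A) = \<I>"
  using assms by (simp_all add: dcounit_def)

text \<open>The contraction of \<open>A\<close> with its dual, with a spectator \<open>Y\<close>.
  Applied after \<open>\<one> A \<otimes> f\<close>, it yields the curried form of
  \<open>f\<close>.\<close>

definition ev :: "'o \<Rightarrow> 'o \<Rightarrow> 'a" where
  "ev A Y = \<l> Y \<cdot> (\<epsilon> A \<otimes> \<one> Y) \<cdot> (\<a> A (A\<^sup>\<star>) Y)\<dagger>"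

definition cv :: "'o \<Rightarrow> 'o \<Rightarrow> 'a" where
  "cv A Y = \<a> (A\<^sup>\<star>) A Y \<cdot> (\<eta> A \<otimes> \<one> Y) \<cdot> (\<l> Y)\<dagger>"

lemma ev_arr [simp]:
  assumes "A \<in> Ob V" "Y \<in> Ob V"
  shows "ev A Y \<in> Arr V" "Dom V (ev A Y) = A \<odot> A\<^sup>\<star> \<odot> Y" "Cod V (ev A Y) = Y"
  using assms by (simp_all add: ev_def)

lemma cv_arr [simp]:
  assumes "A \<in> Ob V" "Y \<in> Ob V"
  shows "cv A Y \<in> Arr V" "Dom V (cv A Y) = Y" "Cod V (cv A Y) = A\<^sup>\<star> \<odot> A \<odot> Y"
  using assms by (simp_all add: cv_def)

text \<open>Here the compatibility of counit, unit and symmetry enters: the dagger of a creation is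
  a contraction up to a swap. Daggers of curried expressions are computed through this.\<close>

lemma ev_eq:
  assumes [simp]: "A \<in> Ob V" "Y \<in> Ob V"
  shows "ev A Y = (cv A Y)\<dagger> \<cdot> sw A (A\<^sup>\<star>) Y"
  by (simp add: ev_def cv_def sw_def dcounit_def whisk)

lemma ev_nat:
  assumes "A \<in> Ob V" "h \<in> Arr V" "Cod V h = Y"
  shows "ev A Y \<cdot> (\<one> A \<otimes> \<one> (A\<^sup>\<star>) \<otimes> h) = h \<cdot> ev A (Dom V h)"
proof -
  have [simp]: "Y \<in> Ob V" using assms by auto
  have "(\<epsilon> A \<otimes> \<one> Y) \<cdot> (\<one> (A \<odot> A\<^sup>\<star>) \<otimes> h) = (\<one> \<I> \<otimes> h) \<cdot> (\<epsilon> A \<otimes> \<one> (Dom V h))"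
    using assms by (simp add: tens_merge)
  note this[simp] comp_lift[OF this, simp]
  show ?thesis using assms by (simp add: ev_def nat)
qed

lemma cv_nat:
  assumes "A \<in> Ob V" "h \<in> Arr V" "Cod V h = Y"
  shows "cv A Y \<cdot> h = (\<one> (A\<^sup>\<star>) \<otimes> \<one> A \<otimes> h) \<cdot> cv A (Dom V h)"
proof -
  have [simp]: "Y \<in> Ob V" using assms by auto
  have "(\<eta> A \<otimes> \<one> Y) \<cdot> (\<one> \<I> \<otimes> h) = (\<one> (A\<^sup>\<star> \<odot> A) \<otimes> h) \<cdot> (\<eta> A \<otimes> \<one> (Dom V h))"
    using assms by (simp add: tens_merge)
  note this[simp] comp_lift[OF this, simp]
  show ?thesis using assms by (simp add: cv_def nat ld_nat comp_lift[OF ld_nat])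
qed

lemma cvd_nat:
  assumes "A \<in> Ob V" "h \<in> Arr V" "Cod V h = Y"
  shows "(cv A Y)\<dagger> \<cdot> (\<one> (A\<^sup>\<star>) \<otimes> \<one> A \<otimes> h) = h \<cdot> (cv A (Dom V h))\<dagger>"
  by (rule dag_inject) (use assms in \<open>auto simp: cv_nat\<close>)

lemmas ev_nats = ev_nat comp_lift[OF ev_nat] cvd_nat comp_lift[OF cvd_nat]

lemma ev_tens:
  assumes [simp]: "A \<in> Ob V" "Y \<in> Ob V" "Z \<in> Ob V"
  shows "ev A (Y \<odot> Z) \<cdot> (\<one> A \<otimes> \<a> (A\<^sup>\<star>) Y Z) = (ev A Y \<otimes> \<one> Z) \<cdot> (\<a> A (A\<^sup>\<star> \<odot> Y) Z)\<dagger>"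
proof -
  have "(ev A Y \<otimes> \<one> Z) \<cdot> (\<a> A (A\<^sup>\<star> \<odot> Y) Z)\<dagger>
    = \<l> (Y \<odot> Z) \<cdot> (\<a> \<I> Y Z \<cdot> ((\<epsilon> A \<otimes> \<one> Y) \<otimes> \<one> Z)) \<cdot> ((\<a> A (A\<^sup>\<star>) Y)\<dagger> \<otimes> \<one> Z) \<cdot> (\<a> A (A\<^sup>\<star> \<odot> Y) Z)\<dagger>"
    by (simp add: ev_def whisk flip: l_tens)
  also have "\<dots> = ev A (Y \<odot> Z) \<cdot> (\<one> A \<otimes> \<a> (A\<^sup>\<star>) Y Z)"
    by (subst a_nat) (simp_all add: ev_def pents)
  finally show ?thesis by simp
qed

lemma cv_tens:
  assumes [simp]: "A \<in> Ob V" "Y \<in> Ob V" "Z \<in> Ob V"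
  shows "\<a> (A\<^sup>\<star>) (A \<odot> Y) Z \<cdot> (cv A Y \<otimes> \<one> Z) = (\<one> (A\<^sup>\<star>) \<otimes> (\<a> A Y Z)\<dagger>) \<cdot> cv A (Y \<odot> Z)"
proof -
  have l: "\<a> \<I> Y Z \<cdot> ((\<l> Y)\<dagger> \<otimes> \<one> Z) = (\<l> (Y \<odot> Z))\<dagger>"
    by (rule dag_inject) (simp_all flip: l_tens)
  show ?thesis by (simp add: cv_def whisk nat pents l)
qed

lemma ev_eta:
  assumes [simp]: "A \<in> Ob V" shows "ev A A \<cdot> (\<one> A \<otimes> \<eta> A) = \<r> A"
proof -
  have "ev A A \<cdot> (\<one> A \<otimes> \<eta> A) = (\<l> A \<cdot> (\<epsilon> A \<otimes> \<one> A) \<cdot> (\<a> A (A\<^sup>\<star>) A)\<dagger> \<cdot> (\<one> A \<otimes> \<eta> A) \<cdot> (\<r> A)\<dagger>) \<cdot> \<r> A"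
    by (simp add: ev_def)
  then show ?thesis by (simp only: snake[OF assms]) simp
qed

text \<open>The first snake equation with a spectator.\<close>

lemma ev_cv:
  assumes [simp]: "A \<in> Ob V" "Y \<in> Ob V"
  shows "ev A (A \<odot> Y) \<cdot> (\<one> A \<otimes> cv A Y) = \<one> (A \<odot> Y)"
proof -
  have r: "(\<a> A \<I> Y)\<dagger> \<cdot> (\<one> A \<otimes> (\<l> Y)\<dagger>) = (\<r> A)\<dagger> \<otimes> \<one> Y"
    by (rule dag_inject) (simp_all add: triangle)
  have "ev A (A \<odot> Y) \<cdot> (\<one> A \<otimes> cv A Y) = ((ev A A \<cdot> (\<one> A \<otimes> \<eta> A)) \<otimes> \<one> Y) \<cdot> ((\<r> A)\<dagger> \<otimes> \<one> Y)"
    by (simp add: cv_def whisk ev_tens comp_lift[OF ev_tens] nat r)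
  then show ?thesis by (simp add: ev_eta tens_merge)
qed

text \<open>The second snake equation with a spectator; with \<open>ev_cv\<close> it makes currying
  a bijection.\<close>

lemma cv_ev:
  assumes [simp]: "A \<in> Ob V" "Y \<in> Ob V"
  shows "(\<one> (A\<^sup>\<star>) \<otimes> ev A Y) \<cdot> cv A (A\<^sup>\<star> \<odot> Y) = \<one> (A\<^sup>\<star> \<odot> Y)"
proof -
  have "(\<one> (A\<^sup>\<star>) \<otimes> ev A Y) \<cdot> cv A (A\<^sup>\<star> \<odot> Y)
    = (\<one> (A\<^sup>\<star>) \<otimes> ev A Y) \<cdot> (\<one> (A\<^sup>\<star>) \<otimes> \<a> A (A\<^sup>\<star>) Y) \<cdot> \<a> (A\<^sup>\<star>) (A \<odot> A\<^sup>\<star>) Y \<cdot> (cv A (A\<^sup>\<star>) \<otimes> \<one> Y)"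
    by (simp add: cv_tens winv)
  also have "\<dots> = (\<one> (A\<^sup>\<star>) \<otimes> \<l> Y) \<cdot> \<a> (A\<^sup>\<star>) \<I> Y \<cdot> ((\<one> (A\<^sup>\<star>) \<otimes> \<epsilon> A) \<otimes> \<one> Y) \<cdot> (cv A (A\<^sup>\<star>) \<otimes> \<one> Y)"
    by (simp add: ev_def whisk winv nat)
  also have "\<dots> = (\<r> (A\<^sup>\<star>) \<cdot> (\<one> (A\<^sup>\<star>) \<otimes> \<epsilon> A) \<cdot> cv A (A\<^sup>\<star>)) \<otimes> \<one> Y"
    by (simp add: comp_lift[OF triangle] tens_merge)
  also have "\<dots> = \<one> (A\<^sup>\<star> \<odot> Y)"
    by (simp add: cv_def snake_Dual)
  finally show ?thesis .
qed

text \<open>By \<open>cv_ev\<close> every map into \<open>A\<^sup>\<star> \<odot> Y\<close> is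
  rebuilt from its curried form. This is the way in which maps into doubled objects are compared
  below.\<close>

lemma hat_inject:
  assumes "f \<in> Arr V" "g \<in> Arr V" "Dom V f = Dom V g" "Cod V f = A\<^sup>\<star> \<odot> Y" "Cod V g = A\<^sup>\<star> \<odot> Y"
    and [simp]: "A \<in> Ob V" "Y \<in> Ob V"
    and eq: "ev A Y \<cdot> (\<one> A \<otimes> f) = ev A Y \<cdot> (\<one> A \<otimes> g)"
  shows "f = g"
proof -
  have *: "k = (\<one> (A\<^sup>\<star>) \<otimes> (ev A Y \<cdot> (\<one> A \<otimes> k))) \<cdot> cv A (Dom V k)"
    if [simp]: "k \<in> Arr V" "Cod V k = A\<^sup>\<star> \<odot> Y" for k
  proof -
    have "k = ((\<one> (A\<^sup>\<star>) \<otimes> ev A Y) \<cdot> cv A (A\<^sup>\<star> \<odot> Y)) \<cdot> k" by (simp add: cv_ev)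
    also have "\<dots> = (\<one> (A\<^sup>\<star>) \<otimes> (ev A Y \<cdot> (\<one> A \<otimes> k))) \<cdot> cv A (Dom V k)"
      by (simp add: cv_nat whisk)
    finally show ?thesis .
  qed
  show ?thesis
    by (subst *[OF assms(1,4)], subst *[OF assms(2,5)]) (simp only: eq assms(3))
qed

text \<open>Naturality of the swap applied to the counit, whose target, the unit object, passes
  \<open>Z\<close> by a unitor.\<close>

lemma ev_slide:
  assumes [simp]: "A \<in> Ob V" "Y \<in> Ob V" "Z \<in> Ob V"
  shows "ev A (Z \<odot> Y) \<cdot> (\<one> A \<otimes> sw Z (A\<^sup>\<star>) Y) = (\<one> Z \<otimes> ev A Y) \<cdot> sw A Z (A\<^sup>\<star> \<odot> Y)"
proof -
  have "\<l> (Z \<odot> Y) \<cdot> (\<epsilon> A \<otimes> \<one> (Z \<odot> Y)) = (\<one> Z \<otimes> \<l> Y) \<cdot> sw \<I> Z Y \<cdot> (\<epsilon> A \<otimes> \<one> (Z \<odot> Y))"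
    by (simp add: sw_unit_first winv)
  also have "\<dots> = (\<one> Z \<otimes> \<l> Y) \<cdot> (\<one> Z \<otimes> \<epsilon> A \<otimes> \<one> Y) \<cdot> sw (A \<odot> A\<^sup>\<star>) Z Y"
    by (simp add: sw_nats)
  also have "\<dots> = (\<one> Z \<otimes> ev A Y) \<cdot> sw A Z (A\<^sup>\<star> \<odot> Y) \<cdot> (\<one> A \<otimes> sw (A\<^sup>\<star>) Z Y) \<cdot> \<a> A (A\<^sup>\<star>) (Z \<odot> Y)"
    by (simp add: sw_tens_first ev_def whisk)
  finally have e: "\<l> (Z \<odot> Y) \<cdot> (\<epsilon> A \<otimes> \<one> (Z \<odot> Y))
    = (\<one> Z \<otimes> ev A Y) \<cdot> sw A Z (A\<^sup>\<star> \<odot> Y) \<cdot> (\<one> A \<otimes> sw (A\<^sup>\<star>) Z Y) \<cdot> \<a> A (A\<^sup>\<star>) (Z \<odot> Y)" .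
  show ?thesis
    by (subst ev_def) (simp add: comp_lift[OF e], simp add: tens_merge)
qed

lemma ev_unit:
  assumes [simp]: "A \<in> Ob V" shows "ev A \<I> = \<epsilon> A \<cdot> (\<one> A \<otimes> \<r> (A\<^sup>\<star>))"
proof -
  have "ev A \<I> = \<epsilon> A \<cdot> \<r> (A \<odot> A\<^sup>\<star>) \<cdot> (\<a> A (A\<^sup>\<star>) \<I>)\<dagger>"
    by (simp add: ev_def nat flip: l_eq_r)
  then show ?thesis by (simp flip: r_tens)
qed

text \<open>\<open>ev A \<I>\<close> is the counit up to a unitor, so this is
  \<open>hat_inject\<close> after tensoring with the unit object.\<close>

lemma eps_inject:
  assumes "f \<in> Arr V" "g \<in> Arr V" "Dom V f = Dom V g" "Cod V f = A\<^sup>\<star>" "Cod V g = A\<^sup>\<star>"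
    and [simp]: "A \<in> Ob V" and eq: "\<epsilon> A \<cdot> (\<one> A \<otimes> f) = \<epsilon> A \<cdot> (\<one> A \<otimes> g)"
  shows "f = g"
proof (rule unit_faithful_right)
  show "f \<otimes> \<one> \<I> = g \<otimes> \<one> \<I>"
  proof (rule hat_inject)
    have *: "ev A \<I> \<cdot> (\<one> A \<otimes> k \<otimes> \<one> \<I>) = (\<epsilon> A \<cdot> (\<one> A \<otimes> k)) \<cdot> (\<one> A \<otimes> \<r> (Dom V k))"
      if [simp]: "k \<in> Arr V" "Cod V k = A\<^sup>\<star>" for k
      by (simp add: ev_unit tens_merge r_nat)
    show "ev A \<I> \<cdot> (\<one> A \<otimes> f \<otimes> \<one> \<I>) = ev A \<I> \<cdot> (\<one> A \<otimes> g \<otimes> \<one> \<I>)"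
      by (simp only: *[OF assms(1,4)] *[OF assms(2,5)] eq assms(3))
  qed (use assms in simp_all)
qed (use assms in simp_all)

lemma transpose_eq:
  assumes [simp]: "f \<in> Arr V" "Dom V f = A" "Cod V f = B"
  shows "transpose_arr V f = \<r> (A\<^sup>\<star>) \<cdot> (\<one> (A\<^sup>\<star>) \<otimes> (\<epsilon> B \<cdot> (f \<otimes> \<one> (B\<^sup>\<star>)))) \<cdot> cv A (B\<^sup>\<star>)"
proof -
  have [simp]: "A \<in> Ob V" "B \<in> Ob V" using Dom_in_Ob[OF assms(1)] Cod_in_Ob[OF assms(1)] by simp_all
  show ?thesis by (simp add: transpose_arr_def Let_def cv_def whisk nat)
qed

lemma transpose_arr [simp]:
  assumes "f \<in> Arr V"
  shows "transpose_arr V f \<in> Arr V" "Dom V (transpose_arr V f) = (Cod V f)\<^sup>\<star>"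
    "Cod V (transpose_arr V f) = (Dom V f)\<^sup>\<star>"
  using assms by (simp_all add: transpose_eq[OF assms refl refl])

text \<open>By \<open>eps_inject\<close> this property determines the transpose, so it replaces the
  defining composite from here on.\<close>

lemma eps_transpose:
  assumes "f \<in> Arr V" "Dom V f = A"
  shows "\<epsilon> A \<cdot> (\<one> A \<otimes> transpose_arr V f) = \<epsilon> (Cod V f) \<cdot> (f \<otimes> \<one> ((Cod V f)\<^sup>\<star>))"
proof -
  have [simp]: "A \<in> Ob V" using assms by auto
  let ?B = "Cod V f"
  let ?k = "\<epsilon> ?B \<cdot> (f \<otimes> \<one> (?B\<^sup>\<star>))"
  have "\<epsilon> A \<cdot> (\<one> A \<otimes> transpose_arr V f) = ev A \<I> \<cdot> (\<one> A \<otimes> \<one> (A\<^sup>\<star>) \<otimes> ?k) \<cdot> (\<one> A \<otimes> cv A (?B\<^sup>\<star>))"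
    using assms by (simp add: transpose_eq ev_unit whisk)
  also have "\<dots> = ?k \<cdot> ev A (A \<odot> ?B\<^sup>\<star>) \<cdot> (\<one> A \<otimes> cv A (?B\<^sup>\<star>))"
    using assms by (subst comp_lift[OF ev_nat]) simp_all
  also have "\<dots> = ?k" using assms by (simp add: ev_cv)
  finally show ?thesis .
qed

lemma ev_transpose:
  assumes "f \<in> Arr V" "Dom V f = A" and [simp]: "Y \<in> Ob V"
  shows "ev A Y \<cdot> (\<one> A \<otimes> transpose_arr V f \<otimes> \<one> Y) = ev (Cod V f) Y \<cdot> (f \<otimes> \<one> ((Cod V f)\<^sup>\<star> \<odot> Y))"
proof -
  have [simp]: "A \<in> Ob V" using assms by auto
  have "ev A Y \<cdot> (\<one> A \<otimes> transpose_arr V f \<otimes> \<one> Y)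
    = \<l> Y \<cdot> ((\<epsilon> A \<cdot> (\<one> A \<otimes> transpose_arr V f)) \<otimes> \<one> Y) \<cdot> (\<a> A ((Cod V f)\<^sup>\<star>) Y)\<dagger>"
    using assms by (simp add: ev_def nat whisk)
  also have "\<dots> = ev (Cod V f) Y \<cdot> (f \<otimes> \<one> ((Cod V f)\<^sup>\<star> \<odot> Y))"
    using assms by (simp add: eps_transpose ev_def nat whisk)
  finally show ?thesis .
qed

text \<open>In curried form both sides are \<open>f\<close> after a unitor.\<close>

lemma transpose_eta:
  assumes "f \<in> Arr V" "Cod V f = B"
  shows "(transpose_arr V f \<otimes> \<one> B) \<cdot> \<eta> B = (\<one> ((Dom V f)\<^sup>\<star>) \<otimes> f) \<cdot> \<eta> (Dom V f)"
proof (rule hat_inject)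
  let ?A = "Dom V f"
  have [simp]: "B \<in> Ob V" using assms by auto
  have "ev ?A B \<cdot> (\<one> ?A \<otimes> ((transpose_arr V f \<otimes> \<one> B) \<cdot> \<eta> B))
    = ev B B \<cdot> (f \<otimes> \<one> (B\<^sup>\<star> \<odot> B)) \<cdot> (\<one> ?A \<otimes> \<eta> B)"
    using assms by (simp add: whisk comp_lift[OF ev_transpose])
  also have "\<dots> = ev B B \<cdot> (\<one> B \<otimes> \<eta> B) \<cdot> (f \<otimes> \<one> \<I>)"
    using assms by (simp add: tens_merge)
  also have "\<dots> = f \<cdot> \<r> ?A"
    using assms by (simp add: comp_lift[OF ev_eta] r_nat)
  also have "\<dots> = ev ?A B \<cdot> (\<one> ?A \<otimes> ((\<one> (?A\<^sup>\<star>) \<otimes> f) \<cdot> \<eta> ?A))"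
    using assms by (simp add: whisk ev_nats ev_eta)
  finally show "ev ?A B \<cdot> (\<one> ?A \<otimes> ((transpose_arr V f \<otimes> \<one> B) \<cdot> \<eta> B))
    = ev ?A B \<cdot> (\<one> ?A \<otimes> ((\<one> (?A\<^sup>\<star>) \<otimes> f) \<cdot> \<eta> ?A))" .
qed (use assms in auto)

text \<open>The dagger of \<open>transpose_eta\<close>, with the dagger of the unit rewritten as a
  counit, shows that the left side has the property characterising the transpose of
  \<open>f\<dagger>\<close>.\<close>

lemma transpose_dag:
  assumes [simp]: "f \<in> Arr V" shows "(transpose_arr V f)\<dagger> = transpose_arr V (f\<dagger>)"
proof (rule eps_inject)
  let ?A = "Dom V f" and ?B = "Cod V f"
  have e: "(\<eta> ?A)\<dagger> \<cdot> (\<one> (?A\<^sup>\<star>) \<otimes> f\<dagger>) = (\<eta> ?B)\<dagger> \<cdot> ((transpose_arr V f)\<dagger> \<otimes> \<one> ?B)"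
    by (rule dag_inject) (simp_all add: transpose_eta)
  have "\<epsilon> ?B \<cdot> (\<one> ?B \<otimes> (transpose_arr V f)\<dagger>) = ((\<eta> ?B)\<dagger> \<cdot> ((transpose_arr V f)\<dagger> \<otimes> \<one> ?B)) \<cdot> \<sigma> ?B (?A\<^sup>\<star>)"
    by (simp add: dcounit_def s_nat_idn)
  also have "\<dots> = \<epsilon> ?A \<cdot> (f\<dagger> \<otimes> \<one> (?A\<^sup>\<star>))"
    by (simp add: dcounit_def s_nat_idn flip: e)
  finally show "\<epsilon> ?B \<cdot> (\<one> ?B \<otimes> (transpose_arr V f)\<dagger>) = \<epsilon> ?B \<cdot> (\<one> ?B \<otimes> transpose_arr V (f\<dagger>))"
    by (simp add: eps_transpose)
qed simp_all

section \<open>Conjugates and doubled arrows\<close>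

abbreviation dbl :: "'a \<Rightarrow> 'a" where "dbl g \<equiv> lower_star V g \<otimes> g"

lemma ls_arr [simp]:
  assumes "g \<in> Arr V"
  shows "lower_star V g \<in> Arr V" "Dom V (lower_star V g) = (Dom V g)\<^sup>\<star>"
    "Cod V (lower_star V g) = (Cod V g)\<^sup>\<star>"
  using assms by (simp_all add: lower_star_def)

lemma ls_dag [simp]: "g \<in> Arr V \<Longrightarrow> (lower_star V g)\<dagger> = lower_star V (g\<dagger>)"
  by (simp add: lower_star_def transpose_dag)

lemma eps_ls:
  assumes "g \<in> Arr V" "Cod V g = B"
  shows "\<epsilon> B \<cdot> (\<one> B \<otimes> lower_star V g) = \<epsilon> (Dom V g) \<cdot> (g\<dagger> \<otimes> \<one> ((Dom V g)\<^sup>\<star>))"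
  using eps_transpose[of "g\<dagger>" B] assms by (simp add: lower_star_def)

lemma ev_ls:
  assumes "g \<in> Arr V" "Cod V g = B" "Y \<in> Ob V"
  shows "ev B Y \<cdot> (\<one> B \<otimes> lower_star V g \<otimes> \<one> Y) = ev (Dom V g) Y \<cdot> (g\<dagger> \<otimes> \<one> ((Dom V g)\<^sup>\<star> \<odot> Y))"
  using ev_transpose[of "g\<dagger>" B Y] assms by (simp add: lower_star_def)

lemma ls_idn [simp]: "A \<in> Ob V \<Longrightarrow> lower_star V (\<one> A) = \<one> (A\<^sup>\<star>)"
  by (rule eps_inject[of _ _ A]) (simp_all add: eps_ls)

lemma ls_comp:
  assumes "f \<in> Arr V" "g \<in> Arr V" "Cod V f = Dom V g"
  shows "lower_star V (g \<cdot> f) = lower_star V g \<cdot> lower_star V f"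
proof (rule eps_inject)
  let ?C = "Cod V g"
  have s: "(g\<dagger> \<otimes> \<one> ((Dom V g)\<^sup>\<star>)) \<cdot> (\<one> ?C \<otimes> lower_star V f)
    = (\<one> (Dom V g) \<otimes> lower_star V f) \<cdot> (g\<dagger> \<otimes> \<one> ((Dom V f)\<^sup>\<star>))"
    using assms by (simp add: tens_merge)
  show "\<epsilon> ?C \<cdot> (\<one> ?C \<otimes> lower_star V (g \<cdot> f)) = \<epsilon> ?C \<cdot> (\<one> ?C \<otimes> (lower_star V g \<cdot> lower_star V f))"
    using assms by (simp add: eps_ls whisk comp_lift[OF eps_ls] s)
qed (use assms in auto)

lemma dbl_comp:
  assumes "f \<in> Arr V" "g \<in> Arr V" "Cod V f = Dom V g"
  shows "dbl (g \<cdot> f) = dbl g \<cdot> dbl f"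
  using assms by (simp add: ls_comp tens_merge)

lemma ev_dbl:
  assumes "g \<in> Arr V" "Cod V g = B"
  shows "ev B B \<cdot> (\<one> B \<otimes> dbl g) = g \<cdot> ev (Dom V g) (Dom V g) \<cdot> (g\<dagger> \<otimes> \<one> ((Dom V g)\<^sup>\<star> \<odot> Dom V g))"
proof -
  have [simp]: "B \<in> Ob V" using assms by auto
  have "ev B B \<cdot> (\<one> B \<otimes> dbl g)
    = ev B B \<cdot> (\<one> B \<otimes> \<one> (B\<^sup>\<star>) \<otimes> g) \<cdot> (\<one> B \<otimes> lower_star V g \<otimes> \<one> (Dom V g))"
    using assms by (simp add: tens_merge)
  also have "\<dots> = g \<cdot> ev (Dom V g) (Dom V g) \<cdot> (g\<dagger> \<otimes> \<one> ((Dom V g)\<^sup>\<star> \<odot> Dom V g))"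
    using assms by (simp add: ev_nats ev_ls)
  finally show ?thesis .
qed

lemma unit_arr_ls [simp]: "unit_arr g \<Longrightarrow> unit_arr (lower_star V g)"
  by (auto simp: unit_arr_def simp flip: ls_comp)

subsection \<open>The dual of a tensor product\<close>

lemma cap_eq:
  assumes [simp]: "A \<in> Ob V" "B \<in> Ob V"
  shows "cap_middle V A B = (\<one> (B\<^sup>\<star>) \<otimes> (cv A B)\<dagger>) \<cdot> \<a> (B\<^sup>\<star>) (A\<^sup>\<star>) (A \<odot> B)"
  by (simp add: cap_middle_def cv_def)

lemma nested_eq:
  assumes [simp]: "A \<in> Ob V" "B \<in> Ob V"
  shows "nested_unit V A B = (\<a> (B\<^sup>\<star>) (A\<^sup>\<star>) (A \<odot> B))\<dagger> \<cdot> (\<one> (B\<^sup>\<star>) \<otimes> cv A B) \<cdot> \<eta> B"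
  by (simp add: nested_unit_def cap_eq)

lemma nested_arr [simp]:
  assumes "A \<in> Ob V" "B \<in> Ob V"
  shows "nested_unit V A B \<in> Arr V" "Dom V (nested_unit V A B) = \<I>"
    "Cod V (nested_unit V A B) = (B\<^sup>\<star> \<odot> A\<^sup>\<star>) \<odot> (A \<odot> B)"
  using assms by (simp_all add: nested_eq)

text \<open>Creation for the second candidate dual
  \<open>B\<^sup>\<star> \<odot> A\<^sup>\<star>\<close> of \<open>A \<odot> B\<close>. The matching
  contraction \<open>nev\<close> removes \<open>B\<close> first and \<open>A\<close>
  afterwards.\<close>

definition ncv :: "'o \<Rightarrow> 'o \<Rightarrow> 'o \<Rightarrow> 'a" where
  "ncv A B Y = \<a> (B\<^sup>\<star> \<odot> A\<^sup>\<star>) (A \<odot> B) Y \<cdot> (nested_unit V A B \<otimes> \<one> Y) \<cdot> (\<l> Y)\<dagger>"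

definition nev :: "'o \<Rightarrow> 'o \<Rightarrow> 'o \<Rightarrow> 'a" where
  "nev A B Y = ev A Y \<cdot> (\<one> A \<otimes> ev B (A\<^sup>\<star> \<odot> Y)) \<cdot> \<a> A B (B\<^sup>\<star> \<odot> A\<^sup>\<star> \<odot> Y) \<cdot> (\<one> (A \<odot> B) \<otimes> \<a> (B\<^sup>\<star>) (A\<^sup>\<star>) Y)"

lemma ncv_eq:
  assumes [simp]: "A \<in> Ob V" "B \<in> Ob V" "Y \<in> Ob V"
  shows "ncv A B Y = (\<a> (B\<^sup>\<star>) (A\<^sup>\<star>) ((A \<odot> B) \<odot> Y))\<dagger> \<cdot> (\<one> (B\<^sup>\<star>) \<otimes> \<one> (A\<^sup>\<star>) \<otimes> (\<a> A B Y)\<dagger>)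
    \<cdot> (\<one> (B\<^sup>\<star>) \<otimes> cv A (B \<odot> Y)) \<cdot> cv B Y"
  by (simp add: ncv_def nested_eq whisk nat pents whisk_lift[OF cv_tens] comp_lift[OF whisk_lift[OF cv_tens]])
    (simp add: cv_def)

lemma ncv_arr [simp]:
  assumes "A \<in> Ob V" "B \<in> Ob V" "Y \<in> Ob V"
  shows "ncv A B Y \<in> Arr V" "Dom V (ncv A B Y) = Y" "Cod V (ncv A B Y) = (B\<^sup>\<star> \<odot> A\<^sup>\<star>) \<odot> (A \<odot> B) \<odot> Y"
  using assms by (simp_all add: ncv_eq)

lemma nev_arr [simp]:
  assumes "A \<in> Ob V" "B \<in> Ob V" "Y \<in> Ob V"
  shows "nev A B Y \<in> Arr V" "Dom V (nev A B Y) = (A \<odot> B) \<odot> (B\<^sup>\<star> \<odot> A\<^sup>\<star>) \<odot> Y" "Cod V (nev A B Y) = Y"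
  using assms by (simp_all add: nev_def)

lemma ncv_nat:
  assumes "A \<in> Ob V" "B \<in> Ob V" "h \<in> Arr V" "Cod V h = Y"
  shows "ncv A B Y \<cdot> h = (\<one> (B\<^sup>\<star> \<odot> A\<^sup>\<star>) \<otimes> \<one> (A \<odot> B) \<otimes> h) \<cdot> ncv A B (Dom V h)"
proof -
  have [simp]: "Y \<in> Ob V" using assms by auto
  have "(nested_unit V A B \<otimes> \<one> Y) \<cdot> (\<one> \<I> \<otimes> h) = (\<one> ((B\<^sup>\<star> \<odot> A\<^sup>\<star>) \<odot> (A \<odot> B)) \<otimes> h) \<cdot> (nested_unit V A B \<otimes> \<one> (Dom V h))"
    using assms by (simp add: tens_merge)
  note this[simp] comp_lift[OF this, simp]
  show ?thesis using assms by (simp add: ncv_def nat ld_nat comp_lift[OF ld_nat])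
qed

lemma whisk_ev_cv:
  assumes [simp]: "A \<in> Ob V" "Y \<in> Ob V" "Z \<in> Ob V"
  shows "(\<one> Z \<otimes> ev A (A \<odot> Y)) \<cdot> (\<one> Z \<otimes> \<one> A \<otimes> cv A Y) = \<one> (Z \<odot> A \<odot> Y)"
  by (simp add: tens_merge ev_cv)

text \<open>Two nested snakes, one for \<open>A\<close> and one for \<open>B\<close>.\<close>

lemma nev_ncv:
  assumes [simp]: "A \<in> Ob V" "B \<in> Ob V" "Y \<in> Ob V"
  shows "nev A B ((A \<odot> B) \<odot> Y) \<cdot> (\<one> (A \<odot> B) \<otimes> ncv A B Y) = \<one> ((A \<odot> B) \<odot> Y)"
  by (simp add: nev_def ncv_eq whisk winv a_nat_idn comp_lift[OF a_nat_idn] whisk_lift[OF ev_nat] comp_lift[OF whisk_lift[OF ev_nat]]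
      comp_lift[OF whisk_ev_cv] ev_nats comp_lift[OF ev_cv])

lemma ncv_nev:
  assumes [simp]: "A \<in> Ob V" "B \<in> Ob V" "Y \<in> Ob V"
  shows "(\<one> (B\<^sup>\<star> \<odot> A\<^sup>\<star>) \<otimes> nev A B Y) \<cdot> ncv A B ((B\<^sup>\<star> \<odot> A\<^sup>\<star>) \<odot> Y) = \<one> ((B\<^sup>\<star> \<odot> A\<^sup>\<star>) \<odot> Y)"
proof (rule unit_arr_left_eq)
  let ?Q = "B\<^sup>\<star> \<odot> A\<^sup>\<star>"
  let ?e = "ev B (A\<^sup>\<star> \<odot> Y) \<cdot> (\<one> B \<otimes> \<a> (B\<^sup>\<star>) (A\<^sup>\<star>) Y)"
  have n: "nev A B Y \<cdot> (\<a> A B (?Q \<odot> Y))\<dagger> = ev A Y \<cdot> (\<one> A \<otimes> ?e)"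
    by (simp add: nev_def nat whisk)
  have "\<a> (B\<^sup>\<star>) (A\<^sup>\<star>) Y \<cdot> (\<one> ?Q \<otimes> nev A B Y) \<cdot> ncv A B (?Q \<odot> Y)
    = (\<one> (B\<^sup>\<star>) \<otimes> ((\<one> (A\<^sup>\<star>) \<otimes> (nev A B Y \<cdot> (\<a> A B (?Q \<odot> Y))\<dagger>)) \<cdot> cv A (B \<odot> ?Q \<odot> Y))) \<cdot> cv B (?Q \<odot> Y)"
    by (simp add: ncv_eq nat whisk)
  also have "\<dots> = (\<one> (B\<^sup>\<star>) \<otimes> (((\<one> (A\<^sup>\<star>) \<otimes> ev A Y) \<cdot> cv A (A\<^sup>\<star> \<odot> Y)) \<cdot> ?e)) \<cdot> cv B (?Q \<odot> Y)"
    unfolding n by (simp add: whisk cv_nat comp_lift[OF cv_nat])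
  also have "\<dots> = ((\<one> (B\<^sup>\<star>) \<otimes> ev B (A\<^sup>\<star> \<odot> Y)) \<cdot> cv B (B\<^sup>\<star> \<odot> A\<^sup>\<star> \<odot> Y)) \<cdot> \<a> (B\<^sup>\<star>) (A\<^sup>\<star>) Y"
    unfolding cv_ev[OF assms(1,3)] by (simp add: whisk cv_nat comp_lift[OF cv_nat])
  also have "\<dots> = \<a> (B\<^sup>\<star>) (A\<^sup>\<star>) Y" by (simp add: cv_ev)
  finally show "\<a> (B\<^sup>\<star>) (A\<^sup>\<star>) Y \<cdot> (\<one> ?Q \<otimes> nev A B Y) \<cdot> ncv A B (?Q \<odot> Y) = \<a> (B\<^sup>\<star>) (A\<^sup>\<star>) Y \<cdot> \<one> (?Q \<odot> Y)"
    by simp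
qed simp_all

lemma cv_slide:
  assumes [simp]: "A \<in> Ob V" "Y \<in> Ob V" "Z \<in> Ob V"
  shows "sw (A\<^sup>\<star>) Z (A \<odot> Y) \<cdot> (\<one> (A\<^sup>\<star>) \<otimes> sw A Z Y) \<cdot> cv A (Z \<odot> Y) = \<one> Z \<otimes> cv A Y"
proof -
  have "(\<one> Z \<otimes> \<a> (A\<^sup>\<star>) A Y) \<cdot> sw (A\<^sup>\<star> \<odot> A) Z Y \<cdot> (\<eta> A \<otimes> \<one> (Z \<odot> Y)) \<cdot> (\<l> (Z \<odot> Y))\<dagger> = \<one> Z \<otimes> cv A Y"
    by (simp add: sw_nats sw_unit_first cv_def whisk)
  then show ?thesis by (simp add: sw_tens_first cv_def winv)
qed

text \<open>The analogue of \<open>ev_eq\<close> for the nested dual. The large swap splits into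
  four; two of them bring \<open>A\<close> and \<open>B\<close> to their own duals, the mixed ones
  are absorbed by \<open>ev_slide\<close> and \<open>cv_slide\<close>. Unitarity of
  \<open>dual_tensor\<close> rests on this.\<close>

lemma nev_eq:
  assumes [simp]: "A \<in> Ob V" "B \<in> Ob V" "Y \<in> Ob V"
  shows "nev A B Y = (ncv A B Y)\<dagger> \<cdot> sw (A \<odot> B) (B\<^sup>\<star> \<odot> A\<^sup>\<star>) Y"
proof -
  have c: "(cv B (A \<odot> Z))\<dagger> \<cdot> (\<one> (B\<^sup>\<star>) \<otimes> sw A B Z) \<cdot> sw A (B\<^sup>\<star>) (B \<odot> Z) = \<one> A \<otimes> (cv B Z)\<dagger>"
    if [simp]: "Z \<in> Ob V" for Z
    by (rule dag_inject) (simp_all add: cv_slide)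
  have "(ncv A B Y)\<dagger> \<cdot> sw (A \<odot> B) (B\<^sup>\<star> \<odot> A\<^sup>\<star>) Y
    = (cv B Y)\<dagger> \<cdot> (\<one> (B\<^sup>\<star>) \<otimes> (((cv A (B \<odot> Y))\<dagger> \<cdot> sw A (A\<^sup>\<star>) (B \<odot> Y)) \<cdot> (\<one> A \<otimes> sw B (A\<^sup>\<star>) Y)))
      \<cdot> sw A (B\<^sup>\<star>) (B \<odot> A\<^sup>\<star> \<odot> Y) \<cdot> (\<one> A \<otimes> sw B (B\<^sup>\<star>) (A\<^sup>\<star> \<odot> Y)) \<cdot> \<a> A B (B\<^sup>\<star> \<odot> A\<^sup>\<star> \<odot> Y)
      \<cdot> (\<one> (A \<odot> B) \<otimes> \<a> (B\<^sup>\<star>) (A\<^sup>\<star>) Y)"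
    by (simp add: ncv_eq sw_tens_mid' sw_tens_first whisk winv)
  also have "\<dots> = (cv B Y)\<dagger> \<cdot> (\<one> (B\<^sup>\<star>) \<otimes> \<one> B \<otimes> ev A Y) \<cdot> (\<one> (B\<^sup>\<star>) \<otimes> sw A B (A\<^sup>\<star> \<odot> Y))
      \<cdot> sw A (B\<^sup>\<star>) (B \<odot> A\<^sup>\<star> \<odot> Y) \<cdot> (\<one> A \<otimes> sw B (B\<^sup>\<star>) (A\<^sup>\<star> \<odot> Y)) \<cdot> \<a> A B (B\<^sup>\<star> \<odot> A\<^sup>\<star> \<odot> Y)
      \<cdot> (\<one> (A \<odot> B) \<otimes> \<a> (B\<^sup>\<star>) (A\<^sup>\<star>) Y)"
    by (simp add: ev_slide whisk flip: ev_eq)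
  also have "\<dots> = ev A Y \<cdot> ((cv B (A \<odot> A\<^sup>\<star> \<odot> Y))\<dagger> \<cdot> (\<one> (B\<^sup>\<star>) \<otimes> sw A B (A\<^sup>\<star> \<odot> Y))
      \<cdot> sw A (B\<^sup>\<star>) (B \<odot> A\<^sup>\<star> \<odot> Y)) \<cdot> (\<one> A \<otimes> sw B (B\<^sup>\<star>) (A\<^sup>\<star> \<odot> Y)) \<cdot> \<a> A B (B\<^sup>\<star> \<odot> A\<^sup>\<star> \<odot> Y)
      \<cdot> (\<one> (A \<odot> B) \<otimes> \<a> (B\<^sup>\<star>) (A\<^sup>\<star>) Y)"
    by (simp add: ev_nats)
  also have "\<dots> = ev A Y \<cdot> (\<one> A \<otimes> ((cv B (A\<^sup>\<star> \<odot> Y))\<dagger> \<cdot> sw B (B\<^sup>\<star>) (A\<^sup>\<star> \<odot> Y))) \<cdot> \<a> A B (B\<^sup>\<star> \<odot> A\<^sup>\<star> \<odot> Y)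
      \<cdot> (\<one> (A \<odot> B) \<otimes> \<a> (B\<^sup>\<star>) (A\<^sup>\<star>) Y)"
    by (subst c) (simp_all add: whisk)
  also have "\<dots> = nev A B Y"
    by (simp add: nev_def flip: ev_eq)
  finally show ?thesis by simp
qed

lemma dt_arr [simp]:
  assumes "A \<in> Ob V" "B \<in> Ob V"
  shows "dual_tensor V A B \<in> Arr V" "Dom V (dual_tensor V A B) = (A \<odot> B)\<^sup>\<star>"
    "Cod V (dual_tensor V A B) = B\<^sup>\<star> \<odot> A\<^sup>\<star>"
  using assms by (simp_all add: dual_tensor_def Let_def)

text \<open>Reads the comparison map as the creation of a nested pair followed by a contraction with
  the chosen dual, a form to which naturality of both applies.\<close>

lemma dt_whisk:
  assumes [simp]: "A \<in> Ob V" "B \<in> Ob V" "Y \<in> Ob V"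
  shows "dual_tensor V A B \<otimes> \<one> Y = (\<one> (B\<^sup>\<star> \<odot> A\<^sup>\<star>) \<otimes> ev (A \<odot> B) Y) \<cdot> ncv A B ((A \<odot> B)\<^sup>\<star> \<odot> Y)"
proof -
  let ?W = "A \<odot> B" and ?Q = "B\<^sup>\<star> \<odot> A\<^sup>\<star>"
  let ?P = "?W\<^sup>\<star>"
  have l: "\<a> \<I> ?P Y \<cdot> ((\<l> ?P)\<dagger> \<otimes> \<one> Y) = (\<l> (?P \<odot> Y))\<dagger>"
    by (rule dag_inject) (simp_all flip: l_tens)
  have n: "\<a> ?Q (?W \<odot> ?P) Y \<cdot> (ncv A B ?P \<otimes> \<one> Y) = (\<one> ?Q \<otimes> (\<a> ?W ?P Y)\<dagger>) \<cdot> ncv A B (?P \<odot> Y)"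
    by (simp add: ncv_def whisk nat pents l)
  have "(\<one> ?Q \<otimes> ev ?W Y) \<cdot> ncv A B (?P \<odot> Y)
    = (\<one> ?Q \<otimes> \<l> Y) \<cdot> (\<one> ?Q \<otimes> \<epsilon> ?W \<otimes> \<one> Y) \<cdot> (\<one> ?Q \<otimes> (\<a> ?W ?P Y)\<dagger>) \<cdot> ncv A B (?P \<odot> Y)"
    by (simp add: ev_def whisk)
  also have "\<dots> = (\<one> ?Q \<otimes> \<l> Y) \<cdot> \<a> ?Q \<I> Y \<cdot> ((\<one> ?Q \<otimes> \<epsilon> ?W) \<otimes> \<one> Y) \<cdot> (ncv A B ?P \<otimes> \<one> Y)"
    by (simp add: nat flip: n)
  also have "\<dots> = (\<r> ?Q \<cdot> (\<one> ?Q \<otimes> \<epsilon> ?W) \<cdot> ncv A B ?P) \<otimes> \<one> Y"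
    by (simp add: comp_lift[OF triangle] tens_merge)
  also have "\<dots> = dual_tensor V A B \<otimes> \<one> Y"
    by (simp add: dual_tensor_def Let_def ncv_def)
  finally show ?thesis by simp
qed

lemma nev_dt:
  assumes [simp]: "A \<in> Ob V" "B \<in> Ob V" "Y \<in> Ob V"
  shows "nev A B Y \<cdot> (\<one> (A \<odot> B) \<otimes> dual_tensor V A B \<otimes> \<one> Y) = ev (A \<odot> B) Y"
proof -
  have nat: "nev A B Y \<cdot> (\<one> (A \<odot> B) \<otimes> \<one> (B\<^sup>\<star> \<odot> A\<^sup>\<star>) \<otimes> ev (A \<odot> B) Y)
    = ev (A \<odot> B) Y \<cdot> nev A B ((A \<odot> B) \<odot> (A \<odot> B)\<^sup>\<star> \<odot> Y)"
    by (simp add: nev_def nat whisk whisk_lift[OF whisk_lift[OF a_nat_idn]] comp_lift[OF whisk_lift[OF whisk_lift[OF a_nat_idn]]]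
      whisk_lift[OF ev_nat] comp_lift[OF whisk_lift[OF ev_nat]] ev_nats)
  show ?thesis by (simp add: dt_whisk whisk comp_lift[OF nat] nev_ncv)
qed

lemma dt_cv:
  assumes [simp]: "A \<in> Ob V" "B \<in> Ob V" "Y \<in> Ob V"
  shows "(dual_tensor V A B \<otimes> \<one> ((A \<odot> B) \<odot> Y)) \<cdot> cv (A \<odot> B) Y = ncv A B Y"
proof -
  have "(dual_tensor V A B \<otimes> \<one> ((A \<odot> B) \<odot> Y)) \<cdot> cv (A \<odot> B) Y
    = (\<one> (B\<^sup>\<star> \<odot> A\<^sup>\<star>) \<otimes> (ev (A \<odot> B) ((A \<odot> B) \<odot> Y) \<cdot> (\<one> (A \<odot> B) \<otimes> cv (A \<odot> B) Y))) \<cdot> ncv A B Y"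
    by (simp add: dt_whisk ncv_nat whisk)
  then show ?thesis by (simp add: ev_cv)
qed

lemma ev_dtd:
  assumes [simp]: "A \<in> Ob V" "B \<in> Ob V" "Y \<in> Ob V"
  shows "ev (A \<odot> B) Y \<cdot> (\<one> (A \<odot> B) \<otimes> (dual_tensor V A B)\<dagger> \<otimes> \<one> Y) = nev A B Y"
proof -
  have d: "(cv (A \<odot> B) Y)\<dagger> \<cdot> ((dual_tensor V A B)\<dagger> \<otimes> \<one> ((A \<odot> B) \<odot> Y)) = (ncv A B Y)\<dagger>"
    by (rule dag_inject) (simp_all add: dt_cv)
  show ?thesis by (simp add: ev_eq nev_eq sw_nats comp_lift[OF d])
qed

text \<open>The comparison map turns \<open>nev\<close> into \<open>ev\<close> and its dagger turns
  \<open>ev\<close> into \<open>nev\<close>, so both composites are determined by their effect on a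
  contraction.\<close>

lemma dt_unit [simp]:
  assumes [simp]: "A \<in> Ob V" "B \<in> Ob V" shows "unit_arr (dual_tensor V A B)"
proof -
  let ?d = "dual_tensor V A B" and ?W = "A \<odot> B" and ?Q = "B\<^sup>\<star> \<odot> A\<^sup>\<star>"
  \<comment> \<open>The unit object plays the spectator that \<open>hat_inject\<close> expects;
    \<open>unit_faithful_right\<close> removes it afterwards.\<close>
  have "(?d\<dagger> \<otimes> \<one> \<I>) \<cdot> (?d \<otimes> \<one> \<I>) = \<one> (?W\<^sup>\<star> \<odot> \<I>)"
    by (rule hat_inject[of _ _ ?W \<I>]) (simp_all add: whisk comp_lift[OF ev_dtd] nev_dt)
  then have 1: "?d\<dagger> \<cdot> ?d = \<one> (?W\<^sup>\<star>)"
    using unit_faithful_right[of "?d\<dagger> \<cdot> ?d" "\<one> (?W\<^sup>\<star>)"] by (simp add: tens_merge)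
  have "(?d \<otimes> \<one> \<I>) \<cdot> (?d\<dagger> \<otimes> \<one> \<I>) = (\<one> ?Q \<otimes> (ev ?W \<I> \<cdot> (\<one> ?W \<otimes> ?d\<dagger> \<otimes> \<one> \<I>))) \<cdot> ncv A B (?Q \<odot> \<I>)"
    by (simp add: dt_whisk ncv_nat whisk)
  then have "(?d \<otimes> \<one> \<I>) \<cdot> (?d\<dagger> \<otimes> \<one> \<I>) = \<one> (?Q \<odot> \<I>)"
    by (simp add: ev_dtd ncv_nev)
  then have "?d \<cdot> ?d\<dagger> = \<one> ?Q"
    using unit_faithful_right[of "?d \<cdot> ?d\<dagger>" "\<one> ?Q"] by (simp add: tens_merge)
  with 1 show ?thesis by (simp add: unit_arr_def)
qed

subsection \<open>The doubling functor is strong monoidal\<close>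

abbreviation mu :: "'o \<Rightarrow> 'o \<Rightarrow> 'a" where "mu \<equiv> reorder V"

lemma mu_eq:
  "mu A B = ((dual_tensor V A B)\<dagger> \<otimes> \<one> (A \<odot> B)) \<cdot> (\<a> (B\<^sup>\<star>) (A\<^sup>\<star>) (A \<odot> B))\<dagger>
     \<cdot> (\<one> (B\<^sup>\<star>) \<otimes> \<a> (A\<^sup>\<star>) A B) \<cdot> sw (A\<^sup>\<star> \<odot> A) (B\<^sup>\<star>) B" if "A \<in> Ob V" "B \<in> Ob V"
  using that by (simp add: reorder_def sw_def)

lemma mu_unit [simp]:
  assumes [simp]: "A \<in> Ob V" "B \<in> Ob V"
  shows "unit_arr (mu A B)" "mu A B \<in> Arr V" "Dom V (mu A B) = (A\<^sup>\<star> \<odot> A) \<odot> (B\<^sup>\<star> \<odot> B)"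
    "Cod V (mu A B) = (A \<odot> B)\<^sup>\<star> \<odot> (A \<odot> B)"
  by (simp_all add: mu_eq)

text \<open>After the comparison of duals is undone, the contraction of \<open>B\<close> slides past
  the doubled \<open>A\<close> by \<open>ev_slide\<close>, so that the two contractions become
  parallel.\<close>

lemma ev_mu:
  assumes [simp]: "A \<in> Ob V" "B \<in> Ob V"
  shows "ev (A \<odot> B) (A \<odot> B) \<cdot> (\<one> (A \<odot> B) \<otimes> mu A B)
    = (ev A A \<otimes> ev B B) \<cdot> ic A B (A\<^sup>\<star> \<odot> A) (B\<^sup>\<star> \<odot> B)"
proof -
  let ?W = "A \<odot> B" and ?DA = "A\<^sup>\<star> \<odot> A"
  have "ev ?W ?W \<cdot> (\<one> ?W \<otimes> mu A B) = nev A B ?W \<cdot> (\<one> ?W \<otimes> (\<a> (B\<^sup>\<star>) (A\<^sup>\<star>) ?W)\<dagger>)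
      \<cdot> (\<one> ?W \<otimes> \<one> (B\<^sup>\<star>) \<otimes> \<a> (A\<^sup>\<star>) A B) \<cdot> (\<one> ?W \<otimes> sw ?DA (B\<^sup>\<star>) B)"
    by (simp add: mu_eq whisk comp_lift[OF ev_dtd])
  also have "\<dots> = (ev A ?W \<cdot> (\<one> A \<otimes> \<a> (A\<^sup>\<star>) A B)) \<cdot> (\<one> A \<otimes> (ev B (?DA \<odot> B) \<cdot> (\<one> B \<otimes> sw ?DA (B\<^sup>\<star>) B)))
      \<cdot> \<a> A B (?DA \<odot> B\<^sup>\<star> \<odot> B)"
    by (simp add: nev_def nat whisk winv whisk_lift[OF ev_nat] comp_lift[OF whisk_lift[OF ev_nat]])
  also have "\<dots> = (ev A A \<otimes> \<one> B) \<cdot> (\<a> A ?DA B)\<dagger> \<cdot> (\<one> A \<otimes> \<one> ?DA \<otimes> ev B B) \<cdot> (\<one> A \<otimes> sw B ?DA (B\<^sup>\<star> \<odot> B))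
      \<cdot> \<a> A B (?DA \<odot> B\<^sup>\<star> \<odot> B)"
    by (simp only: ev_slide ev_tens assms Dual_Ob TensO_Ob) (simp add: whisk)
  also have "\<dots> = (ev A A \<otimes> ev B B) \<cdot> ic A B ?DA (B\<^sup>\<star> \<odot> B)"
  proof -
    have "(\<a> A ?DA B)\<dagger> \<cdot> (\<one> A \<otimes> \<one> ?DA \<otimes> ev B B) = (\<one> (A \<odot> ?DA) \<otimes> ev B B) \<cdot> (\<a> A ?DA (B \<odot> B\<^sup>\<star> \<odot> B))\<dagger>"
      using ad_nat[of "\<one> A" "\<one> ?DA" "ev B B"] by simp
    note e = this comp_lift[OF this]
    show ?thesis by (simp add: e ic_eq) (simp add: tens_merge)
  qed
  finally show ?thesis .
qed

lemma ic_nat_idn1: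
  assumes "A \<in> Ob V" "B \<in> Ob V" "h \<in> Arr V" "k \<in> Arr V" "Cod V h = C" "Cod V k = D"
  shows "ic A B C D \<cdot> (\<one> (A \<odot> B) \<otimes> (h \<otimes> k)) = ((\<one> A \<otimes> h) \<otimes> (\<one> B \<otimes> k)) \<cdot> ic A B (Dom V h) (Dom V k)"
  using ic_nat[of "\<one> A" "\<one> B" h k A B C D] assms by simp

lemma ic_nat_idn2:
  assumes "C \<in> Ob V" "D \<in> Ob V" "h \<in> Arr V" "k \<in> Arr V" "Cod V h = A" "Cod V k = B"
  shows "ic A B C D \<cdot> ((h \<otimes> k) \<otimes> \<one> (C \<odot> D)) = ((h \<otimes> \<one> C) \<otimes> (k \<otimes> \<one> D)) \<cdot> ic (Dom V h) (Dom V k) C D"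
  using ic_nat[of h k "\<one> C" "\<one> D" A B C D] assms by simp

lemmas ic_nats = ic_nat comp_lift[OF ic_nat] ic_nat_idn1 comp_lift[OF ic_nat_idn1]
  ic_nat_idn2 comp_lift[OF ic_nat_idn2]

lemma swap_whisk:
  assumes "f \<in> Arr V" "g \<in> Arr V" "Cod V g = X" "Dom V f = Y"
  shows "(f \<otimes> \<one> X) \<cdot> (\<one> Y \<otimes> g) = (\<one> (Cod V f) \<otimes> g) \<cdot> (f \<otimes> \<one> (Dom V g))"
  using assms by (auto simp: tens_merge)

text \<open>In curried form both sides are conjugation by \<open>f\<close> on one factor and by
  \<open>g\<close> on the other.\<close>

lemma mu_nat:
  assumes [simp]: "f \<in> Arr V" "g \<in> Arr V" and c: "Cod V f = A'" "Cod V g = B'"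
  shows "mu A' B' \<cdot> (dbl f \<otimes> dbl g) = dbl (f \<otimes> g) \<cdot> mu (Dom V f) (Dom V g)"
proof (rule hat_inject)
  let ?A = "Dom V f" and ?B = "Dom V g"
  have [simp]: "A' \<in> Ob V" "B' \<in> Ob V" using Cod_in_Ob[OF assms(1)] Cod_in_Ob[OF assms(2)] c by simp_all
  let ?e = "ev (A' \<odot> B') (A' \<odot> B')"
  have "?e \<cdot> (\<one> (A' \<odot> B') \<otimes> (mu A' B' \<cdot> (dbl f \<otimes> dbl g)))
    = (ev A' A' \<otimes> ev B' B') \<cdot> ((\<one> A' \<otimes> dbl f) \<otimes> (\<one> B' \<otimes> dbl g)) \<cdot> ic A' B' (?A\<^sup>\<star> \<odot> ?A) (?B\<^sup>\<star> \<odot> ?B)"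
    using c by (simp add: whisk comp_lift[OF ev_mu] ic_nats)
  also have "\<dots> = ((ev A' A' \<cdot> (\<one> A' \<otimes> dbl f)) \<otimes> (ev B' B' \<cdot> (\<one> B' \<otimes> dbl g))) \<cdot> ic A' B' (?A\<^sup>\<star> \<odot> ?A) (?B\<^sup>\<star> \<odot> ?B)"
    using c by (simp add: tens_merge)
  also have "\<dots> = (f \<otimes> g) \<cdot> (ev ?A ?A \<otimes> ev ?B ?B) \<cdot> ((f\<dagger> \<otimes> \<one> (?A\<^sup>\<star> \<odot> ?A)) \<otimes> (g\<dagger> \<otimes> \<one> (?B\<^sup>\<star> \<odot> ?B)))
      \<cdot> ic A' B' (?A\<^sup>\<star> \<odot> ?A) (?B\<^sup>\<star> \<odot> ?B)"
    using c by (simp add: ev_dbl) (simp add: tens_merge)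
  also have "\<dots> = (f \<otimes> g) \<cdot> ((ev ?A ?A \<otimes> ev ?B ?B) \<cdot> ic ?A ?B (?A\<^sup>\<star> \<odot> ?A) (?B\<^sup>\<star> \<odot> ?B))
      \<cdot> ((f\<dagger> \<otimes> g\<dagger>) \<otimes> \<one> ((?A\<^sup>\<star> \<odot> ?A) \<odot> (?B\<^sup>\<star> \<odot> ?B)))"
    using c by (simp add: ic_nats)
  also have "\<dots> = ?e \<cdot> (\<one> (A' \<odot> B') \<otimes> (dbl (f \<otimes> g) \<cdot> mu ?A ?B))"
    using c by (simp add: whisk comp_lift[OF ev_dbl] swap_whisk comp_lift[OF ev_mu])
  finally show "?e \<cdot> (\<one> (A' \<odot> B') \<otimes> (mu A' B' \<cdot> (dbl f \<otimes> dbl g)))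
    = ?e \<cdot> (\<one> (A' \<odot> B') \<otimes> (dbl (f \<otimes> g) \<cdot> mu ?A ?B))" .
qed (use assms in auto)

text \<open>In curried form this is \<open>ic_assoc'\<close>. The unit and symmetry laws below
  reduce in the same way to \<open>ic_unit_left'\<close>, \<open>ic_unit_right'\<close> and
  \<open>ic_sigma'\<close>.\<close>

lemma mu_assoc:
  assumes [simp]: "A \<in> Ob V" "B \<in> Ob V" "C \<in> Ob V"
  shows "dbl (\<a> A B C) \<cdot> mu (A \<odot> B) C \<cdot> (mu A B \<otimes> \<one> (C\<^sup>\<star> \<odot> C))
    = mu A (B \<odot> C) \<cdot> (\<one> (A\<^sup>\<star> \<odot> A) \<otimes> mu B C) \<cdot> \<a> (A\<^sup>\<star> \<odot> A) (B\<^sup>\<star> \<odot> B) (C\<^sup>\<star> \<odot> C)"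
proof (rule hat_inject)
  let ?DA = "A\<^sup>\<star> \<odot> A" and ?DB = "B\<^sup>\<star> \<odot> B" and ?DC = "C\<^sup>\<star> \<odot> C"
  let ?W = "A \<odot> B \<odot> C"
  have "ev ?W ?W \<cdot> (\<one> ?W \<otimes> (dbl (\<a> A B C) \<cdot> mu (A \<odot> B) C \<cdot> (mu A B \<otimes> \<one> ?DC)))
    = \<a> A B C \<cdot> (ev (A \<odot> B) (A \<odot> B) \<otimes> ev C C) \<cdot> ((\<one> (A \<odot> B) \<otimes> mu A B) \<otimes> (\<one> C \<otimes> \<one> ?DC))
      \<cdot> ic (A \<odot> B) C (?DA \<odot> ?DB) ?DC \<cdot> ((\<a> A B C)\<dagger> \<otimes> \<one> ((?DA \<odot> ?DB) \<odot> ?DC))"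
    by (simp add: whisk comp_lift[OF ev_dbl] swap_whisk comp_lift[OF swap_whisk] comp_lift[OF ev_mu] ic_nats)
  also have "\<dots> = \<a> A B C \<cdot> (((ev A A \<otimes> ev B B) \<cdot> ic A B ?DA ?DB) \<otimes> (ev C C \<cdot> (\<one> (C \<odot> ?DC))))
      \<cdot> ic (A \<odot> B) C (?DA \<odot> ?DB) ?DC \<cdot> ((\<a> A B C)\<dagger> \<otimes> \<one> ((?DA \<odot> ?DB) \<odot> ?DC))"
    by (simp add: tens_merge ev_mu)
  also have "\<dots> = (ev A A \<otimes> (ev B B \<otimes> ev C C)) \<cdot>
      (\<a> (A \<odot> ?DA) (B \<odot> ?DB) (C \<odot> ?DC) \<cdot> (ic A B ?DA ?DB \<otimes> \<one> (C \<odot> ?DC)) \<cdot> ic (A \<odot> B) C (?DA \<odot> ?DB) ?DC)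
       \<cdot> ((\<a> A B C)\<dagger> \<otimes> \<one> ((?DA \<odot> ?DB) \<odot> ?DC))"
  proof -
    have s: "((ev A A \<otimes> ev B B) \<cdot> ic A B ?DA ?DB) \<otimes> (ev C C \<cdot> (\<one> (C \<odot> ?DC)))
      = ((ev A A \<otimes> ev B B) \<otimes> ev C C) \<cdot> (ic A B ?DA ?DB \<otimes> \<one> (C \<odot> ?DC))"
      by (simp add: tens_merge)
    show ?thesis unfolding s by (simp add: nat)
  qed
  also have "\<dots> = (ev A A \<otimes> (ev B B \<otimes> ev C C)) \<cdot> (\<one> (A \<odot> ?DA) \<otimes> ic B C ?DB ?DC)
      \<cdot> ic A (B \<odot> C) ?DA (?DB \<odot> ?DC) \<cdot> (\<one> ?W \<otimes> \<a> ?DA ?DB ?DC)"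
    unfolding ic_assoc'[OF assms(1) Dual_Ob[THEN TensO_Ob, OF assms(1,1)] assms(2) Dual_Ob[THEN TensO_Ob, OF assms(2,2)] assms(3) Dual_Ob[THEN TensO_Ob, OF assms(3,3)]]
    by simp (simp add: tens_merge)
  also have "\<dots> = ev ?W ?W \<cdot> (\<one> ?W \<otimes> (mu A (B \<odot> C) \<cdot> (\<one> ?DA \<otimes> mu B C) \<cdot> \<a> ?DA ?DB ?DC))"
  proof -
    have "(ev A A \<otimes> ev (B \<odot> C) (B \<odot> C)) \<cdot> (\<one> (A \<odot> ?DA) \<otimes> (\<one> (B \<odot> C) \<otimes> mu B C))
      = (ev A A \<otimes> (ev B B \<otimes> ev C C)) \<cdot> (\<one> (A \<odot> ?DA) \<otimes> ic B C ?DB ?DC)"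
      by (simp add: tens_merge ev_mu)
    note comp_lift[OF this]
    then show ?thesis by (simp add: whisk comp_lift[OF ev_mu] ic_nats)
  qed
  finally show "ev ?W ?W \<cdot> (\<one> ?W \<otimes> (dbl (\<a> A B C) \<cdot> mu (A \<odot> B) C \<cdot> (mu A B \<otimes> \<one> ?DC)))
    = ev ?W ?W \<cdot> (\<one> ?W \<otimes> (mu A (B \<odot> C) \<cdot> (\<one> ?DA \<otimes> mu B C) \<cdot> \<a> ?DA ?DB ?DC))" .
qed simp_all

lemma mu_l:
  assumes [simp]: "A \<in> Ob V"
  shows "dbl (\<l> A) \<cdot> mu \<I> A \<cdot> (\<eta> \<I> \<otimes> \<one> (A\<^sup>\<star> \<odot> A)) = \<l> (A\<^sup>\<star> \<odot> A)"
proof (rule hat_inject)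
  let ?DA = "A\<^sup>\<star> \<odot> A" and ?DI = "\<I>\<^sup>\<star> \<odot> \<I>"
  have "ev A A \<cdot> (\<one> A \<otimes> (dbl (\<l> A) \<cdot> mu \<I> A \<cdot> (\<eta> \<I> \<otimes> \<one> ?DA)))
    = \<l> A \<cdot> (ev \<I> \<I> \<otimes> ev A A) \<cdot> ((\<one> \<I> \<otimes> \<eta> \<I>) \<otimes> \<one> (A \<odot> ?DA)) \<cdot> ic \<I> A \<I> ?DA \<cdot> ((\<l> A)\<dagger> \<otimes> \<one> (\<I> \<odot> ?DA))"
    by (simp add: whisk comp_lift[OF ev_dbl] swap_whisk comp_lift[OF swap_whisk] comp_lift[OF ev_mu] ic_nats)
  also have "\<dots> = \<l> A \<cdot> (\<one> \<I> \<otimes> ev A A) \<cdot> (\<l> \<I> \<otimes> \<one> (A \<odot> ?DA)) \<cdot> ic \<I> A \<I> ?DA \<cdot> ((\<l> A)\<dagger> \<otimes> \<one> (\<I> \<odot> ?DA))"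
    by (simp add: tens_merge ev_eta l_eq_r)
  also have "\<dots> = ev A A \<cdot> (\<l> (A \<odot> ?DA) \<cdot> (\<l> \<I> \<otimes> \<one> (A \<odot> ?DA)) \<cdot> ic \<I> A \<I> ?DA) \<cdot> ((\<l> A)\<dagger> \<otimes> \<one> (\<I> \<odot> ?DA))"
    by (simp add: nat)
  also have "\<dots> = ev A A \<cdot> (\<one> A \<otimes> \<l> ?DA)"
    by (subst ic_unit_left') (simp_all add: tens_merge)
  finally show "ev A A \<cdot> (\<one> A \<otimes> (dbl (\<l> A) \<cdot> mu \<I> A \<cdot> (\<eta> \<I> \<otimes> \<one> ?DA))) = ev A A \<cdot> (\<one> A \<otimes> \<l> ?DA)" .
qed simp_all

lemma mu_r:
  assumes [simp]: "A \<in> Ob V"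
  shows "dbl (\<r> A) \<cdot> mu A \<I> \<cdot> (\<one> (A\<^sup>\<star> \<odot> A) \<otimes> \<eta> \<I>) = \<r> (A\<^sup>\<star> \<odot> A)"
proof (rule hat_inject)
  let ?DA = "A\<^sup>\<star> \<odot> A" and ?DI = "\<I>\<^sup>\<star> \<odot> \<I>"
  have "ev A A \<cdot> (\<one> A \<otimes> (dbl (\<r> A) \<cdot> mu A \<I> \<cdot> (\<one> ?DA \<otimes> \<eta> \<I>)))
    = \<r> A \<cdot> (ev A A \<otimes> ev \<I> \<I>) \<cdot> (\<one> (A \<odot> ?DA) \<otimes> (\<one> \<I> \<otimes> \<eta> \<I>)) \<cdot> ic A \<I> ?DA \<I> \<cdot> ((\<r> A)\<dagger> \<otimes> \<one> (?DA \<odot> \<I>))"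
    by (simp add: whisk comp_lift[OF ev_dbl] swap_whisk comp_lift[OF swap_whisk] comp_lift[OF ev_mu] ic_nats)
  also have "\<dots> = \<r> A \<cdot> (ev A A \<otimes> \<one> \<I>) \<cdot> (\<one> (A \<odot> ?DA) \<otimes> \<l> \<I>) \<cdot> ic A \<I> ?DA \<I> \<cdot> ((\<r> A)\<dagger> \<otimes> \<one> (?DA \<odot> \<I>))"
    by (simp add: tens_merge ev_eta l_eq_r)
  also have "\<dots> = ev A A \<cdot> (\<r> (A \<odot> ?DA) \<cdot> (\<one> (A \<odot> ?DA) \<otimes> \<l> \<I>) \<cdot> ic A \<I> ?DA \<I>) \<cdot> ((\<r> A)\<dagger> \<otimes> \<one> (?DA \<odot> \<I>))"
    by (simp add: nat)
  also have "\<dots> = ev A A \<cdot> (\<one> A \<otimes> \<r> ?DA)"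
    by (subst ic_unit_right') (simp_all add: tens_merge)
  finally show "ev A A \<cdot> (\<one> A \<otimes> (dbl (\<r> A) \<cdot> mu A \<I> \<cdot> (\<one> ?DA \<otimes> \<eta> \<I>))) = ev A A \<cdot> (\<one> A \<otimes> \<r> ?DA)" .
qed simp_all

lemma mu_sigma:
  assumes [simp]: "A \<in> Ob V" "B \<in> Ob V"
  shows "dbl (\<sigma> A B) \<cdot> mu A B = mu B A \<cdot> \<sigma> (A\<^sup>\<star> \<odot> A) (B\<^sup>\<star> \<odot> B)"
proof (rule hat_inject)
  let ?DA = "A\<^sup>\<star> \<odot> A" and ?DB = "B\<^sup>\<star> \<odot> B"
  have "ev (B \<odot> A) (B \<odot> A) \<cdot> (\<one> (B \<odot> A) \<otimes> (dbl (\<sigma> A B) \<cdot> mu A B))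
    = \<sigma> A B \<cdot> (ev A A \<otimes> ev B B) \<cdot> ic A B ?DA ?DB \<cdot> (\<sigma> B A \<otimes> \<one> (?DA \<odot> ?DB))"
    by (simp add: whisk comp_lift[OF ev_dbl] swap_whisk comp_lift[OF swap_whisk] comp_lift[OF ev_mu])
  also have "\<dots> = (ev B B \<otimes> ev A A) \<cdot> (\<sigma> (A \<odot> ?DA) (B \<odot> ?DB) \<cdot> ic A B ?DA ?DB) \<cdot> (\<sigma> B A \<otimes> \<one> (?DA \<odot> ?DB))"
    by (simp add: nat)
  also have "\<dots> = (ev B B \<otimes> ev A A) \<cdot> ic B A ?DB ?DA \<cdot> (\<one> (B \<odot> A) \<otimes> \<sigma> ?DA ?DB)"
    by (subst ic_sigma') (simp_all add: tens_merge)
  also have "\<dots> = ev (B \<odot> A) (B \<odot> A) \<cdot> (\<one> (B \<odot> A) \<otimes> (mu B A \<cdot> \<sigma> ?DA ?DB))"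
    by (simp add: whisk comp_lift[OF ev_mu])
  finally show "ev (B \<odot> A) (B \<odot> A) \<cdot> (\<one> (B \<odot> A) \<otimes> (dbl (\<sigma> A B) \<cdot> mu A B))
    = ev (B \<odot> A) (B \<odot> A) \<cdot> (\<one> (B \<odot> A) \<otimes> (mu B A \<cdot> \<sigma> ?DA ?DB))" .
qed simp_all

text \<open>The curried form of a unit is a unitor (\<open>ev_eta\<close>), so this is the unit law
  \<open>ic_unit_right\<close> of the interchange.\<close>

lemma mu_eta:
  assumes [simp]: "A \<in> Ob V" "B \<in> Ob V"
  shows "mu A B \<cdot> (\<eta> A \<otimes> \<eta> B) = \<eta> (A \<odot> B) \<cdot> \<l> \<I>"
proof (rule hat_inject)
  have "ev (A \<odot> B) (A \<odot> B) \<cdot> (\<one> (A \<odot> B) \<otimes> (mu A B \<cdot> (\<eta> A \<otimes> \<eta> B)))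
    = (ev A A \<otimes> ev B B) \<cdot> ((\<one> A \<otimes> \<eta> A) \<otimes> (\<one> B \<otimes> \<eta> B)) \<cdot> ic A B \<I> \<I>"
    by (simp add: whisk comp_lift[OF ev_mu] ic_nats)
  also have "\<dots> = (\<r> A \<otimes> \<r> B) \<cdot> ic A B \<I> \<I>"
    by (simp add: tens_merge ev_eta)
  also have "\<dots> = ((\<r> A \<otimes> \<r> B) \<cdot> ic A B \<I> \<I> \<cdot> (\<one> (A \<odot> B) \<otimes> (\<l> \<I>)\<dagger>)) \<cdot> (\<one> (A \<odot> B) \<otimes> \<l> \<I>)"
    by (simp add: winv)
  also have "\<dots> = ev (A \<odot> B) (A \<odot> B) \<cdot> (\<one> (A \<odot> B) \<otimes> (\<eta> (A \<odot> B) \<cdot> \<l> \<I>))"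
    by (subst ic_unit_right) (simp_all add: whisk comp_lift[OF ev_eta])
  finally show "ev (A \<odot> B) (A \<odot> B) \<cdot> (\<one> (A \<odot> B) \<otimes> (mu A B \<cdot> (\<eta> A \<otimes> \<eta> B)))
    = ev (A \<odot> B) (A \<odot> B) \<cdot> (\<one> (A \<odot> B) \<otimes> (\<eta> (A \<odot> B) \<cdot> \<l> \<I>))" .
qed simp_all

lemma eta_unit_eq: "(\<one> (\<I>\<^sup>\<star>) \<otimes> \<l> \<I>) \<cdot> cv \<I> \<I> = \<eta> \<I>"
  by (simp add: cv_def comp_lift[OF triangle] idn_r comp_lift[OF r_nat] l_eq_r)

text \<open>This is the unit comparison of the doubling functor. Up to unitors its dagger is the
  contraction \<open>ev \<I> \<I>\<close>, and the two snake equations become the two halves of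
  unitarity.\<close>

lemma eta_unit: "unit_arr (\<eta> \<I>)"
proof -
  have d: "(\<eta> \<I>)\<dagger> = ev \<I> \<I> \<cdot> (\<l> (\<I>\<^sup>\<star> \<odot> \<I>))\<dagger>"
    unfolding eta_unit_eq[symmetric] by (simp add: ev_eq sw_unit_first)
  have "\<eta> \<I> \<cdot> (\<eta> \<I>)\<dagger> = (\<one> (\<I>\<^sup>\<star>) \<otimes> \<l> \<I>) \<cdot> cv \<I> \<I> \<cdot> ev \<I> \<I> \<cdot> (\<l> (\<I>\<^sup>\<star> \<odot> \<I>))\<dagger>"
    unfolding d by (simp flip: eta_unit_eq)
  also have "\<dots> = (\<one> (\<I>\<^sup>\<star>) \<otimes> (\<l> \<I> \<cdot> (\<one> \<I> \<otimes> ev \<I> \<I>))) \<cdot> cv \<I> (\<I> \<odot> \<I>\<^sup>\<star> \<odot> \<I>) \<cdot> (\<l> (\<I>\<^sup>\<star> \<odot> \<I>))\<dagger>"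
    by (simp add: cv_nat comp_lift[OF cv_nat] whisk)
  also have "\<dots> = (\<one> (\<I>\<^sup>\<star>) \<otimes> ev \<I> \<I>) \<cdot> ((\<one> (\<I>\<^sup>\<star>) \<otimes> \<one> \<I> \<otimes> \<l> (\<I>\<^sup>\<star> \<odot> \<I>)) \<cdot> cv \<I> (\<I> \<odot> \<I>\<^sup>\<star> \<odot> \<I>)) \<cdot> (\<l> (\<I>\<^sup>\<star> \<odot> \<I>))\<dagger>"
    by (simp add: l_nat whisk idn_l)
  also have "\<dots> = (\<one> (\<I>\<^sup>\<star>) \<otimes> ev \<I> \<I>) \<cdot> (cv \<I> (\<I>\<^sup>\<star> \<odot> \<I>) \<cdot> \<l> (\<I>\<^sup>\<star> \<odot> \<I>)) \<cdot> (\<l> (\<I>\<^sup>\<star> \<odot> \<I>))\<dagger>"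
    by (subst cv_nat[of "\<I>" "\<l> (\<I>\<^sup>\<star> \<odot> \<I>)"]) simp_all
  also have "\<dots> = \<one> (\<I>\<^sup>\<star> \<odot> \<I>)" by (simp add: cv_ev)
  finally have 1: "\<eta> \<I> \<cdot> (\<eta> \<I>)\<dagger> = \<one> (\<I>\<^sup>\<star> \<odot> \<I>)" .
  have "(\<eta> \<I>)\<dagger> \<cdot> \<eta> \<I> = ev \<I> \<I> \<cdot> (\<l> (\<I>\<^sup>\<star> \<odot> \<I>))\<dagger> \<cdot> (\<one> (\<I>\<^sup>\<star>) \<otimes> \<l> \<I>) \<cdot> cv \<I> \<I>"
    unfolding d by (simp flip: eta_unit_eq)
  also have "\<dots> = \<l> \<I> \<cdot> (ev \<I> (\<I> \<odot> \<I>) \<cdot> (\<one> \<I> \<otimes> cv \<I> \<I>)) \<cdot> (\<l> \<I>)\<dagger>"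
    by (simp add: ld_nat comp_lift[OF ld_nat] whisk ev_nats)
  also have "\<dots> = \<one> \<I>" by (simp add: ev_cv)
  finally show ?thesis using 1 by (simp add: unit_arr_def)
qed

subsection \<open>Partial trace and complete positivity\<close>

text \<open>The part of a completely positive map that does not depend on its Kraus
  morphism.\<close>

definition tr :: "'o \<Rightarrow> 'o \<Rightarrow> 'a" where
  "tr X B = cap_middle V X B \<cdot> (dual_tensor V X B \<otimes> \<one> (X \<odot> B))"

lemma tr_arr [simp]:
  assumes "X \<in> Ob V" "B \<in> Ob V"
  shows "tr X B \<in> Arr V" "Dom V (tr X B) = (X \<odot> B)\<^sup>\<star> \<odot> (X \<odot> B)" "Cod V (tr X B) = B\<^sup>\<star> \<odot> B"
  using assms by (simp_all add: tr_def cap_eq)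

text \<open>Under currying, \<^term>\<open>tr X B\<close> becomes the ordinary partial trace over \<^term>\<open>X\<close>.\<close>

lemma ev_tr:
  assumes [simp]: "X \<in> Ob V" "B \<in> Ob V"
  shows "ev B B \<cdot> (\<one> B \<otimes> tr X B) = (cv X B)\<dagger> \<cdot> (\<one> (X\<^sup>\<star>) \<otimes> (ev (X \<odot> B) (X \<odot> B) \<cdot> (\<a> X B ((X \<odot> B)\<^sup>\<star> \<odot> X \<odot> B))\<dagger>))
     \<cdot> cv X (B \<odot> (X \<odot> B)\<^sup>\<star> \<odot> X \<odot> B)"
proof -
  let ?W = "X \<odot> B"
  let ?DW = "?W\<^sup>\<star> \<odot> ?W" and ?d = "dual_tensor V X B"
  let ?z = "ev B (X\<^sup>\<star> \<odot> ?W) \<cdot> (\<one> B \<otimes> (\<a> (B\<^sup>\<star>) (X\<^sup>\<star>) ?W \<cdot> (?d \<otimes> \<one> ?W)))"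
  have "ev ?W ?W \<cdot> (\<a> X B ?DW)\<dagger> = nev X B ?W \<cdot> (\<one> ?W \<otimes> ?d \<otimes> \<one> ?W) \<cdot> (\<a> X B ?DW)\<dagger>"
    by (simp add: comp_lift[OF nev_dt])
  also have "\<dots> = ev X ?W \<cdot> (\<one> X \<otimes> ?z)"
    by (simp add: nev_def whisk nat)
  finally have e: "ev ?W ?W \<cdot> (\<a> X B ?DW)\<dagger> = ev X ?W \<cdot> (\<one> X \<otimes> ?z)" .
  have "(cv X B)\<dagger> \<cdot> (\<one> (X\<^sup>\<star>) \<otimes> (ev ?W ?W \<cdot> (\<a> X B ?DW)\<dagger>)) \<cdot> cv X (B \<odot> ?DW)
    = (cv X B)\<dagger> \<cdot> ((\<one> (X\<^sup>\<star>) \<otimes> ev X ?W) \<cdot> cv X (X\<^sup>\<star> \<odot> ?W)) \<cdot> ?z"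
    unfolding e by (simp add: whisk cv_nat comp_lift[OF cv_nat])
  also have "\<dots> = (cv X B)\<dagger> \<cdot> ?z" by (simp add: cv_ev)
  also have "\<dots> = ev B B \<cdot> (\<one> B \<otimes> tr X B)"
    by (simp add: tr_def cap_eq whisk ev_nats)
  finally show ?thesis by simp
qed

text \<open>Seen through the reordering, the trace over \<open>X\<close> is a cap on the first
  doubled factor alone. Together with the monoidal laws of \<open>mu\<close> this gives naturality
  and iteration of traces.\<close>

lemma tr_mu:
  assumes [simp]: "X \<in> Ob V" "B \<in> Ob V"
  shows "tr X B \<cdot> mu X B = \<l> (B\<^sup>\<star> \<odot> B) \<cdot> ((\<eta> X)\<dagger> \<otimes> \<one> (B\<^sup>\<star> \<odot> B))"
proof (rule hat_inject)
  let ?W = "X \<odot> B" and ?DX = "X\<^sup>\<star> \<odot> X" and ?DB = "B\<^sup>\<star> \<odot> B"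
  let ?DW = "?W\<^sup>\<star> \<odot> ?W"
  let ?y = "\<a> (X\<^sup>\<star>) X B \<cdot> (\<one> ?DX \<otimes> ev B B) \<cdot> sw B ?DX ?DB"
  have "(ev ?W ?W \<cdot> (\<one> ?W \<otimes> mu X B)) \<cdot> (\<a> X B (?DX \<odot> ?DB))\<dagger>
    = (ev X X \<otimes> ev B B) \<cdot> (\<a> X ?DX (B \<odot> ?DB))\<dagger> \<cdot> (\<one> X \<otimes> sw B ?DX ?DB)"
    unfolding ev_mu[OF assms] by (simp add: ic_eq)
  also have "\<dots> = ((ev X X \<otimes> \<one> B) \<cdot> (\<a> X ?DX B)\<dagger>) \<cdot> (\<one> X \<otimes> ((\<one> ?DX \<otimes> ev B B) \<cdot> sw B ?DX ?DB))"
  proof -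
    have "(\<a> X ?DX B)\<dagger> \<cdot> (\<one> X \<otimes> \<one> ?DX \<otimes> ev B B) = (\<one> (X \<odot> ?DX) \<otimes> ev B B) \<cdot> (\<a> X ?DX (B \<odot> ?DB))\<dagger>"
      using ad_nat[of "\<one> X" "\<one> ?DX" "ev B B"] by simp
    note e = this comp_lift[OF this]
    have s: "ev X X \<otimes> ev B B = (ev X X \<otimes> \<one> B) \<cdot> (\<one> (X \<odot> ?DX) \<otimes> ev B B)"
      by (simp add: tens_merge)
    show ?thesis by (simp add: e s whisk)
  qed
  also have "\<dots> = ev X ?W \<cdot> (\<one> X \<otimes> ?y)"
    by (subst ev_tens[symmetric]) (simp_all add: whisk)
  finally have e: "ev ?W ?W \<cdot> (\<one> ?W \<otimes> mu X B) \<cdot> (\<a> X B (?DX \<odot> ?DB))\<dagger> = ev X ?W \<cdot> (\<one> X \<otimes> ?y)"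
    by simp
  \<comment> \<open>By \<open>e\<close> the contraction under the trace is one of \<open>X\<close>
    alone. Together with the strand created for the trace it forms the snake
    \<open>cv_ev\<close>.\<close>
  have "ev B B \<cdot> (\<one> B \<otimes> (tr X B \<cdot> mu X B))
    = (cv X B)\<dagger> \<cdot> (\<one> (X\<^sup>\<star>) \<otimes> (ev ?W ?W \<cdot> (\<one> ?W \<otimes> mu X B) \<cdot> (\<a> X B (?DX \<odot> ?DB))\<dagger>)) \<cdot> cv X (B \<odot> ?DX \<odot> ?DB)"
    by (simp add: whisk comp_lift[OF ev_tr] cv_nat comp_lift[OF cv_nat])
      (simp add: nat whisk whisk_lift[OF ad_nat] comp_lift[OF whisk_lift[OF ad_nat]])
  also have "\<dots> = (cv X B)\<dagger> \<cdot> ((\<one> (X\<^sup>\<star>) \<otimes> ev X ?W) \<cdot> cv X (X\<^sup>\<star> \<odot> ?W)) \<cdot> ?y"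
    unfolding e by (simp add: whisk cv_nat comp_lift[OF cv_nat])
  also have "\<dots> = \<l> B \<cdot> ((\<eta> X)\<dagger> \<otimes> \<one> B) \<cdot> (\<one> ?DX \<otimes> ev B B) \<cdot> sw B ?DX ?DB"
    unfolding cv_ev[OF assms(1) TensO_Ob[OF assms]] by (simp add: cv_def)
  also have "\<dots> = ev B B \<cdot> \<l> (B \<odot> ?DB) \<cdot> ((\<eta> X)\<dagger> \<otimes> \<one> (B \<odot> ?DB)) \<cdot> sw B ?DX ?DB"
    by (simp add: swap_whisk comp_lift[OF swap_whisk] nat)
  also have "\<dots> = ev B B \<cdot> \<l> (B \<odot> ?DB) \<cdot> sw B \<I> ?DB \<cdot> (\<one> B \<otimes> (\<eta> X)\<dagger> \<otimes> \<one> ?DB)"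
    by (subst sw_nat_idn') simp_all
  also have "\<dots> = ev B B \<cdot> (\<one> B \<otimes> (\<l> ?DB \<cdot> ((\<eta> X)\<dagger> \<otimes> \<one> ?DB)))"
    by (simp add: sw_unit_mid whisk)
  finally show "ev B B \<cdot> (\<one> B \<otimes> (tr X B \<cdot> mu X B)) = ev B B \<cdot> (\<one> B \<otimes> (\<l> ?DB \<cdot> ((\<eta> X)\<dagger> \<otimes> \<one> ?DB)))" .
qed simp_all

lemma mu_cancel [simp]:
  assumes "A \<in> Ob V" "B \<in> Ob V"
  shows "mu A B \<cdot> (mu A B)\<dagger> = \<one> ((A \<odot> B)\<^sup>\<star> \<odot> (A \<odot> B))"
    "(mu A B)\<dagger> \<cdot> mu A B = \<one> ((A\<^sup>\<star> \<odot> A) \<odot> (B\<^sup>\<star> \<odot> B))"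
    "h \<in> Arr V \<Longrightarrow> Cod V h = (A \<odot> B)\<^sup>\<star> \<odot> (A \<odot> B) \<Longrightarrow> mu A B \<cdot> (mu A B)\<dagger> \<cdot> h = h"
    "h \<in> Arr V \<Longrightarrow> Cod V h = (A\<^sup>\<star> \<odot> A) \<odot> (B\<^sup>\<star> \<odot> B) \<Longrightarrow> (mu A B)\<dagger> \<cdot> mu A B \<cdot> h = h"
  using unit_arr_cancel[OF mu_unit(1)[OF assms]] unit_arrD[OF mu_unit(1)[OF assms]] assms by simp_all

lemma tr_eq:
  assumes [simp]: "X \<in> Ob V" "B \<in> Ob V"
  shows "tr X B = \<l> (B\<^sup>\<star> \<odot> B) \<cdot> ((\<eta> X)\<dagger> \<otimes> \<one> (B\<^sup>\<star> \<odot> B)) \<cdot> (mu X B)\<dagger>"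
proof -
  have "tr X B = (tr X B \<cdot> mu X B) \<cdot> (mu X B)\<dagger>" by simp
  then show ?thesis by (simp only: tr_mu[OF assms]) simp
qed

lemma mud_nat:
  assumes [simp]: "f \<in> Arr V" "g \<in> Arr V" and c: "Cod V f = A'" "Cod V g = B'"
  shows "(mu A' B')\<dagger> \<cdot> dbl (f \<otimes> g) = (dbl f \<otimes> dbl g) \<cdot> (mu (Dom V f) (Dom V g))\<dagger>"
  by (rule unit_arr_flip[OF mu_nat]) (use assms Cod_in_Ob[OF assms(1)] Cod_in_Ob[OF assms(2)] in auto)

lemma tr_nat:
  assumes [simp]: "h \<in> Arr V" "X \<in> Ob V" and c: "Dom V h = B"
  shows "dbl h \<cdot> tr X B = tr X (Cod V h) \<cdot> dbl (\<one> X \<otimes> h)"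
proof -
  have [simp]: "B \<in> Ob V" using Dom_in_Ob[OF assms(1)] c by simp
  let ?C = "Cod V h"
  have "tr X ?C \<cdot> dbl (\<one> X \<otimes> h)
    = \<l> (?C\<^sup>\<star> \<odot> ?C) \<cdot> ((\<eta> X)\<dagger> \<otimes> \<one> (?C\<^sup>\<star> \<odot> ?C)) \<cdot> (\<one> (X\<^sup>\<star> \<odot> X) \<otimes> dbl h) \<cdot> (mu X B)\<dagger>"
    using c by (simp add: tr_eq mud_nat)
  also have "\<dots> = dbl h \<cdot> tr X B"
    using c by (simp add: tr_eq swap_whisk comp_lift[OF swap_whisk] nat)
  finally show ?thesis by simp
qed

lemma mu_assoc':
  assumes [simp]: "A \<in> Ob V" "B \<in> Ob V" "C \<in> Ob V"
  shows "(mu A (B \<odot> C))\<dagger> \<cdot> dbl (\<a> A B C) \<cdot> mu (A \<odot> B) C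
    = (\<one> (A\<^sup>\<star> \<odot> A) \<otimes> mu B C) \<cdot> \<a> (A\<^sup>\<star> \<odot> A) (B\<^sup>\<star> \<odot> B) (C\<^sup>\<star> \<odot> C) \<cdot> ((mu A B)\<dagger> \<otimes> \<one> (C\<^sup>\<star> \<odot> C))"
proof -
  have "(mu A (B \<odot> C))\<dagger> \<cdot> dbl (\<a> A B C) \<cdot> mu (A \<odot> B) C
    = (mu A (B \<odot> C))\<dagger> \<cdot> (dbl (\<a> A B C) \<cdot> mu (A \<odot> B) C \<cdot> (mu A B \<otimes> \<one> (C\<^sup>\<star> \<odot> C))) \<cdot> ((mu A B)\<dagger> \<otimes> \<one> (C\<^sup>\<star> \<odot> C))"
    by (simp add: winv)
  then show ?thesis by (simp only: mu_assoc[OF assms]) simp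
qed

text \<open>By \<open>tr_eq\<close> a trace is a cap on the first doubled factor, and
  \<open>mu_assoc'\<close> separates this factor from the remaining two, among them the spectator
  \<open>C\<close>.\<close>

lemma tr_tens:
  assumes [simp]: "X \<in> Ob V" "B \<in> Ob V" "C \<in> Ob V"
  shows "mu B C \<cdot> (tr X B \<otimes> \<one> (C\<^sup>\<star> \<odot> C)) = tr X (B \<odot> C) \<cdot> dbl (\<a> X B C) \<cdot> mu (X \<odot> B) C"
proof -
  let ?DX = "X\<^sup>\<star> \<odot> X" and ?DB = "B\<^sup>\<star> \<odot> B" and ?DC = "C\<^sup>\<star> \<odot> C"
  let ?DW = "(B \<odot> C)\<^sup>\<star> \<odot> (B \<odot> C)"
  have "tr X (B \<odot> C) \<cdot> dbl (\<a> X B C) \<cdot> mu (X \<odot> B) C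
    = \<l> ?DW \<cdot> ((\<eta> X)\<dagger> \<otimes> \<one> ?DW) \<cdot> (\<one> ?DX \<otimes> mu B C) \<cdot> \<a> ?DX ?DB ?DC \<cdot> ((mu X B)\<dagger> \<otimes> \<one> ?DC)"
    by (simp add: tr_eq mu_assoc')
  also have "\<dots> = mu B C \<cdot> \<l> (?DB \<odot> ?DC) \<cdot> (((\<eta> X)\<dagger> \<otimes> \<one> (?DB \<odot> ?DC)) \<cdot> \<a> ?DX ?DB ?DC) \<cdot> ((mu X B)\<dagger> \<otimes> \<one> ?DC)"
    by (simp add: swap_whisk comp_lift[OF swap_whisk] nat)
  also have "((\<eta> X)\<dagger> \<otimes> \<one> (?DB \<odot> ?DC)) \<cdot> \<a> ?DX ?DB ?DC = \<a> \<I> ?DB ?DC \<cdot> (((\<eta> X)\<dagger> \<otimes> \<one> ?DB) \<otimes> \<one> ?DC)"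
    by (simp add: nat)
  also have "mu B C \<cdot> \<l> (?DB \<odot> ?DC) \<cdot> (\<a> \<I> ?DB ?DC \<cdot> (((\<eta> X)\<dagger> \<otimes> \<one> ?DB) \<otimes> \<one> ?DC)) \<cdot> ((mu X B)\<dagger> \<otimes> \<one> ?DC)
    = mu B C \<cdot> (tr X B \<otimes> \<one> ?DC)"
    by (simp add: tr_eq comp_lift[OF l_tens] whisk)
  finally show ?thesis by simp
qed

text \<open>After \<open>mu (X \<odot> Y) C\<close> is cancelled only caps remain, and the claim
  becomes the dagger of \<open>mu_eta\<close>.\<close>

lemma tr_tr:
  assumes [simp]: "X \<in> Ob V" "Y \<in> Ob V" "C \<in> Ob V"
  shows "tr Y C \<cdot> tr X (Y \<odot> C) \<cdot> dbl (\<a> X Y C) = tr (X \<odot> Y) C"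
proof (rule unit_arr_right_eq)
  let ?DX = "X\<^sup>\<star> \<odot> X" and ?DY = "Y\<^sup>\<star> \<odot> Y" and ?DC = "C\<^sup>\<star> \<odot> C"
  have m: "(\<eta> X)\<dagger> \<otimes> (\<eta> Y)\<dagger> = (\<l> \<I>)\<dagger> \<cdot> (\<eta> (X \<odot> Y))\<dagger> \<cdot> mu X Y"
  proof -
    have "\<eta> X \<otimes> \<eta> Y = (mu X Y)\<dagger> \<cdot> \<eta> (X \<odot> Y) \<cdot> \<l> \<I>"
      by (simp flip: mu_eta)
    from arg_cong[OF this, of "\<lambda>x. x\<dagger>"] show ?thesis by simp
  qed
  have n: "\<l> \<I> \<cdot> (\<one> \<I> \<otimes> (\<eta> Y)\<dagger>) \<cdot> ((\<eta> X)\<dagger> \<otimes> \<one> ?DY) = (\<eta> (X \<odot> Y))\<dagger> \<cdot> mu X Y"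
    using arg_cong[OF m, of "\<lambda>x. \<l> \<I> \<cdot> x"] by (simp add: tens_merge)
  have "(tr Y C \<cdot> tr X (Y \<odot> C) \<cdot> dbl (\<a> X Y C)) \<cdot> mu (X \<odot> Y) C
    = tr Y C \<cdot> mu Y C \<cdot> (tr X Y \<otimes> \<one> ?DC)"
    by (simp flip: tr_tens)
  also have "\<dots> = \<l> ?DC \<cdot> ((\<eta> Y)\<dagger> \<otimes> \<one> ?DC) \<cdot> (tr X Y \<otimes> \<one> ?DC)"
    by (simp add: comp_lift[OF tr_mu])
  also have "\<dots> = \<l> ?DC \<cdot> (((\<eta> Y)\<dagger> \<cdot> \<l> ?DY \<cdot> ((\<eta> X)\<dagger> \<otimes> \<one> ?DY) \<cdot> (mu X Y)\<dagger>) \<otimes> \<one> ?DC)"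
    by (simp add: tr_eq whisk)
  also have "(\<eta> Y)\<dagger> \<cdot> \<l> ?DY \<cdot> ((\<eta> X)\<dagger> \<otimes> \<one> ?DY) \<cdot> (mu X Y)\<dagger>
    = (\<l> \<I> \<cdot> (\<one> \<I> \<otimes> (\<eta> Y)\<dagger>) \<cdot> ((\<eta> X)\<dagger> \<otimes> \<one> ?DY)) \<cdot> (mu X Y)\<dagger>"
    by (simp add: nat)
  also have "\<dots> = (\<eta> (X \<odot> Y))\<dagger>" unfolding n by simp
  also have "\<l> ?DC \<cdot> ((\<eta> (X \<odot> Y))\<dagger> \<otimes> \<one> ?DC) = tr (X \<odot> Y) C \<cdot> mu (X \<odot> Y) C"
    by (simp add: tr_mu)
  finally show "(tr Y C \<cdot> tr X (Y \<odot> C) \<cdot> dbl (\<a> X Y C)) \<cdot> mu (X \<odot> Y) C = tr (X \<odot> Y) C \<cdot> mu (X \<odot> Y) C" .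
qed simp_all

section \<open>Closure properties of complete positivity\<close>

abbreviation cp :: "'o \<Rightarrow> 'o \<Rightarrow> 'a \<Rightarrow> bool" where
  "cp \<equiv> completely_positive V"

lemma cp_iff:
  assumes "B \<in> Ob V"
  shows "cp A B f \<longleftrightarrow> (\<exists>X \<in> Ob V. \<exists>g \<in> Arr V. Dom V g = A \<and> Cod V g = X \<odot> B \<and> f = tr X B \<cdot> dbl g)"
proof -
  have *: "cap_middle V X B \<cdot> (dual_tensor V X B \<otimes> \<one> (X \<odot> B)) \<cdot> dbl g = tr X B \<cdot> dbl g"
    if "X \<in> Ob V" "g \<in> Hom V A (X \<odot> B)" for X g
    using that assms by (simp add: tr_def Hom_iff cap_eq)
  then show ?thesis
    unfolding completely_positive_def by (metis Hom_iff)
qed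

lemma cpI:
  assumes "X \<in> Ob V" "B \<in> Ob V" "g \<in> Arr V" "Dom V g = A" "Cod V g = X \<odot> B" "f = tr X B \<cdot> dbl g"
  shows "cp A B f"
  using assms by (auto simp: cp_iff)

lemma cpE:
  assumes "cp A B f" "B \<in> Ob V"
  obtains X g where "X \<in> Ob V" "g \<in> Arr V" "Dom V g = A" "Cod V g = X \<odot> B" "f = tr X B \<cdot> dbl g"
  using assms by (auto simp: cp_iff)

lemma cp_arr:
  assumes "cp A B f" "B \<in> Ob V"
  shows "f \<in> Arr V" "Dom V f = A\<^sup>\<star> \<odot> A" "Cod V f = B\<^sup>\<star> \<odot> B" "A \<in> Ob V"
  by (rule cpE[OF assms], use assms in force)+

text \<open>Supplies the trivial environment with which a doubled arrow is completely
  positive.\<close>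

lemma tr_unit:
  assumes [simp]: "A \<in> Ob V" shows "tr \<I> A \<cdot> dbl ((\<l> A)\<dagger>) = \<one> (A\<^sup>\<star> \<odot> A)"
proof -
  have "((\<eta> \<I>)\<dagger> \<otimes> \<one> (A\<^sup>\<star> \<odot> A)) \<cdot> (mu \<I> A)\<dagger> \<cdot> dbl ((\<l> A)\<dagger>) = (\<l> (A\<^sup>\<star> \<odot> A))\<dagger>"
    by (rule dag_inject) (simp_all add: mu_l)
  then show ?thesis by (simp add: tr_eq)
qed

lemma cp_dbl:
  assumes [simp]: "g \<in> Arr V" and [simp]: "Dom V g = A" "Cod V g = B"
  shows "cp A B (dbl g)"
proof (rule cpI[of \<I> B "(\<l> B)\<dagger> \<cdot> g"])
  have [simp]: "B \<in> Ob V" using Cod_in_Ob[OF assms(1)] by simp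
  show "dbl g = tr \<I> B \<cdot> dbl ((\<l> B)\<dagger> \<cdot> g)"
    using dbl_comp[of g "(\<l> B)\<dagger>"] comp_lift[OF tr_unit[of B], of "dbl g"] by simp
qed (use Cod_in_Ob[OF assms(1)] in simp_all)

lemma cp_comp:
  assumes "cp A B f" "cp B C g" and [simp]: "B \<in> Ob V" "C \<in> Ob V"
  shows "cp A C (g \<cdot> f)"
proof -
  obtain X h where h [simp]: "X \<in> Ob V" "h \<in> Arr V" "Dom V h = A" "Cod V h = X \<odot> B" "f = tr X B \<cdot> dbl h"
    by (rule cpE[OF assms(1)]) simp
  obtain Y k where k [simp]: "Y \<in> Ob V" "k \<in> Arr V" "Dom V k = B" "Cod V k = Y \<odot> C" "g = tr Y C \<cdot> dbl k"
    by (rule cpE[OF assms(2)]) simp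
  show ?thesis
  \<comment> \<open>The environments accumulate: \<open>h\<close> leaves \<open>X\<close> behind,
    then \<open>k\<close> acts beside it and leaves \<open>Y\<close>.\<close>
  proof (rule cpI[of "X \<odot> Y" C "(\<a> X Y C)\<dagger> \<cdot> (\<one> X \<otimes> k) \<cdot> h"])
    have d: "dbl ((\<a> X Y C)\<dagger> \<cdot> (\<one> X \<otimes> k) \<cdot> h) = dbl ((\<a> X Y C)\<dagger>) \<cdot> dbl (\<one> X \<otimes> k) \<cdot> dbl h"
      using dbl_comp[of h "\<one> X \<otimes> k"] dbl_comp[of "(\<one> X \<otimes> k) \<cdot> h" "(\<a> X Y C)\<dagger>"] by simp
    have e: "tr (X \<odot> Y) C \<cdot> dbl ((\<a> X Y C)\<dagger>) = tr Y C \<cdot> tr X (Y \<odot> C)"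
      by (simp flip: tr_tr dbl_comp)
    have t: "dbl k \<cdot> tr X B = tr X (Y \<odot> C) \<cdot> dbl (\<one> X \<otimes> k)"
      using tr_nat[of k X B] by simp
    show "g \<cdot> f = tr (X \<odot> Y) C \<cdot> dbl ((\<a> X Y C)\<dagger> \<cdot> (\<one> X \<otimes> k) \<cdot> h)"
      unfolding d by (simp add: comp_lift[OF e] comp_lift[OF t])
  qed simp_all
qed

lemma cp_idn: "A \<in> Ob V \<Longrightarrow> cp A A (\<one> (A\<^sup>\<star> \<odot> A))"
  using cp_dbl[of "\<one> A" A A] by simp

lemma cp_tens_idn:
  assumes "cp A B f" and [simp]: "B \<in> Ob V" "C \<in> Ob V"
  shows "cp (A \<odot> C) (B \<odot> C) (mu B C \<cdot> (f \<otimes> \<one> (C\<^sup>\<star> \<odot> C)) \<cdot> (mu A C)\<dagger>)"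
proof -
  obtain X h where h [simp]: "X \<in> Ob V" "h \<in> Arr V" "Dom V h = A" "Cod V h = X \<odot> B" "f = tr X B \<cdot> dbl h"
    by (rule cpE[OF assms(1)]) simp
  have [simp]: "A \<in> Ob V" using Dom_in_Ob[OF h(2)] by simp
  show ?thesis
  proof (rule cpI[of X "B \<odot> C" "\<a> X B C \<cdot> (h \<otimes> \<one> C)"])
    have m: "mu (X \<odot> B) C \<cdot> (dbl h \<otimes> \<one> (C\<^sup>\<star> \<odot> C)) = dbl (h \<otimes> \<one> C) \<cdot> mu A C"
      using mu_nat[of h "\<one> C" "X \<odot> B" C] by simp
    have "mu B C \<cdot> (f \<otimes> \<one> (C\<^sup>\<star> \<odot> C)) \<cdot> (mu A C)\<dagger> = tr X (B \<odot> C) \<cdot> dbl (\<a> X B C) \<cdot> dbl (h \<otimes> \<one> C)"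
      by (simp add: whisk comp_lift[OF tr_tens] comp_lift[OF m])
    also have "\<dots> = tr X (B \<odot> C) \<cdot> dbl (\<a> X B C \<cdot> (h \<otimes> \<one> C))"
      by (subst dbl_comp) simp_all
    finally show "mu B C \<cdot> (f \<otimes> \<one> (C\<^sup>\<star> \<odot> C)) \<cdot> (mu A C)\<dagger> = tr X (B \<odot> C) \<cdot> dbl (\<a> X B C \<cdot> (h \<otimes> \<one> C))" .
  qed simp_all
qed

text \<open>Conjugate \<open>cp_tens_idn\<close> with doubled symmetries, using
  \<open>mu_sigma\<close>.\<close>

lemma cp_idn_tens:
  assumes "cp A B f" and [simp]: "B \<in> Ob V" "C \<in> Ob V"
  shows "cp (C \<odot> A) (C \<odot> B) (mu C B \<cdot> (\<one> (C\<^sup>\<star> \<odot> C) \<otimes> f) \<cdot> (mu C A)\<dagger>)"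
proof -
  note f [simp] = cp_arr[OF assms(1,2)]
  have m: "(mu A C)\<dagger> \<cdot> dbl (\<sigma> C A) = \<sigma> (C\<^sup>\<star> \<odot> C) (A\<^sup>\<star> \<odot> A) \<cdot> (mu C A)\<dagger>"
    by (rule unit_arr_flip) (simp_all add: mu_sigma)
  have "mu C B \<cdot> (\<one> (C\<^sup>\<star> \<odot> C) \<otimes> f) \<cdot> (mu C A)\<dagger>
    = mu C B \<cdot> (\<sigma> (B\<^sup>\<star> \<odot> B) (C\<^sup>\<star> \<odot> C) \<cdot> (f \<otimes> \<one> (C\<^sup>\<star> \<odot> C)) \<cdot> \<sigma> (C\<^sup>\<star> \<odot> C) (A\<^sup>\<star> \<odot> A)) \<cdot> (mu C A)\<dagger>"
    by (simp add: s_nat comp_lift[OF s_nat])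
  also have "\<dots> = dbl (\<sigma> B C) \<cdot> (mu B C \<cdot> (f \<otimes> \<one> (C\<^sup>\<star> \<odot> C)) \<cdot> (mu A C)\<dagger>) \<cdot> dbl (\<sigma> C A)"
    by (simp add: m comp_lift[OF mu_sigma])
  finally show ?thesis
    using cp_comp[OF cp_dbl cp_comp[OF cp_tens_idn[OF assms] cp_dbl]] by simp
qed

lemma cp_tens:
  assumes "cp A B f" "cp A' B' g" and [simp]: "B \<in> Ob V" "B' \<in> Ob V"
  shows "cp (A \<odot> A') (B \<odot> B') (mu B B' \<cdot> (f \<otimes> g) \<cdot> (mu A A')\<dagger>)"
proof -
  note f [simp] = cp_arr[OF assms(1,3)] and g [simp] = cp_arr[OF assms(2,4)]
  have "mu B B' \<cdot> (f \<otimes> g) \<cdot> (mu A A')\<dagger>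
    = (mu B B' \<cdot> (f \<otimes> \<one> (B'\<^sup>\<star> \<odot> B')) \<cdot> (mu A B')\<dagger>) \<cdot> (mu A B' \<cdot> (\<one> (A\<^sup>\<star> \<odot> A) \<otimes> g) \<cdot> (mu A A')\<dagger>)"
    by (simp add: tens_merge)
  then show ?thesis
    using cp_comp[OF cp_idn_tens[OF assms(2,4), of A] cp_tens_idn[OF assms(1,3), of B']] by simp
qed

text \<open>The canonical map \<open>X \<rightarrow> X\<^sup>\<star>\<^sup>\<star>\<close> is an isometry; this is what makes \<^term>\<open>\<eta> X\<close>
  completely positive with Kraus morphism \<^term>\<open>\<eta> X\<close> and environment \<open>X\<^sup>\<star>\<close>.\<close>

lemma double_dual_isometry:
  assumes [simp]: "X \<in> Ob V"
  shows "(cv (X\<^sup>\<star>) X)\<dagger> \<cdot> (\<one> ((X\<^sup>\<star>)\<^sup>\<star>) \<otimes> (\<eta> X \<cdot> (\<eta> X)\<dagger>)) \<cdot> cv (X\<^sup>\<star>) X = \<one> X"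
proof -
  let ?W = "(X\<^sup>\<star>)\<^sup>\<star>" and ?D = "X\<^sup>\<star> \<odot> X"
  let ?k = "(\<one> ?W \<otimes> (\<eta> X)\<dagger>) \<cdot> cv (X\<^sup>\<star>) X"
  \<comment> \<open>The canonical map from \<open>X\<close> to its double dual; fact 1 below is the
    property that characterises it.\<close>
  let ?k' = "\<r> ?W \<cdot> ?k"
  have k: "?k = (\<r> ?W)\<dagger> \<cdot> ?k'" by simp
  have "\<epsilon> (X\<^sup>\<star>) \<cdot> (\<one> (X\<^sup>\<star>) \<otimes> ?k') = (ev (X\<^sup>\<star>) \<I> \<cdot> (\<one> (X\<^sup>\<star>) \<otimes> \<one> ?W \<otimes> (\<eta> X)\<dagger>)) \<cdot> (\<one> (X\<^sup>\<star>) \<otimes> cv (X\<^sup>\<star>) X)"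
    by (simp add: ev_unit whisk)
  also have "\<dots> = (\<eta> X)\<dagger>" by (simp add: ev_nats ev_cv)
  finally have 1: "\<epsilon> (X\<^sup>\<star>) \<cdot> (\<one> (X\<^sup>\<star>) \<otimes> ?k') = (\<eta> X)\<dagger>" .
  have "ev (X\<^sup>\<star>) X \<cdot> (\<one> (X\<^sup>\<star>) \<otimes> ?k' \<otimes> \<one> X) = \<l> X \<cdot> ((\<epsilon> (X\<^sup>\<star>) \<cdot> (\<one> (X\<^sup>\<star>) \<otimes> ?k')) \<otimes> \<one> X) \<cdot> (\<a> (X\<^sup>\<star>) X X)\<dagger>"
    by (simp add: ev_def nat tens_merge)
  then have 2: "ev (X\<^sup>\<star>) X \<cdot> (\<one> (X\<^sup>\<star>) \<otimes> ?k' \<otimes> \<one> X) = (cv X X)\<dagger>"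
    unfolding 1 by (simp add: cv_def)
  have "(cv (X\<^sup>\<star>) X)\<dagger> \<cdot> (\<one> ?W \<otimes> (\<eta> X \<cdot> (\<eta> X)\<dagger>)) \<cdot> cv (X\<^sup>\<star>) X
    = ev (X\<^sup>\<star>) X \<cdot> sw ?W (X\<^sup>\<star>) X \<cdot> (\<one> ?W \<otimes> \<eta> X) \<cdot> ?k"
    by (simp add: ev_eq whisk)
  also have "(\<one> ?W \<otimes> \<eta> X) \<cdot> ?k = (?k' \<otimes> \<one> ?D) \<cdot> (\<one> X \<otimes> \<eta> X) \<cdot> (\<r> X)\<dagger>"
  proof -
    have "(\<r> ?W)\<dagger> \<cdot> ?k' = (?k' \<otimes> \<one> \<I>) \<cdot> (\<r> X)\<dagger>" by (subst rd_nat) simp_all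
    then have "(\<one> ?W \<otimes> \<eta> X) \<cdot> ?k = (\<one> ?W \<otimes> \<eta> X) \<cdot> (?k' \<otimes> \<one> \<I>) \<cdot> (\<r> X)\<dagger>"
      using k by simp
    also have "\<dots> = (?k' \<otimes> \<one> ?D) \<cdot> (\<one> X \<otimes> \<eta> X) \<cdot> (\<r> X)\<dagger>"
      by (simp add: tens_merge)
    finally show ?thesis .
  qed
  also have "ev (X\<^sup>\<star>) X \<cdot> sw ?W (X\<^sup>\<star>) X \<cdot> (?k' \<otimes> \<one> ?D) \<cdot> (\<one> X \<otimes> \<eta> X) \<cdot> (\<r> X)\<dagger>
    = (ev (X\<^sup>\<star>) X \<cdot> (\<one> (X\<^sup>\<star>) \<otimes> ?k' \<otimes> \<one> X)) \<cdot> sw X (X\<^sup>\<star>) X \<cdot> (\<one> X \<otimes> \<eta> X) \<cdot> (\<r> X)\<dagger>"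
    by (subst comp_lift[OF sw_nat_idn]) simp_all
  also have "\<dots> = (ev X X \<cdot> (\<one> X \<otimes> \<eta> X)) \<cdot> (\<r> X)\<dagger>"
    unfolding 2 by (simp add: ev_eq)
  also have "\<dots> = \<one> X" by (simp add: ev_eta)
  finally show ?thesis .
qed

text \<open>In curried form the doubled unit becomes
  \<open>\<eta> X \<cdot> (\<eta> X)\<dagger>\<close>, and tracing out the dual of \<open>X\<close>
  leaves the composite evaluated in \<open>double_dual_isometry\<close>.\<close>

lemma tr_eta:
  assumes [simp]: "X \<in> Ob V"
  shows "tr (X\<^sup>\<star>) X \<cdot> dbl (\<eta> X) \<cdot> \<eta> \<I> = \<eta> X"
proof (rule hat_inject)
  let ?W = "X\<^sup>\<star> \<odot> X"
  let ?t = "dbl (\<eta> X) \<cdot> \<eta> \<I>"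
  have "ev ?W ?W \<cdot> (\<one> ?W \<otimes> ?t) = \<eta> X \<cdot> (\<eta> X)\<dagger> \<cdot> \<r> ?W"
    by (simp add: whisk comp_lift[OF ev_dbl] swap_whisk comp_lift[OF ev_eta] r_nat)
  moreover have "\<r> ?W \<cdot> (\<a> (X\<^sup>\<star>) X \<I>)\<dagger> = \<one> (X\<^sup>\<star>) \<otimes> \<r> X"
    by (simp flip: r_tens)
  ultimately have e: "(ev ?W ?W \<cdot> (\<one> ?W \<otimes> ?t)) \<cdot> (\<a> (X\<^sup>\<star>) X \<I>)\<dagger> = \<eta> X \<cdot> (\<eta> X)\<dagger> \<cdot> (\<one> (X\<^sup>\<star>) \<otimes> \<r> X)"
    by simp
  have a: "(\<a> (X\<^sup>\<star>) X (?W\<^sup>\<star> \<odot> ?W))\<dagger> \<cdot> (\<one> (X\<^sup>\<star>) \<otimes> \<one> X \<otimes> ?t) = (\<one> ?W \<otimes> ?t) \<cdot> (\<a> (X\<^sup>\<star>) X \<I>)\<dagger>"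
    using ad_nat[of "\<one> (X\<^sup>\<star>)" "\<one> X" ?t] by simp
  have "ev X X \<cdot> (\<one> X \<otimes> (tr (X\<^sup>\<star>) X \<cdot> ?t))
    = (cv (X\<^sup>\<star>) X)\<dagger> \<cdot> (\<one> ((X\<^sup>\<star>)\<^sup>\<star>) \<otimes> (ev ?W ?W \<cdot> (\<a> (X\<^sup>\<star>) X (?W\<^sup>\<star> \<odot> ?W))\<dagger>)) \<cdot> cv (X\<^sup>\<star>) (X \<odot> ?W\<^sup>\<star> \<odot> ?W) \<cdot> (\<one> X \<otimes> ?t)"
    using whisk_left[of ?t "tr (X\<^sup>\<star>) X" X] comp_lift[OF ev_tr[of "X\<^sup>\<star>" X], of "\<one> X \<otimes> ?t"] by simp
  also have "\<dots> = (cv (X\<^sup>\<star>) X)\<dagger> \<cdot> (\<one> ((X\<^sup>\<star>)\<^sup>\<star>) \<otimes> (ev ?W ?W \<cdot> (\<a> (X\<^sup>\<star>) X (?W\<^sup>\<star> \<odot> ?W))\<dagger> \<cdot> (\<one> (X\<^sup>\<star>) \<otimes> \<one> X \<otimes> ?t))) \<cdot> cv (X\<^sup>\<star>) (X \<odot> \<I>)"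
    by (subst cv_nat[of "X\<^sup>\<star>" "\<one> X \<otimes> ?t"]) (simp_all add: tens_merge)
  also have "\<dots> = (cv (X\<^sup>\<star>) X)\<dagger> \<cdot> (\<one> ((X\<^sup>\<star>)\<^sup>\<star>) \<otimes> (\<eta> X \<cdot> (\<eta> X)\<dagger> \<cdot> (\<one> (X\<^sup>\<star>) \<otimes> \<r> X))) \<cdot> cv (X\<^sup>\<star>) (X \<odot> \<I>)"
    unfolding a e[symmetric] by simp
  also have "\<dots> = ((cv (X\<^sup>\<star>) X)\<dagger> \<cdot> (\<one> ((X\<^sup>\<star>)\<^sup>\<star>) \<otimes> (\<eta> X \<cdot> (\<eta> X)\<dagger>)) \<cdot> cv (X\<^sup>\<star>) X) \<cdot> \<r> X"
    by (simp add: whisk cv_nat)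
  also have "\<dots> = ev X X \<cdot> (\<one> X \<otimes> \<eta> X)"
    unfolding double_dual_isometry[OF assms] by (simp add: ev_eta)
  finally show "ev X X \<cdot> (\<one> X \<otimes> (tr (X\<^sup>\<star>) X \<cdot> dbl (\<eta> X) \<cdot> \<eta> \<I>)) = ev X X \<cdot> (\<one> X \<otimes> \<eta> X)" .
qed simp_all

text \<open>Morphisms of CPM out of the unit object start at its doubling; the dagger of
  \<open>\<eta> \<I>\<close> identifies that doubling with the unit object.\<close>

lemma cp_eta:
  assumes [simp]: "X \<in> Ob V" shows "cp \<I> X (\<eta> X \<cdot> (\<eta> \<I>)\<dagger>)"
proof (rule cpI[of "X\<^sup>\<star>" X "\<eta> X"])
  have "\<eta> X \<cdot> (\<eta> \<I>)\<dagger> = (tr (X\<^sup>\<star>) X \<cdot> dbl (\<eta> X) \<cdot> \<eta> \<I>) \<cdot> (\<eta> \<I>)\<dagger>"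
    by (simp only: tr_eta[OF assms])
  then show "\<eta> X \<cdot> (\<eta> \<I>)\<dagger> = tr (X\<^sup>\<star>) X \<cdot> dbl (\<eta> X)"
    by (simp add: unit_arrD(3)[OF eta_unit])
qed simp_all

text \<open>For f = \<open>tr X B \<cdot> dbl g\<close> the dagger is a doubled arrow after the
  dagger of the trace. The latter inserts the state of \<open>cp_eta\<close> next to
  \<open>B\<close>, hence is completely positive.\<close>

lemma cp_dag:
  assumes "cp A B f" and [simp]: "B \<in> Ob V"
  shows "cp B A (f\<dagger>)"
proof -
  obtain X g where g [simp]: "X \<in> Ob V" "g \<in> Arr V" "Dom V g = A" "Cod V g = X \<odot> B" "f = tr X B \<cdot> dbl g"
    by (rule cpE[OF assms(1)]) simp
  have [simp]: "A \<in> Ob V" using Dom_in_Ob[OF g(2)] by simp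
  let ?DB = "B\<^sup>\<star> \<odot> B"
  have "(dbl ((\<l> B)\<dagger>) \<cdot> dbl (\<l> B)) \<cdot> mu \<I> B \<cdot> (\<eta> \<I> \<otimes> \<one> ?DB) = dbl ((\<l> B)\<dagger>) \<cdot> \<l> ?DB"
    by (simp add: mu_l del: l_cancel)
  then have e: "mu \<I> B \<cdot> (\<eta> \<I> \<otimes> \<one> ?DB) = dbl ((\<l> B)\<dagger>) \<cdot> \<l> ?DB"
    by (simp flip: dbl_comp)
  have "(mu \<I> B)\<dagger> \<cdot> (dbl ((\<l> B)\<dagger>) \<cdot> \<l> ?DB) \<cdot> (\<l> ?DB)\<dagger> = (\<eta> \<I> \<otimes> \<one> ?DB) \<cdot> (\<l> ?DB)\<dagger>"
    by (simp flip: e)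
  then have "(mu \<I> B)\<dagger> \<cdot> dbl ((\<l> B)\<dagger>) = (\<eta> \<I> \<otimes> \<one> ?DB) \<cdot> (\<l> ?DB)\<dagger>"
    by simp
  then have "(tr X B)\<dagger> = (mu X B \<cdot> ((\<eta> X \<cdot> (\<eta> \<I>)\<dagger>) \<otimes> \<one> ?DB) \<cdot> (mu \<I> B)\<dagger>) \<cdot> dbl ((\<l> B)\<dagger>)"
    by (simp add: tr_eq whisk winv[OF eta_unit])
  moreover have "cp B (X \<odot> B) \<dots>"
    using cp_comp[OF cp_dbl cp_tens_idn[OF cp_eta]] by simp
  ultimately have "cp B (X \<odot> B) ((tr X B)\<dagger>)" by simp
  then show ?thesis using cp_comp[OF _ cp_dbl[of "g\<dagger>" "X \<odot> B" A]] by simp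
qed

subsection \<open>The category of completely positive morphisms\<close>

lemma CPM_simps:
  "Ob (CPM V) = Ob V"
  "Arr (CPM V) = {(A, f, B). A \<in> Ob V \<and> B \<in> Ob V \<and> cp A B f}"
  "Dom (CPM V) (A, f, B) = A"
  "Cod (CPM V) (A, f, B) = B"
  "Idn (CPM V) A = (A, \<one> (A\<^sup>\<star> \<odot> A), A)"
  "Comp (CPM V) (B', g, C) (A, f, B) = (A, g \<cdot> f, C)"
  "Dag (CPM V) (A, f, B) = (B, f\<dagger>, A)"
  "TensO (CPM V) A B = A \<odot> B"
  "TensA (CPM V) (A, f, B) (C, g, D) = (A \<odot> C, mu B D \<cdot> (f \<otimes> g) \<cdot> (mu A C)\<dagger>, B \<odot> D)"
  "UnitO (CPM V) = \<I>"
  "Assoc (CPM V) A B C = double V (\<a> A B C)"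
  "LUnit (CPM V) A = double V (\<l> A)"
  "RUnit (CPM V) A = double V (\<r> A)"
  "Symm (CPM V) A B = double V (\<sigma> A B)"
  by (simp_all add: CPM_def)

lemma CPM_Hom_iff:
  "x \<in> Hom (CPM V) A B \<longleftrightarrow> (\<exists>f. x = (A, f, B) \<and> A \<in> Ob V \<and> B \<in> Ob V \<and> cp A B f
     \<and> f \<in> Arr V \<and> Dom V f = A\<^sup>\<star> \<odot> A \<and> Cod V f = B\<^sup>\<star> \<odot> B)"
  using cp_arr by (fastforce simp: Hom_def CPM_simps)

lemma double_Hom: "g \<in> Arr V \<Longrightarrow> Dom V g = A \<Longrightarrow> Cod V g = B \<Longrightarrow> double V g \<in> Hom (CPM V) A B"
  by (auto simp: CPM_Hom_iff double_def cp_dbl)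

text \<open>With \<open>double_tens\<close>, \<open>double_dag\<close> and \<open>double_idn\<close>
  this makes \<open>double\<close> preserve all operations strictly, so the coherence equations
  between structure maps are transported from \<open>V\<close>. Naturality for arbitrary completely
  positive maps is treated separately.\<close>

lemma double_comp:
  "f \<in> Arr V \<Longrightarrow> g \<in> Arr V \<Longrightarrow> Cod V f = Dom V g \<Longrightarrow> Comp (CPM V) (double V g) (double V f) = double V (g \<cdot> f)"
  by (simp add: double_def CPM_simps dbl_comp)

lemma double_tens:
  "f \<in> Arr V \<Longrightarrow> g \<in> Arr V \<Longrightarrow> TensA (CPM V) (double V f) (double V g) = double V (f \<otimes> g)"
  by (simp add: double_def CPM_simps comp_lift[OF mu_nat])

lemma double_dag: "g \<in> Arr V \<Longrightarrow> Dag (CPM V) (double V g) = double V (g\<dagger>)"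
  by (simp add: double_def CPM_simps)

lemma double_idn: "A \<in> Ob V \<Longrightarrow> Idn (CPM V) A = double V (\<one> A)"
  by (simp add: double_def CPM_simps)

lemma double_unitary:
  assumes "unit_arr g" "Dom V g = A" "Cod V g = B"
  shows "unitary (CPM V) A B (double V g)"
  using assms unit_arrD[OF assms(1)] Dom_in_Ob[of g] Cod_in_Ob[of g]
  by (auto simp: unitary_def double_Hom double_comp double_dag double_idn)

lemma mu_l':
  assumes [simp]: "A \<in> Ob V"
  shows "dbl (\<l> A) \<cdot> mu \<I> A = \<l> (A\<^sup>\<star> \<odot> A) \<cdot> ((\<eta> \<I>)\<dagger> \<otimes> \<one> (A\<^sup>\<star> \<odot> A))"
  unfolding mu_l[OF assms, symmetric] by (simp add: winv[OF eta_unit])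

lemma mu_r':
  assumes [simp]: "A \<in> Ob V"
  shows "dbl (\<r> A) \<cdot> mu A \<I> = \<r> (A\<^sup>\<star> \<odot> A) \<cdot> (\<one> (A\<^sup>\<star> \<odot> A) \<otimes> (\<eta> \<I>)\<dagger>)"
  unfolding mu_r[OF assms, symmetric] by (simp add: winv[OF eta_unit])

lemma mu_dag_assoc:
  assumes [simp]: "A \<in> Ob V" "B \<in> Ob V" "C \<in> Ob V"
  shows "\<a> (A\<^sup>\<star> \<odot> A) (B\<^sup>\<star> \<odot> B) (C\<^sup>\<star> \<odot> C) \<cdot> ((mu A B)\<dagger> \<otimes> \<one> (C\<^sup>\<star> \<odot> C)) \<cdot> (mu (A \<odot> B) C)\<dagger>
    = (\<one> (A\<^sup>\<star> \<odot> A) \<otimes> (mu B C)\<dagger>) \<cdot> (mu A (B \<odot> C))\<dagger> \<cdot> dbl (\<a> A B C)"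
proof -
  have "(\<one> (A\<^sup>\<star> \<odot> A) \<otimes> (mu B C)\<dagger>) \<cdot> ((mu A (B \<odot> C))\<dagger> \<cdot> dbl (\<a> A B C) \<cdot> mu (A \<odot> B) C) \<cdot> (mu (A \<odot> B) C)\<dagger>
    = \<a> (A\<^sup>\<star> \<odot> A) (B\<^sup>\<star> \<odot> B) (C\<^sup>\<star> \<odot> C) \<cdot> ((mu A B)\<dagger> \<otimes> \<one> (C\<^sup>\<star> \<odot> C)) \<cdot> (mu (A \<odot> B) C)\<dagger>"
    unfolding mu_assoc'[OF assms] by (simp add: winv)
  then show ?thesis by simp
qed

text \<open>\<open>mu_assoc\<close> exchanges the doubled associator for the associator of the
  doubled objects, where naturality in \<open>V\<close> applies; \<open>mu_dag_assoc\<close> changes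
  back.\<close>

lemma CPM_assoc_nat:
  assumes [simp]: "X \<in> Ob V" "X' \<in> Ob V" "Y \<in> Ob V" "Y' \<in> Ob V" "Z \<in> Ob V" "Z' \<in> Ob V"
    and [simp]: "f \<in> Arr V" "Dom V f = X\<^sup>\<star> \<odot> X" "Cod V f = X'\<^sup>\<star> \<odot> X'"
    and [simp]: "g \<in> Arr V" "Dom V g = Y\<^sup>\<star> \<odot> Y" "Cod V g = Y'\<^sup>\<star> \<odot> Y'"
    and [simp]: "h \<in> Arr V" "Dom V h = Z\<^sup>\<star> \<odot> Z" "Cod V h = Z'\<^sup>\<star> \<odot> Z'"
  shows "dbl (\<a> X' Y' Z') \<cdot> mu (X' \<odot> Y') Z' \<cdot> ((mu X' Y' \<cdot> (f \<otimes> g) \<cdot> (mu X Y)\<dagger>) \<otimes> h) \<cdot> (mu (X \<odot> Y) Z)\<dagger>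
    = mu X' (Y' \<odot> Z') \<cdot> (f \<otimes> (mu Y' Z' \<cdot> (g \<otimes> h) \<cdot> (mu Y Z)\<dagger>)) \<cdot> (mu X (Y \<odot> Z))\<dagger> \<cdot> dbl (\<a> X Y Z)"
proof -
  have "(mu X' Y' \<cdot> (f \<otimes> g) \<cdot> (mu X Y)\<dagger>) \<otimes> h = (mu X' Y' \<otimes> \<one> (Z'\<^sup>\<star> \<odot> Z')) \<cdot> ((f \<otimes> g) \<otimes> h) \<cdot> ((mu X Y)\<dagger> \<otimes> \<one> (Z\<^sup>\<star> \<odot> Z))"
    by (simp add: tens_merge)
  moreover have "f \<otimes> (mu Y' Z' \<cdot> (g \<otimes> h) \<cdot> (mu Y Z)\<dagger>) = (\<one> (X'\<^sup>\<star> \<odot> X') \<otimes> mu Y' Z') \<cdot> (f \<otimes> (g \<otimes> h)) \<cdot> (\<one> (X\<^sup>\<star> \<odot> X) \<otimes> (mu Y Z)\<dagger>)"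
    by (simp add: tens_merge)
  moreover have "dbl (\<a> X' Y' Z') \<cdot> mu (X' \<odot> Y') Z' \<cdot> (mu X' Y' \<otimes> \<one> (Z'\<^sup>\<star> \<odot> Z')) \<cdot> k
    = (mu X' (Y' \<odot> Z') \<cdot> (\<one> (X'\<^sup>\<star> \<odot> X') \<otimes> mu Y' Z') \<cdot> \<a> (X'\<^sup>\<star> \<odot> X') (Y'\<^sup>\<star> \<odot> Y') (Z'\<^sup>\<star> \<odot> Z')) \<cdot> k"
    if "k \<in> Arr V" "Cod V k = ((X'\<^sup>\<star> \<odot> X') \<odot> (Y'\<^sup>\<star> \<odot> Y')) \<odot> (Z'\<^sup>\<star> \<odot> Z')" for k
    using that by (simp flip: mu_assoc)
  ultimately show ?thesis by (simp add: a_nat comp_lift[OF a_nat] mu_dag_assoc)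
qed

lemma CPM_tens_Hom:
  assumes "x \<in> Hom (CPM V) X Y" "y \<in> Hom (CPM V) Z W"
  shows "TensA (CPM V) x y \<in> Hom (CPM V) (X \<odot> Z) (Y \<odot> W)"
  using assms by (auto simp: CPM_Hom_iff CPM_simps cp_tens)

lemma CPM_dagger_category: "dagger_category (CPM V)"
proof unfold_locales
  fix f assume "f \<in> Arr (CPM V)"
  then show "Dom (CPM V) f \<in> Ob (CPM V)" "Cod (CPM V) f \<in> Ob (CPM V)"
    by (auto simp: CPM_simps)
next
  fix X assume "X \<in> Ob (CPM V)"
  then show "Idn (CPM V) X \<in> Hom (CPM V) X X" "Dag (CPM V) (Idn (CPM V) X) = Idn (CPM V) X"
    by (auto simp: CPM_simps CPM_Hom_iff cp_idn)
next
  fix f g h X Y Z W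
  assume f: "f \<in> Hom (CPM V) X Y"
  show "Comp (CPM V) (Idn (CPM V) Y) f = f" "Comp (CPM V) f (Idn (CPM V) X) = f"
    "Dag (CPM V) f \<in> Hom (CPM V) Y X" "Dag (CPM V) (Dag (CPM V) f) = f"
    using f by (auto simp: CPM_simps CPM_Hom_iff cp_dag)
  assume g: "g \<in> Hom (CPM V) Y Z"
  show "Comp (CPM V) g f \<in> Hom (CPM V) X Z"
    "Dag (CPM V) (Comp (CPM V) g f) = Comp (CPM V) (Dag (CPM V) f) (Dag (CPM V) g)"
    using f g by (auto simp: CPM_simps CPM_Hom_iff cp_comp)
  assume h: "h \<in> Hom (CPM V) Z W"
  show "Comp (CPM V) (Comp (CPM V) h g) f = Comp (CPM V) h (Comp (CPM V) g f)"
    using f g h by (auto simp: CPM_simps CPM_Hom_iff)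
qed

lemma CPM_dsm: "dagger_symmetric_monoidal_category (CPM V)"
proof -
  interpret CPM: dagger_category "CPM V" by (rule CPM_dagger_category)
  show ?thesis
  proof unfold_locales
    show "UnitO (CPM V) \<in> Ob (CPM V)" by (simp add: CPM_simps)
  next
    fix X Y assume "X \<in> Ob (CPM V)" "Y \<in> Ob (CPM V)"
    then show "TensO (CPM V) X Y \<in> Ob (CPM V)" by (simp add: CPM_simps)
  next
    fix f X Y g Z W
    assume f: "f \<in> Hom (CPM V) X Y" and g: "g \<in> Hom (CPM V) Z W"
    from CPM_tens_Hom[OF f g]
    show "TensA (CPM V) f g \<in> Hom (CPM V) (TensO (CPM V) X Z) (TensO (CPM V) Y W)"
      by (simp add: CPM_simps)
    show "Dag (CPM V) (TensA (CPM V) f g) = TensA (CPM V) (Dag (CPM V) f) (Dag (CPM V) g)"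
      using f g by (auto simp: CPM_simps CPM_Hom_iff)
    show "Comp (CPM V) (Symm (CPM V) Y W) (TensA (CPM V) f g)
      = Comp (CPM V) (TensA (CPM V) g f) (Symm (CPM V) X Z)"
    proof -
      have m: "(mu Z X)\<dagger> \<cdot> dbl (\<sigma> X Z) = \<sigma> (X\<^sup>\<star> \<odot> X) (Z\<^sup>\<star> \<odot> Z) \<cdot> (mu X Z)\<dagger>"
        if "X \<in> Ob V" "Z \<in> Ob V"
        by (rule unit_arr_flip) (use that in \<open>simp_all add: mu_sigma\<close>)
      show ?thesis using f g
        by (auto simp: CPM_simps CPM_Hom_iff double_def comp_lift[OF mu_sigma] m s_nat comp_lift[OF s_nat])
    qed
  next
    fix X Y assume "X \<in> Ob (CPM V)" "Y \<in> Ob (CPM V)"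
    then have [simp]: "X \<in> Ob V" "Y \<in> Ob V" by (simp_all add: CPM_simps)
    show "TensA (CPM V) (Idn (CPM V) X) (Idn (CPM V) Y) = Idn (CPM V) (TensO (CPM V) X Y)"
      by (simp add: CPM_simps)
    show "unitary (CPM V) (TensO (CPM V) X Y) (TensO (CPM V) Y X) (Symm (CPM V) X Y)"
      "unitary (CPM V) (TensO (CPM V) (UnitO (CPM V)) X) X (LUnit (CPM V) X)"
      "unitary (CPM V) (TensO (CPM V) X (UnitO (CPM V))) X (RUnit (CPM V) X)"
      by (simp_all add: CPM_simps double_unitary)
    \<comment> \<open>Identities and composites stay folded here, because \<open>double_idn\<close>
      and \<open>double_comp\<close> have to match them.\<close>
    show "Comp (CPM V) (TensA (CPM V) (Idn (CPM V) X) (LUnit (CPM V) Y)) (Assoc (CPM V) X (UnitO (CPM V)) Y)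
      = TensA (CPM V) (RUnit (CPM V) X) (Idn (CPM V) Y)"
      by (simp add: CPM_simps(8-) double_idn double_comp double_tens triangle)
    show "Comp (CPM V) (Symm (CPM V) Y X) (Symm (CPM V) X Y) = Idn (CPM V) (TensO (CPM V) X Y)"
      by (simp add: CPM_simps(8-) double_idn double_comp)
    fix Z assume "Z \<in> Ob (CPM V)"
    then have [simp]: "Z \<in> Ob V" by (simp_all add: CPM_simps)
    show "unitary (CPM V) (TensO (CPM V) (TensO (CPM V) X Y) Z) (TensO (CPM V) X (TensO (CPM V) Y Z)) (Assoc (CPM V) X Y Z)"
      by (simp_all add: CPM_simps double_unitary)
    show "Comp (CPM V) (Assoc (CPM V) Y Z X) (Comp (CPM V) (Symm (CPM V) X (TensO (CPM V) Y Z)) (Assoc (CPM V) X Y Z))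
      = Comp (CPM V) (TensA (CPM V) (Idn (CPM V) Y) (Symm (CPM V) X Z))
        (Comp (CPM V) (Assoc (CPM V) Y X Z) (TensA (CPM V) (Symm (CPM V) X Y) (Idn (CPM V) Z)))"
      by (simp add: CPM_simps(8-) double_idn double_comp double_tens hexagon)
    fix W assume "W \<in> Ob (CPM V)"
    then have [simp]: "W \<in> Ob V" by (simp_all add: CPM_simps)
    show "Comp (CPM V) (TensA (CPM V) (Idn (CPM V) X) (Assoc (CPM V) Y Z W))
        (Comp (CPM V) (Assoc (CPM V) X (TensO (CPM V) Y Z) W) (TensA (CPM V) (Assoc (CPM V) X Y Z) (Idn (CPM V) W)))
      = Comp (CPM V) (Assoc (CPM V) X Y (TensO (CPM V) Z W)) (Assoc (CPM V) (TensO (CPM V) X Y) Z W)"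
      by (simp add: CPM_simps(8-) double_idn double_comp double_tens pentagon)
  next
    fix f X Y f' Z g U V' g' W
    assume "f \<in> Hom (CPM V) X Y" "f' \<in> Hom (CPM V) Y Z" "g \<in> Hom (CPM V) U V'" "g' \<in> Hom (CPM V) V' W"
    then show "TensA (CPM V) (Comp (CPM V) f' f) (Comp (CPM V) g' g)
      = Comp (CPM V) (TensA (CPM V) f' g') (TensA (CPM V) f g)"
      by (auto simp: CPM_simps CPM_Hom_iff tens_merge)
  next
    fix f X X' g Y Y' h Z Z'
    assume "f \<in> Hom (CPM V) X X'" "g \<in> Hom (CPM V) Y Y'" "h \<in> Hom (CPM V) Z Z'"
    then show "Comp (CPM V) (Assoc (CPM V) X' Y' Z') (TensA (CPM V) (TensA (CPM V) f g) h)
      = Comp (CPM V) (TensA (CPM V) f (TensA (CPM V) g h)) (Assoc (CPM V) X Y Z)"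
      by (auto simp: CPM_simps CPM_Hom_iff double_def CPM_assoc_nat)
  next
    fix f X Y assume f: "f \<in> Hom (CPM V) X Y"
    then obtain k where k [simp]: "f = (X, k, Y)" "X \<in> Ob V" "Y \<in> Ob V" "k \<in> Arr V"
      "Dom V k = X\<^sup>\<star> \<odot> X" "Cod V k = Y\<^sup>\<star> \<odot> Y"
      by (auto simp: CPM_Hom_iff)
    let ?DI = "\<I>\<^sup>\<star> \<odot> \<I>" and ?DX = "X\<^sup>\<star> \<odot> X" and ?DY = "Y\<^sup>\<star> \<odot> Y"
    have "dbl (\<l> Y) \<cdot> mu \<I> Y \<cdot> (\<one> ?DI \<otimes> k) \<cdot> (mu \<I> X)\<dagger> = k \<cdot> (\<l> ?DX \<cdot> ((\<eta> \<I>)\<dagger> \<otimes> \<one> ?DX)) \<cdot> (mu \<I> X)\<dagger>"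
      by (simp add: comp_lift[OF mu_l'] swap_whisk comp_lift[OF swap_whisk] nat)
    also have "\<dots> = k \<cdot> dbl (\<l> X)"
      unfolding mu_l'[OF k(2), symmetric] by simp
    finally show "Comp (CPM V) (LUnit (CPM V) Y) (TensA (CPM V) (Idn (CPM V) (UnitO (CPM V))) f) = Comp (CPM V) f (LUnit (CPM V) X)"
      by (simp add: CPM_simps double_def)
    have "dbl (\<r> Y) \<cdot> mu Y \<I> \<cdot> (k \<otimes> \<one> ?DI) \<cdot> (mu X \<I>)\<dagger> = k \<cdot> (\<r> ?DX \<cdot> (\<one> ?DX \<otimes> (\<eta> \<I>)\<dagger>)) \<cdot> (mu X \<I>)\<dagger>"
    proof -
      have "(\<one> ?DY \<otimes> (\<eta> \<I>)\<dagger>) \<cdot> (k \<otimes> \<one> ?DI) = (k \<otimes> \<one> \<I>) \<cdot> (\<one> ?DX \<otimes> (\<eta> \<I>)\<dagger>)"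
        by (simp add: tens_merge)
      note s = comp_lift[OF this]
      show ?thesis by (simp add: comp_lift[OF mu_r'] s nat)
    qed
    also have "\<dots> = k \<cdot> dbl (\<r> X)"
      unfolding mu_r'[OF k(2), symmetric] by simp
    finally show "Comp (CPM V) (RUnit (CPM V) Y) (TensA (CPM V) f (Idn (CPM V) (UnitO (CPM V)))) = Comp (CPM V) f (RUnit (CPM V) X)"
      by (simp add: CPM_simps double_def)
  qed
qed

end

subsection \<open>The dagger idempotent splitting is dagger symmetric monoidal\<close>

context dagger_symmetric_monoidal_category
begin

lemma split_simps:
  "Ob (Split_dagger C) = split_Ob C"
  "Dom (Split_dagger C) (P, f, Q) = P"
  "Cod (Split_dagger C) (P, f, Q) = Q"
  "Idn (Split_dagger C) P = (P, snd P, P)"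
  "Comp (Split_dagger C) (Q', g, R) (P, f, Q) = (P, g \<cdot> f, R)"
  "Dag (Split_dagger C) (P, f, Q) = (Q, f\<dagger>, P)"
  "TensO (Split_dagger C) = split_TensO C"
  "TensA (Split_dagger C) (P, f, Q) (P', g, Q') = (split_TensO C P P', f \<otimes> g, split_TensO C Q Q')"
  "UnitO (Split_dagger C) = split_UnitO C"
  "Assoc (Split_dagger C) P Q R = split_arr C (split_TensO C (split_TensO C P Q) R)
                (\<a> (fst P) (fst Q) (fst R)) (split_TensO C P (split_TensO C Q R))"
  "LUnit (Split_dagger C) P = split_arr C (split_TensO C (split_UnitO C) P) (\<l> (fst P)) P"
  "RUnit (Split_dagger C) P = split_arr C (split_TensO C P (split_UnitO C)) (\<r> (fst P)) P"
  "Symm (Split_dagger C) P Q = split_arr C (split_TensO C P Q) (\<sigma> (fst P) (fst Q)) (split_TensO C Q P)"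
  by (simp_all add: Split_dagger_def case_prod_beta)

lemma split_Ob_iff:
  "P \<in> split_Ob C \<longleftrightarrow> snd P \<in> Arr C \<and> Dom C (snd P) = fst P \<and> Cod C (snd P) = fst P
    \<and> (snd P)\<dagger> = snd P \<and> snd P \<cdot> snd P = snd P"
  using Dom_in_Ob by (auto simp: split_Ob_def Hom_iff)

text \<open>Every arrow of \<open>C\<close> that commutes with the idempotents induces one of the splitting, and all
  arrows and structure maps of the splitting arise so. Hence every axiom is inherited from \<open>C\<close>.\<close>

definition splits :: "'o \<times> 'a \<Rightarrow> 'a \<Rightarrow> 'o \<times> 'a \<Rightarrow> bool" where
  "splits P f Q \<longleftrightarrow> P \<in> split_Ob C \<and> Q \<in> split_Ob C \<and> f \<in> Arr C \<and> Dom C f = fst P \<and> Cod C f = fst Q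
    \<and> snd Q \<cdot> f = f \<cdot> snd P"

lemma splitsD:
  assumes "splits P f Q"
  shows "f \<in> Arr C" "Dom C f = fst P" "Cod C f = fst Q" "snd Q \<cdot> f = f \<cdot> snd P"
    "h \<in> Arr C \<Longrightarrow> Cod C h = fst P \<Longrightarrow> snd Q \<cdot> f \<cdot> h = f \<cdot> snd P \<cdot> h"
    "snd P \<in> Arr C" "Dom C (snd P) = fst P" "Cod C (snd P) = fst P" "(snd P)\<dagger> = snd P" "snd P \<cdot> snd P = snd P"
    "h \<in> Arr C \<Longrightarrow> Cod C h = fst P \<Longrightarrow> snd P \<cdot> snd P \<cdot> h = snd P \<cdot> h"
    "snd Q \<in> Arr C" "Dom C (snd Q) = fst Q" "Cod C (snd Q) = fst Q" "(snd Q)\<dagger> = snd Q" "snd Q \<cdot> snd Q = snd Q"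
    "fst P \<in> Ob C" "fst Q \<in> Ob C"
proof -
  show *: "f \<in> Arr C" "Dom C f = fst P" "Cod C f = fst Q" "snd Q \<cdot> f = f \<cdot> snd P"
    "snd P \<in> Arr C" "Dom C (snd P) = fst P" "Cod C (snd P) = fst P" "(snd P)\<dagger> = snd P" "snd P \<cdot> snd P = snd P"
    "snd Q \<in> Arr C" "Dom C (snd Q) = fst Q" "Cod C (snd Q) = fst Q" "(snd Q)\<dagger> = snd Q" "snd Q \<cdot> snd Q = snd Q"
    using assms by (simp_all add: splits_def split_Ob_iff)
  show "fst P \<in> Ob C" "fst Q \<in> Ob C" using Dom_in_Ob[OF *(1)] Cod_in_Ob[OF *(1)] *(2,3) by simp_all
  assume "h \<in> Arr C" "Cod C h = fst P"
  then show "snd Q \<cdot> f \<cdot> h = f \<cdot> snd P \<cdot> h" "snd P \<cdot> snd P \<cdot> h = snd P \<cdot> h"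
    using comp_lift[OF *(4)] comp_lift[OF *(9)] * by simp_all
qed

lemma split_arr_eq:
  assumes "splits P f Q" shows "split_arr C P f Q = (P, f \<cdot> snd P, Q)"
  using splitsD[OF assms] by (simp add: split_arr_def)

text \<open>The condition f = q f p amounts to q f = f p together with f p = f. The first equation
  is the one stable under all operations (\<open>splits\<close>), the second a
  normalisation.\<close>

lemma split_Hom_iff:
  "x \<in> Hom (Split_dagger C) P Q \<longleftrightarrow> (\<exists>f. x = (P, f, Q) \<and> splits P f Q \<and> f \<cdot> snd P = f)"
proof -
  have e: "f = q \<cdot> f \<cdot> p \<longleftrightarrow> q \<cdot> f = f \<cdot> p \<and> f \<cdot> p = f"
    if "f \<in> Arr C" "p \<in> Arr C" "q \<in> Arr C" "Dom C f = Cod C p" "Cod C f = Dom C q"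
      "p \<cdot> p = p" "q \<cdot> q = q" "Dom C q = Cod C q" "Dom C p = Cod C p" for f p q
  proof
    assume f: "f = q \<cdot> f \<cdot> p"
    have "q \<cdot> f = q \<cdot> q \<cdot> f \<cdot> p" by (subst f) simp
    also have "\<dots> = q \<cdot> f \<cdot> p" using that by (simp add: comp_lift[OF that(7)])
    finally have 1: "q \<cdot> f = f" by (simp flip: f)
    have "f \<cdot> p = (q \<cdot> f \<cdot> p) \<cdot> p" by (simp flip: f)
    also have "\<dots> = q \<cdot> f \<cdot> p" using that by simp
    also have "\<dots> = f" by (rule f[symmetric])
    finally show "q \<cdot> f = f \<cdot> p \<and> f \<cdot> p = f" using 1 by simp
  next
    assume "q \<cdot> f = f \<cdot> p \<and> f \<cdot> p = f"
    then show "f = q \<cdot> f \<cdot> p" by simp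
  qed
  have 1: "x \<in> Hom (Split_dagger C) P Q \<longleftrightarrow> (\<exists>f. x = (P, f, Q) \<and> P \<in> split_Ob C \<and> Q \<in> split_Ob C
      \<and> f \<in> Hom C (fst P) (fst Q) \<and> f = snd Q \<cdot> f \<cdot> snd P)"
  proof -
    have A: "Arr (Split_dagger C) = {(P, f, Q). P \<in> split_Ob C \<and> Q \<in> split_Ob C
        \<and> f \<in> Hom C (fst P) (fst Q) \<and> f = snd Q \<cdot> f \<cdot> snd P}"
      by (simp add: Split_dagger_def case_prod_unfold)
    show ?thesis
      unfolding Hom_def[of "Split_dagger C"] A
      by (cases x) (simp only: split_simps(2,3) mem_Collect_eq prod.case prod.inject, blast)
  qed
  have 2: "P \<in> split_Ob C \<and> Q \<in> split_Ob C \<and> f \<in> Hom C (fst P) (fst Q) \<and> f = snd Q \<cdot> f \<cdot> snd P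
      \<longleftrightarrow> splits P f Q \<and> f \<cdot> snd P = f" for f
  proof (cases "P \<in> split_Ob C \<and> Q \<in> split_Ob C \<and> f \<in> Hom C (fst P) (fst Q)")
    case True
    then have "f = snd Q \<cdot> f \<cdot> snd P \<longleftrightarrow> snd Q \<cdot> f = f \<cdot> snd P \<and> f \<cdot> snd P = f"
      by (intro e) (simp_all add: split_Ob_iff Hom_iff)
    with True show ?thesis unfolding splits_def Hom_iff by blast
  next
    case False
    then show ?thesis unfolding splits_def Hom_iff by blast
  qed
  show ?thesis unfolding 1 2 ..
qed

lemma split_HomE:
  assumes "x \<in> Hom (Split_dagger C) P Q"
  obtains f where "x = split_arr C P f Q" "splits P f Q"
proof -
  obtain f where "x = (P, f, Q)" "splits P f Q" "f \<cdot> snd P = f"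
    using assms unfolding split_Hom_iff by blast
  then show thesis by (intro that[of f]) (simp_all add: split_arr_eq)
qed

lemma split_arr_Hom:
  assumes "splits P f Q" shows "split_arr C P f Q \<in> Hom (Split_dagger C) P Q"
  using splitsD[OF assms] assms by (simp add: split_arr_eq split_Hom_iff) (simp add: splits_def)

lemma splits_idn: "P \<in> split_Ob C \<Longrightarrow> splits P (\<one> (fst P)) P"
  using Dom_in_Ob[of "snd P"] by (auto simp: splits_def split_Ob_iff)

lemma splits_comp:
  assumes "splits P f Q" "splits Q g R" shows "splits P (g \<cdot> f) R"
  using assms splitsD[OF assms(1)] splitsD[OF assms(2)] by (simp add: splits_def)

lemma splits_dag:
  assumes "splits P f Q" shows "splits Q (f\<dagger>) P"
proof -
  have "(snd Q \<cdot> f)\<dagger> = (f \<cdot> snd P)\<dagger>" by (simp only: splitsD(4)[OF assms])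
  then have "f\<dagger> \<cdot> snd Q = snd P \<cdot> f\<dagger>"
    using splitsD(1-3,6-9,12-15)[OF assms] by simp
  then show ?thesis using assms splitsD(1)[OF assms] by (simp add: splits_def)
qed

lemma split_TensO_Ob: "P \<in> split_Ob C \<Longrightarrow> Q \<in> split_Ob C \<Longrightarrow> split_TensO C P Q \<in> split_Ob C"
  by (auto simp: split_Ob_iff split_TensO_def tens_merge)

lemma splits_tens:
  assumes "splits P f Q" "splits P' f' Q'"
  shows "splits (split_TensO C P P') (f \<otimes> f') (split_TensO C Q Q')"
  using assms splitsD[OF assms(1)] splitsD[OF assms(2)]
  by (auto simp: splits_def split_TensO_Ob) (auto simp: split_TensO_def tens_merge)

lemma split_ObD:
  assumes "P \<in> split_Ob C"
  shows "snd P \<in> Arr C" "Dom C (snd P) = fst P" "Cod C (snd P) = fst P" "(snd P)\<dagger> = snd P"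
    "snd P \<cdot> snd P = snd P" "h \<in> Arr C \<Longrightarrow> Cod C h = fst P \<Longrightarrow> snd P \<cdot> snd P \<cdot> h = snd P \<cdot> h"
  using assms comp_lift[of "snd P" "snd P" "snd P" h] by (simp_all add: split_Ob_iff)

text \<open>The middle idempotent moves left through \<open>g\<close> and is absorbed by that of
  \<open>R\<close>.\<close>

lemma split_arr_comp:
  assumes "splits Q g R" "P \<in> split_Ob C" "f \<in> Arr C" "Dom C f = fst P" "Cod C f = fst Q"
  shows "Comp (Split_dagger C) (split_arr C Q g R) (split_arr C P f Q) = split_arr C P (g \<cdot> f) R"
proof -
  note [simp] = splitsD(1-3,5-)[OF assms(1)] split_ObD[OF assms(2)]
  have R: "R \<in> split_Ob C" using assms(1) by (simp add: splits_def)
  show ?thesis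
    using assms(3-5) splitsD(5)[OF assms(1), of "f \<cdot> snd P"] split_ObD(6)[OF R, of "g \<cdot> f \<cdot> snd P"]
    by (simp add: split_arr_def split_simps)
qed

lemma split_arr_dag:
  assumes "P \<in> split_Ob C" "Q \<in> split_Ob C" "f \<in> Arr C" "Dom C f = fst P" "Cod C f = fst Q"
  shows "Dag (Split_dagger C) (split_arr C P f Q) = split_arr C Q (f\<dagger>) P"
  using assms split_ObD[OF assms(1)] split_ObD[OF assms(2)]
  by (simp add: split_arr_def split_simps)

lemma split_arr_tens:
  assumes "splits P f Q" "splits P' f' Q'"
  shows "TensA (Split_dagger C) (split_arr C P f Q) (split_arr C P' f' Q')
    = split_arr C (split_TensO C P P') (f \<otimes> f') (split_TensO C Q Q')"
  using splitsD[OF assms(1)] splitsD[OF assms(2)] splits_tens[OF assms] assms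
  by (simp add: split_arr_eq split_simps) (simp add: split_TensO_def tens_merge)

lemma split_arr_idn:
  assumes "P \<in> split_Ob C" shows "Idn (Split_dagger C) P = split_arr C P (\<one> (fst P)) P"
  using assms splits_idn[OF assms] by (simp add: split_arr_eq split_simps split_Ob_iff)

lemmas split_arrs = split_arr_comp split_arr_dag split_arr_tens split_arr_idn
lemmas splits_intros = splits_comp splits_dag splits_tens splits_idn split_TensO_Ob

lemma split_unitary:
  assumes "splits P f Q" "unit_arr f"
  shows "unitary (Split_dagger C) P Q (split_arr C P f Q)"
proof -
  have "P \<in> split_Ob C" "Q \<in> split_Ob C" using assms(1) by (simp_all add: splits_def)
  then show ?thesis
    using assms unit_arrD[OF assms(2)] splitsD(1-3)[OF assms(1)] 
    by (simp add: unitary_def split_arr_Hom split_arrs splits_dag)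
qed

lemma split_UnitO_Ob: "split_UnitO C \<in> split_Ob C"
  by (simp add: split_Ob_iff split_UnitO_def)

lemma splits_structure:
  "P \<in> split_Ob C \<Longrightarrow> Q \<in> split_Ob C \<Longrightarrow> R \<in> split_Ob C \<Longrightarrow>
    splits (split_TensO C (split_TensO C P Q) R) (\<a> (fst P) (fst Q) (fst R)) (split_TensO C P (split_TensO C Q R))"
  "P \<in> split_Ob C \<Longrightarrow> splits (split_TensO C (split_UnitO C) P) (\<l> (fst P)) P"
  "P \<in> split_Ob C \<Longrightarrow> splits (split_TensO C P (split_UnitO C)) (\<r> (fst P)) P"
  "P \<in> split_Ob C \<Longrightarrow> Q \<in> split_Ob C \<Longrightarrow> splits (split_TensO C P Q) (\<sigma> (fst P) (fst Q)) (split_TensO C Q P)"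
proof -
  have O: "fst P \<in> Ob C" if "P \<in> split_Ob C" for P
    using that by (auto simp: split_Ob_def)
  note defs = split_Ob_iff split_TensO_def split_UnitO_def
  show "P \<in> split_Ob C \<Longrightarrow> Q \<in> split_Ob C \<Longrightarrow> R \<in> split_Ob C \<Longrightarrow>
    splits (split_TensO C (split_TensO C P Q) R) (\<a> (fst P) (fst Q) (fst R)) (split_TensO C P (split_TensO C Q R))"
    using O[of P] O[of Q] O[of R]
    by (simp add: splits_def split_TensO_Ob) (simp add: defs a_nat)
  show "P \<in> split_Ob C \<Longrightarrow> splits (split_TensO C (split_UnitO C) P) (\<l> (fst P)) P"
    "P \<in> split_Ob C \<Longrightarrow> splits (split_TensO C P (split_UnitO C)) (\<r> (fst P)) P"
    using O[of P] by (simp_all add: splits_def split_TensO_Ob split_UnitO_Ob) (simp_all add: defs l_nat r_nat)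
  show "P \<in> split_Ob C \<Longrightarrow> Q \<in> split_Ob C \<Longrightarrow> splits (split_TensO C P Q) (\<sigma> (fst P) (fst Q)) (split_TensO C Q P)"
    using O[of P] O[of Q] by (simp add: splits_def split_TensO_Ob) (simp add: defs s_nat)
qed

lemma Split_dsm: "dagger_symmetric_monoidal_category (Split_dagger C)"
proof -
  let ?S = "Split_dagger C"
  note [simp] = split_simps(1,7,9-13) split_arrs splits_intros splits_structure split_UnitO_Ob
  have fO [simp]: "fst P \<in> Ob C" if "P \<in> split_Ob C" for P
    using that by (auto simp: split_Ob_def)
  have fT [simp]: "fst (split_TensO C P Q) = fst P \<odot> fst Q" "fst (split_UnitO C) = \<I>" for P Q
    by (simp_all add: split_TensO_def split_UnitO_def)
  have [simp]: "splits (split_UnitO C) (\<one> \<I>) (split_UnitO C)"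
    using splits_idn[OF split_UnitO_Ob] by simp
  have [simp]: "splits (split_TensO C P Q) (\<one> (fst P \<odot> fst Q)) (split_TensO C P Q)"
    if "P \<in> split_Ob C" "Q \<in> split_Ob C" for P Q
    using splits_idn[OF split_TensO_Ob[OF that]] by simp
  \<comment> \<open>At tensor objects the simplifier has already evaluated \<open>fst\<close>, so
    the arguments of structure maps are matched only up to equations.\<close>
  have [simp]: "splits (split_TensO C P Q) (\<sigma> X Y) (split_TensO C Q P)"
    if "P \<in> split_Ob C" "Q \<in> split_Ob C" "X = fst P" "Y = fst Q" for P Q X Y
    using that by simp
  have [simp]: "splits (split_TensO C (split_TensO C P Q) R) (\<a> X Y Z) (split_TensO C P (split_TensO C Q R))"
    if "P \<in> split_Ob C" "Q \<in> split_Ob C" "R \<in> split_Ob C" "X = fst P" "Y = fst Q" "Z = fst R" for P Q R X Y Z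
    using that by simp
  have O: "P \<in> split_Ob C" "Q \<in> split_Ob C" if "splits P f Q" for P f Q
    using that by (simp_all add: splits_def)
  show ?thesis
  proof unfold_locales
    fix f assume "f \<in> Arr ?S"
    then show "Dom ?S f \<in> Ob ?S" "Cod ?S f \<in> Ob ?S"
      by (auto simp: Split_dagger_def)
  next
    fix X assume "X \<in> Ob ?S"
    then show "Idn ?S X \<in> Hom ?S X X" "Dag ?S (Idn ?S X) = Idn ?S X"
      by (simp_all add: split_arr_Hom)
  next
    fix f g h X Y Z W
    assume "f \<in> Hom ?S X Y"
    then obtain f' where f [simp]: "f = split_arr C X f' Y" "splits X f' Y" by (rule split_HomE)
    note [simp] = splitsD(1-3)[OF f(2)] O[OF f(2)]
    show "Comp ?S (Idn ?S Y) f = f" "Comp ?S f (Idn ?S X) = f" "Dag ?S f \<in> Hom ?S Y X" "Dag ?S (Dag ?S f) = f"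
      by (simp_all add: split_arr_Hom)
    show "Comp ?S (LUnit ?S Y) (TensA ?S (Idn ?S (UnitO ?S)) f) = Comp ?S f (LUnit ?S X)"
      "Comp ?S (RUnit ?S Y) (TensA ?S f (Idn ?S (UnitO ?S))) = Comp ?S f (RUnit ?S X)"
      by (simp_all add: l_nat r_nat)
    assume "g \<in> Hom ?S Y Z"
    then obtain g' where g [simp]: "g = split_arr C Y g' Z" "splits Y g' Z" by (rule split_HomE)
    note [simp] = splitsD(1-3)[OF g(2)] O[OF g(2)]
    note [simp] = splits_comp[OF f(2) g(2)]
    show "Comp ?S g f \<in> Hom ?S X Z" "Dag ?S (Comp ?S g f) = Comp ?S (Dag ?S f) (Dag ?S g)"
      by (simp_all add: split_arr_Hom)
    assume "h \<in> Hom ?S Z W"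
    then obtain h' where h [simp]: "h = split_arr C Z h' W" "splits Z h' W" by (rule split_HomE)
    note [simp] = splitsD(1-3)[OF h(2)]
    note [simp] = splits_comp[OF g(2) h(2)]
    show "Comp ?S (Comp ?S h g) f = Comp ?S h (Comp ?S g f)" by simp
  next
    show "UnitO ?S \<in> Ob ?S" by simp
  next
    fix X Y assume "X \<in> Ob ?S" "Y \<in> Ob ?S"
    then have [simp]: "X \<in> split_Ob C" "Y \<in> split_Ob C" by simp_all
    show "TensO ?S X Y \<in> Ob ?S" "TensA ?S (Idn ?S X) (Idn ?S Y) = Idn ?S (TensO ?S X Y)"
      "unitary ?S (TensO ?S (UnitO ?S) X) X (LUnit ?S X)" "unitary ?S (TensO ?S X (UnitO ?S)) X (RUnit ?S X)"
      "unitary ?S (TensO ?S X Y) (TensO ?S Y X) (Symm ?S X Y)"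
      "Comp ?S (TensA ?S (Idn ?S X) (LUnit ?S Y)) (Assoc ?S X (UnitO ?S) Y) = TensA ?S (RUnit ?S X) (Idn ?S Y)"
      "Comp ?S (Symm ?S Y X) (Symm ?S X Y) = Idn ?S (TensO ?S X Y)"
      by (simp_all add: split_unitary triangle)
    fix Z assume "Z \<in> Ob ?S"
    then have [simp]: "Z \<in> split_Ob C" by simp
    show "unitary ?S (TensO ?S (TensO ?S X Y) Z) (TensO ?S X (TensO ?S Y Z)) (Assoc ?S X Y Z)"
      "Comp ?S (Assoc ?S Y Z X) (Comp ?S (Symm ?S X (TensO ?S Y Z)) (Assoc ?S X Y Z))
        = Comp ?S (TensA ?S (Idn ?S Y) (Symm ?S X Z)) (Comp ?S (Assoc ?S Y X Z) (TensA ?S (Symm ?S X Y) (Idn ?S Z)))"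
      by (simp_all add: split_unitary hexagon)
    fix W assume "W \<in> Ob ?S"
    then have [simp]: "W \<in> split_Ob C" by simp
    show "Comp ?S (TensA ?S (Idn ?S X) (Assoc ?S Y Z W))
        (Comp ?S (Assoc ?S X (TensO ?S Y Z) W) (TensA ?S (Assoc ?S X Y Z) (Idn ?S W)))
      = Comp ?S (Assoc ?S X Y (TensO ?S Z W)) (Assoc ?S (TensO ?S X Y) Z W)"
      by (simp add: pentagon)
  next
    fix f X X' g Y Y'
    assume "f \<in> Hom ?S X X'"
    then obtain f' where f [simp]: "f = split_arr C X f' X'" "splits X f' X'" by (rule split_HomE)
    assume "g \<in> Hom ?S Y Y'"
    then obtain g' where g [simp]: "g = split_arr C Y g' Y'" "splits Y g' Y'" by (rule split_HomE)
    note [simp] = splitsD(1-3)[OF f(2)] O[OF f(2)] splitsD(1-3)[OF g(2)] O[OF g(2)]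
    show "TensA ?S f g \<in> Hom ?S (TensO ?S X Y) (TensO ?S X' Y')"
      "Dag ?S (TensA ?S f g) = TensA ?S (Dag ?S f) (Dag ?S g)"
      "Comp ?S (Symm ?S X' Y') (TensA ?S f g) = Comp ?S (TensA ?S g f) (Symm ?S X Y)"
      by (simp_all add: split_arr_Hom s_nat)
    fix h Z Z' assume "h \<in> Hom ?S Z Z'"
    then obtain h' where h [simp]: "h = split_arr C Z h' Z'" "splits Z h' Z'" by (rule split_HomE)
    note [simp] = splitsD(1-3)[OF h(2)] O[OF h(2)]
    show "Comp ?S (Assoc ?S X' Y' Z') (TensA ?S (TensA ?S f g) h) = Comp ?S (TensA ?S f (TensA ?S g h)) (Assoc ?S X Y Z)"
      by (simp add: a_nat)
  next
    fix f X Y f' Z g U W g' W'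
    assume "f \<in> Hom ?S X Y" "f' \<in> Hom ?S Y Z" "g \<in> Hom ?S U W" "g' \<in> Hom ?S W W'"
    then obtain k k' l l' where *: "f = split_arr C X k Y" "f' = split_arr C Y k' Z"
      "g = split_arr C U l W" "g' = split_arr C W l' W'" "splits X k Y" "splits Y k' Z" "splits U l W" "splits W l' W'"
      by (metis split_HomE)
    then show "TensA ?S (Comp ?S f' f) (Comp ?S g' g) = Comp ?S (TensA ?S f' g') (TensA ?S f g)"
      using splitsD(1-3)[OF *(5)] splitsD(1-3)[OF *(6)] splitsD(1-3)[OF *(7)] splitsD(1-3)[OF *(8)]
        O[OF *(5)] O[OF *(6)] O[OF *(7)] O[OF *(8)] splits_comp[OF *(5,6)] splits_comp[OF *(7,8)]
      by (simp add: tens_comp)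
  qed
qed

subsection \<open>Dagger Frobenius algebras\<close>

text \<open>Passing \<open>Y\<close> and \<open>W\<close> one after the other is passing their
  tensor product, and the swap is natural in that factor for the symmetry of \<open>Y\<close> and
  \<open>W\<close>.\<close>

lemma yang_baxter:
  assumes [simp]: "X \<in> Ob C" "Y \<in> Ob C" "W \<in> Ob C" "Z \<in> Ob C"
  shows "sw Y W (X \<odot> Z) \<cdot> (\<one> Y \<otimes> sw X W Z) \<cdot> sw X Y (W \<odot> Z)
    = (\<one> W \<otimes> sw X Y Z) \<cdot> sw X W (Y \<odot> Z) \<cdot> (\<one> X \<otimes> sw Y W Z)"
proof -
  have "sw Y W (X \<odot> Z) \<cdot> (\<one> Y \<otimes> sw X W Z) \<cdot> sw X Y (W \<odot> Z)
    = \<a> W Y (X \<odot> Z) \<cdot> ((\<sigma> Y W \<otimes> \<one> (X \<odot> Z)) \<cdot> sw X (Y \<odot> W) Z) \<cdot> (\<one> X \<otimes> (\<a> Y W Z)\<dagger>)"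
    by (simp add: sw_def[of Y W "X \<odot> Z"] sw_tens_mid' winv)
  also have "(\<sigma> Y W \<otimes> \<one> (X \<odot> Z)) \<cdot> sw X (Y \<odot> W) Z = sw X (W \<odot> Y) Z \<cdot> (\<one> X \<otimes> \<sigma> Y W \<otimes> \<one> Z)"
    by (simp add: sw_nat_idn')
  also have "\<a> W Y (X \<odot> Z) \<cdot> (sw X (W \<odot> Y) Z \<cdot> (\<one> X \<otimes> \<sigma> Y W \<otimes> \<one> Z)) \<cdot> (\<one> X \<otimes> (\<a> Y W Z)\<dagger>)
    = (\<one> W \<otimes> sw X Y Z) \<cdot> sw X W (Y \<odot> Z) \<cdot> (\<one> X \<otimes> sw Y W Z)"
    by (simp add: sw_def[of Y W Z] comp_lift[OF sw_tens_mid] whisk)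
  finally show ?thesis .
qed

end

section \<open>Multiplications, actions and the trace of right multiplication\<close>

locale multiplication = dagger_compact_category V
  for V :: "('o, 'a, 'x) dc_cat_scheme" (structure) +
  fixes A :: 'o and m :: 'a
  assumes A_Ob [simp]: "A \<in> Ob V"
    and m_arr [simp]: "m \<in> Arr V" "Dom V m = A \<odot> A" "Cod V m = A"
begin

definition mm :: "'o \<Rightarrow> 'a" where "mm Y = (m \<otimes> \<one> Y) \<cdot> (\<a> A A Y)\<dagger>"

abbreviation act :: 'a where "act \<equiv> action V A m"

lemma mm_arr [simp]:
  assumes "Y \<in> Ob V"
  shows "mm Y \<in> Arr V" "Dom V (mm Y) = A \<odot> A \<odot> Y" "Cod V (mm Y) = A \<odot> Y"
  using assms by (simp_all add: mm_def)

lemma mm_nat: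
  assumes "h \<in> Arr V" "Cod V h = Y"
  shows "mm Y \<cdot> (\<one> A \<otimes> \<one> A \<otimes> h) = (\<one> A \<otimes> h) \<cdot> mm (Dom V h)"
proof -
  have "(\<a> A A Y)\<dagger> \<cdot> (\<one> A \<otimes> \<one> A \<otimes> h) = (\<one> (A \<odot> A) \<otimes> h) \<cdot> (\<a> A A (Dom V h))\<dagger>"
    using ad_nat[of "\<one> A" "\<one> A" h A A Y] assms by simp
  note this[simp]
  have [simp]: "Y \<in> Ob V" using assms by auto
  show ?thesis using assms by (simp add: mm_def swap_whisk comp_lift[OF swap_whisk])
qed

lemma act_eq: "act = (\<one> (A\<^sup>\<star>) \<otimes> m) \<cdot> cv A A"
  by (simp add: action_def cv_def)

lemma act_arr [simp]: "act \<in> Arr V" "Dom V act = A" "Cod V act = A\<^sup>\<star> \<odot> A"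
  by (simp_all add: act_eq)

lemma ev_act: "ev A A \<cdot> (\<one> A \<otimes> act) = m"
  by (simp add: act_eq whisk ev_nats ev_cv)

lemma mm_sw:
  assumes [simp]: "X \<in> Ob V" "Y \<in> Ob V"
  shows "sw A X Y \<cdot> mm (X \<odot> Y) = (\<one> X \<otimes> mm Y) \<cdot> sw A X (A \<odot> Y) \<cdot> (\<one> A \<otimes> sw A X Y)"
  by (simp add: mm_def comp_lift[OF sw_nat_idn] sw_tens_first whisk)

text \<open>The partial trace of the symmetry is the identity: a snake equation after
  \<open>cv_slide\<close> has turned the loop into one.\<close>

lemma cv_yank:
  assumes [simp]: "Y \<in> Ob V"
  shows "(cv A (A \<odot> Y))\<dagger> \<cdot> (\<one> (A\<^sup>\<star>) \<otimes> sw A A Y) \<cdot> cv A (A \<odot> Y) = \<one> (A \<odot> Y)"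
proof -
  have d: "(ev A (A \<odot> Y))\<dagger> = sw (A\<^sup>\<star>) A (A \<odot> Y) \<cdot> cv A (A \<odot> Y)"
    by (simp add: ev_eq)
  have "\<one> A \<otimes> cv A Y = sw (A\<^sup>\<star>) A (A \<odot> Y) \<cdot> (\<one> (A\<^sup>\<star>) \<otimes> sw A A Y) \<cdot> cv A (A \<odot> Y)"
    by (simp add: cv_slide)
  then have "(ev A (A \<odot> Y) \<cdot> (\<one> A \<otimes> cv A Y)) = (cv A (A \<odot> Y))\<dagger> \<cdot> sw A (A\<^sup>\<star>) (A \<odot> Y) \<cdot> sw (A\<^sup>\<star>) A (A \<odot> Y) \<cdot> (\<one> (A\<^sup>\<star>) \<otimes> sw A A Y) \<cdot> cv A (A \<odot> Y)"
    by (simp add: ev_eq)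
  then show ?thesis by (simp add: ev_cv)
qed

text \<open>In terms of elements, both sides send \<open>a \<otimes> \<phi> \<otimes> b \<otimes> y\<close> to \<open>\<phi>(b a) y\<close>; the left hand side
  computes this as a trace.\<close>

lemma trace_mult:
  assumes [simp]: "Y \<in> Ob V"
  shows "(cv A Y)\<dagger> \<cdot> (\<one> (A\<^sup>\<star>) \<otimes> (ev A (A \<odot> Y) \<cdot> mm (A\<^sup>\<star> \<odot> A \<odot> Y))) \<cdot> cv A (A \<odot> A\<^sup>\<star> \<odot> A \<odot> Y)
    = (cv A Y)\<dagger> \<cdot> (\<one> (A\<^sup>\<star>) \<otimes> (mm Y \<cdot> sw A A Y)) \<cdot> sw A (A\<^sup>\<star>) (A \<odot> Y)"
proof -
  let ?Y' = "A\<^sup>\<star> \<odot> Y"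
  let ?x = "sw A A ?Y' \<cdot> (\<one> A \<otimes> sw (A\<^sup>\<star>) A Y)"
  \<comment> \<open>A swap is inserted and undone, so that \<open>ev_slide\<close> can carry the
    contraction past the strand that is being traced.\<close>
  have "ev A (A \<odot> Y) = ev A (A \<odot> Y) \<cdot> (\<one> A \<otimes> sw A (A\<^sup>\<star>) Y) \<cdot> (\<one> A \<otimes> sw (A\<^sup>\<star>) A Y)"
    by (simp add: tens_merge)
  then have e: "ev A (A \<odot> Y) = (\<one> A \<otimes> ev A Y) \<cdot> sw A A ?Y' \<cdot> (\<one> A \<otimes> sw (A\<^sup>\<star>) A Y)"
    by (simp add: comp_lift[OF ev_slide])
  have "ev A (A \<odot> Y) \<cdot> mm (A\<^sup>\<star> \<odot> A \<odot> Y) = (\<one> A \<otimes> ev A Y) \<cdot> (sw A A ?Y' \<cdot> mm (A \<odot> ?Y')) \<cdot> (\<one> A \<otimes> \<one> A \<otimes> sw (A\<^sup>\<star>) A Y)"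
    unfolding e by (simp add: mm_nat)
  also have "\<dots> = (\<one> A \<otimes> (ev A Y \<cdot> mm ?Y')) \<cdot> sw A A (A \<odot> ?Y') \<cdot> (\<one> A \<otimes> ?x)"
    unfolding mm_sw[OF A_Ob TensO_Ob[OF Dual_Ob[OF A_Ob] assms]] by (simp add: whisk)
  finally have "(cv A Y)\<dagger> \<cdot> (\<one> (A\<^sup>\<star>) \<otimes> (ev A (A \<odot> Y) \<cdot> mm (A\<^sup>\<star> \<odot> A \<odot> Y))) \<cdot> cv A (A \<odot> A\<^sup>\<star> \<odot> A \<odot> Y)
    = (cv A Y)\<dagger> \<cdot> (\<one> (A\<^sup>\<star>) \<otimes> ((\<one> A \<otimes> (ev A Y \<cdot> mm ?Y')) \<cdot> sw A A (A \<odot> ?Y') \<cdot> (\<one> A \<otimes> ?x))) \<cdot> cv A (A \<odot> A\<^sup>\<star> \<odot> A \<odot> Y)"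
    by (simp only:)
  \<comment> \<open>All other maps have been pulled out of the loop, which now contains a single
    swap and is removed by \<open>cv_yank\<close>.\<close>
  also have "\<dots> = (ev A Y \<cdot> mm ?Y') \<cdot> ((cv A (A \<odot> A \<odot> ?Y'))\<dagger> \<cdot> (\<one> (A\<^sup>\<star>) \<otimes> sw A A (A \<odot> ?Y')) \<cdot> cv A (A \<odot> A \<odot> ?Y')) \<cdot> ?x"
    by (simp add: whisk ev_nats cv_nat comp_lift[OF cv_nat])
  also have "\<dots> = (ev A Y \<cdot> mm ?Y') \<cdot> ?x"
    by (subst cv_yank) simp_all
  also have "\<dots> = (cv A Y)\<dagger> \<cdot> (sw A (A\<^sup>\<star>) Y \<cdot> mm ?Y') \<cdot> ?x"
    by (simp add: ev_eq)
  also have "\<dots> = (cv A Y)\<dagger> \<cdot> (\<one> (A\<^sup>\<star>) \<otimes> mm Y) \<cdot> (sw A (A\<^sup>\<star>) (A \<odot> Y) \<cdot> (\<one> A \<otimes> sw A (A\<^sup>\<star>) Y) \<cdot> sw A A ?Y') \<cdot> (\<one> A \<otimes> sw (A\<^sup>\<star>) A Y)"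
    unfolding mm_sw[OF Dual_Ob[OF A_Ob] assms] by simp
  also have "\<dots> = (cv A Y)\<dagger> \<cdot> (\<one> (A\<^sup>\<star>) \<otimes> mm Y) \<cdot> (\<one> (A\<^sup>\<star>) \<otimes> sw A A Y) \<cdot> sw A (A\<^sup>\<star>) (A \<odot> Y) \<cdot> ((\<one> A \<otimes> sw A (A\<^sup>\<star>) Y) \<cdot> (\<one> A \<otimes> sw (A\<^sup>\<star>) A Y))"
    by (subst yang_baxter) simp_all
  also have "(\<one> A \<otimes> sw A (A\<^sup>\<star>) Y) \<cdot> (\<one> A \<otimes> sw (A\<^sup>\<star>) A Y) = \<one> (A \<odot> A\<^sup>\<star> \<odot> A \<odot> Y)"
    by (simp add: tens_comp)
  finally show ?thesis by (simp add: whisk)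
qed

lemma cv_unit: "(cv A \<I>)\<dagger> \<cdot> (\<one> (A\<^sup>\<star>) \<otimes> (\<r> A)\<dagger>) = (\<eta> A)\<dagger>"
proof -
  have "(\<a> (A\<^sup>\<star>) A \<I>)\<dagger> \<cdot> (\<one> (A\<^sup>\<star>) \<otimes> (\<r> A)\<dagger>) = (\<r> (A\<^sup>\<star> \<odot> A))\<dagger>"
    by (rule dag_inject) (simp_all add: r_tens)
  then show ?thesis by (simp add: cv_def r_nat comp_lift[OF r_nat] flip: l_eq_r)
qed

lemma mm_assoc:
  assumes as: "m \<cdot> (m \<otimes> \<one> A) = m \<cdot> (\<one> A \<otimes> m) \<cdot> \<a> A A A" and [simp]: "Y \<in> Ob V"
  shows "mm Y \<cdot> (\<one> A \<otimes> mm Y) = mm Y \<cdot> mm (A \<odot> Y)"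
proof -
  have "mm Y \<cdot> mm (A \<odot> Y) = ((m \<cdot> (m \<otimes> \<one> A)) \<otimes> \<one> Y) \<cdot> (\<a> (A \<odot> A) A Y)\<dagger> \<cdot> (\<a> A A (A \<odot> Y))\<dagger>"
    by (simp add: mm_def nat whisk)
  also have "\<dots> = mm Y \<cdot> (\<one> A \<otimes> mm Y)"
    unfolding as by (simp add: mm_def whisk nat pents)
  finally show ?thesis by simp
qed

text \<open>As \<^term>\<open>act\<close> sends \<open>c\<close> to right multiplication by \<open>c\<close>, this is the trace of that map.\<close>

definition tau :: 'a where "tau = (\<eta> A)\<dagger> \<cdot> act"

lemma tau_arr [simp]: "tau \<in> Arr V" "Dom V tau = A" "Cod V tau = \<I>"
  by (simp_all add: tau_def)

text \<open>Cyclicity of the trace. The value at ab is the trace of x \<mapsto> (xa)b; expanding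
  multiplication by b through \<open>act\<close> and applying \<open>trace_mult\<close> turns this
  into the trace of x \<mapsto> (xb)a.\<close>

lemma tau_sym:
  assumes as: "m \<cdot> (m \<otimes> \<one> A) = m \<cdot> (\<one> A \<otimes> m) \<cdot> \<a> A A A"
  shows "tau \<cdot> m \<cdot> \<sigma> A A = tau \<cdot> m"
proof -
  let ?DA = "A\<^sup>\<star> \<odot> A"
  have mas: "m \<cdot> (\<one> A \<otimes> m) = m \<cdot> mm A"
    using arg_cong[OF as, of "\<lambda>x. x \<cdot> (\<a> A A A)\<dagger>"] by (simp add: mm_def)
  have 1: "tau \<cdot> m = (\<eta> A)\<dagger> \<cdot> (\<one> (A\<^sup>\<star>) \<otimes> (m \<cdot> mm A)) \<cdot> cv A (A \<odot> A)"
    by (simp add: tau_def act_eq cv_nat comp_lift[OF cv_nat] whisk flip: mas)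
  have "m \<cdot> mm A = ev A A \<cdot> (\<one> A \<otimes> act) \<cdot> mm A" by (simp add: comp_lift[OF ev_act])
  also have "\<dots> = ev A A \<cdot> mm ?DA \<cdot> (\<one> A \<otimes> \<one> A \<otimes> act)" by (simp add: mm_nat)
  finally have 2: "m \<cdot> mm A = ev A A \<cdot> mm ?DA \<cdot> (\<one> A \<otimes> \<one> A \<otimes> act)" .
  \<comment> \<open>\<open>trace_mult\<close> carries a spectator. Here it is the unit object,
    introduced and removed through the unitor.\<close>
  have "(\<r> A)\<dagger> \<cdot> ev A A \<cdot> mm ?DA = ev A (A \<odot> \<I>) \<cdot> mm (A\<^sup>\<star> \<odot> A \<odot> \<I>) \<cdot> (\<one> A \<otimes> \<one> A \<otimes> \<one> (A\<^sup>\<star>) \<otimes> (\<r> A)\<dagger>)"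
    by (simp add: mm_nat comp_lift[OF mm_nat] ev_nats)
  then have "(\<eta> A)\<dagger> \<cdot> (\<one> (A\<^sup>\<star>) \<otimes> (ev A A \<cdot> mm ?DA)) \<cdot> cv A (A \<odot> ?DA)
    = (cv A \<I>)\<dagger> \<cdot> (\<one> (A\<^sup>\<star>) \<otimes> (ev A (A \<odot> \<I>) \<cdot> mm (A\<^sup>\<star> \<odot> A \<odot> \<I>) \<cdot> (\<one> A \<otimes> \<one> A \<otimes> \<one> (A\<^sup>\<star>) \<otimes> (\<r> A)\<dagger>))) \<cdot> cv A (A \<odot> ?DA)"
    unfolding cv_unit[symmetric] by (simp add: tens_merge)
  also have "\<dots> = ((cv A \<I>)\<dagger> \<cdot> (\<one> (A\<^sup>\<star>) \<otimes> (ev A (A \<odot> \<I>) \<cdot> mm (A\<^sup>\<star> \<odot> A \<odot> \<I>))) \<cdot> cv A (A \<odot> A\<^sup>\<star> \<odot> A \<odot> \<I>)) \<cdot> (\<one> A \<otimes> \<one> (A\<^sup>\<star>) \<otimes> (\<r> A)\<dagger>)"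
    by (simp add: whisk cv_nat comp_lift[OF cv_nat])
  also have "\<dots> = (cv A \<I>)\<dagger> \<cdot> (\<one> (A\<^sup>\<star>) \<otimes> (mm \<I> \<cdot> sw A A \<I> \<cdot> (\<one> A \<otimes> (\<r> A)\<dagger>))) \<cdot> sw A (A\<^sup>\<star>) A"
    by (subst trace_mult) (simp_all add: whisk sw_nat_last)
  also have "mm \<I> \<cdot> sw A A \<I> \<cdot> (\<one> A \<otimes> (\<r> A)\<dagger>) = (\<r> A)\<dagger> \<cdot> m \<cdot> \<sigma> A A"
  proof -
    have r: "(\<a> A A \<I>)\<dagger> \<cdot> (\<one> A \<otimes> (\<r> A)\<dagger>) = (\<r> (A \<odot> A))\<dagger>"
      by (rule dag_inject) (simp_all add: r_tens)
    show ?thesis by (simp add: mm_def sw_def r rd_nat comp_lift[OF rd_nat] whisk)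
  qed
  also have "(cv A \<I>)\<dagger> \<cdot> (\<one> (A\<^sup>\<star>) \<otimes> ((\<r> A)\<dagger> \<cdot> m \<cdot> \<sigma> A A)) \<cdot> sw A (A\<^sup>\<star>) A = (\<eta> A)\<dagger> \<cdot> (\<one> (A\<^sup>\<star>) \<otimes> (m \<cdot> \<sigma> A A)) \<cdot> sw A (A\<^sup>\<star>) A"
    unfolding cv_unit[symmetric] by (simp add: whisk)
  finally have 3: "(\<eta> A)\<dagger> \<cdot> (\<one> (A\<^sup>\<star>) \<otimes> (ev A A \<cdot> mm ?DA)) \<cdot> cv A (A \<odot> ?DA) = (\<eta> A)\<dagger> \<cdot> (\<one> (A\<^sup>\<star>) \<otimes> (m \<cdot> \<sigma> A A)) \<cdot> sw A (A\<^sup>\<star>) A" .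
  have cs: "sw A (A\<^sup>\<star>) (A \<odot> A) \<cdot> (\<one> A \<otimes> cv A A) = (\<one> (A\<^sup>\<star>) \<otimes> sw A A A) \<cdot> cv A (A \<odot> A)"
    by (simp flip: cv_slide)
  have ss: "\<sigma> A (A \<odot> A) \<cdot> sw A A A = (\<a> A A A)\<dagger> \<cdot> (\<one> A \<otimes> \<sigma> A A)"
  proof -
    have "\<sigma> A (A \<odot> A) = (\<a> A A A)\<dagger> \<cdot> (\<one> A \<otimes> \<sigma> A A) \<cdot> sw A A A"
      by (subst sigma_tens_right) (simp_all add: sw_def)
    then show ?thesis by simp
  qed
  have "tau \<cdot> m = ((\<eta> A)\<dagger> \<cdot> (\<one> (A\<^sup>\<star>) \<otimes> (ev A A \<cdot> mm ?DA)) \<cdot> cv A (A \<odot> ?DA)) \<cdot> (\<one> A \<otimes> act)"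
    unfolding 1 2 by (simp add: whisk cv_nat comp_lift[OF cv_nat])
  also have "\<dots> = (\<eta> A)\<dagger> \<cdot> (\<one> (A\<^sup>\<star>) \<otimes> (m \<cdot> \<sigma> A A)) \<cdot> sw A (A\<^sup>\<star>) A \<cdot> (\<one> A \<otimes> act)"
    unfolding 3 by simp
  also have "\<dots> = (\<eta> A)\<dagger> \<cdot> (\<one> (A\<^sup>\<star>) \<otimes> (m \<cdot> \<sigma> A A \<cdot> (\<one> A \<otimes> m) \<cdot> sw A A A)) \<cdot> cv A (A \<odot> A)"
    by (simp add: act_eq whisk sw_nats comp_lift[OF sw_nat_last] cs)
  also have "m \<cdot> \<sigma> A A \<cdot> (\<one> A \<otimes> m) \<cdot> sw A A A = m \<cdot> mm A \<cdot> (\<one> A \<otimes> \<sigma> A A)"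
    by (simp add: comp_lift[OF s_nat_idn(2)] ss mm_def)
  also have "(\<eta> A)\<dagger> \<cdot> (\<one> (A\<^sup>\<star>) \<otimes> (m \<cdot> mm A \<cdot> (\<one> A \<otimes> \<sigma> A A))) \<cdot> cv A (A \<odot> A)
    = ((\<eta> A)\<dagger> \<cdot> (\<one> (A\<^sup>\<star>) \<otimes> (m \<cdot> mm A)) \<cdot> cv A (A \<odot> A)) \<cdot> \<sigma> A A"
    by (simp add: whisk cv_nat)
  also have "\<dots> = (tau \<cdot> m) \<cdot> \<sigma> A A" unfolding 1 ..
  finally show ?thesis by simp
qed

end

context dagger_compact_category
begin

text \<open>\<open>transpose_eta\<close> with a spectator: along a created pair, an arrow on the
  dual strand may be traded for its dagger on the other strand.\<close>

lemma cv_ls: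
  assumes "g \<in> Arr V" "Dom V g = A" and [simp]: "Y \<in> Ob V"
  shows "(lower_star V g \<otimes> \<one> (A \<odot> Y)) \<cdot> cv A Y = (\<one> ((Cod V g)\<^sup>\<star>) \<otimes> g\<dagger> \<otimes> \<one> Y) \<cdot> cv (Cod V g) Y"
proof -
  let ?B = "Cod V g"
  have [simp]: "A \<in> Ob V" using assms by auto
  have e: "(lower_star V g \<otimes> \<one> A) \<cdot> \<eta> A = (\<one> (?B\<^sup>\<star>) \<otimes> g\<dagger>) \<cdot> \<eta> ?B"
    using transpose_eta[of "g\<dagger>" A] assms by (simp add: lower_star_def)
  have "(lower_star V g \<otimes> \<one> (A \<odot> Y)) \<cdot> cv A Y = \<a> (?B\<^sup>\<star>) A Y \<cdot> (((lower_star V g \<otimes> \<one> A) \<cdot> \<eta> A) \<otimes> \<one> Y) \<cdot> (\<l> Y)\<dagger>"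
    using assms by (simp add: cv_def whisk nat)
  also have "\<dots> = (\<one> (?B\<^sup>\<star>) \<otimes> g\<dagger> \<otimes> \<one> Y) \<cdot> cv ?B Y"
    unfolding e using assms by (simp add: cv_def whisk nat)
  finally show ?thesis .
qed

end

section \<open>The Frobenius form and complete positivity of the action\<close>

locale frobenius_algebra = multiplication +
  fixes u :: 'b
  assumes u_arr [simp]: "u \<in> Arr V" "Dom V u = \<I>" "Cod V u = A"
    and m_assoc: "m \<cdot> (m \<otimes> \<one> A) = m \<cdot> (\<one> A \<otimes> m) \<cdot> \<a> A A A"
    and m_unit_left: "m \<cdot> (u \<otimes> \<one> A) = \<l> A"
    and m_unit_right: "m \<cdot> (\<one> A \<otimes> u) = \<r> A"
    and frob_left: "(m \<otimes> \<one> A) \<cdot> (\<a> A A A)\<dagger> \<cdot> (\<one> A \<otimes> m\<dagger>) = m\<dagger> \<cdot> m"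
    and frob_right: "m\<dagger> \<cdot> m = (\<one> A \<otimes> m) \<cdot> \<a> A A A \<cdot> (m\<dagger> \<otimes> \<one> A)"
begin

definition uu :: "'a \<Rightarrow> 'b" where "uu Y = (u \<otimes> \<one> Y) \<cdot> (\<l> Y)\<dagger>"

lemma uu_arr [simp]:
  assumes "Y \<in> Ob V" shows "uu Y \<in> Arr V" "Dom V (uu Y) = Y" "Cod V (uu Y) = A \<odot> Y"
  using assms by (simp_all add: uu_def)

lemma uu_nat:
  assumes "f \<in> Arr V" "Cod V f = Y" shows "uu Y \<cdot> f = (\<one> A \<otimes> f) \<cdot> uu (Dom V f)"
proof -
  have [simp]: "Y \<in> Ob V" using assms by auto
  show ?thesis using assms by (simp add: uu_def ld_nat swap_whisk comp_lift[OF swap_whisk])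
qed

lemma mm_uu_left:
  assumes [simp]: "Y \<in> Ob V" shows "mm Y \<cdot> uu (A \<odot> Y) = \<one> (A \<odot> Y)"
proof -
  have "mm Y \<cdot> uu (A \<odot> Y) = ((m \<cdot> (u \<otimes> \<one> A)) \<otimes> \<one> Y) \<cdot> (\<a> \<I> A Y)\<dagger> \<cdot> (\<l> (A \<odot> Y))\<dagger>"
    by (simp add: mm_def uu_def nat whisk)
  then show ?thesis unfolding m_unit_left by (simp flip: l_tens)
qed

lemma mm_uu_right:
  assumes [simp]: "Y \<in> Ob V" shows "mm Y \<cdot> (\<one> A \<otimes> uu Y) = \<one> (A \<odot> Y)"
proof -
  have "mm Y \<cdot> (\<one> A \<otimes> uu Y) = ((m \<cdot> (\<one> A \<otimes> u)) \<otimes> \<one> Y) \<cdot> (\<a> A \<I> Y)\<dagger> \<cdot> (\<one> A \<otimes> (\<l> Y)\<dagger>)"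
    by (simp add: mm_def uu_def nat whisk)
  then show ?thesis unfolding m_unit_right by (simp flip: triangle add: winv)
qed

lemma mm_frob:
  assumes [simp]: "Y \<in> Ob V" shows "(\<one> A \<otimes> mm Y) \<cdot> (mm (A \<odot> Y))\<dagger> = (mm Y)\<dagger> \<cdot> mm Y"
proof -
  have "(mm Y)\<dagger> \<cdot> mm Y = \<a> A A Y \<cdot> ((m\<dagger> \<cdot> m) \<otimes> \<one> Y) \<cdot> (\<a> A A Y)\<dagger>"
    by (simp add: mm_def whisk)
  also have "\<dots> = (\<one> A \<otimes> mm Y) \<cdot> (mm (A \<odot> Y))\<dagger>"
    unfolding frob_right by (simp add: mm_def whisk nat pents)
  finally show ?thesis by simp
qed

text \<open>The form \<open>a \<otimes> b \<mapsto> u\<^sup>\<dagger>(a b)\<close>, tensored with \<open>Y\<close>.\<close>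

definition bb :: "'a \<Rightarrow> 'b" where "bb Y = (uu Y)\<dagger> \<cdot> mm Y"

lemma bb_arr [simp]:
  assumes "Y \<in> Ob V" shows "bb Y \<in> Arr V" "Dom V (bb Y) = A \<odot> A \<odot> Y" "Cod V (bb Y) = Y"
  using assms by (simp_all add: bb_def)

lemma bb_nat:
  assumes "h \<in> Arr V" "Cod V h = Y"
  shows "bb Y \<cdot> (\<one> A \<otimes> \<one> A \<otimes> h) = h \<cdot> bb (Dom V h)"
proof -
  have [simp]: "Y \<in> Ob V" using assms by auto
  have "(uu Y)\<dagger> \<cdot> (\<one> A \<otimes> h) = h \<cdot> (uu (Dom V h))\<dagger>"
    by (rule dag_inject) (use assms in \<open>simp_all add: uu_nat\<close>)
  note comp_lift[OF this, simp]
  show ?thesis using assms by (simp add: bb_def mm_nat)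
qed

text \<open>The Frobenius law makes the form nondegenerate: the comultiplied unit inverts it (fact
  \<open>b\<close>), so \<open>f\<close> is rebuilt from its pairing.\<close>

lemma bb_inject:
  assumes "f \<in> Arr V" "g \<in> Arr V" "Dom V f = Dom V g" "Cod V f = A \<odot> Y" "Cod V g = A \<odot> Y"
    and [simp]: "Y \<in> Ob V" and eq: "bb Y \<cdot> (\<one> A \<otimes> f) = bb Y \<cdot> (\<one> A \<otimes> g)"
  shows "f = g"
proof -
  have u: "(\<one> A \<otimes> (uu Y)\<dagger>) \<cdot> (mm Y)\<dagger> = \<one> (A \<odot> Y)"
    by (rule dag_inject) (simp_all add: mm_uu_right)
  have "(\<one> A \<otimes> bb Y) \<cdot> (mm (A \<odot> Y))\<dagger> \<cdot> uu (A \<odot> Y)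
    = (\<one> A \<otimes> (uu Y)\<dagger>) \<cdot> ((\<one> A \<otimes> mm Y) \<cdot> (mm (A \<odot> Y))\<dagger>) \<cdot> uu (A \<odot> Y)"
    by (simp add: bb_def whisk)
  also have "\<dots> = \<one> (A \<odot> Y)"
    unfolding mm_frob[OF \<open>Y \<in> Ob V\<close>] by (simp add: u mm_uu_left)
  finally have b: "(\<one> A \<otimes> bb Y) \<cdot> (mm (A \<odot> Y))\<dagger> \<cdot> uu (A \<odot> Y) = \<one> (A \<odot> Y)" .
  have *: "k = (\<one> A \<otimes> (bb Y \<cdot> (\<one> A \<otimes> k))) \<cdot> (mm (Dom V k))\<dagger> \<cdot> uu (Dom V k)"
    if [simp]: "k \<in> Arr V" "Cod V k = A \<odot> Y" for k
  proof -
    have n: "(mm (A \<odot> Y))\<dagger> \<cdot> (\<one> A \<otimes> k) = (\<one> A \<otimes> \<one> A \<otimes> k) \<cdot> (mm (Dom V k))\<dagger>"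
      by (rule dag_inject) (simp_all add: mm_nat)
    have "k = ((\<one> A \<otimes> bb Y) \<cdot> (mm (A \<odot> Y))\<dagger> \<cdot> uu (A \<odot> Y)) \<cdot> k" unfolding b by simp
    also have "\<dots> = (\<one> A \<otimes> (bb Y \<cdot> (\<one> A \<otimes> k))) \<cdot> (mm (Dom V k))\<dagger> \<cdot> uu (Dom V k)"
      by (simp add: uu_nat comp_lift[OF n] whisk)
    finally show ?thesis .
  qed
  show ?thesis
    by (subst *[OF assms(1,4)], subst *[OF assms(2,5)]) (simp only: eq assms(3))
qed

lemma bb_slide:
  assumes [simp]: "X \<in> Ob V" "Y \<in> Ob V"
  shows "bb (X \<odot> Y) \<cdot> (\<one> A \<otimes> sw X A Y) = (\<one> X \<otimes> bb Y) \<cdot> sw A X (A \<odot> Y)"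
proof -
  have "sw X A Y \<cdot> (\<one> X \<otimes> uu Y) = uu (X \<odot> Y)"
    by (simp add: uu_def whisk comp_lift[OF sw_nat_idn'] sw_unit_mid winv)
  then have "(sw X A Y \<cdot> (\<one> X \<otimes> uu Y))\<dagger> = (uu (X \<odot> Y))\<dagger>" by simp
  then have u: "(uu (X \<odot> Y))\<dagger> = (\<one> X \<otimes> (uu Y)\<dagger>) \<cdot> sw A X Y" by simp
  have "bb (X \<odot> Y) \<cdot> (\<one> A \<otimes> sw X A Y) = (\<one> X \<otimes> (uu Y)\<dagger>) \<cdot> (sw A X Y \<cdot> mm (X \<odot> Y)) \<cdot> (\<one> A \<otimes> sw X A Y)"
    by (simp add: bb_def u)
  also have "\<dots> = (\<one> X \<otimes> bb Y) \<cdot> sw A X (A \<odot> Y) \<cdot> ((\<one> A \<otimes> sw A X Y) \<cdot> (\<one> A \<otimes> sw X A Y))"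
    by (simp add: mm_sw bb_def whisk)
  also have "(\<one> A \<otimes> sw A X Y) \<cdot> (\<one> A \<otimes> sw X A Y) = \<one> (A \<odot> X \<odot> A \<odot> Y)"
    by (simp add: tens_comp)
  finally show ?thesis by simp
qed

text \<open>In terms of elements: \<open>b\<^sub>1 a \<otimes> b\<^sub>2 = b\<^sub>1 \<otimes> a b\<^sub>2\<close> whenever the form is symmetric.\<close>

lemma balanced:
  assumes sym: "u\<dagger> \<cdot> m \<cdot> \<sigma> A A = u\<dagger> \<cdot> m"
  shows "mm A \<cdot> sw A A A \<cdot> (\<one> A \<otimes> m\<dagger>) = (\<one> A \<otimes> m) \<cdot> sw A A A \<cdot> (\<one> A \<otimes> m\<dagger>)"
proof (rule bb_inject)
  have bs: "bb Y \<cdot> sw A A Y = bb Y" if [simp]: "Y \<in> Ob V" for Y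
  proof -
    have "bb Y \<cdot> sw A A Y = \<l> Y \<cdot> ((u\<dagger> \<cdot> m \<cdot> \<sigma> A A) \<otimes> \<one> Y) \<cdot> (\<a> A A Y)\<dagger>"
      by (simp add: bb_def uu_def mm_def sw_def whisk)
    then show ?thesis unfolding sym by (simp add: bb_def uu_def mm_def whisk)
  qed
  have ba: "bb Y \<cdot> (\<one> A \<otimes> mm Y) = bb Y \<cdot> mm (A \<odot> Y)" if [simp]: "Y \<in> Ob V" for Y
    by (simp add: bb_def mm_assoc[OF m_assoc])
  \<comment> \<open>The Frobenius law followed by the counit: if m\<dagger> sends b to the sum of b1
    \<otimes> b2, then u\<dagger>(c b1) b2 = cb.\<close>
  have bm: "bb A \<cdot> (\<one> A \<otimes> m\<dagger>) = m"
  proof -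
    have 1: "mm A \<cdot> (\<one> A \<otimes> m\<dagger>) = m\<dagger> \<cdot> m" by (simp add: mm_def frob_left)
    have "m \<cdot> uu A = \<one> A" by (simp add: uu_def comp_lift[OF m_unit_left])
    then have "(m \<cdot> uu A)\<dagger> = \<one> A" by simp
    then have 2: "(uu A)\<dagger> \<cdot> m\<dagger> = \<one> A" by simp
    show ?thesis by (simp add: bb_def 1 comp_lift[OF 2])
  qed
  have mas: "m \<cdot> (\<one> A \<otimes> m) = m \<cdot> mm A"
    using arg_cong[OF m_assoc, of "\<lambda>x. x \<cdot> (\<a> A A A)\<dagger>"] by (simp add: mm_def)
  have ww: "(\<one> A \<otimes> sw A A A) \<cdot> (\<one> A \<otimes> sw A A A) = \<one> (A \<odot> A \<odot> A \<odot> A)"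
    by (simp add: tens_comp)
  \<comment> \<open>Pairing with a further element c and writing b1 \<otimes> b2 for m\<dagger>(b),
    the chain is u\<dagger>(c(b1 a)) b2 = u\<dagger>((ac) b1) b2 = (ac)b = a(cb) = u\<dagger>(c b1)
    (a b2).\<close>
  have "bb A \<cdot> (\<one> A \<otimes> (mm A \<cdot> sw A A A \<cdot> (\<one> A \<otimes> m\<dagger>)))
    = (bb A \<cdot> sw A A A) \<cdot> mm (A \<odot> A) \<cdot> (\<one> A \<otimes> sw A A A) \<cdot> (\<one> A \<otimes> \<one> A \<otimes> m\<dagger>)"
    by (simp add: bs whisk comp_lift[OF ba])
  also have "\<dots> = (bb A \<cdot> (\<one> A \<otimes> mm A)) \<cdot> sw A A (A \<odot> A) \<cdot> ((\<one> A \<otimes> sw A A A) \<cdot> (\<one> A \<otimes> sw A A A)) \<cdot> (\<one> A \<otimes> \<one> A \<otimes> m\<dagger>)"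
    by (simp add: comp_lift[OF mm_sw])
  also have "\<dots> = bb A \<cdot> (mm (A \<odot> A) \<cdot> (\<one> A \<otimes> \<one> A \<otimes> m\<dagger>)) \<cdot> sw A A A"
    unfolding ww ba[OF A_Ob] by (simp add: sw_nat_last)
  also have "\<dots> = (bb A \<cdot> (\<one> A \<otimes> m\<dagger>)) \<cdot> mm A \<cdot> sw A A A"
    by (simp add: mm_nat)
  also have "\<dots> = m \<cdot> (\<one> A \<otimes> m) \<cdot> sw A A A"
    unfolding bm by (simp add: comp_lift[OF mas])
  also have "\<dots> = m \<cdot> (\<one> A \<otimes> (bb A \<cdot> (\<one> A \<otimes> m\<dagger>))) \<cdot> sw A A A"
    unfolding bm ..
  also have "\<dots> = m \<cdot> ((\<one> A \<otimes> bb A) \<cdot> sw A A (A \<odot> A)) \<cdot> (\<one> A \<otimes> \<one> A \<otimes> m\<dagger>)"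
    by (simp add: whisk sw_nat_last)
  also have "\<dots> = bb A \<cdot> (\<one> A \<otimes> ((\<one> A \<otimes> m) \<cdot> sw A A A \<cdot> (\<one> A \<otimes> m\<dagger>)))"
    by (simp add: whisk comp_lift[OF bb_nat] flip: bb_slide)
  finally show "bb A \<cdot> (\<one> A \<otimes> (mm A \<cdot> sw A A A \<cdot> (\<one> A \<otimes> m\<dagger>)))
    = bb A \<cdot> (\<one> A \<otimes> ((\<one> A \<otimes> m) \<cdot> sw A A A \<cdot> (\<one> A \<otimes> m\<dagger>)))" .
qed simp_all

lemma act_dag: "act\<dagger> = (cv A A)\<dagger> \<cdot> (\<one> (A\<^sup>\<star>) \<otimes> m\<dagger>)"
  by (simp add: act_eq)

text \<open>The Frobenius law splits \<open>m\<dagger> \<cdot> m\<close>, so the loop closes over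
  one multiplication only and becomes \<open>tau\<close>, while the other leg of the
  comultiplication stays free.\<close>

lemma act_dag_act: "act\<dagger> \<cdot> act = \<l> A \<cdot> (tau \<otimes> \<one> A) \<cdot> m\<dagger>"
proof -
  have "act\<dagger> \<cdot> act = (cv A A)\<dagger> \<cdot> (\<one> (A\<^sup>\<star>) \<otimes> (m\<dagger> \<cdot> m)) \<cdot> cv A A"
    unfolding act_dag by (simp add: act_eq whisk)
  also have "\<dots> = (cv A A)\<dagger> \<cdot> (\<one> (A\<^sup>\<star>) \<otimes> m \<otimes> \<one> A) \<cdot> ((\<one> (A\<^sup>\<star>) \<otimes> (\<a> A A A)\<dagger>) \<cdot> cv A (A \<odot> A)) \<cdot> m\<dagger>"
    unfolding frob_left[symmetric] by (simp add: whisk cv_nat)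
  also have "\<dots> = (cv A A)\<dagger> \<cdot> (\<one> (A\<^sup>\<star>) \<otimes> m \<otimes> \<one> A) \<cdot> \<a> (A\<^sup>\<star>) (A \<odot> A) A \<cdot> (cv A A \<otimes> \<one> A) \<cdot> m\<dagger>"
    by (simp flip: cv_tens)
  also have "\<dots> = (cv A A)\<dagger> \<cdot> \<a> (A\<^sup>\<star>) A A \<cdot> (act \<otimes> \<one> A) \<cdot> m\<dagger>"
    by (simp add: act_eq whisk nat)
  also have "\<dots> = \<l> A \<cdot> (tau \<otimes> \<one> A) \<cdot> m\<dagger>"
    by (simp add: cv_def tau_def whisk)
  finally show ?thesis .
qed

text \<open>The left side is the curried form of \<open>act \<cdot> act\<dagger>\<close>, the right
  side that of \<open>tr A A \<cdot> dbl (m\<dagger>)\<close>. Evaluating the trace by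
  \<open>trace_mult\<close> leaves exactly the two sides of \<open>balanced\<close>.\<close>

lemma m_act_dag:
  assumes sym: "u\<dagger> \<cdot> m \<cdot> \<sigma> A A = u\<dagger> \<cdot> m"
  shows "m \<cdot> (\<one> A \<otimes> act\<dagger>)
    = (cv A A)\<dagger> \<cdot> (\<one> (A\<^sup>\<star>) \<otimes> (m\<dagger> \<cdot> ev A A \<cdot> mm (A\<^sup>\<star> \<odot> A))) \<cdot> cv A (A \<odot> A\<^sup>\<star> \<odot> A)"
proof -
  have c: "(cv A (A \<odot> A))\<dagger> \<cdot> (\<one> (A\<^sup>\<star>) \<otimes> sw A A A) \<cdot> sw A (A\<^sup>\<star>) (A \<odot> A) = \<one> A \<otimes> (cv A A)\<dagger>"
    by (rule dag_inject) (simp_all add: cv_slide)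
  have "(m\<dagger> \<cdot> ev A A) \<cdot> mm (A\<^sup>\<star> \<odot> A) = ev A (A \<odot> A) \<cdot> mm (A\<^sup>\<star> \<odot> A \<odot> A) \<cdot> (\<one> A \<otimes> \<one> A \<otimes> \<one> (A\<^sup>\<star>) \<otimes> m\<dagger>)"
    by (simp add: mm_nat ev_nats)
  then have "(cv A A)\<dagger> \<cdot> (\<one> (A\<^sup>\<star>) \<otimes> (m\<dagger> \<cdot> ev A A \<cdot> mm (A\<^sup>\<star> \<odot> A))) \<cdot> cv A (A \<odot> A\<^sup>\<star> \<odot> A)
    = (cv A A)\<dagger> \<cdot> (\<one> (A\<^sup>\<star>) \<otimes> (ev A (A \<odot> A) \<cdot> mm (A\<^sup>\<star> \<odot> A \<odot> A) \<cdot> (\<one> A \<otimes> \<one> A \<otimes> \<one> (A\<^sup>\<star>) \<otimes> m\<dagger>))) \<cdot> cv A (A \<odot> A\<^sup>\<star> \<odot> A)"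
    by simp
  also have "\<dots> = ((cv A A)\<dagger> \<cdot> (\<one> (A\<^sup>\<star>) \<otimes> (ev A (A \<odot> A) \<cdot> mm (A\<^sup>\<star> \<odot> A \<odot> A))) \<cdot> cv A (A \<odot> A\<^sup>\<star> \<odot> A \<odot> A)) \<cdot> (\<one> A \<otimes> \<one> (A\<^sup>\<star>) \<otimes> m\<dagger>)"
    by (simp add: whisk cv_nat comp_lift[OF cv_nat])
  also have "\<dots> = (cv A A)\<dagger> \<cdot> (\<one> (A\<^sup>\<star>) \<otimes> (mm A \<cdot> sw A A A \<cdot> (\<one> A \<otimes> m\<dagger>))) \<cdot> sw A (A\<^sup>\<star>) A"
    by (subst trace_mult) (simp_all add: whisk sw_nat_last)
  also have "\<dots> = m \<cdot> ((cv A (A \<odot> A))\<dagger> \<cdot> (\<one> (A\<^sup>\<star>) \<otimes> sw A A A) \<cdot> sw A (A\<^sup>\<star>) (A \<odot> A)) \<cdot> (\<one> A \<otimes> \<one> (A\<^sup>\<star>) \<otimes> m\<dagger>)"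
    unfolding balanced[OF sym] by (simp add: whisk ev_nats sw_nat_last)
  also have "\<dots> = m \<cdot> (\<one> A \<otimes> act\<dagger>)"
    unfolding c act_dag by (simp add: whisk)
  finally show ?thesis by simp
qed

text \<open>The Kraus morphism is comultiplication followed by \<open>h\<close> on the environment.\<close>

lemma cp_act_dag:
  assumes sym: "u\<dagger> \<cdot> m \<cdot> \<sigma> A A = u\<dagger> \<cdot> m"
    and [simp]: "h \<in> Arr V" "Dom V h = A"
    and cent: "m \<cdot> ((h\<dagger> \<cdot> h) \<otimes> \<one> A) = m \<cdot> (\<one> A \<otimes> (h\<dagger> \<cdot> h))"
  shows "cp A A (act \<cdot> (h\<dagger> \<cdot> h) \<cdot> act\<dagger>)"
proof -
  let ?X = "Cod V h" and ?DA = "A\<^sup>\<star> \<odot> A" and ?z = "h\<dagger> \<cdot> h"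
  let ?W = "?X \<odot> A"
  let ?DW = "?W\<^sup>\<star> \<odot> ?W"
  let ?k = "(h \<otimes> \<one> A) \<cdot> m\<dagger>"
  show ?thesis
  proof (rule cpI[of ?X A ?k])
    show "act \<cdot> ?z \<cdot> act\<dagger> = tr ?X A \<cdot> dbl ?k"
    proof (rule hat_inject)
      have z [simp]: "?z \<in> Arr V" "Dom V ?z = A" "Cod V ?z = A" by simp_all
      have an: "(\<a> ?X A ?DW)\<dagger> \<cdot> (\<one> ?X \<otimes> \<one> A \<otimes> dbl ?k) = (\<one> ?W \<otimes> dbl ?k) \<cdot> (\<a> ?X A ?DA)\<dagger>"
        using ad_nat[of "\<one> ?X" "\<one> A" "dbl ?k"] by simp
      \<comment> \<open>By \<open>c1\<close> and \<open>c2\<close> both occurrences of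
        \<open>h\<close> move to the dual strand of the loop, where they fuse to the conjugate of
        \<open>?z\<close>. By \<open>c3\<close> it returns to the traced strand as
        \<open>?z\<close>, and \<open>mz\<close> moves it out of the loop.\<close>
      have c1: "(cv ?X A)\<dagger> \<cdot> (\<one> (?X\<^sup>\<star>) \<otimes> h \<otimes> \<one> A) = (cv A A)\<dagger> \<cdot> (lower_star V (h\<dagger>) \<otimes> \<one> (A \<odot> A))"
        by (rule dag_inject) (simp_all add: cv_ls)
      have c2: "(\<one> (?X\<^sup>\<star>) \<otimes> h\<dagger> \<otimes> \<one> Y) \<cdot> cv ?X Y = (lower_star V h \<otimes> \<one> (A \<odot> Y)) \<cdot> cv A Y" if "Y \<in> Ob V" for Y
        using that by (simp add: cv_ls)
      have c3: "(lower_star V ?z \<otimes> \<one> (A \<odot> Y)) \<cdot> cv A Y = (\<one> (A\<^sup>\<star>) \<otimes> ?z \<otimes> \<one> Y) \<cdot> cv A Y" if "Y \<in> Ob V" for Y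
        using cv_ls[OF z(1,2) that] by simp
      have mz: "mm ?DA \<cdot> (?z \<otimes> \<one> (A \<odot> ?DA)) = mm ?DA \<cdot> (\<one> A \<otimes> ?z \<otimes> \<one> ?DA)"
      proof -
        have "mm ?DA \<cdot> (?z \<otimes> \<one> (A \<odot> ?DA)) = ((m \<cdot> (?z \<otimes> \<one> A)) \<otimes> \<one> ?DA) \<cdot> (\<a> A A ?DA)\<dagger>"
          by (simp only: mm_def whisk_right) (simp add: nat tens_merge)
        also have "\<dots> = mm ?DA \<cdot> (\<one> A \<otimes> ?z \<otimes> \<one> ?DA)"
          unfolding cent by (simp add: mm_def nat tens_merge)
        finally show ?thesis .
      qed
      have kk: "(?k\<dagger> \<otimes> \<one> ?DA) \<cdot> (\<a> ?X A ?DA)\<dagger> = mm ?DA \<cdot> (h\<dagger> \<otimes> \<one> (A \<odot> ?DA))"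
        by (simp add: mm_def whisk nat)
      have "ev A A \<cdot> (\<one> A \<otimes> (tr ?X A \<cdot> dbl ?k))
        = (cv ?X A)\<dagger> \<cdot> (\<one> (?X\<^sup>\<star>) \<otimes> (ev ?W ?W \<cdot> (\<a> ?X A ?DW)\<dagger>)) \<cdot> cv ?X (A \<odot> ?DW) \<cdot> (\<one> A \<otimes> dbl ?k)"
        using whisk_left[of "dbl ?k" "tr ?X A" A] comp_lift[OF ev_tr[of ?X A], of "\<one> A \<otimes> dbl ?k"] by simp
      also have "\<dots> = (cv ?X A)\<dagger> \<cdot> (\<one> (?X\<^sup>\<star>) \<otimes> (ev ?W ?W \<cdot> (\<a> ?X A ?DW)\<dagger> \<cdot> (\<one> ?X \<otimes> \<one> A \<otimes> dbl ?k))) \<cdot> cv ?X (A \<odot> ?DA)"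
        by (subst cv_nat[of ?X "\<one> A \<otimes> dbl ?k"]) (simp_all add: tens_merge)
      also have "ev ?W ?W \<cdot> (\<a> ?X A ?DW)\<dagger> \<cdot> (\<one> ?X \<otimes> \<one> A \<otimes> dbl ?k) = (ev ?W ?W \<cdot> (\<one> ?W \<otimes> dbl ?k)) \<cdot> (\<a> ?X A ?DA)\<dagger>"
        unfolding an by simp
      also have "\<dots> = ?k \<cdot> ev A A \<cdot> (?k\<dagger> \<otimes> \<one> ?DA) \<cdot> (\<a> ?X A ?DA)\<dagger>"
        by (subst ev_dbl) simp_all
      also have "\<dots> = (h \<otimes> \<one> A) \<cdot> (m\<dagger> \<cdot> ev A A \<cdot> mm ?DA) \<cdot> (h\<dagger> \<otimes> \<one> (A \<odot> ?DA))"
        unfolding kk by simp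
      also have "(cv ?X A)\<dagger> \<cdot> (\<one> (?X\<^sup>\<star>) \<otimes> ((h \<otimes> \<one> A) \<cdot> (m\<dagger> \<cdot> ev A A \<cdot> mm ?DA) \<cdot> (h\<dagger> \<otimes> \<one> (A \<odot> ?DA)))) \<cdot> cv ?X (A \<odot> ?DA)
        = ((cv ?X A)\<dagger> \<cdot> (\<one> (?X\<^sup>\<star>) \<otimes> h \<otimes> \<one> A)) \<cdot> (\<one> (?X\<^sup>\<star>) \<otimes> (m\<dagger> \<cdot> ev A A \<cdot> mm ?DA)) \<cdot> ((\<one> (?X\<^sup>\<star>) \<otimes> h\<dagger> \<otimes> \<one> (A \<odot> ?DA)) \<cdot> cv ?X (A \<odot> ?DA))"
        by (simp add: whisk)
      also have "\<dots> = (cv A A)\<dagger> \<cdot> ((lower_star V (h\<dagger>) \<otimes> \<one> (A \<odot> A)) \<cdot> (\<one> (?X\<^sup>\<star>) \<otimes> (m\<dagger> \<cdot> ev A A \<cdot> mm ?DA)) \<cdot> (lower_star V h \<otimes> \<one> (A \<odot> A \<odot> ?DA))) \<cdot> cv A (A \<odot> ?DA)"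
        unfolding c1 c2[OF TensO_Ob[OF A_Ob TensO_Ob[OF Dual_Ob[OF A_Ob] A_Ob]]] by simp
      also have "(lower_star V (h\<dagger>) \<otimes> \<one> (A \<odot> A)) \<cdot> (\<one> (?X\<^sup>\<star>) \<otimes> (m\<dagger> \<cdot> ev A A \<cdot> mm ?DA)) \<cdot> (lower_star V h \<otimes> \<one> (A \<odot> A \<odot> ?DA))
        = (\<one> (A\<^sup>\<star>) \<otimes> (m\<dagger> \<cdot> ev A A \<cdot> mm ?DA)) \<cdot> (lower_star V ?z \<otimes> \<one> (A \<odot> A \<odot> ?DA))"
        by (simp add: ls_comp tens_merge)
      also have "(cv A A)\<dagger> \<cdot> ((\<one> (A\<^sup>\<star>) \<otimes> (m\<dagger> \<cdot> ev A A \<cdot> mm ?DA)) \<cdot> (lower_star V ?z \<otimes> \<one> (A \<odot> A \<odot> ?DA))) \<cdot> cv A (A \<odot> ?DA)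
        = (cv A A)\<dagger> \<cdot> (\<one> (A\<^sup>\<star>) \<otimes> (m\<dagger> \<cdot> ev A A \<cdot> (mm ?DA \<cdot> (?z \<otimes> \<one> (A \<odot> ?DA))))) \<cdot> cv A (A \<odot> ?DA)"
        using c3[of "A \<odot> ?DA"] by (simp add: whisk_left del: comp_assoc) (simp add: whisk_left)
      also have "\<dots> = ((cv A A)\<dagger> \<cdot> (\<one> (A\<^sup>\<star>) \<otimes> (m\<dagger> \<cdot> ev A A \<cdot> mm ?DA)) \<cdot> cv A (A \<odot> ?DA)) \<cdot> (?z \<otimes> \<one> ?DA)"
        unfolding mz using cv_nat[of A "?z \<otimes> \<one> ?DA" "A \<odot> ?DA"] by (simp add: whisk_left)
      also have "\<dots> = (m \<cdot> (?z \<otimes> \<one> A)) \<cdot> (\<one> A \<otimes> act\<dagger>)"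
        unfolding m_act_dag[OF sym, symmetric] by (simp add: tens_merge)
      also have "\<dots> = ev A A \<cdot> (\<one> A \<otimes> (act \<cdot> ?z \<cdot> act\<dagger>))"
        unfolding cent by (simp add: whisk comp_lift[OF ev_act])
      finally show "ev A A \<cdot> (\<one> A \<otimes> (act \<cdot> ?z \<cdot> act\<dagger>)) = ev A A \<cdot> (\<one> A \<otimes> (tr ?X A \<cdot> dbl ?k))" by simp
    qed simp_all
  qed simp_all
qed

end

section \<open>Consequences of normalisation\<close>

locale normalisable_algebra = frobenius_algebra +
  fixes z :: 'b
  assumes normal: "normaliser V A m u z"
begin

lemma z_arr [simp]: "z \<in> Arr V" "Dom V z = A" "Cod V z = A"
  using normal by (simp_all add: normaliser_def central_def Hom_iff)

lemma z_central: "m \<cdot> (z \<otimes> \<one> A) = z \<cdot> m" "m \<cdot> (\<one> A \<otimes> z) = z \<cdot> m"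
  using normal by (simp_all add: normaliser_def central_def)

lemma z_norm: "tau \<cdot> z \<cdot> z = u\<dagger>"
  using normal by (simp add: normaliser_def tau_def)

lemma z_sqrt: obtains h where "h \<in> Arr V" "Dom V h = A" "z = h\<dagger> \<cdot> h"
  using normal by (auto simp: normaliser_def positive_def Hom_iff)

lemma z_dag [simp]: "z\<dagger> = z"
proof -
  obtain h where "h \<in> Arr V" "Dom V h = A" "z = h\<dagger> \<cdot> h" by (rule z_sqrt)
  then show ?thesis by simp
qed

lemma u_sym: "u\<dagger> \<cdot> m \<cdot> \<sigma> A A = u\<dagger> \<cdot> m"
proof -
  have zzl: "z \<cdot> z \<cdot> m = m \<cdot> ((z \<cdot> z) \<otimes> \<one> A)"
    by (simp add: whisk comp_lift[OF z_central(1)] z_central(1))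
  have zzr: "z \<cdot> z \<cdot> m = m \<cdot> (\<one> A \<otimes> (z \<cdot> z))"
    by (simp add: whisk comp_lift[OF z_central(2)] z_central(2))
  have "u\<dagger> \<cdot> m \<cdot> \<sigma> A A = tau \<cdot> (z \<cdot> z \<cdot> m) \<cdot> \<sigma> A A"
    by (simp flip: z_norm)
  also have "\<dots> = tau \<cdot> m \<cdot> \<sigma> A A \<cdot> (\<one> A \<otimes> (z \<cdot> z))"
    unfolding zzl by (simp add: s_nat_idn)
  also have "\<dots> = (tau \<cdot> m) \<cdot> (\<one> A \<otimes> (z \<cdot> z))"
    unfolding tau_sym[OF m_assoc, symmetric] by simp
  also have "\<dots> = tau \<cdot> (z \<cdot> z \<cdot> m)" unfolding zzr by simp
  also have "\<dots> = u\<dagger> \<cdot> m" by (simp flip: z_norm)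
  finally show ?thesis .
qed

text \<open>Positivity of the normaliser supplies the factor to be placed on the environment, and
  centrality is the condition that \<open>cp_act_dag\<close> puts on its square.\<close>

lemma cp_act_z: "cp A A (act \<cdot> z \<cdot> act\<dagger>)"
proof -
  obtain h where "h \<in> Arr V" "Dom V h = A" "z = h\<dagger> \<cdot> h" by (rule z_sqrt)
  then show ?thesis using cp_act_dag[OF u_sym, of h] z_central by simp
qed

lemma cp_act: "cp A A (act \<cdot> act\<dagger>)"
  using cp_act_dag[OF u_sym, of "\<one> A"] by simp

text \<open>Curried, the doubled normaliser puts one \<open>z\<close> before and one after the
  multiplication; centrality collects them. It allows a pair of normalisers to be inserted by
  composing with a completely positive map.\<close>

lemma act_z2: "act \<cdot> z \<cdot> z = dbl z \<cdot> act"
proof (rule hat_inject)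
  have "ev A A \<cdot> (\<one> A \<otimes> (dbl z \<cdot> act)) = z \<cdot> (ev A A \<cdot> (\<one> A \<otimes> act)) \<cdot> (z \<otimes> \<one> A)"
    by (simp add: whisk comp_lift[OF ev_dbl] swap_whisk)
  also have "\<dots> = ev A A \<cdot> (\<one> A \<otimes> (act \<cdot> z \<cdot> z))"
    by (simp add: ev_act whisk comp_lift[OF ev_act] z_central comp_lift[OF z_central(2)])
  finally show "ev A A \<cdot> (\<one> A \<otimes> (act \<cdot> z \<cdot> z)) = ev A A \<cdot> (\<one> A \<otimes> (dbl z \<cdot> act))" by simp
qed simp_all

text \<open>Inverse to \<open>z \<cdot> z\<close> by \<open>w_zz\<close>; by \<open>z_w_z\<close>
  the composite \<open>act \<cdot> z\<close> is an isometry.\<close>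

definition w :: 'b where "w = act\<dagger> \<cdot> act"

lemma w_arr [simp]: "w \<in> Arr V" "Dom V w = A" "Cod V w = A" "w\<dagger> = w"
  by (simp_all add: w_def)

text \<open>In \<open>act_dag_act\<close> the normalisers pass through the comultiplication to
  \<open>tau\<close>, where normalisation turns them into the counit; the counit law
  finishes.\<close>

lemma w_zz: "w \<cdot> z \<cdot> z = \<one> A" "z \<cdot> z \<cdot> w = \<one> A"
proof -
  have "m\<dagger> \<cdot> z = (z \<cdot> m)\<dagger>" by simp
  also have "\<dots> = (z \<otimes> \<one> A) \<cdot> m\<dagger>" unfolding z_central(1)[symmetric] by simp
  finally have mz: "m\<dagger> \<cdot> z = (z \<otimes> \<one> A) \<cdot> m\<dagger>" .
  have "w \<cdot> z \<cdot> z = \<l> A \<cdot> ((tau \<cdot> z \<cdot> z) \<otimes> \<one> A) \<cdot> m\<dagger>"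
    by (simp add: w_def comp_lift[OF act_dag_act, simplified] act_dag_act mz comp_lift[OF mz] whisk)
  also have "\<dots> = (m \<cdot> (u \<otimes> \<one> A) \<cdot> (\<l> A)\<dagger>)\<dagger>" unfolding z_norm by simp
  also have "\<dots> = \<one> A" by (simp add: comp_lift[OF m_unit_left])
  finally show 1: "w \<cdot> z \<cdot> z = \<one> A" .
  have "(w \<cdot> z \<cdot> z)\<dagger> = \<one> A" unfolding 1 by simp
  then show "z \<cdot> z \<cdot> w = \<one> A" by simp
qed

text \<open>As the two-sided inverse of \<open>z \<cdot> z\<close>, the map \<open>w\<close>
  commutes with \<open>z\<close>.\<close>

lemma z_w_z: "z \<cdot> w \<cdot> z = \<one> A"
proof -
  have "z \<cdot> w = (w \<cdot> z \<cdot> z) \<cdot> z \<cdot> w" unfolding w_zz by simp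
  also have "\<dots> = w \<cdot> z \<cdot> (z \<cdot> z \<cdot> w)" by simp
  also have "\<dots> = w \<cdot> z" unfolding w_zz by simp
  finally have "z \<cdot> w = w \<cdot> z" .
  then have "z \<cdot> w \<cdot> z = z \<cdot> z \<cdot> w" by simp
  then show ?thesis by (simp add: w_zz)
qed

end

subsection \<open>Tensor products of normalisable algebras\<close>

context dagger_compact_category
begin

abbreviation alg :: "'o \<Rightarrow> 'a \<Rightarrow> 'a \<Rightarrow> 'a \<Rightarrow> bool" where
  "alg \<equiv> normalisable_algebra V"

lemma cpstar_Ob_iff: "(A, m, u, z) \<in> cpstar_Ob V \<longleftrightarrow> alg A m u z"
  unfolding cpstar_Ob_def normalisable_algebra_def normalisable_algebra_axioms_def
    frobenius_algebra_def frobenius_algebra_axioms_def multiplication_def multiplication_axioms_def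
    dagger_frobenius_def Hom_iff mem_Collect_eq prod.case
  using dagger_compact_category_axioms by blast

lemma algD:
  assumes "alg A m u z"
  shows "A \<in> Ob V" "m \<in> Arr V" "Dom V m = A \<odot> A" "Cod V m = A" "u \<in> Arr V" "Dom V u = \<I>" "Cod V u = A"
    "z \<in> Arr V" "Dom V z = A" "Cod V z = A" "z\<dagger> = z"
    "action V A m \<in> Arr V" "Dom V (action V A m) = A" "Cod V (action V A m) = A\<^sup>\<star> \<odot> A"
    "(action V A m)\<dagger> \<cdot> action V A m \<cdot> z \<cdot> z = \<one> A"
    "z \<cdot> (action V A m)\<dagger> \<cdot> action V A m \<cdot> z = \<one> A"
    "z \<cdot> z \<cdot> (action V A m)\<dagger> \<cdot> action V A m = \<one> A"
    "h \<in> Arr V \<Longrightarrow> Cod V h = A \<Longrightarrow> (action V A m)\<dagger> \<cdot> action V A m \<cdot> z \<cdot> z \<cdot> h = h"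
    "h \<in> Arr V \<Longrightarrow> Cod V h = A \<Longrightarrow> z \<cdot> (action V A m)\<dagger> \<cdot> action V A m \<cdot> z \<cdot> h = h"
    "h \<in> Arr V \<Longrightarrow> Cod V h = A \<Longrightarrow> z \<cdot> z \<cdot> (action V A m)\<dagger> \<cdot> action V A m \<cdot> h = h"
proof -
  interpret normalisable_algebra V A m u z by (rule assms)
  show "A \<in> Ob V" "m \<in> Arr V" "Dom V m = A \<odot> A" "Cod V m = A" "u \<in> Arr V" "Dom V u = \<I>" "Cod V u = A"
    "z \<in> Arr V" "Dom V z = A" "Cod V z = A" "z\<dagger> = z" "act \<in> Arr V" "Dom V act = A" "Cod V act = A\<^sup>\<star> \<odot> A"
    by simp_all
  show 1: "act\<dagger> \<cdot> act \<cdot> z \<cdot> z = \<one> A" "z \<cdot> act\<dagger> \<cdot> act \<cdot> z = \<one> A" "z \<cdot> z \<cdot> act\<dagger> \<cdot> act = \<one> A"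
    using w_zz z_w_z by (simp_all add: w_def)
  assume h: "h \<in> Arr V" "Cod V h = A"
  have "(act\<dagger> \<cdot> act \<cdot> z \<cdot> z) \<cdot> h = h" "(z \<cdot> act\<dagger> \<cdot> act \<cdot> z) \<cdot> h = h" "(z \<cdot> z \<cdot> act\<dagger> \<cdot> act) \<cdot> h = h"
    unfolding 1 using h by simp_all
  then show "act\<dagger> \<cdot> act \<cdot> z \<cdot> z \<cdot> h = h" "z \<cdot> act\<dagger> \<cdot> act \<cdot> z \<cdot> h = h" "z \<cdot> z \<cdot> act\<dagger> \<cdot> act \<cdot> h = h"
    using h by simp_all
qed

lemma alg_cp:
  assumes "alg A m u z"
  shows "cp A A (action V A m \<cdot> (action V A m)\<dagger>)" "cp A A (action V A m \<cdot> z \<cdot> (action V A m)\<dagger>)"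
    and "dbl z \<cdot> action V A m = action V A m \<cdot> z \<cdot> z"
proof -
  interpret normalisable_algebra V A m u z by (rule assms)
  show "cp A A (act \<cdot> act\<dagger>)" "cp A A (act \<cdot> z \<cdot> act\<dagger>)" "dbl z \<cdot> act = act \<cdot> z \<cdot> z"
    by (simp_all add: cp_act cp_act_z act_z2)
qed

lemma action_tens:
  assumes "multiplication V A m" "multiplication V B n"
  shows "action V (A \<odot> B) ((m \<otimes> n) \<cdot> ic A B A B) = mu A B \<cdot> (action V A m \<otimes> action V B n)"
proof (rule hat_inject)
  interpret A: multiplication V A m by (rule assms)
  interpret B: multiplication V B n by (rule assms)
  interpret AB: multiplication V "A \<odot> B" "(m \<otimes> n) \<cdot> ic A B A B"
    by unfold_locales simp_all
  have "ev (A \<odot> B) (A \<odot> B) \<cdot> (\<one> (A \<odot> B) \<otimes> (mu A B \<cdot> (A.act \<otimes> B.act)))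
    = (ev A A \<otimes> ev B B) \<cdot> ((\<one> A \<otimes> A.act) \<otimes> (\<one> B \<otimes> B.act)) \<cdot> ic A B A B"
    by (simp add: whisk comp_lift[OF ev_mu] ic_nats)
  also have "\<dots> = (m \<otimes> n) \<cdot> ic A B A B"
    by (simp add: tens_merge A.ev_act B.ev_act)
  finally show "ev (A \<odot> B) (A \<odot> B) \<cdot> (\<one> (A \<odot> B) \<otimes> AB.act)
    = ev (A \<odot> B) (A \<odot> B) \<cdot> (\<one> (A \<odot> B) \<otimes> (mu A B \<cdot> (A.act \<otimes> B.act)))"
    by (simp add: AB.ev_act)
  show "A \<odot> B \<in> Ob V" by simp
  show "A \<odot> B \<in> Ob V" by simp
qed (use assms[THEN multiplication.act_arr(1)] assms[THEN multiplication.act_arr(2)]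
    assms[THEN multiplication.act_arr(3)] assms[THEN multiplication.A_Ob]
    multiplication.act_arr[of V "A \<odot> B" "(m \<otimes> n) \<cdot> ic A B A B"] assms in
    \<open>simp_all add: multiplication_def multiplication_axioms_def\<close>)

text \<open>Each axiom splits into the tensor product of the two given instances and a coherence law
  for the interchange.\<close>

lemma alg_tens:
  assumes "alg A m u z" "alg B n v y"
  shows "alg (A \<odot> B) ((m \<otimes> n) \<cdot> ic A B A B) ((u \<otimes> v) \<cdot> (\<l> \<I>)\<dagger>) (z \<otimes> y)"
proof -
  interpret A: normalisable_algebra V A m u z by (rule assms)
  interpret B: normalisable_algebra V B n v y by (rule assms)
  let ?m = "(m \<otimes> n) \<cdot> ic A B A B" and ?u = "(u \<otimes> v) \<cdot> (\<l> \<I>)\<dagger>"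
  interpret AB: multiplication V "A \<odot> B" ?m
    by unfold_locales simp_all
  have m1: "?m \<otimes> \<one> (A \<odot> B) = ((m \<otimes> n) \<otimes> \<one> (A \<odot> B)) \<cdot> (ic A B A B \<otimes> \<one> (A \<odot> B))"
    and m2: "\<one> (A \<odot> B) \<otimes> ?m = (\<one> (A \<odot> B) \<otimes> (m \<otimes> n)) \<cdot> (\<one> (A \<odot> B) \<otimes> ic A B A B)"
    and m3: "?m\<dagger> \<otimes> \<one> (A \<odot> B) = (ic A A B B \<otimes> \<one> (A \<odot> B)) \<cdot> ((m\<dagger> \<otimes> n\<dagger>) \<otimes> \<one> (A \<odot> B))"
    by (simp_all add: whisk)
  have assoc: "?m \<cdot> (?m \<otimes> \<one> (A \<odot> B)) = ?m \<cdot> (\<one> (A \<odot> B) \<otimes> ?m) \<cdot> \<a> (A \<odot> B) (A \<odot> B) (A \<odot> B)"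
  proof -
    have "?m \<cdot> (?m \<otimes> \<one> (A \<odot> B)) = ((m \<cdot> (m \<otimes> \<one> A)) \<otimes> (n \<cdot> (n \<otimes> \<one> B))) \<cdot> ic (A \<odot> A) (B \<odot> B) A B \<cdot> (ic A B A B \<otimes> \<one> (A \<odot> B))"
      unfolding m1 by (simp add: ic_nats) (simp add: tens_merge)
    also have "\<dots> = ((m \<cdot> (\<one> A \<otimes> m)) \<otimes> (n \<cdot> (\<one> B \<otimes> n))) \<cdot> ((\<a> A A A \<otimes> \<a> B B B) \<cdot> ic (A \<odot> A) (B \<odot> B) A B \<cdot> (ic A B A B \<otimes> \<one> (A \<odot> B)))"
      unfolding A.m_assoc B.m_assoc by (simp add: tens_merge)
    also have "\<dots> = ?m \<cdot> (\<one> (A \<odot> B) \<otimes> ?m) \<cdot> \<a> (A \<odot> B) (A \<odot> B) (A \<odot> B)"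
      unfolding m2 by (subst ic_assoc) (simp_all add: ic_nats, simp add: tens_merge)
    finally show ?thesis .
  qed
  have ul: "?m \<cdot> (?u \<otimes> \<one> (A \<odot> B)) = \<l> (A \<odot> B)"
  proof -
    have "?m \<cdot> (?u \<otimes> \<one> (A \<odot> B)) = ((m \<cdot> (u \<otimes> \<one> A)) \<otimes> (n \<cdot> (v \<otimes> \<one> B))) \<cdot> ic \<I> \<I> A B \<cdot> ((\<l> \<I>)\<dagger> \<otimes> \<one> (A \<odot> B))"
      by (simp add: whisk ic_nats) (simp add: tens_merge)
    then show ?thesis unfolding A.m_unit_left B.m_unit_left by (simp add: ic_unit_left)
  qed
  have ur: "?m \<cdot> (\<one> (A \<odot> B) \<otimes> ?u) = \<r> (A \<odot> B)"
  proof -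
    have "?m \<cdot> (\<one> (A \<odot> B) \<otimes> ?u) = ((m \<cdot> (\<one> A \<otimes> u)) \<otimes> (n \<cdot> (\<one> B \<otimes> v))) \<cdot> ic A B \<I> \<I> \<cdot> (\<one> (A \<odot> B) \<otimes> (\<l> \<I>)\<dagger>)"
      by (simp add: whisk ic_nats) (simp add: tens_merge)
    then show ?thesis unfolding A.m_unit_right B.m_unit_right by (simp add: ic_unit_right)
  qed
  have mdm: "?m\<dagger> \<cdot> ?m = ic A A B B \<cdot> ((m\<dagger> \<cdot> m) \<otimes> (n\<dagger> \<cdot> n)) \<cdot> ic A B A B"
    by (simp add: tens_merge)
  have fr: "?m\<dagger> \<cdot> ?m = (\<one> (A \<odot> B) \<otimes> ?m) \<cdot> \<a> (A \<odot> B) (A \<odot> B) (A \<odot> B) \<cdot> (?m\<dagger> \<otimes> \<one> (A \<odot> B))"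
  proof -
    \<comment> \<open>This is \<open>ic_assoc\<close> with two of its interchanges carried to the
      other side.\<close>
    have i: "ic A (A \<odot> A) B (B \<odot> B) \<cdot> (\<a> A A A \<otimes> \<a> B B B) \<cdot> ic (A \<odot> A) (B \<odot> B) A B
      = (\<one> (A \<odot> B) \<otimes> ic A B A B) \<cdot> \<a> (A \<odot> B) (A \<odot> B) (A \<odot> B) \<cdot> (ic A A B B \<otimes> \<one> (A \<odot> B))"
    proof -
      have "ic A (A \<odot> A) B (B \<odot> B) \<cdot> ((\<a> A A A \<otimes> \<a> B B B) \<cdot> ic (A \<odot> A) (B \<odot> B) A B \<cdot> (ic A B A B \<otimes> \<one> (A \<odot> B))) \<cdot> (ic A A B B \<otimes> \<one> (A \<odot> B))
        = (\<one> (A \<odot> B) \<otimes> ic A B A B) \<cdot> \<a> (A \<odot> B) (A \<odot> B) (A \<odot> B) \<cdot> (ic A A B B \<otimes> \<one> (A \<odot> B))"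
        by (subst ic_assoc) simp_all
      then show ?thesis by (simp add: tens_comp)
    qed
    have s: "((m\<dagger> \<cdot> m) \<otimes> (n\<dagger> \<cdot> n)) = ((\<one> A \<otimes> m) \<otimes> (\<one> B \<otimes> n)) \<cdot> (\<a> A A A \<otimes> \<a> B B B) \<cdot> ((m\<dagger> \<otimes> \<one> A) \<otimes> (n\<dagger> \<otimes> \<one> B))"
      unfolding A.frob_right B.frob_right by (simp add: tens_merge)
    have "?m\<dagger> \<cdot> ?m = (\<one> (A \<odot> B) \<otimes> (m \<otimes> n)) \<cdot> (ic A (A \<odot> A) B (B \<odot> B) \<cdot> (\<a> A A A \<otimes> \<a> B B B) \<cdot> ic (A \<odot> A) (B \<odot> B) A B) \<cdot> ((m\<dagger> \<otimes> n\<dagger>) \<otimes> \<one> (A \<odot> B))"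
      unfolding mdm s by (simp add: ic_nats)
    also have "\<dots> = (\<one> (A \<odot> B) \<otimes> ?m) \<cdot> \<a> (A \<odot> B) (A \<odot> B) (A \<odot> B) \<cdot> (?m\<dagger> \<otimes> \<one> (A \<odot> B))"
      unfolding i m2 m3 by simp
    finally show ?thesis .
  qed
  have fl: "(?m \<otimes> \<one> (A \<odot> B)) \<cdot> (\<a> (A \<odot> B) (A \<odot> B) (A \<odot> B))\<dagger> \<cdot> (\<one> (A \<odot> B) \<otimes> ?m\<dagger>) = ?m\<dagger> \<cdot> ?m"
  proof -
    \<comment> \<open>As \<open>?m\<dagger> \<cdot> ?m\<close> is self-adjoint, the left Frobenius
      law is the dagger of the right one.\<close>
    have "((\<one> (A \<odot> B) \<otimes> ?m) \<cdot> \<a> (A \<odot> B) (A \<odot> B) (A \<odot> B) \<cdot> (?m\<dagger> \<otimes> \<one> (A \<odot> B)))\<dagger>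
      = (?m \<otimes> \<one> (A \<odot> B)) \<cdot> (\<a> (A \<odot> B) (A \<odot> B) (A \<odot> B))\<dagger> \<cdot> (\<one> (A \<odot> B) \<otimes> ?m\<dagger>)"
      by simp
    moreover have "(?m\<dagger> \<cdot> ?m)\<dagger> = ?m\<dagger> \<cdot> ?m" by simp
    ultimately show ?thesis unfolding fr[symmetric] by simp
  qed
  have cz: "(z \<otimes> y) \<cdot> ?m = ?m \<cdot> ((z \<otimes> y) \<otimes> \<one> (A \<odot> B))" "?m \<cdot> ((z \<otimes> y) \<otimes> \<one> (A \<odot> B)) = ?m \<cdot> (\<one> (A \<odot> B) \<otimes> (z \<otimes> y))"
    by (simp_all add: ic_nats tens_merge A.z_central B.z_central)
  have pos: "positive V (A \<odot> B) (z \<otimes> y)"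
  proof -
    obtain h where h: "h \<in> Arr V" "Dom V h = A" "z = h\<dagger> \<cdot> h" by (rule A.z_sqrt)
    obtain k where k: "k \<in> Arr V" "Dom V k = B" "y = k\<dagger> \<cdot> k" by (rule B.z_sqrt)
    have "h \<otimes> k \<in> Hom V (A \<odot> B) (Cod V h \<odot> Cod V k)" "z \<otimes> y = (h \<otimes> k)\<dagger> \<cdot> (h \<otimes> k)"
      using h k by (simp_all add: Hom_iff tens_comp)
    moreover have "Cod V h \<odot> Cod V k \<in> Ob V" using h k by simp
    ultimately show ?thesis unfolding positive_def by blast
  qed
  have iso: "isomorphism V (A \<odot> B) (A \<odot> B) (z \<otimes> y)"
  proof -
    have "\<exists>g \<in> Hom V A A. g \<cdot> z = \<one> A \<and> z \<cdot> g = \<one> A" "\<exists>g \<in> Hom V B B. g \<cdot> y = \<one> B \<and> y \<cdot> g = \<one> B"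
      using A.normal B.normal by (simp_all add: normaliser_def isomorphism_def)
    then obtain g k where g: "g \<in> Arr V" "Dom V g = A" "Cod V g = A" "g \<cdot> z = \<one> A" "z \<cdot> g = \<one> A"
      and k: "k \<in> Arr V" "Dom V k = B" "Cod V k = B" "k \<cdot> y = \<one> B" "y \<cdot> k = \<one> B"
      by (auto simp: Hom_iff)
    have "g \<otimes> k \<in> Hom V (A \<odot> B) (A \<odot> B)" "(g \<otimes> k) \<cdot> (z \<otimes> y) = \<one> (A \<odot> B)" "(z \<otimes> y) \<cdot> (g \<otimes> k) = \<one> (A \<odot> B)"
      using g k by (simp_all add: Hom_iff tens_comp)
    then show ?thesis unfolding isomorphism_def by (auto simp: Hom_iff)
  qed
  have nm: "(\<eta> (A \<odot> B))\<dagger> \<cdot> AB.act \<cdot> (z \<otimes> y) \<cdot> (z \<otimes> y) = ?u\<dagger>"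
  proof -
    \<comment> \<open>The dagger of \<open>mu_eta\<close> lets the trace form of the tensor product
      factor into those of the two algebras.\<close>
    have "(mu A B \<cdot> (\<eta> A \<otimes> \<eta> B))\<dagger> = (\<eta> (A \<odot> B) \<cdot> \<l> \<I>)\<dagger>" by (simp only: mu_eta A.A_Ob B.A_Ob)
    then have "\<l> \<I> \<cdot> (((\<eta> A)\<dagger> \<otimes> (\<eta> B)\<dagger>) \<cdot> (mu A B)\<dagger>) \<cdot> mu A B = \<l> \<I> \<cdot> ((\<l> \<I>)\<dagger> \<cdot> (\<eta> (A \<odot> B))\<dagger>) \<cdot> mu A B"
      by (simp del: l_cancel mu_cancel)
    then have e: "(\<eta> (A \<odot> B))\<dagger> \<cdot> mu A B = \<l> \<I> \<cdot> ((\<eta> A)\<dagger> \<otimes> (\<eta> B)\<dagger>)" by simp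
    have "(\<eta> (A \<odot> B))\<dagger> \<cdot> AB.act \<cdot> (z \<otimes> y) \<cdot> (z \<otimes> y) = ((\<eta> (A \<odot> B))\<dagger> \<cdot> mu A B) \<cdot> (A.act \<otimes> B.act) \<cdot> (z \<otimes> y) \<cdot> (z \<otimes> y)"
      unfolding action_tens[OF A.multiplication_axioms B.multiplication_axioms] by simp
    also have "\<dots> = \<l> \<I> \<cdot> ((A.tau \<cdot> z \<cdot> z) \<otimes> (B.tau \<cdot> y \<cdot> y))"
      unfolding e by (simp add: tens_merge A.tau_def B.tau_def)
    also have "\<dots> = ?u\<dagger>" unfolding A.z_norm B.z_norm by simp
    finally show ?thesis .
  qed
  show ?thesis
    by unfold_locales (use assoc ul ur fl fr cz pos iso nm in \<open>simp_all add: normaliser_def central_def Hom_iff\<close>)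
qed

text \<open>Hence the idempotent that \<open>F\<close> assigns to the unit algebra is
  \<open>\<eta> \<I> \<cdot> (\<eta> \<I>)\<dagger>\<close>, an identity by \<open>eta_unit\<close>,
  and the unit object is preserved strictly.\<close>

lemma action_unit: "action V \<I> (\<l> \<I>) = \<eta> \<I>"
  using eta_unit_eq by (simp add: action_def cv_def)

lemma alg_unit: "alg \<I> (\<l> \<I>) (\<one> \<I>) (\<one> \<I>)"
proof -
  have t: "(\<one> \<I> \<otimes> \<l> \<I>) \<cdot> \<a> \<I> \<I> \<I> = \<l> \<I> \<otimes> \<one> \<I>"
    by (simp add: triangle l_eq_r)
  have t': "(\<a> \<I> \<I> \<I>)\<dagger> \<cdot> (\<one> \<I> \<otimes> (\<l> \<I>)\<dagger>) = (\<l> \<I>)\<dagger> \<otimes> \<one> \<I>"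
    by (rule dag_inject) (simp_all add: t)
  have "positive V \<I> (\<one> \<I>)" "isomorphism V \<I> \<I> (\<one> \<I>)"
    unfolding positive_def isomorphism_def by (auto simp: Hom_iff intro!: bexI[of _ "\<one> \<I>"] bexI[of _ \<I>])
  then show ?thesis
    by unfold_locales (simp_all add: t t' comp_lift[OF t] l_eq_r tens_comp normaliser_def central_def Hom_iff action_unit
        unit_arrD(2)[OF eta_unit])
qed

text \<open>In curried form the left side multiplies in \<open>A\<close> between
  \<open>f\<dagger>\<close> and \<open>f\<close>. The homomorphism property moves \<open>f\<close>
  inside the multiplication, where unitarity cancels it against \<open>f\<dagger>\<close>.\<close>

lemma action_hom:
  assumes "multiplication V A m" "multiplication V B n" "unit_arr f" "Dom V f = A" "Cod V f = B"
    and hom: "f \<cdot> m = n \<cdot> (f \<otimes> f)"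
  shows "dbl f \<cdot> action V A m = action V B n \<cdot> f"
proof (rule hat_inject)
  interpret A: multiplication V A m by (rule assms)
  interpret B: multiplication V B n by (rule assms)
  note [simp] = unit_arrD(1)[OF assms(3)] assms(4,5)
  have u: "f \<cdot> f\<dagger> = \<one> B" using unit_arrD(3)[OF assms(3)] by simp
  have "ev B B \<cdot> (\<one> B \<otimes> (dbl f \<cdot> A.act)) = f \<cdot> (ev A A \<cdot> (\<one> A \<otimes> A.act)) \<cdot> (f\<dagger> \<otimes> \<one> A)"
    by (simp add: whisk comp_lift[OF ev_dbl] swap_whisk)
  also have "\<dots> = (f \<cdot> m) \<cdot> (f\<dagger> \<otimes> \<one> A)" by (simp add: A.ev_act)
  also have "\<dots> = n \<cdot> (\<one> B \<otimes> f)" unfolding hom by (simp add: tens_comp u)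
  also have "\<dots> = ev B B \<cdot> (\<one> B \<otimes> (B.act \<cdot> f))" by (simp add: whisk comp_lift[OF B.ev_act])
  finally show "ev B B \<cdot> (\<one> B \<otimes> (dbl f \<cdot> A.act)) = ev B B \<cdot> (\<one> B \<otimes> (B.act \<cdot> f))" .
  show "dbl f \<cdot> A.act \<in> Arr V" "B.act \<cdot> f \<in> Arr V" "Dom V (dbl f \<cdot> A.act) = Dom V (B.act \<cdot> f)"
    "Cod V (dbl f \<cdot> A.act) = B\<^sup>\<star> \<odot> B" "Cod V (B.act \<cdot> f) = B\<^sup>\<star> \<odot> B" "B \<in> Ob V" "B \<in> Ob V"
    by simp_all
qed

subsection \<open>The category of normalisable algebras\<close>

abbreviation mul :: "'o \<times> 'a \<times> 'a \<times> 'a \<Rightarrow> 'a" where "mul P \<equiv> fst (snd P)"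
abbreviation nor :: "'o \<times> 'a \<times> 'a \<times> 'a \<Rightarrow> 'a" where "nor P \<equiv> snd (snd (snd P))"
abbreviation al :: "'o \<times> 'a \<times> 'a \<times> 'a \<Rightarrow> 'a" where "al P \<equiv> action V (fst P) (mul P)"

lemma cpstar_alg: "P \<in> cpstar_Ob V \<longleftrightarrow> alg (fst P) (mul P) (fst (snd (snd P))) (nor P)"
  by (cases P) (simp add: cpstar_Ob_iff)

lemma cpstar_Ob_D:
  assumes "P \<in> cpstar_Ob V"
  shows "fst P \<in> Ob V" "nor P \<in> Arr V" "Dom V (nor P) = fst P" "Cod V (nor P) = fst P" "(nor P)\<dagger> = nor P"
    "al P \<in> Arr V" "Dom V (al P) = fst P" "Cod V (al P) = (fst P)\<^sup>\<star> \<odot> fst P"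
    "(al P)\<dagger> \<cdot> al P \<cdot> nor P \<cdot> nor P = \<one> (fst P)"
    "nor P \<cdot> (al P)\<dagger> \<cdot> al P \<cdot> nor P = \<one> (fst P)"
    "nor P \<cdot> nor P \<cdot> (al P)\<dagger> \<cdot> al P = \<one> (fst P)"
    "h \<in> Arr V \<Longrightarrow> Cod V h = fst P \<Longrightarrow> (al P)\<dagger> \<cdot> al P \<cdot> nor P \<cdot> nor P \<cdot> h = h"
    "h \<in> Arr V \<Longrightarrow> Cod V h = fst P \<Longrightarrow> nor P \<cdot> (al P)\<dagger> \<cdot> al P \<cdot> nor P \<cdot> h = h"
    "h \<in> Arr V \<Longrightarrow> Cod V h = fst P \<Longrightarrow> nor P \<cdot> nor P \<cdot> (al P)\<dagger> \<cdot> al P \<cdot> h = h"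
    "mul P \<in> Arr V" "Dom V (mul P) = fst P \<odot> fst P" "Cod V (mul P) = fst P"
  using algD[OF assms[unfolded cpstar_alg]] by simp_all

definition cpstar_arr :: "'o \<times> 'a \<times> 'a \<times> 'a \<Rightarrow> 'a \<Rightarrow> 'o \<times> 'a \<times> 'a \<times> 'a \<Rightarrow> bool" where
  "cpstar_arr P f Q \<longleftrightarrow> P \<in> cpstar_Ob V \<and> Q \<in> cpstar_Ob V \<and> f \<in> Arr V \<and> Dom V f = fst P \<and> Cod V f = fst Q
     \<and> cp (fst P) (fst Q) (al Q \<cdot> f \<cdot> (al P)\<dagger>)"

lemma cpstar_arrD:
  assumes "cpstar_arr P f Q"
  shows "P \<in> cpstar_Ob V" "Q \<in> cpstar_Ob V" "f \<in> Arr V" "Dom V f = fst P" "Cod V f = fst Q"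
    "cp (fst P) (fst Q) (al Q \<cdot> f \<cdot> (al P)\<dagger>)"
  using assms by (simp_all add: cpstar_arr_def)

lemma CPstar_simps:
  "Ob (CPstar V) = cpstar_Ob V"
  "Dom (CPstar V) (P, f, Q) = P"
  "Cod (CPstar V) (P, f, Q) = Q"
  "Idn (CPstar V) P = (P, \<one> (fst P), P)"
  "Comp (CPstar V) (Q', g, R) (P, f, Q) = (P, g \<cdot> f, R)"
  "Dag (CPstar V) (P, f, Q) = (Q, f\<dagger>, P)"
  "TensO (CPstar V) = cpstar_TensO V"
  "TensA (CPstar V) (P, f, Q) (P', g, Q') = (cpstar_TensO V P P', f \<otimes> g, cpstar_TensO V Q Q')"
  "UnitO (CPstar V) = cpstar_UnitO V"
  "Assoc (CPstar V) P Q R = (cpstar_TensO V (cpstar_TensO V P Q) R, \<a> (fst P) (fst Q) (fst R),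
     cpstar_TensO V P (cpstar_TensO V Q R))"
  "LUnit (CPstar V) P = (cpstar_TensO V (cpstar_UnitO V) P, \<l> (fst P), P)"
  "RUnit (CPstar V) P = (cpstar_TensO V P (cpstar_UnitO V), \<r> (fst P), P)"
  "Symm (CPstar V) P Q = (cpstar_TensO V P Q, \<sigma> (fst P) (fst Q), cpstar_TensO V Q P)"
  by (simp_all add: CPstar_def)

lemma CPstar_Arr: "Arr (CPstar V) = {(P, f, Q). cpstar_arr P f Q}"
  by (auto simp: CPstar_def cpstar_arr_def Hom_iff)

lemma CPstar_Hom_iff: "x \<in> Hom (CPstar V) P Q \<longleftrightarrow> (\<exists>f. x = (P, f, Q) \<and> cpstar_arr P f Q)"
  by (cases x) (auto simp: Hom_def CPstar_Arr CPstar_simps)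

lemma cpstar_TensO_sel [simp]:
  "fst (cpstar_TensO V P Q) = fst P \<odot> fst Q"
  "mul (cpstar_TensO V P Q) = (mul P \<otimes> mul Q) \<cdot> ic (fst P) (fst Q) (fst P) (fst Q)"
  "nor (cpstar_TensO V P Q) = nor P \<otimes> nor Q"
  "fst (cpstar_UnitO V) = \<I>" "mul (cpstar_UnitO V) = \<l> \<I>" "nor (cpstar_UnitO V) = \<one> \<I>"
  by (cases P; cases Q; simp add: cpstar_UnitO_def)+

lemma cpstar_TensO_Ob [simp]:
  "P \<in> cpstar_Ob V \<Longrightarrow> Q \<in> cpstar_Ob V \<Longrightarrow> cpstar_TensO V P Q \<in> cpstar_Ob V"
  by (cases P; cases Q) (simp add: cpstar_Ob_iff alg_tens)

lemma cpstar_UnitO_Ob [simp]: "cpstar_UnitO V \<in> cpstar_Ob V"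
  by (simp add: cpstar_UnitO_def cpstar_Ob_iff alg_unit)

lemma cpstar_multiplication: "P \<in> cpstar_Ob V \<Longrightarrow> multiplication V (fst P) (mul P)"
  by (simp add: cpstar_alg normalisable_algebra_def frobenius_algebra_def)

lemma al_tens:
  "P \<in> cpstar_Ob V \<Longrightarrow> Q \<in> cpstar_Ob V \<Longrightarrow> al (cpstar_TensO V P Q) = mu (fst P) (fst Q) \<cdot> (al P \<otimes> al Q)"
  using action_tens[OF cpstar_multiplication cpstar_multiplication] by simp

lemma cp_al:
  assumes "P \<in> cpstar_Ob V"
  shows "cp (fst P) (fst P) (al P \<cdot> (al P)\<dagger>)" "cp (fst P) (fst P) (al P \<cdot> nor P \<cdot> (al P)\<dagger>)"
    "dbl (nor P) \<cdot> al P = al P \<cdot> nor P \<cdot> nor P"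
  using alg_cp[OF assms[unfolded cpstar_alg]] by simp_all

lemma cpstar_arr_idn: "P \<in> cpstar_Ob V \<Longrightarrow> cpstar_arr P (\<one> (fst P)) P"
  using cp_al[of P] cpstar_Ob_D[of P] by (simp add: cpstar_arr_def)

text \<open>Composing the two tested maps would insert \<open>w\<close> twice if a map is put
  between them; \<alpha> z z z z \<alpha>\<dagger> compensates, as w z z z z w = 1. It is completely
  positive, being \<alpha> \<alpha>\<dagger> between two doubled normalisers.\<close>

lemma cpstar_arr_comp:
  assumes "cpstar_arr P f Q" "cpstar_arr Q g R"
  shows "cpstar_arr P (g \<cdot> f) R"
proof -
  note f = cpstar_arrD[OF assms(1)] and g = cpstar_arrD[OF assms(2)]
  note P = cpstar_Ob_D[OF f(1)] and Q = cpstar_Ob_D[OF f(2)] and R = cpstar_Ob_D[OF g(2)]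
  have n: "cp (fst Q) (fst Q) (dbl (nor Q) \<cdot> (al Q \<cdot> (al Q)\<dagger>) \<cdot> dbl (nor Q))"
    using cp_comp[OF cp_comp[OF cp_dbl[of "nor Q" "fst Q" "fst Q"] cp_al(1)[OF f(2)]] cp_dbl[of "nor Q" "fst Q" "fst Q"]] Q
    by simp
  have "(dbl (nor Q) \<cdot> al Q)\<dagger> = (al Q \<cdot> nor Q \<cdot> nor Q)\<dagger>" by (simp only: cp_al[OF f(2)])
  then have "(al Q)\<dagger> \<cdot> dbl (nor Q) = nor Q \<cdot> nor Q \<cdot> (al Q)\<dagger>" using Q by simp
  then have "dbl (nor Q) \<cdot> (al Q \<cdot> (al Q)\<dagger>) \<cdot> dbl (nor Q) = al Q \<cdot> nor Q \<cdot> nor Q \<cdot> nor Q \<cdot> nor Q \<cdot> (al Q)\<dagger>"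
    using Q cp_al(3)[OF f(2)] comp_lift[OF cp_al(3)[OF f(2)]] by simp
  with n have n: "cp (fst Q) (fst Q) (al Q \<cdot> nor Q \<cdot> nor Q \<cdot> nor Q \<cdot> nor Q \<cdot> (al Q)\<dagger>)" by simp
  have "cp (fst P) (fst R) ((al R \<cdot> g \<cdot> (al Q)\<dagger>) \<cdot> (al Q \<cdot> nor Q \<cdot> nor Q \<cdot> nor Q \<cdot> nor Q \<cdot> (al Q)\<dagger>) \<cdot> (al Q \<cdot> f \<cdot> (al P)\<dagger>))"
    by (rule cp_comp[OF cp_comp[OF f(6) n] g(6)]) (simp_all add: Q R)
  also have "(al R \<cdot> g \<cdot> (al Q)\<dagger>) \<cdot> (al Q \<cdot> nor Q \<cdot> nor Q \<cdot> nor Q \<cdot> nor Q \<cdot> (al Q)\<dagger>) \<cdot> (al Q \<cdot> f \<cdot> (al P)\<dagger>)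
    = al R \<cdot> (g \<cdot> f) \<cdot> (al P)\<dagger>"
    using P Q R f(3-5) g(3-5) by simp
  finally show ?thesis using f g by (simp add: cpstar_arr_def)
qed

lemma cpstar_arr_dag:
  assumes "cpstar_arr P f Q" shows "cpstar_arr Q (f\<dagger>) P"
proof -
  note f = cpstar_arrD[OF assms]
  note P = cpstar_Ob_D[OF f(1)] and Q = cpstar_Ob_D[OF f(2)]
  show ?thesis using cp_dag[OF f(6) Q(1)] f(1-5) P Q by (simp add: cpstar_arr_def)
qed

lemma cpstar_arr_tens:
  assumes "cpstar_arr P f Q" "cpstar_arr P' g Q'"
  shows "cpstar_arr (cpstar_TensO V P P') (f \<otimes> g) (cpstar_TensO V Q Q')"
proof -
  note f = cpstar_arrD[OF assms(1)] and g = cpstar_arrD[OF assms(2)]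
  note [simp] = cpstar_Ob_D(1,6-8)[OF f(1)] cpstar_Ob_D(1,6-8)[OF f(2)] cpstar_Ob_D(1,6-8)[OF g(1)] cpstar_Ob_D(1,6-8)[OF g(2)]
  have "cp (fst P \<odot> fst P') (fst Q \<odot> fst Q') (al (cpstar_TensO V Q Q') \<cdot> (f \<otimes> g) \<cdot> (al (cpstar_TensO V P P'))\<dagger>)"
    unfolding al_tens[OF f(1) g(1)] al_tens[OF f(2) g(2)]
    using cp_tens[OF f(6) g(6)] f(3-5) g(3-5) by (simp add: tens_merge)
  then show ?thesis using f g by (simp add: cpstar_arr_def)
qed

text \<open>The common property of associators, unitors and symmetries between tensor algebras. It
  yields both that they are morphisms of CP* and that \<open>F\<close> sends them to the structure
  maps of the splitting (\<open>Fa_iso\<close>).\<close>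

definition alg_iso :: "'o \<times> 'a \<times> 'a \<times> 'a \<Rightarrow> 'a \<Rightarrow> 'o \<times> 'a \<times> 'a \<times> 'a \<Rightarrow> bool" where
  "alg_iso P f Q \<longleftrightarrow> P \<in> cpstar_Ob V \<and> Q \<in> cpstar_Ob V \<and> unit_arr f \<and> Dom V f = fst P \<and> Cod V f = fst Q
     \<and> f \<cdot> mul P = mul Q \<cdot> (f \<otimes> f) \<and> f \<cdot> nor P = nor Q \<cdot> f"

lemma alg_iso_al:
  assumes "alg_iso P f Q" shows "dbl f \<cdot> al P = al Q \<cdot> f"
  using assms by (intro action_hom) (simp_all add: alg_iso_def cpstar_multiplication)

text \<open>By \<open>alg_iso_al\<close> the map to be tested is \<open>dbl f\<close> after \<alpha>
  \<alpha>\<dagger>.\<close>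

lemma cpstar_arr_iso:
  assumes "alg_iso P f Q" shows "cpstar_arr P f Q"
proof -
  have P: "P \<in> cpstar_Ob V" and Q: "Q \<in> cpstar_Ob V" and u: "unit_arr f" and f: "Dom V f = fst P" "Cod V f = fst Q"
    using assms by (simp_all add: alg_iso_def)
  note [simp] = cpstar_Ob_D[OF P] cpstar_Ob_D[OF Q] unit_arrD(1)[OF u] f
  have "cp (fst P) (fst Q) (dbl f \<cdot> (al P \<cdot> (al P)\<dagger>))"
    by (rule cp_comp[OF cp_al(1)[OF P] cp_dbl]) simp_all
  also have "dbl f \<cdot> (al P \<cdot> (al P)\<dagger>) = al Q \<cdot> f \<cdot> (al P)\<dagger>"
    by (simp add: comp_lift[OF alg_iso_al[OF assms]])
  finally show ?thesis using P Q by (simp add: cpstar_arr_def)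
qed

lemma alg_iso_a:
  assumes P: "P \<in> cpstar_Ob V" and Q: "Q \<in> cpstar_Ob V" and R: "R \<in> cpstar_Ob V"
  shows "alg_iso (cpstar_TensO V (cpstar_TensO V P Q) R) (\<a> (fst P) (fst Q) (fst R)) (cpstar_TensO V P (cpstar_TensO V Q R))"
proof -
  note [simp] = cpstar_Ob_D[OF P] cpstar_Ob_D[OF Q] cpstar_Ob_D[OF R] P Q R
  let ?A = "fst P" and ?B = "fst Q" and ?C = "fst R"
  have s: "((mul P \<otimes> mul Q) \<cdot> ic ?A ?B ?A ?B) \<otimes> mul R = ((mul P \<otimes> mul Q) \<otimes> mul R) \<cdot> (ic ?A ?B ?A ?B \<otimes> \<one> (?C \<odot> ?C))"
    by (simp add: tens_comp)
  have t: "mul P \<otimes> ((mul Q \<otimes> mul R) \<cdot> ic ?B ?C ?B ?C) = (mul P \<otimes> (mul Q \<otimes> mul R)) \<cdot> (\<one> (?A \<odot> ?A) \<otimes> ic ?B ?C ?B ?C)"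
    by (simp add: tens_comp)
  have "\<a> ?A ?B ?C \<cdot> (((mul P \<otimes> mul Q) \<cdot> ic ?A ?B ?A ?B) \<otimes> mul R) \<cdot> ic (?A \<odot> ?B) ?C (?A \<odot> ?B) ?C
    = (mul P \<otimes> ((mul Q \<otimes> mul R) \<cdot> ic ?B ?C ?B ?C)) \<cdot> ic ?A (?B \<odot> ?C) ?A (?B \<odot> ?C) \<cdot> (\<a> ?A ?B ?C \<otimes> \<a> ?A ?B ?C)"
    unfolding s t by (simp add: ic_assoc'[symmetric] nat del: ic_ic)
  then show ?thesis by (simp add: alg_iso_def a_nat)
qed

lemma alg_iso_l:
  assumes P: "P \<in> cpstar_Ob V"
  shows "alg_iso (cpstar_TensO V (cpstar_UnitO V) P) (\<l> (fst P)) P"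
proof -
  note [simp] = cpstar_Ob_D[OF P] P
  let ?A = "fst P"
  have "\<l> \<I> \<otimes> mul P = (\<one> \<I> \<otimes> mul P) \<cdot> (\<l> \<I> \<otimes> \<one> (?A \<odot> ?A))" by (simp add: tens_comp)
  then have "\<l> ?A \<cdot> (\<l> \<I> \<otimes> mul P) \<cdot> ic \<I> ?A \<I> ?A = mul P \<cdot> (\<l> ?A \<otimes> \<l> ?A)"
    by (simp add: nat ic_unit_left')
  then show ?thesis by (simp add: alg_iso_def l_nat)
qed

lemma alg_iso_r:
  assumes P: "P \<in> cpstar_Ob V"
  shows "alg_iso (cpstar_TensO V P (cpstar_UnitO V)) (\<r> (fst P)) P"
proof -
  note [simp] = cpstar_Ob_D[OF P] P
  let ?A = "fst P"
  have "mul P \<otimes> \<l> \<I> = (mul P \<otimes> \<one> \<I>) \<cdot> (\<one> (?A \<odot> ?A) \<otimes> \<l> \<I>)" by (simp add: tens_comp)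
  then have "\<r> ?A \<cdot> (mul P \<otimes> \<l> \<I>) \<cdot> ic ?A \<I> ?A \<I> = mul P \<cdot> (\<r> ?A \<otimes> \<r> ?A)"
    by (simp add: nat ic_unit_right')
  then show ?thesis by (simp add: alg_iso_def r_nat)
qed

lemma alg_iso_s:
  assumes P: "P \<in> cpstar_Ob V" and Q: "Q \<in> cpstar_Ob V"
  shows "alg_iso (cpstar_TensO V P Q) (\<sigma> (fst P) (fst Q)) (cpstar_TensO V Q P)"
  using cpstar_Ob_D[OF P] cpstar_Ob_D[OF Q] P Q
  by (simp add: alg_iso_def s_nat comp_lift[OF s_nat] ic_sigma')

lemmas alg_iso_structure = alg_iso_a alg_iso_l alg_iso_r alg_iso_s

lemma CPstar_unitary:
  assumes "alg_iso P f Q" shows "unitary (CPstar V) P Q (P, f, Q)"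
proof -
  have "unit_arr f" "Dom V f = fst P" "Cod V f = fst Q" using assms by (simp_all add: alg_iso_def)
  then show ?thesis
    using cpstar_arr_iso[OF assms] unit_arrD[of f] by (simp add: unitary_def CPstar_Hom_iff CPstar_simps)
qed

text \<open>All operations are those of \<open>V\<close> on underlying arrows, so the equations are
  inherited. The content lies in closure of the morphisms, provided by the lemmas above.\<close>

lemma CPstar_dsm: "dagger_symmetric_monoidal_category (CPstar V)"
proof -
  let ?S = "CPstar V"
  show ?thesis
  proof unfold_locales
    fix f assume "f \<in> Arr ?S"
    then show "Dom ?S f \<in> Ob ?S" "Cod ?S f \<in> Ob ?S"
      by (auto simp: CPstar_Arr CPstar_simps cpstar_arr_def)
  next
    fix X assume X: "X \<in> Ob ?S"
    then show "Idn ?S X \<in> Hom ?S X X" "Dag ?S (Idn ?S X) = Idn ?S X"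
      using cpstar_Ob_D[of X] by (simp_all add: CPstar_simps CPstar_Hom_iff cpstar_arr_idn)
    show "unitary ?S (TensO ?S (UnitO ?S) X) X (LUnit ?S X)" "unitary ?S (TensO ?S X (UnitO ?S)) X (RUnit ?S X)"
      using X by (simp_all add: CPstar_simps CPstar_unitary alg_iso_structure)
  next
    fix f g h X Y Z W
    assume "f \<in> Hom ?S X Y"
    then obtain f' where f [simp]: "f = (X, f', Y)" "cpstar_arr X f' Y" by (auto simp: CPstar_Hom_iff)
    note [simp] = cpstar_arrD(1-5)[OF f(2)] cpstar_Ob_D(1)[OF cpstar_arrD(1)[OF f(2)]] cpstar_Ob_D(1)[OF cpstar_arrD(2)[OF f(2)]]
    show "Comp ?S (Idn ?S Y) f = f" "Comp ?S f (Idn ?S X) = f" "Dag ?S f \<in> Hom ?S Y X" "Dag ?S (Dag ?S f) = f"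
      by (simp_all add: CPstar_simps CPstar_Hom_iff cpstar_arr_dag)
    show "Comp ?S (LUnit ?S Y) (TensA ?S (Idn ?S (UnitO ?S)) f) = Comp ?S f (LUnit ?S X)"
      "Comp ?S (RUnit ?S Y) (TensA ?S f (Idn ?S (UnitO ?S))) = Comp ?S f (RUnit ?S X)"
      by (simp_all add: CPstar_simps l_nat r_nat)
    assume "g \<in> Hom ?S Y Z"
    then obtain g' where g [simp]: "g = (Y, g', Z)" "cpstar_arr Y g' Z" by (auto simp: CPstar_Hom_iff)
    note [simp] = cpstar_arrD(1-5)[OF g(2)]
    show "Comp ?S g f \<in> Hom ?S X Z" "Dag ?S (Comp ?S g f) = Comp ?S (Dag ?S f) (Dag ?S g)"
      using cpstar_arr_comp[OF f(2) g(2)] by (simp_all add: CPstar_simps CPstar_Hom_iff)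
    assume "h \<in> Hom ?S Z W"
    then obtain h' where h [simp]: "h = (Z, h', W)" "cpstar_arr Z h' W" by (auto simp: CPstar_Hom_iff)
    note [simp] = cpstar_arrD(1-5)[OF h(2)]
    show "Comp ?S (Comp ?S h g) f = Comp ?S h (Comp ?S g f)" by (simp add: CPstar_simps)
  next
    show "UnitO ?S \<in> Ob ?S" by (simp add: CPstar_simps)
  next
    fix X Y assume X: "X \<in> Ob ?S" and Y: "Y \<in> Ob ?S"
    then have [simp]: "X \<in> cpstar_Ob V" "Y \<in> cpstar_Ob V" by (simp_all add: CPstar_simps)
    note [simp] = cpstar_Ob_D(1)[of X] cpstar_Ob_D(1)[of Y]
    show "TensO ?S X Y \<in> Ob ?S" "TensA ?S (Idn ?S X) (Idn ?S Y) = Idn ?S (TensO ?S X Y)"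
      "unitary ?S (TensO ?S X Y) (TensO ?S Y X) (Symm ?S X Y)"
      "Comp ?S (TensA ?S (Idn ?S X) (LUnit ?S Y)) (Assoc ?S X (UnitO ?S) Y) = TensA ?S (RUnit ?S X) (Idn ?S Y)"
      "Comp ?S (Symm ?S Y X) (Symm ?S X Y) = Idn ?S (TensO ?S X Y)"
      by (simp_all add: CPstar_simps CPstar_unitary alg_iso_structure triangle)
    fix Z assume "Z \<in> Ob ?S"
    then have [simp]: "Z \<in> cpstar_Ob V" by (simp add: CPstar_simps)
    note [simp] = cpstar_Ob_D(1)[of Z]
    show "unitary ?S (TensO ?S (TensO ?S X Y) Z) (TensO ?S X (TensO ?S Y Z)) (Assoc ?S X Y Z)"
      "Comp ?S (Assoc ?S Y Z X) (Comp ?S (Symm ?S X (TensO ?S Y Z)) (Assoc ?S X Y Z))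
        = Comp ?S (TensA ?S (Idn ?S Y) (Symm ?S X Z)) (Comp ?S (Assoc ?S Y X Z) (TensA ?S (Symm ?S X Y) (Idn ?S Z)))"
      by (simp_all add: CPstar_simps CPstar_unitary alg_iso_structure hexagon)
    fix W assume "W \<in> Ob ?S"
    then have [simp]: "W \<in> cpstar_Ob V" by (simp add: CPstar_simps)
    note [simp] = cpstar_Ob_D(1)[of W]
    show "Comp ?S (TensA ?S (Idn ?S X) (Assoc ?S Y Z W))
        (Comp ?S (Assoc ?S X (TensO ?S Y Z) W) (TensA ?S (Assoc ?S X Y Z) (Idn ?S W)))
      = Comp ?S (Assoc ?S X Y (TensO ?S Z W)) (Assoc ?S (TensO ?S X Y) Z W)"
      by (simp add: CPstar_simps pentagon)
  next
    fix f X X' g Y Y'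
    assume "f \<in> Hom ?S X X'"
    then obtain f' where f [simp]: "f = (X, f', X')" "cpstar_arr X f' X'" by (auto simp: CPstar_Hom_iff)
    assume "g \<in> Hom ?S Y Y'"
    then obtain g' where g [simp]: "g = (Y, g', Y')" "cpstar_arr Y g' Y'" by (auto simp: CPstar_Hom_iff)
    note [simp] = cpstar_arrD(1-5)[OF f(2)] cpstar_arrD(1-5)[OF g(2)]
    show "TensA ?S f g \<in> Hom ?S (TensO ?S X Y) (TensO ?S X' Y')"
      "Dag ?S (TensA ?S f g) = TensA ?S (Dag ?S f) (Dag ?S g)"
      "Comp ?S (Symm ?S X' Y') (TensA ?S f g) = Comp ?S (TensA ?S g f) (Symm ?S X Y)"
      by (simp_all add: CPstar_simps CPstar_Hom_iff cpstar_arr_tens s_nat)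
    fix h Z Z' assume "h \<in> Hom ?S Z Z'"
    then obtain h' where h [simp]: "h = (Z, h', Z')" "cpstar_arr Z h' Z'" by (auto simp: CPstar_Hom_iff)
    note [simp] = cpstar_arrD(1-5)[OF h(2)]
    show "Comp ?S (Assoc ?S X' Y' Z') (TensA ?S (TensA ?S f g) h) = Comp ?S (TensA ?S f (TensA ?S g h)) (Assoc ?S X Y Z)"
      by (simp add: CPstar_simps a_nat)
  next
    fix f X Y f' Z g U W g' W'
    assume "f \<in> Hom ?S X Y" "f' \<in> Hom ?S Y Z" "g \<in> Hom ?S U W" "g' \<in> Hom ?S W W'"
    then obtain k k' l l' where "f = (X, k, Y)" "f' = (Y, k', Z)" "g = (U, l, W)" "g' = (W, l', W')"
      "cpstar_arr X k Y" "cpstar_arr Y k' Z" "cpstar_arr U l W" "cpstar_arr W l' W'"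
      by (auto simp: CPstar_Hom_iff)
    then show "TensA ?S (Comp ?S f' f) (Comp ?S g' g) = Comp ?S (TensA ?S f' g') (TensA ?S f g)"
      using cpstar_arrD(3-5) by (simp add: CPstar_simps tens_comp)
  qed
qed

subsection \<open>The functor\<close>

definition Fo :: "'o \<times> 'a \<times> 'a \<times> 'a \<Rightarrow> 'o \<times> 'o \<times> 'a \<times> 'o" where
  "Fo P = (fst P, (fst P, al P \<cdot> nor P \<cdot> nor P \<cdot> (al P)\<dagger>, fst P))"

definition Fm :: "'o \<times> 'a \<times> 'a \<times> 'a \<Rightarrow> 'a \<Rightarrow> 'o \<times> 'a \<times> 'a \<times> 'a \<Rightarrow> 'a" where
  "Fm P f Q = al Q \<cdot> nor Q \<cdot> f \<cdot> nor P \<cdot> (al P)\<dagger>"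

definition Fa :: "('o \<times> 'a \<times> 'a \<times> 'a) \<times> 'a \<times> ('o \<times> 'a \<times> 'a \<times> 'a)
    \<Rightarrow> ('o \<times> 'o \<times> 'a \<times> 'o) \<times> ('o \<times> 'a \<times> 'o) \<times> ('o \<times> 'o \<times> 'a \<times> 'o)" where
  "Fa = (\<lambda>(P, f, Q). (Fo P, (fst P, Fm P f Q, fst Q), Fo Q))"

lemma Fa_simp: "Fa (P, f, Q) = (Fo P, (fst P, Fm P f Q, fst Q), Fo Q)"
  by (simp add: Fa_def)

text \<open>The idempotent of an algebra is the image of its identity, so idempotency and
  self-adjointness are instances of \<open>Fm_comp\<close> and \<open>Fm_dag\<close>.\<close>

lemma Fo_Fm: "P \<in> cpstar_Ob V \<Longrightarrow> Fo P = (fst P, (fst P, Fm P (\<one> (fst P)) P, fst P))"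
  using cpstar_Ob_D[of P] by (simp add: Fo_def Fm_def)

lemma Fm_arr:
  assumes "P \<in> cpstar_Ob V" "Q \<in> cpstar_Ob V" "f \<in> Arr V" "Dom V f = fst P" "Cod V f = fst Q"
  shows "Fm P f Q \<in> Arr V" "Dom V (Fm P f Q) = (fst P)\<^sup>\<star> \<odot> fst P" "Cod V (Fm P f Q) = (fst Q)\<^sup>\<star> \<odot> fst Q"
  using assms cpstar_Ob_D[OF assms(1)] cpstar_Ob_D[OF assms(2)] by (simp_all add: Fm_def)

text \<open>In the middle of the composite stands z \<alpha>\<dagger> \<alpha> z, which is the
  identity.\<close>

lemma Fm_comp:
  assumes "cpstar_arr P f Q" "cpstar_arr Q g R"
  shows "Fm Q g R \<cdot> Fm P f Q = Fm P (g \<cdot> f) R"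
proof -
  note f = cpstar_arrD[OF assms(1)] and g = cpstar_arrD[OF assms(2)]
  show ?thesis
    using f(3-5) g(3-5) cpstar_Ob_D[OF f(1)] cpstar_Ob_D[OF f(2)] cpstar_Ob_D[OF g(2)]
    by (simp add: Fm_def)
qed

lemma Fm_dag:
  assumes "cpstar_arr P f Q" shows "(Fm P f Q)\<dagger> = Fm Q (f\<dagger>) P"
proof -
  note f = cpstar_arrD[OF assms]
  show ?thesis using f(3-5) cpstar_Ob_D[OF f(1)] cpstar_Ob_D[OF f(2)] by (simp add: Fm_def)
qed

text \<open>Doubled normalisers put z z on both sides of \<open>f\<close>. Composing with \<alpha> z
  \<alpha>\<dagger> at both ends then leaves a single z each, because \<alpha>\<dagger> \<alpha>
  cancels the pair.\<close>

lemma cp_Fm: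
  assumes "cpstar_arr P f Q" shows "cp (fst P) (fst Q) (Fm P f Q)"
proof -
  note f = cpstar_arrD[OF assms]
  note [simp] = f(3-5) cpstar_Ob_D[OF f(1)] cpstar_Ob_D[OF f(2)]
  have "(dbl (nor P) \<cdot> al P)\<dagger> = (al P \<cdot> nor P \<cdot> nor P)\<dagger>" by (simp only: cp_al[OF f(1)])
  then have p: "(al P)\<dagger> \<cdot> dbl (nor P) = nor P \<cdot> nor P \<cdot> (al P)\<dagger>" by simp
  have "cp (fst P) (fst Q) ((al Q \<cdot> nor Q \<cdot> (al Q)\<dagger>) \<cdot> (dbl (nor Q) \<cdot> (al Q \<cdot> f \<cdot> (al P)\<dagger>) \<cdot> dbl (nor P)) \<cdot> (al P \<cdot> nor P \<cdot> (al P)\<dagger>))"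
    by (rule cp_comp[OF cp_comp[OF cp_al(2)[OF f(1)] cp_comp[OF cp_comp[OF cp_dbl f(6)] cp_dbl]] cp_al(2)[OF f(2)]]) simp_all
  also have "dbl (nor Q) \<cdot> (al Q \<cdot> f \<cdot> (al P)\<dagger>) \<cdot> dbl (nor P) = al Q \<cdot> nor Q \<cdot> nor Q \<cdot> f \<cdot> nor P \<cdot> nor P \<cdot> (al P)\<dagger>"
    by (simp add: p comp_lift[OF cp_al(3)[OF f(2)]])
  also have "(al Q \<cdot> nor Q \<cdot> (al Q)\<dagger>) \<cdot> (al Q \<cdot> nor Q \<cdot> nor Q \<cdot> f \<cdot> nor P \<cdot> nor P \<cdot> (al P)\<dagger>) \<cdot> (al P \<cdot> nor P \<cdot> (al P)\<dagger>) = Fm P f Q"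
    by (simp add: Fm_def)
  finally show ?thesis .
qed

lemma Fm_tens:
  assumes "cpstar_arr P f Q" "cpstar_arr P' g Q'"
  shows "mu (fst Q) (fst Q') \<cdot> (Fm P f Q \<otimes> Fm P' g Q') \<cdot> (mu (fst P) (fst P'))\<dagger>
    = Fm (cpstar_TensO V P P') (f \<otimes> g) (cpstar_TensO V Q Q')"
proof -
  note f = cpstar_arrD[OF assms(1)] and g = cpstar_arrD[OF assms(2)]
  note [simp] = f(3-5) g(3-5) cpstar_Ob_D[OF f(1)] cpstar_Ob_D[OF f(2)] cpstar_Ob_D[OF g(1)] cpstar_Ob_D[OF g(2)]
  show ?thesis
    unfolding Fm_def al_tens[OF f(1) g(1)] al_tens[OF f(2) g(2)] by (simp add: tens_merge)
qed

interpretation CPM: dagger_symmetric_monoidal_category "CPM V" by (rule CPM_dsm)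
interpretation S: dagger_symmetric_monoidal_category "Split_dagger (CPM V)" by (rule CPM.Split_dsm)
interpretation CS: dagger_symmetric_monoidal_category "CPstar V" by (rule CPstar_dsm)

lemma Fo_split_Ob: "P \<in> cpstar_Ob V \<Longrightarrow> Fo P \<in> split_Ob (CPM V)"
  using cpstar_arr_idn[of P] Fm_arr[of P P "\<one> (fst P)"] cpstar_Ob_D(1)[of P]
    Fm_comp[of P "\<one> (fst P)" P "\<one> (fst P)" P] Fm_dag[of P "\<one> (fst P)" P]
  by (simp add: split_Ob_def Fo_Fm CPM_simps CPM_Hom_iff cp_Fm)

lemma Fa_split_Hom:
  assumes "cpstar_arr P f Q" shows "Fa (P, f, Q) \<in> Hom (Split_dagger (CPM V)) (Fo P) (Fo Q)"
proof -
  note f = cpstar_arrD[OF assms]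
  have "Fm Q (\<one> (fst Q)) Q \<cdot> Fm P f Q = Fm P f Q" "Fm P f Q \<cdot> Fm P (\<one> (fst P)) P = Fm P f Q"
    using Fm_comp[OF assms cpstar_arr_idn[OF f(2)]] Fm_comp[OF cpstar_arr_idn[OF f(1)] assms] f(3-5) by simp_all
  moreover have "(fst P, Fm P f Q, fst Q) \<in> Arr (CPM V)"
    using cp_Fm[OF assms] cpstar_Ob_D(1)[OF f(1)] cpstar_Ob_D(1)[OF f(2)] by (simp add: CPM_simps)
  ultimately show ?thesis
    using Fo_split_Ob[OF f(1)] Fo_split_Ob[OF f(2)]
    by (simp add: CPM.split_Hom_iff CPM.splits_def Fa_simp) (simp add: Fo_Fm f CPM_simps)
qed

lemma Fo_tens:
  assumes "P \<in> cpstar_Ob V" "Q \<in> cpstar_Ob V"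
  shows "split_TensO (CPM V) (Fo P) (Fo Q) = Fo (cpstar_TensO V P Q)"
  using Fm_tens[OF cpstar_arr_idn[OF assms(1)] cpstar_arr_idn[OF assms(2)]] assms cpstar_Ob_D(1)[OF assms(1)] cpstar_Ob_D(1)[OF assms(2)]
  by (simp add: split_TensO_def Fo_Fm CPM_simps)

lemma Fo_unit: "split_UnitO (CPM V) = Fo (cpstar_UnitO V)"
  using unit_arrD(3)[OF eta_unit] by (simp add: split_UnitO_def Fo_def CPM_simps action_unit)

text \<open>\<open>alg_iso_al\<close> moves the doubled arrow past \<alpha>, where z z
  \<alpha>\<dagger> \<alpha> = 1 removes the idempotent of \<open>Q\<close>. Compatibility with the
  normalisers then distributes the remaining pair over the two sides.\<close>

lemma Fa_iso:
  assumes "alg_iso P f Q"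
  shows "split_arr (CPM V) (Fo P) (double V f) (Fo Q) = Fa (P, f, Q)"
proof -
  have P: "P \<in> cpstar_Ob V" and Q: "Q \<in> cpstar_Ob V" and u: "unit_arr f" and f: "Dom V f = fst P" "Cod V f = fst Q"
    and z: "f \<cdot> nor P = nor Q \<cdot> f"
    using assms by (simp_all add: alg_iso_def)
  note [simp] = cpstar_Ob_D[OF P] cpstar_Ob_D[OF Q] unit_arrD(1)[OF u] f
  have "(al Q \<cdot> nor Q \<cdot> nor Q \<cdot> (al Q)\<dagger>) \<cdot> dbl f \<cdot> al P \<cdot> nor P \<cdot> nor P \<cdot> (al P)\<dagger>
    = al Q \<cdot> (f \<cdot> nor P) \<cdot> nor P \<cdot> (al P)\<dagger>"
    by (simp add: comp_lift[OF alg_iso_al[OF assms]])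
  also have "\<dots> = Fm P f Q" unfolding z by (simp add: Fm_def)
  finally show ?thesis
    by (simp add: split_arr_def Fo_def double_def CPM_simps Fa_def)
qed

lemma Fa_functor: "category_functor (CPstar V) (Split_dagger (CPM V)) Fo Fa"
proof unfold_locales
  fix X assume "X \<in> Ob (CPstar V)"
  then have X: "X \<in> cpstar_Ob V" by (simp add: CPstar_simps)
  show "Fo X \<in> Ob (Split_dagger (CPM V))" by (simp add: CPM.split_simps Fo_split_Ob X)
  show "Fa (Idn (CPstar V) X) = Idn (Split_dagger (CPM V)) (Fo X)"
    by (simp add: CPstar_simps CPM.split_simps Fa_simp Fo_Fm X)
next
  fix f g X Y Z
  assume "f \<in> Hom (CPstar V) X Y"
  then obtain f' where f: "f = (X, f', Y)" "cpstar_arr X f' Y" by (auto simp: CPstar_Hom_iff)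
  then show "Fa f \<in> Hom (Split_dagger (CPM V)) (Fo X) (Fo Y)" by (simp add: Fa_split_Hom)
  assume "g \<in> Hom (CPstar V) Y Z"
  then obtain g' where g: "g = (Y, g', Z)" "cpstar_arr Y g' Z" by (auto simp: CPstar_Hom_iff)
  show "Fa (Comp (CPstar V) g f) = Comp (Split_dagger (CPM V)) (Fa g) (Fa f)"
    using Fm_comp[OF f(2) g(2)] by (simp add: f g CPstar_simps Fa_simp CPM.split_simps CPM_simps)
qed

lemma Fa_full: "full_functor (CPstar V) (Split_dagger (CPM V)) Fo Fa"
proof -
  interpret category_functor "CPstar V" "Split_dagger (CPM V)" Fo Fa by (rule Fa_functor)
  show ?thesis
  proof unfold_locales
    fix X Y g assume "X \<in> Ob (CPstar V)" "Y \<in> Ob (CPstar V)" and g: "g \<in> Hom (Split_dagger (CPM V)) (Fo X) (Fo Y)"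
    then have X: "X \<in> cpstar_Ob V" and Y: "Y \<in> cpstar_Ob V" by (simp_all add: CPstar_simps)
    note [simp] = cpstar_Ob_D[OF X] cpstar_Ob_D[OF Y]
    obtain k where k: "g = (Fo X, k, Fo Y)" "CPM.splits (Fo X) k (Fo Y)" "Comp (CPM V) k (snd (Fo X)) = k"
      using g by (auto simp: CPM.split_Hom_iff)
    have "k \<in> Hom (CPM V) (fst X) (fst Y)"
      using k(2) by (simp add: CPM.splits_def Hom_def Fo_def)
    then obtain c where c [simp]: "k = (fst X, c, fst Y)" "cp (fst X) (fst Y) c" "c \<in> Arr V"
      "Dom V c = (fst X)\<^sup>\<star> \<odot> fst X" "Cod V c = (fst Y)\<^sup>\<star> \<odot> fst Y"
      by (auto simp: CPM_Hom_iff)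
    have cX: "c \<cdot> al X \<cdot> nor X \<cdot> nor X \<cdot> (al X)\<dagger> = c"
      using k(3) by (simp add: Fo_def CPM_simps)
    have cY: "al Y \<cdot> nor Y \<cdot> nor Y \<cdot> (al Y)\<dagger> \<cdot> c = c"
      using k(2) cX by (simp add: CPM.splits_def Fo_def CPM_simps)
    \<comment> \<open>The compression of \<open>c\<close> by the isometries
      \<open>al X \<cdot> nor X\<close> and \<open>al Y \<cdot> nor Y\<close>, which recovers an
      arrow from its image under \<open>Fm\<close>.\<close>
    let ?f = "nor Y \<cdot> (al Y)\<dagger> \<cdot> c \<cdot> al X \<cdot> nor X"
    \<comment> \<open>Regrouped, this composite is
      \<open>al Y \<cdot> ?f \<cdot> (al X)\<dagger>\<close>, the map that has to be completely
      positive.\<close>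
    have "cp (fst X) (fst Y) ((al Y \<cdot> nor Y \<cdot> (al Y)\<dagger>) \<cdot> c \<cdot> (al X \<cdot> nor X \<cdot> (al X)\<dagger>))"
      by (rule cp_comp[OF cp_comp[OF cp_al(2)[OF X] c(2)] cp_al(2)[OF Y]]) simp_all
    then have f: "cpstar_arr X ?f Y"
      using X Y by (simp add: cpstar_arr_def)
    have "Fm X ?f Y = (al Y \<cdot> nor Y \<cdot> nor Y \<cdot> (al Y)\<dagger> \<cdot> c) \<cdot> al X \<cdot> nor X \<cdot> nor X \<cdot> (al X)\<dagger>"
      by (simp add: Fm_def)
    also have "\<dots> = c" unfolding cY cX ..
    finally have "Fa (X, ?f, Y) = g" by (simp add: Fa_simp k(1))
    with f show "\<exists>f\<in>Hom (CPstar V) X Y. Fa f = g" by (auto simp: CPstar_Hom_iff)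
  qed
qed

lemma Fa_faithful: "faithful_functor (CPstar V) (Split_dagger (CPM V)) Fo Fa"
proof -
  interpret category_functor "CPstar V" "Split_dagger (CPM V)" Fo Fa by (rule Fa_functor)
  show ?thesis
  proof unfold_locales
    fix X Y
    \<comment> \<open>Compressing by the isometries undoes \<open>Fm\<close>.\<close>
    have *: "f = nor Y \<cdot> (al Y)\<dagger> \<cdot> Fm X f Y \<cdot> al X \<cdot> nor X" if "cpstar_arr X f Y" for f
      using cpstar_arrD(3-5)[OF that] cpstar_Ob_D[OF cpstar_arrD(1)[OF that]] cpstar_Ob_D[OF cpstar_arrD(2)[OF that]]
      by (simp add: Fm_def)
    show "inj_on Fa (Hom (CPstar V) X Y)"
    proof (rule inj_onI)
      fix f g assume "f \<in> Hom (CPstar V) X Y" "g \<in> Hom (CPstar V) X Y" and e: "Fa f = Fa g"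
      then obtain f' g' where f: "f = (X, f', Y)" "cpstar_arr X f' Y" and g: "g = (X, g', Y)" "cpstar_arr X g' Y"
        by (auto simp: CPstar_Hom_iff)
      have "Fm X f' Y = Fm X g' Y" using e by (simp add: f g Fa_simp)
      then show "f = g" using *[OF f(2)] *[OF g(2)] by (simp add: f g)
    qed
  qed
qed

text \<open>Since tensor products and unit are preserved strictly, identities serve as comparison
  maps, and the coherence conditions say only that \<open>Fa\<close> preserves structure
  maps.\<close>

lemma Fa_monoidal:
  "strong_dagger_symmetric_monoidal_functor (CPstar V) (Split_dagger (CPM V)) Fo Fa
    (\<lambda>X Y. Idn (Split_dagger (CPM V)) (Fo (cpstar_TensO V X Y))) (Idn (Split_dagger (CPM V)) (Fo (cpstar_UnitO V)))"
proof -
  let ?S = "Split_dagger (CPM V)"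
  interpret category_functor "CPstar V" ?S Fo Fa by (rule Fa_functor)
  have F [simp]: "Fo P \<in> Ob ?S" if "P \<in> cpstar_Ob V" for P
    using Fo_split_Ob[OF that] by (simp add: CPM.split_simps)
  have h [simp]: "Fa (P, f, Q) \<in> Arr ?S" "Dom ?S (Fa (P, f, Q)) = Fo P" "Cod ?S (Fa (P, f, Q)) = Fo Q" if "cpstar_arr P f Q" for P f Q
    using Fa_split_Hom[OF that] by (simp_all add: S.Hom_iff)
  note [simp] = Fo_tens[folded CPM.split_simps(7)] Fo_unit[folded CPM.split_simps(9)] CPstar_simps
    cpstar_arr_iso[OF alg_iso_a] cpstar_arr_iso[OF alg_iso_l] cpstar_arr_iso[OF alg_iso_r] cpstar_arr_iso[OF alg_iso_s]
  show ?thesis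
  proof unfold_locales
    show "unitary ?S (UnitO ?S) (Fo (UnitO (CPstar V))) (Idn ?S (Fo (cpstar_UnitO V)))"
      by (simp add: S.unitary_iff)
  next
    fix f X Y assume "f \<in> Hom (CPstar V) X Y"
    then show "Fa (Dag (CPstar V) f) = Dag ?S (Fa f)"
      by (auto simp: CPstar_Hom_iff Fa_simp CPM.split_simps CPM_simps Fm_dag)
  next
    fix f X X' g Y Y'
    assume "f \<in> Hom (CPstar V) X X'" "g \<in> Hom (CPstar V) Y Y'"
    then obtain f' g' where f: "f = (X, f', X')" "cpstar_arr X f' X'" and g: "g = (Y, g', Y')" "cpstar_arr Y g' Y'"
      by (auto simp: CPstar_Hom_iff)
    note [simp] = cpstar_arrD(1,2)[OF f(2)] cpstar_arrD(1,2)[OF g(2)]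
    have t: "TensA ?S (Fa f) (Fa g) = Fa (TensA (CPstar V) f g)"
      using Fm_tens[OF f(2) g(2)] Fo_tens by (simp add: f g Fa_simp CPM.split_simps CPM_simps)
    show "Comp ?S (Idn ?S (Fo (cpstar_TensO V X' Y'))) (TensA ?S (Fa f) (Fa g))
      = Comp ?S (Fa (TensA (CPstar V) f g)) (Idn ?S (Fo (cpstar_TensO V X Y)))"
      unfolding t using cpstar_arr_tens[OF f(2) g(2)] by (simp add: f g)
  next
    fix X Y assume "X \<in> Ob (CPstar V)" "Y \<in> Ob (CPstar V)"
    then have [simp]: "X \<in> cpstar_Ob V" "Y \<in> cpstar_Ob V" by simp_all
    show "unitary ?S (TensO ?S (Fo X) (Fo Y)) (Fo (TensO (CPstar V) X Y)) (Idn ?S (Fo (cpstar_TensO V X Y)))"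
      by (simp add: S.unitary_iff)
    have a: "LUnit ?S (Fo X) = Fa (LUnit (CPstar V) X)" "RUnit ?S (Fo X) = Fa (RUnit (CPstar V) X)"
      "Symm ?S (Fo X) (Fo Y) = Fa (Symm (CPstar V) X Y)"
      using Fa_iso[OF alg_iso_l[of X]] Fa_iso[OF alg_iso_r[of X]] Fa_iso[OF alg_iso_s[of X Y]]
      by (simp_all add: CPM.split_simps Fo_tens Fo_unit CPM_simps) (simp_all add: Fo_def)
    show "Comp ?S (Fa (LUnit (CPstar V) X)) (Comp ?S (Idn ?S (Fo (cpstar_TensO V (UnitO (CPstar V)) X)))
        (TensA ?S (Idn ?S (Fo (cpstar_UnitO V))) (Idn ?S (Fo X)))) = LUnit ?S (Fo X)"
      "Comp ?S (Fa (RUnit (CPstar V) X)) (Comp ?S (Idn ?S (Fo (cpstar_TensO V X (UnitO (CPstar V)))))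
        (TensA ?S (Idn ?S (Fo X)) (Idn ?S (Fo (cpstar_UnitO V))))) = RUnit ?S (Fo X)"
      "Comp ?S (Fa (Symm (CPstar V) X Y)) (Idn ?S (Fo (cpstar_TensO V X Y)))
        = Comp ?S (Idn ?S (Fo (cpstar_TensO V Y X))) (Symm ?S (Fo X) (Fo Y))"
      unfolding a by simp_all
    fix Z assume "Z \<in> Ob (CPstar V)"
    then have [simp]: "Z \<in> cpstar_Ob V" by simp_all
    have b: "Assoc ?S (Fo X) (Fo Y) (Fo Z) = Fa (Assoc (CPstar V) X Y Z)"
      using Fa_iso[OF alg_iso_a[of X Y Z]]
      by (simp add: CPM.split_simps Fo_tens CPM_simps) (simp add: Fo_def)
    show "Comp ?S (Fa (Assoc (CPstar V) X Y Z)) (Comp ?S (Idn ?S (Fo (cpstar_TensO V (TensO (CPstar V) X Y) Z)))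
        (TensA ?S (Idn ?S (Fo (cpstar_TensO V X Y))) (Idn ?S (Fo Z))))
      = Comp ?S (Idn ?S (Fo (cpstar_TensO V X (TensO (CPstar V) Y Z))))
        (Comp ?S (TensA ?S (Idn ?S (Fo X)) (Idn ?S (Fo (cpstar_TensO V Y Z)))) (Assoc ?S (Fo X) (Fo Y) (Fo Z)))"
      unfolding b by simp
  qed
qed

end

theorem lemma2p2:
  fixes V :: "('o, 'a) dc_cat"
  assumes "dagger_compact_category V"
  shows "\<exists>Fo Fa \<phi> \<phi>0.
    (\<forall>A m u z. (A, m, u, z) \<in> Ob (CPstar V) \<longrightarrow>
       Fo (A, m, u, z) =
         (A, (A, action V A m \<cdot>\<^bsub>V\<^esub> z \<cdot>\<^bsub>V\<^esub> z \<cdot>\<^bsub>V\<^esub> (action V A m)\<dagger>\<^bsub>V\<^esub>, A))) \<and>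
    (\<forall>A mA uA zA B mB uB zB f.
       ((A, mA, uA, zA), f, (B, mB, uB, zB)) \<in> Arr (CPstar V) \<longrightarrow>
       Fa ((A, mA, uA, zA), f, (B, mB, uB, zB)) =
         (Fo (A, mA, uA, zA),
          (A, action V B mB \<cdot>\<^bsub>V\<^esub> zB \<cdot>\<^bsub>V\<^esub> f \<cdot>\<^bsub>V\<^esub> zA \<cdot>\<^bsub>V\<^esub> (action V A mA)\<dagger>\<^bsub>V\<^esub>, B),
          Fo (B, mB, uB, zB))) \<and>
    full_functor (CPstar V) (Split_dagger (CPM V)) Fo Fa \<and>
    faithful_functor (CPstar V) (Split_dagger (CPM V)) Fo Fa \<and>
    strong_dagger_symmetric_monoidal_functor (CPstar V) (Split_dagger (CPM V)) Fo Fa \<phi> \<phi>0"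
proof -
  interpret dagger_compact_category V by (rule assms)
  show ?thesis
    \<comment> \<open>The comparison maps stay schematic and are fixed by unification with
      \<open>Fa_monoidal\<close>.\<close>
    using Fa_full Fa_faithful Fa_monoidal
    by - (rule exI[of _ Fo], rule exI[of _ Fa], rule exI, rule exI, intro conjI allI impI;
      (assumption | simp only: Fo_def Fa_simp Fm_def fst_conv snd_conv))
qed

end
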